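(* Let $\Gamma$ be a finitely generated torsion-free nilpotent group, let $\mathfrak{n}$ be its Malcev Lie algebra (a nilpotent Lie algebra over $\mathbb{Q}$) and set $\mathfrak{n}^{\mathbb{C}}=\mathbb{C}\otimes_{\mathbb{Q}}\mathfrak{n}$. The following assertions are equivalent: (i) $\Gamma$ is freely self-similar; (ii) $\Gamma$ is freely densely self-similar; (iii) the Lie algebra $\mathfrak{n}^{\mathbb{C}}$ admits a very special grading.
   Context: For a finite alphabet $A$, $A^\omega$ is the space of infinite words over $A$ with the profinite (product) topology. An action of a group $\Gamma$ on $A^\omega$ is self-similar if for every $\gamma\in\Gamma$ and $a\in A$ there exist $\gamma_a\in\Gamma$ and $b\in A$ with $\gamma(aw)=b\gamma_a(w)$ for all $w\in A^\omega$. $\Gamma$ is freely self-similar if it admits a free self-similar action on some $A^\omega$ with $A$ finite, and freely densely self-similar if it admits a free self-similar action with dense orbits on some $A^\omega$ with $A$ finite. The Malcev Lie algebra of $\Gamma$ is the unique finite-dimensional nilpotent Lie algebra $\mathfrak{n}$ over $\mathbb{Q}$ containing $\Gamma$ as a multiplicative lattice, i.e. as a finitely generated subgroup of $\mathfrak{n}$ for the Campbell–Hausdorff product which generates $\mathfrak{n}$ as a Lie algebra. A grading of a Lie algebra $\mathfrak{m}$ is a decomposition $\mathfrak{m}=\oplus_{k\in\mathbb{Z}}\mathfrak{m}_k$ with $[\mathfrak{m}_k,\mathfrak{m}_l]\subset\mathfrak{m}_{k+l}$; it is very special if $\mathfrak{m}_0=0$. *)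

theory Defs
  imports "HOL-Algebra.Algebra" "HOL-Analysis.Analysis"
begin

definition fin_gen_group :: "('g, 'b) monoid_scheme \<Rightarrow> bool" where
  "fin_gen_group G \<longleftrightarrow>
     (\<exists>S. finite S \<and> S \<subseteq> carrier G \<and> generate G S = carrier G)"

definition torsion_free_group :: "('g, 'b) monoid_scheme \<Rightarrow> bool" where
  "torsion_free_group G \<longleftrightarrow>
     (\<forall>g\<in>carrier G. \<forall>n::nat. n > 0 \<longrightarrow> g [^]\<^bsub>G\<^esub> n = \<one>\<^bsub>G\<^esub> \<longrightarrow> g = \<one>\<^bsub>G\<^esub>)"

fun lower_central :: "('g, 'b) monoid_scheme \<Rightarrow> nat \<Rightarrow> 'g set" where
  "lower_central G 0 = carrier G"
| "lower_central G (Suc n) = generate G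
     {x \<otimes>\<^bsub>G\<^esub> y \<otimes>\<^bsub>G\<^esub> inv\<^bsub>G\<^esub> x \<otimes>\<^bsub>G\<^esub> inv\<^bsub>G\<^esub> y | x y.
        x \<in> carrier G \<and> y \<in> lower_central G n}"

definition nilpotent_group :: "('g, 'b) monoid_scheme \<Rightarrow> bool" where
  "nilpotent_group G \<longleftrightarrow> (\<exists>n. lower_central G n = {\<one>\<^bsub>G\<^esub>})"

definition inf_words :: "nat \<Rightarrow> (nat \<Rightarrow> nat) set" where
  "inf_words d = {w. \<forall>i. w i < d}"

definition wcons :: "nat \<Rightarrow> (nat \<Rightarrow> nat) \<Rightarrow> (nat \<Rightarrow> nat)" where
  "wcons a w = (\<lambda>i. if i = 0 then a else w (i - 1))"

definition self_similar_action ::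
  "('g, 'b) monoid_scheme \<Rightarrow> nat \<Rightarrow> ('g \<Rightarrow> (nat \<Rightarrow> nat) \<Rightarrow> (nat \<Rightarrow> nat)) \<Rightarrow> bool" where
  "self_similar_action G d \<phi> \<longleftrightarrow>
     group_action G (inf_words d) \<phi> \<and>
     (\<forall>g\<in>carrier G. \<forall>a<d. \<exists>h\<in>carrier G. \<exists>b<d.
        \<forall>w\<in>inf_words d. \<phi> g (wcons a w) = wcons b (\<phi> h w))"

definition free_action ::
  "('g, 'b) monoid_scheme \<Rightarrow> nat \<Rightarrow> ('g \<Rightarrow> (nat \<Rightarrow> nat) \<Rightarrow> (nat \<Rightarrow> nat)) \<Rightarrow> bool" where
  "free_action G d \<phi> \<longleftrightarrow>
     (\<forall>g\<in>carrier G. \<forall>w\<in>inf_words d. \<phi> g w = w \<longrightarrow> g = \<one>\<^bsub>G\<^esub>)"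

text \<open>Dense orbits in the product topology: every cylinder set (given by a finite
  prefix u) meets every orbit.\<close>
definition dense_orbits ::
  "('g, 'b) monoid_scheme \<Rightarrow> nat \<Rightarrow> ('g \<Rightarrow> (nat \<Rightarrow> nat) \<Rightarrow> (nat \<Rightarrow> nat)) \<Rightarrow> bool" where
  "dense_orbits G d \<phi> \<longleftrightarrow>
     (\<forall>w\<in>inf_words d. \<forall>u. set u \<subseteq> {..<d} \<longrightarrow>
        (\<exists>g\<in>carrier G. \<forall>i<length u. \<phi> g w i = u ! i))"

definition freely_self_similar :: "('g, 'b) monoid_scheme \<Rightarrow> bool" where
  "freely_self_similar G \<longleftrightarrow>
     (\<exists>d \<phi>. d \<ge> 1 \<and> self_similar_action G d \<phi> \<and> free_action G d \<phi>)"

definition freely_densely_self_similar :: "('g, 'b) monoid_scheme \<Rightarrow> bool" where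
  "freely_densely_self_similar G \<longleftrightarrow>
     (\<exists>d \<phi>. d \<ge> 1 \<and> self_similar_action G d \<phi> \<and> free_action G d \<phi> \<and> dense_orbits G d \<phi>)"

text \<open>An m-dimensional Lie algebra over Q is represented on Q^m (vectors nat => rat
  vanishing from index m on) with bracket given by rational structure constants
  c i j k ([e_i, e_j] = sum_k c i j k e_k).  The same constants define the bracket of
  the complexification C (x) n = C^m.\<close>

definition in_space :: "nat \<Rightarrow> (nat \<Rightarrow> 'a::zero) \<Rightarrow> bool" where
  "in_space m x \<longleftrightarrow> (\<forall>i\<ge>m. x i = 0)"

definition vadd :: "(nat \<Rightarrow> 'a::plus) \<Rightarrow> (nat \<Rightarrow> 'a) \<Rightarrow> nat \<Rightarrow> 'a" where
  "vadd x y = (\<lambda>i. x i + y i)"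

definition vscale :: "'a::times \<Rightarrow> (nat \<Rightarrow> 'a) \<Rightarrow> nat \<Rightarrow> 'a" where
  "vscale a x = (\<lambda>i. a * x i)"

definition lie_br :: "nat \<Rightarrow> (nat \<Rightarrow> nat \<Rightarrow> nat \<Rightarrow> rat) \<Rightarrow>
    (nat \<Rightarrow> 'a::field_char_0) \<Rightarrow> (nat \<Rightarrow> 'a) \<Rightarrow> nat \<Rightarrow> 'a" where
  "lie_br m c x y = (\<lambda>k. if k < m then (\<Sum>i<m. \<Sum>j<m. of_rat (c i j k) * x i * y j) else 0)"

definition is_lie_algebra :: "nat \<Rightarrow> (nat \<Rightarrow> nat \<Rightarrow> nat \<Rightarrow> rat) \<Rightarrow> bool" where
  "is_lie_algebra m c \<longleftrightarrow>
     (\<forall>x::nat\<Rightarrow>rat. in_space m x \<longrightarrow> lie_br m c x x = (\<lambda>_. 0)) \<and>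
     (\<forall>x y z::nat\<Rightarrow>rat. in_space m x \<longrightarrow> in_space m y \<longrightarrow> in_space m z \<longrightarrow>
        vadd (vadd (lie_br m c x (lie_br m c y z)) (lie_br m c y (lie_br m c z x)))
             (lie_br m c z (lie_br m c x y)) = (\<lambda>_. 0))"

fun nest_br :: "nat \<Rightarrow> (nat \<Rightarrow> nat \<Rightarrow> nat \<Rightarrow> rat) \<Rightarrow> (nat \<Rightarrow> 'a::field_char_0) list \<Rightarrow> nat \<Rightarrow> 'a" where
  "nest_br m c [] = (\<lambda>_. 0)"
| "nest_br m c [z] = z"
| "nest_br m c (z # zs) = lie_br m c z (nest_br m c zs)"

definition is_nilpotent_lie :: "nat \<Rightarrow> (nat \<Rightarrow> nat \<Rightarrow> nat \<Rightarrow> rat) \<Rightarrow> bool" where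
  "is_nilpotent_lie m c \<longleftrightarrow>
     (\<exists>N. \<forall>zs::(nat\<Rightarrow>rat) list. length zs = Suc N \<longrightarrow> (\<forall>z\<in>set zs. in_space m z) \<longrightarrow>
        nest_br m c zs = (\<lambda>_. 0))"

text \<open>For ps = [(r1,s1),...,(rn,sn)] the word X^r1 Y^s1 ... X^rn Y^sn, its total degree,
  and Dynkin's coefficient (-1)^(n-1) / (n * deg * prod r_i! s_i!).\<close>
definition dyn_word :: "'v \<Rightarrow> 'v \<Rightarrow> (nat \<times> nat) list \<Rightarrow> 'v list" where
  "dyn_word u v ps = concat (map (\<lambda>(r, s). replicate r u @ replicate s v) ps)"

definition dyn_deg :: "(nat \<times> nat) list \<Rightarrow> nat" where
  "dyn_deg ps = sum_list (map (\<lambda>(r, s). r + s) ps)"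

definition dyn_coeff :: "(nat \<times> nat) list \<Rightarrow> rat" where
  "dyn_coeff ps = (- 1) ^ (length ps - 1) /
      (of_nat (length ps) * of_nat (dyn_deg ps) *
       of_nat (prod_list (map (\<lambda>(r, s). fact r * fact s) ps)))"

definition dyn_index :: "nat \<Rightarrow> (nat \<times> nat) list set" where
  "dyn_index N = {ps. ps \<noteq> [] \<and> (\<forall>(r, s)\<in>set ps. r + s \<ge> 1) \<and> dyn_deg ps \<le> N}"

text \<open>In a nilpotent Lie algebra of dimension m all brackets of m+1 elements vanish,
  so the Campbell--Hausdorff series is exactly its truncation to degree m+1.\<close>
definition ch_product :: "nat \<Rightarrow> (nat \<Rightarrow> nat \<Rightarrow> nat \<Rightarrow> rat) \<Rightarrow>
    (nat \<Rightarrow> rat) \<Rightarrow> (nat \<Rightarrow> rat) \<Rightarrow> nat \<Rightarrow> rat" where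
  "ch_product m c u v = (\<lambda>k. \<Sum>ps\<in>dyn_index (m + 1).
      dyn_coeff ps * nest_br m c (dyn_word u v ps) k)"

definition lie_subalgebra_generated_is_all ::
  "nat \<Rightarrow> (nat \<Rightarrow> nat \<Rightarrow> nat \<Rightarrow> rat) \<Rightarrow> (nat \<Rightarrow> rat) set \<Rightarrow> bool" where
  "lie_subalgebra_generated_is_all m c T \<longleftrightarrow>
     (\<forall>S. (\<forall>x\<in>S. in_space m x) \<and> (\<lambda>_. 0) \<in> S \<and>
          (\<forall>x\<in>S. \<forall>y\<in>S. vadd x y \<in> S) \<and> (\<forall>a. \<forall>x\<in>S. vscale a x \<in> S) \<and>
          (\<forall>x\<in>S. \<forall>y\<in>S. lie_br m c x y \<in> S) \<and> T \<subseteq> S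
        \<longrightarrow> {x. in_space m x} \<subseteq> S)"

definition malcev_lie_algebra ::
  "('g, 'b) monoid_scheme \<Rightarrow> nat \<Rightarrow> (nat \<Rightarrow> nat \<Rightarrow> nat \<Rightarrow> rat) \<Rightarrow> bool" where
  "malcev_lie_algebra G m c \<longleftrightarrow>
     is_lie_algebra m c \<and> is_nilpotent_lie m c \<and>
     (\<exists>\<iota>. (\<forall>g\<in>carrier G. in_space m (\<iota> g)) \<and> inj_on \<iota> (carrier G) \<and>
          (\<forall>g\<in>carrier G. \<forall>h\<in>carrier G. \<iota> (g \<otimes>\<^bsub>G\<^esub> h) = ch_product m c (\<iota> g) (\<iota> h)) \<and>
          fin_gen_group G \<and>
          lie_subalgebra_generated_is_all m c (\<iota> ` carrier G))"

definition complex_subspace :: "nat \<Rightarrow> (nat \<Rightarrow> complex) set \<Rightarrow> bool" where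
  "complex_subspace m V \<longleftrightarrow>
     (\<forall>x\<in>V. in_space m x) \<and> (\<lambda>_. 0) \<in> V \<and>
     (\<forall>x\<in>V. \<forall>y\<in>V. vadd x y \<in> V) \<and> (\<forall>a. \<forall>x\<in>V. vscale a x \<in> V)"

definition is_grading_C ::
  "nat \<Rightarrow> (nat \<Rightarrow> nat \<Rightarrow> nat \<Rightarrow> rat) \<Rightarrow> (int \<Rightarrow> (nat \<Rightarrow> complex) set) \<Rightarrow> bool" where
  "is_grading_C m c V \<longleftrightarrow>
     (\<forall>k. complex_subspace m (V k)) \<and>
     (\<forall>x. in_space m x \<longrightarrow>
        (\<exists>!f::int \<Rightarrow> nat \<Rightarrow> complex. finite {k. f k \<noteq> (\<lambda>_. 0)} \<and> (\<forall>k. f k \<in> V k) \<and>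
             x = (\<lambda>i. \<Sum>k\<in>{k. f k \<noteq> (\<lambda>_. 0)}. f k i))) \<and>
     (\<forall>k l. \<forall>x\<in>V k. \<forall>y\<in>V l. lie_br m c x y \<in> V (k + l))"

definition has_very_special_grading_C :: "nat \<Rightarrow> (nat \<Rightarrow> nat \<Rightarrow> nat \<Rightarrow> rat) \<Rightarrow> bool" where
  "has_very_special_grading_C m c \<longleftrightarrow>
     (\<exists>V. is_grading_C m c V \<and> V 0 = {\<lambda>_. 0})"

end

theory Submission
  imports Defs "HOL-Library.Function_Algebras" "HOL-Computational_Algebra.Fundamental_Theorem_Algebra"
begin

text \<open>
  (i) implies (iii): a self-similar action yields a homomorphism \<open>f\<close> from the stabilizer of a letter to
  \<open>\<Gamma>\<close>. By rigidity \<open>f\<close> extends to an automorphism \<open>F\<close> of \<open>\<nn>\<close>. If some eigenvalue of \<open>F\<close> were a root of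
  unity, a nontrivial element of \<open>\<Gamma>\<close> would have a periodic \<open>f\<close>-orbit inside the stabilizer and so fix a word.
  Hence some homomorphism from the group generated by the eigenvalues to \<open>\<int>\<close> is nonzero on every
  eigenvalue, and it grades the generalized eigenspaces.

  (iii) implies (ii): a very special grading gives an invertible derivation of \<open>\<nn>\<^sup>\<complex>\<close>, which can be
  perturbed to an invertible rational derivation \<open>D\<close>. Let \<open>\<Lambda>\<close> be its set of eigenvalues, \<open>h\<close> a
  rational functional without zeros on \<open>\<Lambda>\<close>, and \<open>k \<alpha> \<nu> = (\<Sum>\<sigma>. h (\<sigma> \<alpha>) * h (\<sigma> \<nu>))\<close> with \<open>\<sigma>\<close> ranging over
  the Galois group. The function \<open>\<alpha> \<mapsto> (\<Prod>\<nu>. (1 - b \<nu>) powi (k \<alpha> \<nu>))\<close>, the product being over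
  \<open>\<nu> \<in> \<Lambda> \<union> - \<Lambda>\<close>, is multiplicative and Galois equivariant, so it defines an automorphism \<open>F = C E\<^sup>-\<^sup>1\<close> of
  \<open>\<nn>\<close>, where \<open>C\<close> and \<open>E\<close> collect the positive and the negative exponents. For a suitable integer \<open>b\<close>,
  \<open>C\<close> and \<open>E\<close> are coprime, congruent to \<open>1\<close> modulo a large integer, and all eigenvalues of \<open>E\<close> have modulus
  greater than \<open>1\<close>. Then \<open>F\<close> induces a virtual endomorphism of \<open>\<Gamma>\<close>: the orbits of the associated tree
  action are dense because every element factors through \<open>C\<^sup>n\<close> and \<open>E\<close>, and the action is free because
  \<open>E\<^sup>-\<^sup>n v\<close> tends to \<open>0\<close> with bounded denominators for a \<open>v\<close> coming from a point stabilizer.\<close>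

section \<open>Additive subgroups\<close>

text \<open>The image \<Delta> of \<Gamma> in the Lie algebra need not be closed under addition, and
  this shapes both directions. Lattices are compared with \<Delta> up to denominators: a multiple of
  each finitely generated lattice lies in \<Delta>, and \<Delta> lies in such a lattice. Products
  are controlled by their leading terms x + y and (1/2)[x,y], the errors being pushed down the lower
  central series. The exponentials exp(t D) of a derivation are not rational in general, which is
  why multiplicative functions a of the eigenvalues replace them: the operator equal to the scalar
  a(\<alpha>) on the generalized eigenspace of \<alpha> respects brackets when a(\<alpha> + \<beta>)
  = a(\<alpha>) a(\<beta>), and it is rational when a commutes with the Galois group. The set -
  \<Lambda> is included because the exponent k \<alpha> (- \<alpha>) is negative: it supplies a
  factor of modulus greater than 1 to E on every eigenspace. Since C and E are congruent to 1, they
  move the elements of \<Delta> by vectors of a deep lattice, and such translations do not leave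
  \<Delta>. This is how operators that respect addition but not the product, taken one by one, still
  act on the group.\<close>

definition asub :: "'v::ab_group_add set \<Rightarrow> bool" where
  "asub A \<longleftrightarrow> 0 \<in> A \<and> (\<forall>x\<in>A. \<forall>y\<in>A. x - y \<in> A)"

lemma asub_zero: "asub A \<Longrightarrow> 0 \<in> A"
  and asub_diff: "asub A \<Longrightarrow> x \<in> A \<Longrightarrow> y \<in> A \<Longrightarrow> x - y \<in> A"
  by (auto simp: asub_def)

lemma asub_uminus: "asub A \<Longrightarrow> x \<in> A \<Longrightarrow> - x \<in> A"
  using asub_diff[of A 0 x] by (simp add: asub_zero)

lemma asub_add: "asub A \<Longrightarrow> x \<in> A \<Longrightarrow> y \<in> A \<Longrightarrow> x + y \<in> A"
  using asub_diff[of A x "- y"] by (simp add: asub_uminus)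

lemma asub_sum: "asub A \<Longrightarrow> (\<And>i. i \<in> I \<Longrightarrow> f i \<in> A) \<Longrightarrow> sum f I \<in> A"
  by (induction I rule: infinite_finite_induct) (auto simp: asub_zero asub_add)

definition zspan :: "'v::ab_group_add set \<Rightarrow> 'v set" where
  "zspan S = \<Inter>{A. asub A \<and> S \<subseteq> A}"

lemma asub_zspan: "asub (zspan S)"
  unfolding zspan_def asub_def by auto

lemma zspan_base: "x \<in> S \<Longrightarrow> x \<in> zspan S"
  unfolding zspan_def by auto

lemma zspan_minimal: "asub A \<Longrightarrow> S \<subseteq> A \<Longrightarrow> zspan S \<subseteq> A"
  unfolding zspan_def by auto

lemma zspan_mono: "S \<subseteq> S' \<Longrightarrow> zspan S \<subseteq> zspan S'"
  by (rule zspan_minimal[OF asub_zspan]) (auto intro: zspan_base)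

lemma zspan_induct [consumes 1, case_names zero base diff]:
  assumes "x \<in> zspan S" "P 0" "\<And>s. s \<in> S \<Longrightarrow> P s"
    "\<And>x y. P x \<Longrightarrow> P y \<Longrightarrow> P (x - y)"
  shows "P x"
proof -
  have "zspan S \<subseteq> {x. P x}"
    by (rule zspan_minimal) (auto simp: asub_def assms)
  with assms(1) show ?thesis by auto
qed

section \<open>Nested brackets and Dynkin words\<close>

text \<open>An abstract copy of \<open>nest_br\<close>: it is applied to the bracket of a product
  algebra as well, and not only to \<open>lie_br\<close>.\<close>

fun nest :: "('v \<Rightarrow> 'v \<Rightarrow> 'v) \<Rightarrow> 'v list \<Rightarrow> 'v::zero" where
  "nest br [] = 0"
| "nest br [z] = z"
| "nest br (z # zs) = br z (nest br zs)"

lemma nest_Cons: "zs \<noteq> [] \<Longrightarrow> nest br (z # zs) = br z (nest br zs)"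
  by (cases zs) auto

text \<open>The word is the image of a fixed word of booleans, so statements about words in
  different letters become letterwise statements about one list.\<close>

lemma dyn_word_map: "dyn_word u v ps = map (\<lambda>b. if b then u else v) (dyn_word True False ps)"
  by (induction ps) (auto simp: dyn_word_def)

lemma length_dyn_word: "length (dyn_word u v ps) = dyn_deg ps"
  by (induction ps) (auto simp: dyn_word_def dyn_deg_def)

lemma length_le_dyn_deg: "(\<forall>(r, s)\<in>set ps. r + s \<ge> 1) \<Longrightarrow> length ps \<le> dyn_deg ps"
  by (induction ps) (auto simp: dyn_deg_def)

lemma mem_le_dyn_deg: "(r, s) \<in> set ps \<Longrightarrow> r \<le> dyn_deg ps \<and> s \<le> dyn_deg ps"
  by (induction ps) (auto simp: dyn_deg_def)

text \<open>Every pair of an index has positive degree, so the length and all entries are bounded by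
  the total degree.\<close>

lemma finite_dyn_index: "finite (dyn_index N)"
proof (rule finite_subset)
  show "dyn_index N \<subseteq> {ps. set ps \<subseteq> {..N} \<times> {..N} \<and> length ps \<le> N}"
    using length_le_dyn_deg mem_le_dyn_deg unfolding dyn_index_def
    by (fastforce intro: order_trans)
  show "finite {ps. set ps \<subseteq> {..N} \<times> {..N::nat} \<and> length ps \<le> N}"
    by (rule finite_lists_length_le) auto
qed

lemma dyn_deg_pos: "ps \<in> dyn_index N \<Longrightarrow> dyn_deg ps \<ge> 1"
  using length_le_dyn_deg[of ps] unfolding dyn_index_def by (cases ps) auto

lemma dyn_index_deg1:
  assumes "N \<ge> 1"
  shows "{ps \<in> dyn_index N. dyn_deg ps = 1} = {[(1, 0)], [(0, 1)]}"
proof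
  show "{ps \<in> dyn_index N. dyn_deg ps = 1} \<subseteq> {[(1, 0)], [(0, 1)]}"
  proof
    fix ps assume "ps \<in> {ps \<in> dyn_index N. dyn_deg ps = 1}"
    then have *: "ps \<noteq> []" "\<forall>(r, s)\<in>set ps. r + s \<ge> 1" "dyn_deg ps = 1"
      by (auto simp: dyn_index_def)
    then have "length ps = 1"
      using length_le_dyn_deg[of ps] by (cases ps) auto
    then obtain r s where "ps = [(r, s)]"
      by (metis One_nat_def length_0_conv length_Suc_conv surj_pair)
    with * show "ps \<in> {[(1, 0)], [(0, 1)]}" by (auto simp: dyn_deg_def)
  qed
qed (use assms in \<open>auto simp: dyn_index_def dyn_deg_def\<close>)

text \<open>These seven indices give the quadratic part of the series. Only the words xy and yx
  survive, with coefficients 1/2 - 1/4 and -1/4, which add up to (1/2)[x,y].\<close>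

lemma dyn_index_deg2:
  assumes "N \<ge> 2"
  shows "{ps \<in> dyn_index N. dyn_deg ps = 2} =
    {[(2, 0)], [(0, 2)], [(1, 1)], [(1,0),(1,0)], [(0,1),(0,1)], [(1,0),(0,1)], [(0,1),(1,0)]}"
  (is "?A = ?B")
proof
  show "?A \<subseteq> ?B"
  proof
    fix ps assume "ps \<in> ?A"
    then have *: "ps \<noteq> []" "\<forall>(r, s)\<in>set ps. r + s \<ge> 1" "dyn_deg ps = 2"
      by (auto simp: dyn_index_def)
    then have "length ps \<le> 2" using length_le_dyn_deg[of ps] by auto
    with *(1) consider (a) p where "ps = [p]" | (b) p q where "ps = [p, q]"
      by (cases ps; cases "tl ps"; cases "tl (tl ps)") auto
    then show "ps \<in> ?B"
    proof cases
      case a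
      obtain r s where "p = (r, s)" by (cases p)
      with a * have "r + s = 2" by (auto simp: dyn_deg_def)
      then have "(r = 0 \<and> s = 2) \<or> (r = 1 \<and> s = 1) \<or> (r = 2 \<and> s = 0)" by arith
      with a \<open>p = (r, s)\<close> show ?thesis by auto
    next
      case b
      obtain r s where p: "p = (r, s)" by (cases p)
      obtain r' s' where q: "q = (r', s')" by (cases q)
      from b * p q have "r + s + (r' + s') = 2" "r + s \<ge> 1" "r' + s' \<ge> 1"
        by (auto simp: dyn_deg_def)
      then have "((r = 0 \<and> s = 1) \<or> (r = 1 \<and> s = 0)) \<and> ((r' = 0 \<and> s' = 1) \<or> (r' = 1 \<and> s' = 0))"
        by arith
      with b p q show ?thesis by auto
    qed
  qed
qed (use assms in \<open>auto simp: dyn_index_def dyn_deg_def\<close>)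

lemma common_denominator:
  fixes S :: "rat set"
  assumes "finite S"
  shows "\<exists>Q::int. Q > 0 \<and> (\<forall>x\<in>S. of_int Q * x \<in> \<int>)"
  using assms
proof induction
  case empty show ?case by (intro exI[of _ 1]) auto
next
  case (insert x S)
  then obtain Q :: int where Q: "Q > 0" "\<forall>x\<in>S. of_int Q * x \<in> \<int>" by auto
  obtain a b where ab: "quotient_of x = (a, b)" by fastforce
  then have b: "b > 0" "x = of_int a / of_int b"
    using quotient_of_denom_pos quotient_of_div by auto
  show ?case
  proof (intro exI[of _ "Q * b"] conjI ballI)
    fix y assume "y \<in> insert x S"
    then show "of_int (Q * b) * y \<in> \<int>"
    proof
      assume "y = x"
      with b have "of_int (Q * b) * y = of_int (Q * a)" by simp
      then show ?thesis by (metis Ints_of_int)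
    next
      assume "y \<in> S"
      with Q have "of_int b * (of_int Q * y) \<in> \<int>" by (auto intro: Ints_mult[OF Ints_of_int])
      moreover have "of_int b * (of_int Q * y) = of_int (Q * b) * y" by simp
      ultimately show ?thesis by metis
    qed
  qed (use Q b in auto)
qed

lemma dyn_coeff_denom: "\<exists>Q::int. Q > 0 \<and> (\<forall>ps\<in>dyn_index N. of_int Q * dyn_coeff ps \<in> \<int>)"
  using common_denominator[of "dyn_coeff ` dyn_index N"] finite_dyn_index by auto

section \<open>The Campbell--Hausdorff product in a nilpotent Lie algebra\<close>

locale rational_space = vector_space scale
  for scale :: "rat \<Rightarrow> 'v::ab_group_add \<Rightarrow> 'v" (infixr \<open>\<star>\<close> 75)

lemma (in rational_space) subspace_asub: "subspace S \<Longrightarrow> asub S"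
  unfolding asub_def by (auto intro: subspace_0 subspace_diff)

text \<open>\<open>T\<close> is the degree at which the series is cut. The assumptions on it secure
  that the linear part and the quadratic part are the expected ones; with T = m + 1 the second
  alternative of \<open>T2\<close> covers m = 0.\<close>

locale nilpotent_lie = rational_space scale
  for scale :: "rat \<Rightarrow> 'v::ab_group_add \<Rightarrow> 'v" (infixr \<open>\<star>\<close> 75) +
  fixes br :: "'v \<Rightarrow> 'v \<Rightarrow> 'v" and T :: nat
  assumes br_add_left: "br (x + x') y = br x y + br x' y"
    and br_add_right: "br x (y + y') = br x y + br x y'"
    and br_scale_left: "br (a \<star> x) y = a \<star> br x y"
    and br_scale_right: "br x (a \<star> y) = a \<star> br x y"
    and br_self [simp]: "br x x = 0"
    and jacobi: "br x (br y z) + br y (br z x) + br z (br x y) = 0"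
    and nilpotent: "\<exists>K. \<forall>zs. length zs = Suc K \<longrightarrow> nest br zs = 0"
    and T1: "T \<ge> 1"
    and T2: "T \<ge> 2 \<or> (\<forall>x y. br x y = 0)"
begin

lemma br_zero_left [simp]: "br 0 y = 0"
  using br_scale_left[of 0 0 y] by simp

lemma br_zero_right [simp]: "br x 0 = 0"
  using br_scale_right[of x 0 0] by simp

lemma br_diff_left: "br (x - x') y = br x y - br x' y"
  using br_add_left[of "x - x'" x' y] by (simp add: algebra_simps)

lemma br_diff_right: "br x (y - y') = br x y - br x y'"
  using br_add_right[of x "y - y'" y'] by (simp add: algebra_simps)

lemma br_minus_right: "br x (- y) = - br x y"
  using br_diff_right[of x 0 y] by simp

lemma br_anti: "br x y = - br y x"
proof -
  have "br (x + y) (x + y) = 0" by (rule br_self)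
  then have "br x y + br y x = 0"
    unfolding br_add_left br_add_right by (simp add: add.commute)
  then show ?thesis by (simp add: eq_neg_iff_add_eq_0)
qed

definition chp :: "'v \<Rightarrow> 'v \<Rightarrow> 'v" where
  "chp x y = (\<Sum>ps\<in>dyn_index T. dyn_coeff ps \<star> nest br (dyn_word x y ps))"

definition hi :: "'v \<Rightarrow> 'v \<Rightarrow> 'v" where
  "hi x y = (\<Sum>ps\<in>{ps\<in>dyn_index T. dyn_deg ps \<ge> 2}. dyn_coeff ps \<star> nest br (dyn_word x y ps))"

lemma chp_hi: "chp x y = x + y + hi x y"
proof -
  have "chp x y = (\<Sum>ps\<in>{ps\<in>dyn_index T. dyn_deg ps = 1} \<union> {ps\<in>dyn_index T. dyn_deg ps \<ge> 2}.
      dyn_coeff ps \<star> nest br (dyn_word x y ps))"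
    unfolding chp_def using dyn_deg_pos by (intro sum.cong) force+
  also have "\<dots> = (\<Sum>ps\<in>{ps\<in>dyn_index T. dyn_deg ps = 1}. dyn_coeff ps \<star> nest br (dyn_word x y ps)) + hi x y"
    unfolding hi_def by (intro sum.union_disjoint) (auto simp: finite_dyn_index)
  also have "(\<Sum>ps\<in>{ps\<in>dyn_index T. dyn_deg ps = 1}. dyn_coeff ps \<star> nest br (dyn_word x y ps)) = x + y"
    unfolding dyn_index_deg1[OF T1] by (simp add: dyn_coeff_def dyn_deg_def dyn_word_def)
  finally show ?thesis .
qed

definition hi3 :: "'v \<Rightarrow> 'v \<Rightarrow> 'v" where
  "hi3 x y = (\<Sum>ps\<in>{ps\<in>dyn_index T. dyn_deg ps \<ge> 3}. dyn_coeff ps \<star> nest br (dyn_word x y ps))"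

lemma hi_hi3: "hi x y = (1/2) \<star> br x y + hi3 x y"
proof (cases "T \<ge> 2")
  case True
  have "hi x y = (\<Sum>ps\<in>{ps\<in>dyn_index T. dyn_deg ps = 2} \<union> {ps\<in>dyn_index T. dyn_deg ps \<ge> 3}.
      dyn_coeff ps \<star> nest br (dyn_word x y ps))"
    unfolding hi_def by (intro sum.cong) force+
  also have "\<dots> = (\<Sum>ps\<in>{ps\<in>dyn_index T. dyn_deg ps = 2}. dyn_coeff ps \<star> nest br (dyn_word x y ps)) + hi3 x y"
    unfolding hi3_def by (intro sum.union_disjoint) (auto simp: finite_dyn_index)
  also have "(\<Sum>ps\<in>{ps\<in>dyn_index T. dyn_deg ps = 2}. dyn_coeff ps \<star> nest br (dyn_word x y ps)) =
      (1/2) \<star> br x y - (1/4) \<star> br x y - (1/4) \<star> br y x"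
    unfolding dyn_index_deg2[OF True]
    by (simp add: dyn_coeff_def dyn_deg_def dyn_word_def numeral_2_eq_2 [symmetric] scale_minus_left)
      (simp add: numeral_2_eq_2)
  also have "\<dots> = (1/2) \<star> br x y"
    by (subst br_anti[of y x]) simp
  finally show ?thesis .
next
  case False
  then have br0: "br x y = 0" for x y using T2 by auto
  have "nest br zs = 0" if "length zs \<ge> 2" for zs
    using that by (cases zs; cases "tl zs") (auto simp: br0)
  then show ?thesis unfolding hi_def hi3_def by (simp add: br0 length_dyn_word)
qed

text \<open>\<open>A n\<close> bounds the brackets of \<open>n\<close> letters and \<open>J n\<close> bounds
  their variation when the letters vary by elements of \<open>J 1\<close>.\<close>

lemma nest_variation:
  assumes asub: "\<And>n. n \<ge> 1 \<Longrightarrow> asub (J n)"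
    and AA: "\<And>n x y. n \<ge> 1 \<Longrightarrow> x \<in> A 1 \<Longrightarrow> y \<in> A n \<Longrightarrow> br x y \<in> A (Suc n)"
    and AJ: "\<And>n x y. n \<ge> 1 \<Longrightarrow> x \<in> A 1 \<Longrightarrow> y \<in> J n \<Longrightarrow> br x y \<in> J (Suc n)"
    and JA: "\<And>n x y. n \<ge> 1 \<Longrightarrow> x \<in> J 1 \<Longrightarrow> y \<in> A n \<Longrightarrow> br x y \<in> J (Suc n)"
    and "list_all2 (\<lambda>z' z. z' \<in> A 1 \<and> z \<in> A 1 \<and> z' - z \<in> J 1) zs' zs" "zs \<noteq> []"
  shows "nest br zs' \<in> A (length zs) \<and> nest br zs \<in> A (length zs) \<and>
      nest br zs' - nest br zs \<in> J (length zs)"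
  using assms(5,6)
proof (induction rule: list_all2_induct)
  case (Cons z' zs' z zs)
  show ?case
  proof (cases "zs = []")
    case True
    with Cons show ?thesis by auto
  next
    case False
    with Cons have ne: "zs' \<noteq> []" by auto
    have n: "length zs \<ge> 1" using False by (cases zs) auto
    from Cons False have IH: "nest br zs' \<in> A (length zs)" "nest br zs \<in> A (length zs)"
      "nest br zs' - nest br zs \<in> J (length zs)" by auto
    have "nest br (z' # zs') - nest br (z # zs) =
        br (z' - z) (nest br zs') + br z (nest br zs' - nest br zs)"
      using False ne by (simp add: nest_Cons br_diff_left br_diff_right)
    moreover have "\<dots> \<in> J (Suc (length zs))"
      using Cons(1) IH by (intro asub_add asub JA AJ n) auto
    moreover have "br z' (nest br zs') \<in> A (Suc (length zs))" "br z (nest br zs) \<in> A (Suc (length zs))"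
      using Cons(1) IH by (auto intro: AA n)
    ultimately show ?thesis using False ne by (simp add: nest_Cons)
  qed
qed auto

text \<open>\<open>B\<close> has to absorb the Dynkin coefficients. The filtration \<open>J\<close>
  is instantiated in three ways: by the lower central series, by multiples of lattices of iterated
  brackets, and by lattices rescaled according to weight.\<close>

lemma hi_variation:
  assumes "\<And>n. n \<ge> 1 \<Longrightarrow> asub (J n)"
    "\<And>n x y. n \<ge> 1 \<Longrightarrow> x \<in> A 1 \<Longrightarrow> y \<in> A n \<Longrightarrow> br x y \<in> A (Suc n)"
    "\<And>n x y. n \<ge> 1 \<Longrightarrow> x \<in> A 1 \<Longrightarrow> y \<in> J n \<Longrightarrow> br x y \<in> J (Suc n)"
    "\<And>n x y. n \<ge> 1 \<Longrightarrow> x \<in> J 1 \<Longrightarrow> y \<in> A n \<Longrightarrow> br x y \<in> J (Suc n)"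
    and "asub B"
    and B: "\<And>ps x. ps \<in> dyn_index T \<Longrightarrow> dyn_deg ps \<ge> 2 \<Longrightarrow> x \<in> J (dyn_deg ps) \<Longrightarrow> dyn_coeff ps \<star> x \<in> B"
    and "x \<in> A 1" "x' \<in> A 1" "y \<in> A 1" "y' \<in> A 1" "x' - x \<in> J 1" "y' - y \<in> J 1"
  shows "hi x' y' - hi x y \<in> B"
proof -
  have "hi x' y' - hi x y = (\<Sum>ps\<in>{ps\<in>dyn_index T. dyn_deg ps \<ge> 2}.
      dyn_coeff ps \<star> (nest br (dyn_word x' y' ps) - nest br (dyn_word x y ps)))"
    unfolding hi_def by (simp add: scale_right_diff_distrib sum_subtractf)
  also have "\<dots> \<in> B"
  proof (rule asub_sum[OF \<open>asub B\<close>])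
    fix ps assume ps: "ps \<in> {ps\<in>dyn_index T. dyn_deg ps \<ge> 2}"
    have "list_all2 (\<lambda>z' z. z' \<in> A 1 \<and> z \<in> A 1 \<and> z' - z \<in> J 1) (dyn_word x' y' ps) (dyn_word x y ps)"
      unfolding dyn_word_map[of x' y'] dyn_word_map[of x y]
      using assms(7-12) by (auto simp: list_all2_map1 list_all2_map2 list_all2_same)
    moreover have "dyn_word x y ps \<noteq> []"
      using ps length_dyn_word[of x y ps] by auto
    ultimately have "nest br (dyn_word x' y' ps) - nest br (dyn_word x y ps) \<in> J (length (dyn_word x y ps))"
      using nest_variation[where A = A and J = J, OF assms(1-4)] by blast
    with ps show "dyn_coeff ps \<star> (nest br (dyn_word x' y' ps) - nest br (dyn_word x y ps)) \<in> B"
      by (intro B) (auto simp: length_dyn_word)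
  qed
  finally show ?thesis .
qed

text \<open>The two innermost letters are proportional, so their bracket vanishes.\<close>

lemma nest_collinear:
  assumes "length zs \<ge> 2" "\<forall>z\<in>set zs. \<exists>a. z = a \<star> x"
  shows "nest br zs = 0"
  using assms
proof (induction zs)
  case (Cons z zs)
  show ?case
  proof (cases "length zs \<ge> 2")
    case True
    then have "zs \<noteq> []" by auto
    with Cons True show ?thesis by (simp add: nest_Cons)
  next
    case False
    with Cons obtain y where "zs = [y]" by (cases zs; cases "tl zs") auto
    with Cons show ?thesis by (auto simp: br_scale_left br_scale_right)
  qed
qed auto

lemma hi_collinear: "hi (a \<star> x) (b \<star> x) = 0"
proof -
  have "nest br (dyn_word (a \<star> x) (b \<star> x) ps) = 0" if "dyn_deg ps \<ge> 2" for ps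
    by (rule nest_collinear[of _ x]) (use that in \<open>auto simp: length_dyn_word dyn_word_map[of "a \<star> x"]\<close>)
  then show ?thesis unfolding hi_def by simp
qed

text \<open>On a line the product is addition. Powers and inverses in the group therefore become
  integer multiples of vectors.\<close>

lemma chp_collinear: "chp (a \<star> x) (b \<star> x) = (a + b) \<star> x"
  by (simp add: chp_hi hi_collinear scale_left_distrib)

lemma hi_zero_right [simp]: "hi x 0 = 0"
  using hi_collinear[of 1 x 0] by simp

lemma hi_zero_left [simp]: "hi 0 x = 0"
  using hi_collinear[of 0 x 1] by simp

section \<open>The lower central series\<close>

definition subalg :: "'v set \<Rightarrow> bool" where
  "subalg H \<longleftrightarrow> subspace H \<and> (\<forall>x\<in>H. \<forall>y\<in>H. br x y \<in> H)"

text \<open>Indices start at 0, so \<open>lcs H k\<close> is spanned by brackets of k + 1 elements.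
  The series is taken inside a subalgebra \<open>H\<close> because the ambient type is larger than
  the Lie algebra of the group.\<close>

primrec lcs :: "'v set \<Rightarrow> nat \<Rightarrow> 'v set" where
  "lcs H 0 = H"
| "lcs H (Suc k) = span {br x y | x y. x \<in> H \<and> y \<in> lcs H k}"

lemma subalg_UNIV: "subalg UNIV"
  by (auto simp: subalg_def)

lemma subspace_lcs: "subalg H \<Longrightarrow> subspace (lcs H k)"
  by (cases k) (auto simp: subalg_def)

lemma asub_lcs: "subalg H \<Longrightarrow> asub (lcs H k)"
  by (simp add: subspace_asub subspace_lcs)

lemma br_lcs: "x \<in> H \<Longrightarrow> y \<in> lcs H k \<Longrightarrow> br x y \<in> lcs H (Suc k)"
  by (auto intro!: span_base)

lemma br_lcs': "subalg H \<Longrightarrow> x \<in> H \<Longrightarrow> y \<in> lcs H k \<Longrightarrow> br y x \<in> lcs H (Suc k)"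
  using br_lcs[of x H y k] asub_uminus[OF asub_lcs[of H "Suc k"]] br_anti[of y x] by auto

lemma lcs_Suc_subset: "subalg H \<Longrightarrow> lcs H (Suc k) \<subseteq> lcs H k"
proof (induction k)
  case 0
  then have "{br x y |x y. x \<in> H \<and> y \<in> H} \<subseteq> H" by (auto simp: subalg_def)
  with 0 show ?case using span_minimal[of _ H] by (simp add: subalg_def)
next
  case (Suc k)
  then have "{br x y |x y. x \<in> H \<and> y \<in> lcs H (Suc k)} \<subseteq> {br x y |x y. x \<in> H \<and> y \<in> lcs H k}"
    by (auto simp del: lcs.simps)
  then show ?case by (subst (1 2) lcs.simps) (rule span_mono)
qed

lemma lcs_antimono: "subalg H \<Longrightarrow> i \<le> j \<Longrightarrow> lcs H j \<subseteq> lcs H i"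
proof (induction j)
  case (Suc j)
  then show ?case using lcs_Suc_subset[of H j] by (cases "i = Suc j") (auto simp del: lcs.simps)
qed (simp del: lcs.simps)

lemma lcs_subset: "subalg H \<Longrightarrow> lcs H k \<subseteq> H"
  using lcs_antimono[of H 0 k] by simp

lemma lcs_mono: "H \<subseteq> H' \<Longrightarrow> lcs H k \<subseteq> lcs H' k"
proof (induction k)
  case (Suc k)
  then have "{br x y |x y. x \<in> H \<and> y \<in> lcs H k} \<subseteq> {br x y |x y. x \<in> H' \<and> y \<in> lcs H' k}"
    by blast
  then show ?case by (simp add: span_mono)
qed simp

lemma lcs_nest: "lcs UNIV k \<subseteq> span {nest br zs | zs. length zs = Suc k}"
proof (induction k)
  case 0
  have "x \<in> span {nest br zs | zs. length zs = Suc 0}" for x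
    by (rule span_base) (auto intro!: exI[of _ "[x]"])
  then show ?case by auto
next
  case (Suc k)
  have "br x y \<in> span {nest br zs | zs. length zs = Suc (Suc k)}" if "y \<in> lcs UNIV k" for x y
  proof -
    have "y \<in> span {nest br zs | zs. length zs = Suc k}" using Suc that by auto
    then show ?thesis
    proof (induction rule: span_induct_alt)
      case base show ?case by (simp add: span_zero)
    next
      case (step c z w)
      then obtain zs where zs: "z = nest br zs" "length zs = Suc k" by auto
      then have "zs \<noteq> []" by auto
      then have "br x z = nest br (x # zs)" using zs by (simp add: nest_Cons)
      moreover have "length (x # zs) = Suc (Suc k)" using zs by simp
      ultimately have "br x z \<in> span {nest br zs | zs. length zs = Suc (Suc k)}"
        by (intro span_base) blast
      with step show ?case by (simp add: br_add_right br_scale_right span_add span_scale)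
    qed
  qed
  then have "{br x y |x y. x \<in> UNIV \<and> y \<in> lcs UNIV k} \<subseteq> span {nest br zs | zs. length zs = Suc (Suc k)}"
    by auto
  from span_minimal[OF this subspace_span] show ?case by simp
qed

lemma ex_lcs_trivial: "\<exists>K. \<forall>H. lcs H K \<subseteq> {0}"
proof -
  obtain K where K: "\<forall>zs. length zs = Suc K \<longrightarrow> nest br zs = 0" using nilpotent by auto
  have "span {nest br zs | zs. length zs = Suc K} \<subseteq> {0}"
    by (rule span_minimal) (use K in auto)
  then show ?thesis using lcs_nest[of K] lcs_mono[of _ UNIV K] by blast
qed

text \<open>Induction on \<open>i\<close>: the Jacobi identity rewrites [[a,u],y] as [a,[u,y]] -
  [u,[a,y]]. The successor in the index comes from counting from 0.\<close>

lemma lcs_br: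
  assumes H: "subalg H"
  shows "x \<in> lcs H i \<Longrightarrow> y \<in> lcs H j \<Longrightarrow> br x y \<in> lcs H (Suc (i + j))"
proof (induction i arbitrary: x y j)
  case 0
  then show ?case using br_lcs by simp
next
  case (Suc i)
  from Suc.prems(1) have "x \<in> span {br x y | x y. x \<in> H \<and> y \<in> lcs H i}" by simp
  then show ?case
  proof (induction rule: span_induct_alt)
    case base
    show ?case by (simp add: asub_zero[OF asub_lcs[OF H]] del: lcs.simps)
  next
    case (step c z w)
    then obtain a u where z: "z = br a u" and a: "a \<in> H" and u: "u \<in> lcs H i" by auto
    have "br z y = br a (br u y) - br u (br a y)"
      using jacobi[of a u y] br_anti[of y "br a u"] br_anti[of y a]
      by (simp add: z br_minus_right algebra_simps)
    moreover have "br a (br u y) \<in> lcs H (Suc (Suc i + j))"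
      using br_lcs[OF a Suc.IH[OF u Suc.prems(2)]] by simp
    moreover have "br u (br a y) \<in> lcs H (Suc (Suc i + j))"
      using Suc.IH[OF u br_lcs[OF a Suc.prems(2)]] by simp
    ultimately have "br z y \<in> lcs H (Suc (Suc i + j))"
      using asub_diff[OF asub_lcs[OF H]] by metis
    then show ?case using step
      by (simp add: br_add_left br_scale_left subspace_add[OF subspace_lcs[OF H]]
          subspace_scale[OF subspace_lcs[OF H]] del: lcs.simps)
  qed
qed

text \<open>Every term of \<open>hi\<close> has at least two letters, so changing a letter by an
  element of \<open>lcs H k\<close> changes the term by an element one step deeper. Accordingly
  \<open>J\<close> is \<open>lcs H k\<close> for single letters and \<open>lcs H (Suc k)\<close> for
  longer words.\<close>

lemma hi_lcs:
  assumes H: "subalg H" and "x \<in> H" "x' \<in> H" "y \<in> H" "y' \<in> H"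
    and "x' - x \<in> lcs H k" "y' - y \<in> lcs H k"
  shows "hi x' y' - hi x y \<in> lcs H (Suc k)"
proof (rule hi_variation[where A = "\<lambda>_. H" and J = "\<lambda>n. if n \<le> 1 then lcs H k else lcs H (Suc k)"])
  show "asub (if n \<le> 1 then lcs H k else lcs H (Suc k))" for n
    using asub_lcs[OF H] by (simp del: lcs.simps)
  show "br x y \<in> H" if "x \<in> H" "y \<in> H" for x y using H that by (auto simp: subalg_def)
  show "br x y \<in> (if Suc n \<le> 1 then lcs H k else lcs H (Suc k))"
    if "n \<ge> 1" "x \<in> H" "y \<in> (if n \<le> 1 then lcs H k else lcs H (Suc k))" for n x y
  proof -
    have "y \<in> lcs H k" using that lcs_Suc_subset[OF H, of k] by (auto split: if_splits simp del: lcs.simps)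
    with that show ?thesis by (auto simp del: lcs.simps intro: br_lcs)
  qed
  show "br x y \<in> (if Suc n \<le> 1 then lcs H k else lcs H (Suc k))"
    if "n \<ge> 1" "x \<in> (if (1::nat) \<le> 1 then lcs H k else lcs H (Suc k))" "y \<in> H" for n x y
    using that br_lcs'[OF H, of y x k] by (auto simp del: lcs.simps)
  show "asub (lcs H (Suc k))" by (rule asub_lcs[OF H])
  show "dyn_coeff ps \<star> x \<in> lcs H (Suc k)"
    if "dyn_deg ps \<ge> 2" "x \<in> (if dyn_deg ps \<le> 1 then lcs H k else lcs H (Suc k))" for ps x
    using that subspace_scale[OF subspace_lcs[OF H]] by (auto simp del: lcs.simps)
qed (use assms in \<open>auto simp del: lcs.simps\<close>)

lemma hi_in_subalg:
  assumes H: "subalg H" and "x \<in> H" "y \<in> H" shows "hi x y \<in> H"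
proof -
  have "hi x y - hi 0 0 \<in> lcs H (Suc 0)"
    using assms by (intro hi_lcs) (auto simp: subalg_def subspace_0)
  then show ?thesis using lcs_subset[OF H, of "Suc 0"] by (auto simp del: lcs.simps)
qed

lemma chp_in_subalg:
  assumes "subalg H" "x \<in> H" "y \<in> H" shows "chp x y \<in> H"
proof -
  have "subspace H" using assms(1) by (simp add: subalg_def)
  then show ?thesis
    unfolding chp_hi by (intro subspace_add hi_in_subalg assms)
qed

lemma chp_lcs:
  assumes H: "subalg H" and "x \<in> H" "y \<in> lcs H k"
  shows "chp x y - x - y \<in> lcs H (Suc k)" "chp y x - y - x \<in> lcs H (Suc k)"
proof -
  have 0: "0 \<in> H" using H by (auto simp: subalg_def subspace_0)
  have y: "y \<in> H" using assms lcs_subset by blast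
  have x0: "x - x \<in> lcs H k" using asub_lcs[OF H] by (simp add: asub_zero)
  have y0: "y - 0 \<in> lcs H k" using assms by simp
  have "hi x y - hi x 0 \<in> lcs H (Suc k)" "hi y x - hi 0 x \<in> lcs H (Suc k)"
    by (rule hi_lcs[OF H assms(2) assms(2) 0 y x0 y0], rule hi_lcs[OF H 0 y assms(2) assms(2) y0 x0])
  then show "chp x y - x - y \<in> lcs H (Suc k)" "chp y x - y - x \<in> lcs H (Suc k)"
    by (simp_all add: chp_hi del: lcs.simps)
qed

lemma chp_diff_lcs:
  assumes H: "subalg H" and "x \<in> H" "s \<in> H" "s' \<in> H" "s' - s \<in> lcs H k"
  shows "chp x s' - chp x s - (s' - s) \<in> lcs H (Suc k)"
proof -
  have "x - x \<in> lcs H k" using asub_lcs[OF H] by (simp add: asub_zero)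
  then have "hi x s' - hi x s \<in> lcs H (Suc k)"
    using assms by (intro hi_lcs) auto
  then show ?thesis by (simp add: chp_hi algebra_simps del: lcs.simps)
qed

text \<open>The difference s' - s sinks through the whole series: once it lies in
  \<open>lcs UNIV k\<close>, the two equal products differ by it up to an element of
  \<open>lcs UNIV (Suc k)\<close>.\<close>

lemma chp_left_cancel:
  assumes "chp x s = chp x s'" shows "s = s'"
proof -
  have "s' - s \<in> lcs UNIV k" for k
  proof (induction k)
    case (Suc k)
    have "chp x s' - chp x s - (s' - s) \<in> lcs UNIV (Suc k)"
      using Suc by (intro chp_diff_lcs subalg_UNIV) auto
    then have "- (s' - s) \<in> lcs UNIV (Suc k)" unfolding assms by (simp del: lcs.simps)
    from asub_uminus[OF asub_lcs[OF subalg_UNIV] this] show ?case by (simp del: lcs.simps)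
  qed simp
  moreover obtain K where "lcs UNIV K \<subseteq> {0}" using ex_lcs_trivial by auto
  ultimately show ?thesis by fastforce
qed

text \<open>A word with at least one letter \<open>y\<close> and at least three letters only sees \<open>[x,y]\<close> and its brackets.\<close>

lemma nest_word_lcs:
  assumes H: "subalg H" and x: "x \<in> H" and y: "y \<in> lcs H k"
  shows "False \<in> set bs \<Longrightarrow> nest br (map (\<lambda>b. if b then x else y) bs) \<in> lcs H (k + min 2 (length bs - 1))"
proof (induction bs)
  case (Cons b bs)
  let ?m = "\<lambda>bs. map (\<lambda>b. if b then x else y) bs"
  have yH: "y \<in> H" using y lcs_subset[OF H] by blast
  have bH: "(if b then x else y) \<in> H" using x yH by auto
  consider (nil) "bs = []" | (mixed) "bs \<noteq> []" "False \<in> set bs" | (const) "bs \<noteq> []" "False \<notin> set bs" by auto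
  then show ?case
  proof cases
    case nil
    with Cons y show ?thesis by (auto simp del: lcs.simps)
  next
    case mixed
    then have "br (if b then x else y) (nest br (?m bs)) \<in> lcs H (Suc (k + min 2 (length bs - 1)))"
      using Cons.IH bH by (intro br_lcs) auto
    moreover have "k + min 2 (length (b # bs) - 1) \<le> Suc (k + min 2 (length bs - 1))"
      using mixed by (cases bs) auto
    ultimately have "br (if b then x else y) (nest br (?m bs)) \<in> lcs H (k + min 2 (length (b # bs) - 1))"
      using lcs_antimono[OF H] by blast
    then show ?thesis using mixed by (simp add: nest_Cons del: lcs.simps)
  next
    case const
    then have b: "b = False" using Cons.prems by auto
    show ?thesis
    proof (cases "length bs \<ge> 2")
      case True
      have "\<forall>z\<in>set (?m bs). \<exists>a. z = a \<star> x"
        using const by (auto intro!: exI[of _ 1])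
      then have "nest br (?m bs) = 0" using True by (intro nest_collinear[of _ x]) auto
      then show ?thesis using const asub_zero[OF asub_lcs[OF H]] by (simp add: nest_Cons del: lcs.simps)
    next
      case False
      with const obtain b' where "bs = [b']" by (cases bs; cases "tl bs") auto
      with const b have "bs = [True]" by auto
      then show ?thesis using b br_lcs'[OF H x y] by (simp del: lcs.simps)
    qed
  qed
qed auto

text \<open>Words in x alone vanish, being collinear; the words that contain y are covered by
  \<open>nest_word_lcs\<close>.\<close>

lemma hi3_lcs:
  assumes H: "subalg H" and x: "x \<in> H" and y: "y \<in> lcs H k"
  shows "hi3 x y \<in> lcs H (k + 2)" "hi3 y x \<in> lcs H (k + 2)"
proof -
  have *: "nest br (map (\<lambda>b. if b then x else y) bs) \<in> lcs H (k + 2)" if "length bs \<ge> 3" for bs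
  proof (cases "False \<in> set bs")
    case True
    then show ?thesis using nest_word_lcs[OF H x y True] that by (auto simp: min_def simp del: lcs.simps split: if_splits)
  next
    case False
    have "\<forall>z\<in>set (map (\<lambda>b. if b then x else y) bs). \<exists>a. z = a \<star> x"
      using False by (auto intro!: exI[of _ 1])
    then have "nest br (map (\<lambda>b. if b then x else y) bs) = 0"
      using that by (intro nest_collinear[of _ x]) auto
    then show ?thesis using asub_zero[OF asub_lcs[OF H]] by (simp del: lcs.simps)
  qed
  have sc: "a \<star> z \<in> lcs H (k + 2)" if "z \<in> lcs H (k + 2)" for a z
    using subspace_scale[OF subspace_lcs[OF H]] that by blast
  show "hi3 x y \<in> lcs H (k + 2)" unfolding hi3_def
  proof (intro asub_sum[OF asub_lcs[OF H]] sc)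
    fix ps assume "ps \<in> {ps \<in> dyn_index T. 3 \<le> dyn_deg ps}"
    then show "nest br (dyn_word x y ps) \<in> lcs H (k + 2)"
      unfolding dyn_word_map[of x y] by (intro *) (auto simp: length_dyn_word)
  qed
  show "hi3 y x \<in> lcs H (k + 2)" unfolding hi3_def
  proof (intro asub_sum[OF asub_lcs[OF H]] sc)
    fix ps assume ps: "ps \<in> {ps \<in> dyn_index T. 3 \<le> dyn_deg ps}"
    \<comment> \<open>Exchanging the two letters negates the boolean word, which reduces the second
      claim to the same estimate.\<close>
    have "dyn_word y x ps = map (\<lambda>b. if b then x else y) (map Not (dyn_word True False ps))"
      by (subst dyn_word_map) auto
    have "nest br (map (\<lambda>b. if b then x else y) (map Not (dyn_word True False ps))) \<in> lcs H (k + 2)"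
      using ps by (intro *) (auto simp: length_dyn_word)
    then show "nest br (dyn_word y x ps) \<in> lcs H (k + 2)"
      using \<open>dyn_word y x ps = _\<close> by metis
  qed
qed

text \<open>The quadratic terms contribute (1/2)[x,y] - (1/2)[y,x] = [x,y], and the cubic remainders
  are two steps deeper. This is the bridge from group commutators to Lie brackets.\<close>

lemma chp_commutator:
  assumes H: "subalg H" and x: "x \<in> H" and y: "y \<in> lcs H k"
  shows "chp x y - chp y x - br x y \<in> lcs H (k + 2)"
proof -
  have "chp x y - chp y x - br x y = hi3 x y - hi3 y x"
  proof -
    have "(1/2) \<star> br x y - (1/2) \<star> br y x = br x y"
      by (subst br_anti[of y x]) (simp flip: scale_left_distrib)
    then show ?thesis by (simp add: chp_hi hi_hi3 algebra_simps)
  qed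
  then show ?thesis using hi3_lcs[OF assms] asub_diff[OF asub_lcs[OF H]] by metis
qed

end

section \<open>Lattices, their multiples and projections in rational vector spaces\<close>

lemma zspan_map:
  assumes "\<And>x y. f (x - y) = f x - f y" "\<And>x. x \<in> F \<Longrightarrow> f x \<in> B" "asub B" "x \<in> zspan F"
  shows "f x \<in> B"
  using assms(4)
proof (induction rule: zspan_induct)
  case zero
  have "f 0 = 0" using assms(1)[of 0 0] by simp
  then show ?case using assms(3) by (simp add: asub_zero)
qed (use assms in \<open>auto intro: asub_diff\<close>)

context rational_space
begin

lemma asub_scale_int:
  assumes "asub A" "x \<in> A" shows "of_int n \<star> x \<in> A"
proof (cases n)
  case (nonneg k)
  have "of_nat k \<star> x \<in> A"
    by (induction k) (use assms in \<open>auto simp: asub_zero asub_add scale_left_distrib\<close>)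
  then show ?thesis using nonneg by simp
next
  case (neg k)
  have "of_nat j \<star> x \<in> A" for j
    by (induction j) (use assms in \<open>auto simp: asub_zero asub_add scale_left_distrib\<close>)
  from asub_uminus[OF assms(1) this[of "Suc k"]] have "(- of_nat (Suc k)) \<star> x \<in> A"
    by (simp only: scale_minus_left)
  then show ?thesis using neg by simp
qed

definition dil :: "rat \<Rightarrow> 'v set \<Rightarrow> 'v set" where
  "dil M A = (\<lambda>x. M \<star> x) ` A"

lemma asub_dil: "asub A \<Longrightarrow> asub (dil M A)"
  unfolding asub_def dil_def
  by (auto simp flip: scale_right_diff_distrib)

lemma dil_mono: "A \<subseteq> B \<Longrightarrow> dil M A \<subseteq> dil M B"
  by (auto simp: dil_def)

lemma dil_int_subset: "asub A \<Longrightarrow> dil (of_int M) A \<subseteq> A"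
  by (auto simp: dil_def asub_scale_int)

lemma zspan_dil_subset: "F \<subseteq> F' \<Longrightarrow> x \<in> dil M (zspan F) \<Longrightarrow> x \<in> dil M (zspan F')"
  using dil_mono[OF zspan_mono] by blast

lemma subspace_approx:
  assumes "subspace A" "subspace B" shows "subspace {z. \<exists>w\<in>A. z - w \<in> B}"
proof (rule subspaceI)
  show "0 \<in> {z. \<exists>w\<in>A. z - w \<in> B}"
    using assms by (auto intro!: bexI[of _ 0] simp: subspace_0)
next
  fix x y assume "x \<in> {z. \<exists>w\<in>A. z - w \<in> B}" "y \<in> {z. \<exists>w\<in>A. z - w \<in> B}"
  then obtain w v where "w \<in> A" "v \<in> A" "x - w \<in> B" "y - v \<in> B" by auto
  then have "w + v \<in> A" "(x + y) - (w + v) \<in> B"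
    using assms subspace_add[of B "x - w" "y - v"] by (auto simp: subspace_add algebra_simps)
  then show "x + y \<in> {z. \<exists>w\<in>A. z - w \<in> B}" by blast
next
  fix c x assume "x \<in> {z. \<exists>w\<in>A. z - w \<in> B}"
  then obtain w where "w \<in> A" "x - w \<in> B" by auto
  then have "c \<star> w \<in> A" "c \<star> x - c \<star> w \<in> B"
    using assms subspace_scale[of B "x - w" c] by (auto simp: subspace_scale scale_right_diff_distrib)
  then show "c \<star> x \<in> {z. \<exists>w\<in>A. z - w \<in> B}" by blast
qed

lemma clear_denominators:
  assumes "u \<in> span S"
  shows "\<exists>N>0. \<exists>D. finite D \<and> D \<subseteq> S \<and> of_int N \<star> u \<in> zspan D"
  using assms
proof (induction rule: span_induct_alt)
  case base
  show ?case by (intro exI[of _ 1] conjI exI[of _ "{}"]) (auto simp: asub_zero asub_zspan)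
next
  case (step c x y)
  then obtain N D where ND: "N > 0" "finite D" "D \<subseteq> S" "of_int N \<star> y \<in> zspan D" by auto
  obtain p q where pq: "quotient_of c = (p, q)" by fastforce
  then have q: "q > 0" "c = of_int p / of_int q"
    using quotient_of_denom_pos quotient_of_div by auto
  have "of_int (N * q) \<star> (c \<star> x + y) = of_int (N * p) \<star> x + of_int q \<star> (of_int N \<star> y)"
    using q by (simp add: scale_right_distrib mult.commute)
  moreover have "of_int (N * p) \<star> x \<in> zspan (insert x D)"
    by (intro asub_scale_int asub_zspan zspan_base) auto
  moreover have "of_int q \<star> (of_int N \<star> y) \<in> zspan (insert x D)"
    using ND(4) zspan_mono[of D "insert x D"] by (intro asub_scale_int[OF asub_zspan, of "of_int N \<star> y"]) auto
  ultimately have "of_int (N * q) \<star> (c \<star> x + y) \<in> zspan (insert x D)"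
    by (simp add: asub_add asub_zspan)
  then show ?case using ND q step(1)
    by (intro exI[of _ "N * q"] conjI exI[of _ "insert x D"]) auto
qed

lemma zspan_insertE:
  assumes "x \<in> zspan (insert e D)"
  obtains a where "x - of_int a \<star> e \<in> zspan D"
proof -
  from assms have "\<exists>a. x - of_int a \<star> e \<in> zspan D"
  proof (induction rule: zspan_induct)
    case zero
    show ?case by (intro exI[of _ 0]) (simp add: asub_zero asub_zspan)
  next
    case (base s)
    show ?case
    proof (cases "s = e")
      case True
      then show ?thesis by (intro exI[of _ 1]) (simp add: asub_zero asub_zspan)
    next
      case False
      with base show ?thesis by (intro exI[of _ 0]) (simp add: zspan_base)
    qed
  next
    case (diff x y)
    then obtain a b where "x - of_int a \<star> e \<in> zspan D" "y - of_int b \<star> e \<in> zspan D" by auto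
    from asub_diff[OF asub_zspan this] show ?case
      by (intro exI[of _ "a - b"]) (simp add: algebra_simps)
  qed
  with that show thesis by blast
qed

lemma ex_projection:
  assumes "subspace W"
  shows "\<exists>P. range P \<subseteq> W \<and> (\<forall>x y. P (x - y) = P x - P y) \<and> (\<forall>a x. P (a \<star> x) = a \<star> P x) \<and> (\<forall>w\<in>W. P w = w)"
proof -
  interpret vp: vector_space_pair scale scale ..
  have "Vector_Spaces.linear scale scale (\<lambda>x. x)" by unfold_locales auto
  from vp.linear_exists_left_inverse_on[OF this assms]
  obtain g where g: "range g \<subseteq> W" "Vector_Spaces.linear scale scale g" "\<forall>v\<in>W. g v = v" by (auto simp: inj_on_def)
  interpret g: Vector_Spaces.linear scale scale g by (rule g)
  show ?thesis using g g.diff g.scale by blast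
qed

end

context nilpotent_lie
begin

lemma finite_br_image: "finite A \<Longrightarrow> finite B \<Longrightarrow> finite {br x y | x y. x \<in> A \<and> y \<in> B}"
  using finite_image_set2[of "\<lambda>x. x \<in> A" "\<lambda>y. y \<in> B" br] by simp

lemma br_zspan:
  assumes "x \<in> zspan F" "y \<in> zspan G"
  shows "br x y \<in> zspan {br x y | x y. x \<in> F \<and> y \<in> G}"
proof (rule zspan_map[of "\<lambda>x. br x y", OF br_diff_left _ asub_zspan assms(1)])
  fix x assume "x \<in> F"
  then show "br x y \<in> zspan {br x y | x y. x \<in> F \<and> y \<in> G}"
    by (intro zspan_map[of "br x", OF br_diff_right _ asub_zspan assms(2)]) (blast intro: zspan_base)
qed

primrec iter_br :: "'v set \<Rightarrow> nat \<Rightarrow> 'v set" where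
  "iter_br F 0 = F"
| "iter_br F (Suc n) = {br x y | x y. x \<in> F \<and> y \<in> iter_br F n}"

lemma finite_iter_br: "finite F \<Longrightarrow> finite (iter_br F n)"
  by (induction n) (auto intro!: finite_br_image simp del: Collect_disj_eq)

text \<open>\<open>E\<close> does not depend on \<open>M\<close>. By bilinearity, a word whose
  letters change by \<open>M\<close> times the lattice changes by \<open>M\<close> times an iterated
  bracket of generators, and finitely many coefficients occur.\<close>

lemma hi_lattice:
  assumes "finite F"
  shows "\<exists>E. finite E \<and> (\<forall>M x x' y y'. x \<in> zspan F \<longrightarrow> x' \<in> zspan F \<longrightarrow> y \<in> zspan F \<longrightarrow> y' \<in> zspan F
    \<longrightarrow> x' - x \<in> dil M (zspan F) \<longrightarrow> y' - y \<in> dil M (zspan F) \<longrightarrow> hi x' y' - hi x y \<in> dil M (zspan E))"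
proof -
  define E where "E = (\<Union>ps\<in>dyn_index T. (\<lambda>z. dyn_coeff ps \<star> z) ` iter_br F (dyn_deg ps - 1))"
  have "finite E" unfolding E_def using assms finite_dyn_index finite_iter_br by auto
  moreover have "hi x' y' - hi x y \<in> dil M (zspan E)"
    if "x \<in> zspan F" "x' \<in> zspan F" "y \<in> zspan F" "y' \<in> zspan F"
      "x' - x \<in> dil M (zspan F)" "y' - y \<in> dil M (zspan F)" for M x x' y y'
  proof (rule hi_variation[where A = "\<lambda>n. zspan (iter_br F (n - 1))" and J = "\<lambda>n. dil M (zspan (iter_br F (n - 1)))"])
    have *: "br x y \<in> zspan (iter_br F n)"
      if "n \<ge> 1" "x \<in> zspan F" "y \<in> zspan (iter_br F (n - 1))" for n x y
    proof -
      obtain k where "n = Suc k" using \<open>n \<ge> 1\<close> by (cases n) auto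
      with br_zspan[OF that(2,3)] show ?thesis by simp
    qed
    show "br x y \<in> zspan (iter_br F (Suc n - 1))"
      if "n \<ge> 1" "x \<in> zspan (iter_br F (1 - 1))" "y \<in> zspan (iter_br F (n - 1))" for n x y
      using * that by simp
    show "br x y \<in> dil M (zspan (iter_br F (Suc n - 1)))"
      if "n \<ge> 1" "x \<in> zspan (iter_br F (1 - 1))" "y \<in> dil M (zspan (iter_br F (n - 1)))" for n x y
      using * that by (auto simp: dil_def br_scale_right)
    show "br x y \<in> dil M (zspan (iter_br F (Suc n - 1)))"
      if "n \<ge> 1" "x \<in> dil M (zspan (iter_br F (1 - 1)))" "y \<in> zspan (iter_br F (n - 1))" for n x y
      using * that by (auto simp: dil_def br_scale_left)
    show "dyn_coeff ps \<star> x \<in> dil M (zspan E)"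
      if ps: "ps \<in> dyn_index T" and x: "x \<in> dil M (zspan (iter_br F (dyn_deg ps - 1)))" for ps x
    proof -
      obtain z where z: "x = M \<star> z" "z \<in> zspan (iter_br F (dyn_deg ps - 1))"
        using x by (auto simp: dil_def)
      have "dyn_coeff ps \<star> z \<in> zspan E"
        by (rule zspan_map[OF _ _ asub_zspan z(2)])
          (use ps in \<open>auto simp: E_def scale_right_diff_distrib intro!: zspan_base\<close>)
      then show ?thesis using z by (auto simp: dil_def mult.commute intro!: image_eqI[of _ _ "dyn_coeff ps \<star> z"])
    qed
  qed (use that in \<open>auto intro: asub_dil asub_zspan\<close>)
  ultimately show ?thesis by blast
qed

lemma chp_lattice:
  assumes "finite F"
  shows "\<exists>E. finite E \<and> (\<forall>(M::int) x y. x \<in> dil (of_int M) (zspan F) \<longrightarrow> y \<in> dil (of_int M) (zspan F)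
    \<longrightarrow> chp x y \<in> dil (of_int M) (zspan E))"
proof -
  obtain E where E: "finite E" "\<And>M x x' y y'. x \<in> zspan F \<Longrightarrow> x' \<in> zspan F \<Longrightarrow> y \<in> zspan F \<Longrightarrow> y' \<in> zspan F
    \<Longrightarrow> x' - x \<in> dil M (zspan F) \<Longrightarrow> y' - y \<in> dil M (zspan F) \<Longrightarrow> hi x' y' - hi x y \<in> dil M (zspan E)"
    using hi_lattice[OF assms] by blast
  have "chp x y \<in> dil (of_int M) (zspan (F \<union> E))"
    if "x \<in> dil (of_int M) (zspan F)" "y \<in> dil (of_int M) (zspan F)" for x y and M :: int
  proof -
    have "x \<in> zspan F" "y \<in> zspan F" using that dil_int_subset[OF asub_zspan] by blast+
    then have "hi x y - hi 0 0 \<in> dil (of_int M) (zspan E)"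
      using that by (intro E) (auto simp: asub_zero asub_zspan)
    then have "hi x y \<in> dil (of_int M) (zspan (F \<union> E))" by (auto intro: zspan_dil_subset[of E])
    moreover have "x \<in> dil (of_int M) (zspan (F \<union> E))" "y \<in> dil (of_int M) (zspan (F \<union> E))"
      using that by (auto intro: zspan_dil_subset[of F])
    ultimately show ?thesis unfolding chp_hi by (intro asub_add asub_dil asub_zspan)
  qed
  with E(1) assms show ?thesis by (intro exI[of _ "F \<union> E"]) auto
qed

section \<open>Solving \<open>w * s = y\<close>\<close>

text \<open>Fixed point iteration for s = y - w - hi w s, that is for \<open>chp w s = y\<close>.
  Each step gains one term of the lower central series, so finitely many steps solve the equation
  exactly, while the size of the solution stays visible: it is divisible by \<open>M\<close>, up to
  bounded denominators, if y - w is.\<close>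

primrec sol :: "'v \<Rightarrow> 'v \<Rightarrow> nat \<Rightarrow> 'v" where
  "sol w y 0 = 0"
| "sol w y (Suc j) = y - w - hi w (sol w y j)"

lemma sol_approx: "y - chp w (sol w y j) \<in> lcs UNIV j"
proof (induction j)
  case (Suc j)
  let ?s = "sol w y j"
  have "sol w y (Suc j) - ?s = y - chp w ?s" by (simp add: chp_hi)
  with Suc have "sol w y (Suc j) - ?s \<in> lcs UNIV j" by metis
  then have "hi w (sol w y (Suc j)) - hi w ?s \<in> lcs UNIV (Suc j)"
    by (intro hi_lcs[OF subalg_UNIV]) (auto simp: asub_zero[OF asub_lcs[OF subalg_UNIV]] simp del: lcs.simps sol.simps)
  from asub_uminus[OF asub_lcs[OF subalg_UNIV] this]
  show ?case by (simp add: chp_hi del: lcs.simps)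
qed simp

lemma chp_sol: "lcs UNIV K \<subseteq> {0} \<Longrightarrow> chp w (sol w y K) = y"
  using sol_approx[of y w K] by auto

lemma sol_lcs:
  assumes H: "subalg H" and "w \<in> H" "y - w \<in> lcs H k"
  shows "sol w y j \<in> lcs H k"
proof (induction j)
  case 0
  then show ?case using asub_lcs[OF H] by (simp add: asub_zero)
next
  case (Suc j)
  have 0: "0 \<in> H" using H by (auto simp: subalg_def subspace_0)
  have s: "sol w y j \<in> H" using Suc lcs_subset[OF H] by blast
  have w: "w - w \<in> lcs H k" by (simp add: asub_zero[OF asub_lcs[OF H]])
  have "sol w y j - 0 \<in> lcs H k" using Suc by simp
  from hi_lcs[OF H assms(2) assms(2) 0 s w this]
  have "hi w (sol w y j) \<in> lcs H k" using lcs_Suc_subset[OF H] by fastforce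
  with assms(3) show ?case using asub_diff[OF asub_lcs[OF H]] by simp
qed

text \<open>As \<open>hi w 0 = 0\<close>, the value \<open>hi w (sol w y j)\<close> is a variation
  of the second argument by \<open>M\<close> times a lattice, so it is again divisible by
  \<open>M\<close>.\<close>

lemma sol_lattice:
  assumes "finite F"
  shows "\<exists>E. finite E \<and> (\<forall>(M::int) w y. w \<in> zspan F \<longrightarrow> y - w \<in> dil (of_int M) (zspan F)
    \<longrightarrow> sol w y j \<in> dil (of_int M) (zspan E))"
proof (induction j)
  case 0
  show ?case by (intro exI[of _ "{}"]) (auto simp: asub_zero asub_dil asub_zspan)
next
  case (Suc j)
  then obtain E where E: "finite E" "\<And>(M::int) w y. w \<in> zspan F \<Longrightarrow> y - w \<in> dil (of_int M) (zspan F)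
    \<Longrightarrow> sol w y j \<in> dil (of_int M) (zspan E)" by blast
  define F' where "F' = F \<union> E"
  have "finite F'" using assms E by (simp add: F'_def)
  from hi_lattice[OF this] obtain E' where E': "finite E'"
    "\<And>M x x' y y'. x \<in> zspan F' \<Longrightarrow> x' \<in> zspan F' \<Longrightarrow> y \<in> zspan F' \<Longrightarrow> y' \<in> zspan F'
    \<Longrightarrow> x' - x \<in> dil M (zspan F') \<Longrightarrow> y' - y \<in> dil M (zspan F') \<Longrightarrow> hi x' y' - hi x y \<in> dil M (zspan E')"
    by blast
  have "sol w y (Suc j) \<in> dil (of_int M) (zspan (F \<union> E'))"
    if w: "w \<in> zspan F" and y: "y - w \<in> dil (of_int M) (zspan F)" for M :: int and w y
  proof -
    have s: "sol w y j \<in> dil (of_int M) (zspan F')"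
      by (rule zspan_dil_subset[OF _ E(2)[OF w y]]) (auto simp: F'_def)
    then have s': "sol w y j \<in> zspan F'" using dil_int_subset[OF asub_zspan] by blast
    have w': "w \<in> zspan F'" using w zspan_mono[of F F'] by (auto simp: F'_def)
    have "hi w (sol w y j) - hi w 0 \<in> dil (of_int M) (zspan E')"
      using s s' w' by (intro E') (auto simp: asub_zero asub_dil asub_zspan)
    then have "hi w (sol w y j) \<in> dil (of_int M) (zspan (F \<union> E'))"
      by (auto intro: zspan_dil_subset[of E'])
    moreover have "y - w \<in> dil (of_int M) (zspan (F \<union> E'))"
      using y by (auto intro: zspan_dil_subset[of F])
    ultimately show ?thesis by (auto intro: asub_diff asub_dil asub_zspan)
  qed
  with assms E' show ?case by (intro exI[of _ "F \<union> E'"]) auto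
qed

section \<open>Generated subalgebras\<close>

definition lie_hull :: "'v set \<Rightarrow> 'v set" where
  "lie_hull S = \<Inter>{H. subalg H \<and> S \<subseteq> H}"

lemma lie_hull_superset: "S \<subseteq> lie_hull S"
  by (auto simp: lie_hull_def)

lemma lie_hull_minimal: "subalg H \<Longrightarrow> S \<subseteq> H \<Longrightarrow> lie_hull S \<subseteq> H"
  by (auto simp: lie_hull_def)

lemma subalg_lie_hull: "subalg (lie_hull S)"
  unfolding subalg_def
proof (intro conjI ballI subspaceI)
  show "0 \<in> lie_hull S" by (auto simp: lie_hull_def subalg_def subspace_0)
  show "x + y \<in> lie_hull S" if "x \<in> lie_hull S" "y \<in> lie_hull S" for x y
    using that subspace_add unfolding lie_hull_def subalg_def by blast
  show "c \<star> x \<in> lie_hull S" if "x \<in> lie_hull S" for c x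
    using that subspace_scale unfolding lie_hull_def subalg_def by blast
  show "br x y \<in> lie_hull S" if "x \<in> lie_hull S" "y \<in> lie_hull S" for x y
    using that unfolding lie_hull_def subalg_def by blast
qed

end

section \<open>Groups mapped into a Lie algebra by the Campbell-Hausdorff product\<close>

locale malcev_hom = nilpotent_lie scale br T + group G
  for scale :: "rat \<Rightarrow> 'v::ab_group_add \<Rightarrow> 'v" (infixr \<open>\<star>\<close> 75)
    and br :: "'v \<Rightarrow> 'v \<Rightarrow> 'v" and T :: nat and G :: "('g, 'b) monoid_scheme" (structure) +
  fixes \<iota> :: "'g \<Rightarrow> 'v"
  assumes hom: "g \<in> carrier G \<Longrightarrow> h \<in> carrier G \<Longrightarrow> \<iota> (g \<otimes> h) = chp (\<iota> g) (\<iota> h)"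
begin

abbreviation (input) "\<Delta> \<equiv> \<iota> ` carrier G"

lemma iota_one: "\<iota> \<one> = 0"
proof -
  have "chp (\<iota> \<one>) (\<iota> \<one>) = chp (\<iota> \<one>) 0"
    using hom[of \<one> \<one>] by (simp add: chp_hi)
  then show ?thesis by (rule chp_left_cancel)
qed

lemma iota_pow: "g \<in> carrier G \<Longrightarrow> \<iota> (g [^] (n::nat)) = of_nat n \<star> \<iota> g"
proof (induction n)
  case (Suc n)
  then show ?case using chp_collinear[of "of_nat n" "\<iota> g" 1] by (simp add: hom add.commute)
qed (simp add: iota_one)

lemma iota_inv: "g \<in> carrier G \<Longrightarrow> \<iota> (inv g) = - \<iota> g"
proof (rule chp_left_cancel[of "\<iota> g"])
  assume g: "g \<in> carrier G"
  then have "chp (\<iota> g) (\<iota> (inv g)) = 0" using hom[of g "inv g"] by (simp add: iota_one)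
  moreover have "chp (\<iota> g) (- \<iota> g) = 0" using chp_collinear[of 1 "\<iota> g" "-1"] by simp
  ultimately show "chp (\<iota> g) (\<iota> (inv g)) = chp (\<iota> g) (- \<iota> g)" by simp
qed

lemma zero_in_image: "0 \<in> \<Delta>"
  using iota_one by (metis image_eqI one_closed)

lemma chp_in_image: "x \<in> \<Delta> \<Longrightarrow> y \<in> \<Delta> \<Longrightarrow> chp x y \<in> \<Delta>"
  by (auto simp flip: hom intro!: imageI)

lemma int_scale_in_image:
  assumes "x \<in> \<Delta>" shows "of_int n \<star> x \<in> \<Delta>"
proof -
  obtain g where g: "g \<in> carrier G" "x = \<iota> g" using assms by auto
  show ?thesis
  proof (cases n)
    case (nonneg k)
    then show ?thesis using g iota_pow[of g k] by (metis image_eqI nat_pow_closed of_int_of_nat_eq)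
  next
    case (neg k)
    have "of_int n \<star> x = - (of_nat (Suc k) \<star> \<iota> g)" using neg g by (simp flip: scale_minus_left)
    also have "\<dots> = \<iota> (inv (g [^] Suc k))" using g by (simp only: iota_inv iota_pow nat_pow_closed)
    finally show ?thesis using g by (metis image_eqI inv_closed nat_pow_closed)
  qed
qed

text \<open>The image z of the group commutator satisfies z * w = x * y with w = y * x, and x * y -
  w is [x,y] up to \<open>lcs H (k + 2)\<close>. A bootstrap does the rest: if z lies in
  \<open>lcs H j\<close>, then z agrees with [x,y] up to the smaller of the depths j + 1 and k + 2,
  which raises \<open>j\<close> step by step from 0 to k + 1.\<close>

lemma commutator_leading_term:
  assumes H: "subalg H" "\<Delta> \<subseteq> H" and x: "x \<in> \<Delta>" and y: "y \<in> \<Delta>" "y \<in> lcs H k"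
  shows "\<exists>z\<in>\<Delta> \<inter> lcs H (Suc k). z - br x y \<in> lcs H (Suc (Suc k))"
proof -
  obtain g h where g: "g \<in> carrier G" "x = \<iota> g" and h: "h \<in> carrier G" "y = \<iota> h" using x y by auto
  define z where "z = \<iota> (g \<otimes> h \<otimes> inv (h \<otimes> g))"
  define w where "w = chp y x"
  have "(g \<otimes> h \<otimes> inv (h \<otimes> g)) \<otimes> (h \<otimes> g) = g \<otimes> h" using g h by (simp add: m_assoc)
  then have zw: "chp z w = chp x y"
    unfolding z_def w_def g(2) h(2) using g h by (metis hom inv_closed m_closed)
  have zD: "z \<in> \<Delta>" unfolding z_def using g h by auto
  have xH: "x \<in> H" and yH: "y \<in> H" and zH: "z \<in> H" using x y zD H by auto
  have wH: "w \<in> H" unfolding w_def using xH yH H by (intro chp_in_subalg) auto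
  have c: "chp x y - w - br x y \<in> lcs H (Suc (Suc k))"
    using chp_commutator[OF H(1) xH y(2)] by (simp add: w_def del: lcs.simps)
  have step: "z - br x y \<in> lcs H (min (Suc j) (Suc (Suc k)))" if "z \<in> lcs H j" for j
  proof -
    have "chp z w - z - w \<in> lcs H (Suc j)" using chp_lcs(2)[OF H(1) wH that] .
    then have "chp z w - z - w \<in> lcs H (min (Suc j) (Suc (Suc k)))"
      using lcs_antimono[OF H(1)] by (meson min.cobounded1 subsetD)
    moreover have "chp x y - w - br x y \<in> lcs H (min (Suc j) (Suc (Suc k)))"
      using c lcs_antimono[OF H(1)] by (meson min.cobounded2 subsetD)
    ultimately have "(chp x y - w - br x y) - (chp z w - z - w) \<in> lcs H (min (Suc j) (Suc (Suc k)))"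
      by (rule asub_diff[OF asub_lcs[OF H(1)], rotated])
    then show ?thesis by (simp add: zw algebra_simps del: lcs.simps)
  qed
  have brk: "br x y \<in> lcs H (Suc k)" using br_lcs[OF xH y(2)] .
  have "z \<in> lcs H j" if "j \<le> Suc k" for j
    using that
  proof (induction j)
    case (Suc j)
    then have "z - br x y \<in> lcs H (min (Suc j) (Suc (Suc k)))" by (intro step) simp
    then have "z - br x y \<in> lcs H (Suc j)" using Suc.prems by (simp add: min_def del: lcs.simps split: if_splits)
    moreover have "br x y \<in> lcs H (Suc j)" using brk lcs_antimono[OF H(1) Suc.prems] by blast
    ultimately show ?case using asub_add[OF asub_lcs[OF H(1)]] by (metis diff_add_cancel)
  qed (simp add: zH)
  then have zk: "z \<in> lcs H (Suc k)" by blast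
  have "z - br x y \<in> lcs H (Suc (Suc k))" using step[OF zk] by (simp del: lcs.simps)
  with zk zD show ?thesis by blast
qed

text \<open>The elements with this property form a subalgebra, because every bracket is already in
  the derived term and can be approximated by 0.\<close>

lemma hull_mod_derived:
  assumes "x \<in> lie_hull \<Delta>"
  shows "\<exists>u\<in>span \<Delta>. x - u \<in> lcs (lie_hull \<Delta>) 1"
proof -
  let ?H = "lie_hull \<Delta>"
  let ?Q = "?H \<inter> {z. \<exists>u\<in>span \<Delta>. z - u \<in> lcs ?H 1}"
  have sub: "subspace (lcs ?H 1)" by (rule subspace_lcs[OF subalg_lie_hull])
  have "subalg ?Q" unfolding subalg_def
  proof (intro conjI ballI)
    show "subspace ?Q"
      using subalg_lie_hull sub by (intro subspace_inter subspace_approx) (auto simp: subalg_def)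
    fix x y assume xy: "x \<in> ?Q" "y \<in> ?Q"
    then have "br x y \<in> lcs ?H 1" using br_lcs[of x ?H y 0] by simp
    then show "br x y \<in> ?Q" using xy subalg_lie_hull[of \<Delta>]
      by (auto simp: subalg_def simp del: lcs.simps intro!: bexI[of _ 0] span_zero)
  qed
  moreover have "\<Delta> \<subseteq> ?Q"
    using lie_hull_superset[of \<Delta>] subspace_0[OF sub] by (auto intro!: bexI span_base simp del: lcs.simps)
  ultimately have "?H \<subseteq> ?Q" by (rule lie_hull_minimal)
  with assms show ?thesis by blast
qed

text \<open>Each quotient of consecutive terms is spanned by group elements that lie in the smaller
  depth already: a generator [a,y] is, modulo the next term, bilinear in approximations of a and y,
  and brackets of group elements are replaced by group commutators.\<close>

lemma lcs_mod_next:
  "x \<in> lcs (lie_hull \<Delta>) k \<Longrightarrow>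
    \<exists>u\<in>span (\<Delta> \<inter> lcs (lie_hull \<Delta>) k). x - u \<in> lcs (lie_hull \<Delta>) (Suc k)"
proof (induction k arbitrary: x)
  case 0
  have "\<Delta> \<inter> lie_hull \<Delta> = \<Delta>" using lie_hull_superset[of \<Delta>] by auto
  with 0 show ?case using hull_mod_derived[of x] by (simp del: lcs.simps add: lcs.simps(1))
next
  case (Suc k)
  let ?H = "lie_hull \<Delta>"
  let ?S = "span (\<Delta> \<inter> lcs ?H (Suc k))" and ?L = "lcs ?H (Suc (Suc k))"
  define P where "P = {z. \<exists>w\<in>?S. z - w \<in> ?L}"
  have subP: "subspace P" unfolding P_def
    by (intro subspace_approx subspace_span subspace_lcs[OF subalg_lie_hull])
  have LP: "?L \<subseteq> P" by (auto simp: P_def simp del: lcs.simps intro!: bexI[of _ 0] span_zero)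
  have base: "br g h \<in> P" if "g \<in> \<Delta>" "h \<in> \<Delta> \<inter> lcs ?H k" for g h
  proof -
    have "h \<in> \<Delta>" "h \<in> lcs ?H k" using that by auto
    from commutator_leading_term[OF subalg_lie_hull lie_hull_superset that(1) this]
    obtain z where z: "z \<in> \<Delta> \<inter> lcs ?H (Suc k)" "z - br g h \<in> ?L" by metis
    have "br g h - z \<in> ?L"
      using asub_uminus[OF asub_lcs[OF subalg_lie_hull] z(2)] by (simp del: lcs.simps)
    then show ?thesis unfolding P_def using span_base[OF z(1)] by blast
  qed
  have uv: "br u v \<in> P" if u: "u \<in> span \<Delta>" and v: "v \<in> span (\<Delta> \<inter> lcs ?H k)" for u v
    using u
  proof (induction rule: span_induct_alt)
    case base
    then show ?case using subspace_0[OF subP] by simp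
  next
    case (step c g w)
    have "br g v \<in> P" using v
    proof (induction rule: span_induct_alt)
      case base
      then show ?case using subspace_0[OF subP] by simp
    next
      case (step c' h w')
      then show ?case using base[OF \<open>g \<in> \<Delta>\<close>, of h]
        by (simp add: br_add_right br_scale_right subspace_add[OF subP] subspace_scale[OF subP])
    qed
    with step show ?case
      by (simp add: br_add_left br_scale_left subspace_add[OF subP] subspace_scale[OF subP])
  qed
  have gen: "{br a y | a y. a \<in> ?H \<and> y \<in> lcs ?H k} \<subseteq> P"
  proof clarify
    fix a y assume a: "a \<in> ?H" and y: "y \<in> lcs ?H k"
    obtain u where u: "u \<in> span \<Delta>" "a - u \<in> lcs ?H 1" using hull_mod_derived[OF a] by blast
    obtain v where v: "v \<in> span (\<Delta> \<inter> lcs ?H k)" "y - v \<in> lcs ?H (Suc k)" using Suc.IH[OF y] by blast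
    have uH: "u \<in> ?H" using u(1) span_minimal[OF lie_hull_superset] subalg_lie_hull
      by (auto simp: subalg_def)
    have "br a y = br u v + br u (y - v) + br (a - u) y"
      by (simp add: br_diff_left br_diff_right)
    moreover have "br u (y - v) \<in> P" using br_lcs[OF uH v(2)] LP by blast
    moreover have "br (a - u) y \<in> P" using lcs_br[OF subalg_lie_hull u(2) y] LP by auto
    ultimately show "br a y \<in> P" using uv[OF u(1) v(1)] by (metis subP subspace_add)
  qed
  have "x \<in> P" using Suc.prems span_minimal[OF gen subP] by auto
  then show ?case by (simp add: P_def del: lcs.simps)
qed

text \<open>If v is the sum of integer multiples a e, then M a e is the image of a power of a group
  element. The product of these powers has leading term M v and stays in \<open>M\<close> times a
  lattice chosen independently of \<open>M\<close> and v.\<close>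

lemma product_approx:
  assumes H: "subalg H" and "finite D" "D \<subseteq> \<Delta> \<inter> lcs H k"
  shows "\<exists>E. finite E \<and> (\<forall>(M::int) v. v \<in> zspan D \<longrightarrow>
    (\<exists>w\<in>\<Delta>. w \<in> dil (of_int M) (zspan E) \<and> w - of_int M \<star> v \<in> lcs H (Suc k)))"
  using assms(2,3)
proof (induction D)
  case empty
  have "zspan {} \<subseteq> {0::'v}" by (rule zspan_minimal) (auto simp: asub_def)
  show ?case
  proof (intro exI[of _ "{}"] conjI allI impI bexI[of _ 0])
    fix M :: int and v :: 'v assume "v \<in> zspan {}"
    with \<open>zspan {} \<subseteq> {0}\<close> have "v = 0" by auto
    then show "0 - of_int M \<star> v \<in> lcs H (Suc k)" by (simp add: asub_zero[OF asub_lcs[OF H]] del: lcs.simps)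
  qed (use zero_in_image in \<open>auto simp: asub_zero asub_dil asub_zspan\<close>)
next
  case (insert e D)
  then obtain E where E: "finite E" "\<And>(M::int) v. v \<in> zspan D \<Longrightarrow>
    \<exists>w\<in>\<Delta>. w \<in> dil (of_int M) (zspan E) \<and> w - of_int M \<star> v \<in> lcs H (Suc k)" by auto
  have "finite (insert e E)" using E by simp
  from chp_lattice[OF this] obtain E' where E': "finite E'"
    "\<And>(M::int) x y. x \<in> dil (of_int M) (zspan (insert e E)) \<Longrightarrow> y \<in> dil (of_int M) (zspan (insert e E))
    \<Longrightarrow> chp x y \<in> dil (of_int M) (zspan E')" by blast
  have e: "e \<in> \<Delta>" "e \<in> lcs H k" using insert by auto
  have eH: "e \<in> H" using e lcs_subset[OF H] by blast
  have DH: "zspan D \<subseteq> lcs H k" by (rule zspan_minimal) (use asub_lcs[OF H] insert in auto)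
  show ?case
  proof (intro exI[of _ E'] conjI allI impI)
    show "finite E'" by (rule E')
    fix M :: int and v assume v: "v \<in> zspan (insert e D)"
    then obtain a where a: "v - of_int a \<star> e \<in> zspan D" by (rule zspan_insertE)
    define v' where "v' = v - of_int a \<star> e"
    obtain w' where w': "w' \<in> \<Delta>" "w' \<in> dil (of_int M) (zspan E)" "w' - of_int M \<star> v' \<in> lcs H (Suc k)"
      using E(2)[of v' M] a by (auto simp: v'_def)
    have "of_int M \<star> v' \<in> lcs H k"
      using a DH asub_scale_int[OF asub_lcs[OF H]] by (auto simp: v'_def)
    moreover have "w' - of_int M \<star> v' \<in> lcs H k" using w'(3) lcs_Suc_subset[OF H] by blast
    ultimately have w'k: "w' \<in> lcs H k" using asub_add[OF asub_lcs[OF H]] by (metis diff_add_cancel)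
    define p where "p = of_int M \<star> of_int a \<star> e"
    have p: "p \<in> \<Delta>" using int_scale_in_image[OF e(1), of "M * a"] by (simp add: p_def)
    have pH: "p \<in> H" using eH H by (simp add: p_def subalg_def subspace_scale)
    show "\<exists>w\<in>\<Delta>. w \<in> dil (of_int M) (zspan E') \<and> w - of_int M \<star> v \<in> lcs H (Suc k)"
    proof (intro bexI[of _ "chp p w'"] conjI)
      show "chp p w' \<in> \<Delta>" by (rule chp_in_image[OF p w'(1)])
      have "of_int a \<star> e \<in> zspan (insert e E)" by (intro asub_scale_int asub_zspan zspan_base) simp
      then have "p \<in> dil (of_int M) (zspan (insert e E))" unfolding p_def dil_def by (rule imageI)
      moreover have "w' \<in> dil (of_int M) (zspan (insert e E))" using w'(2) by (rule zspan_dil_subset[rotated]) auto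
      ultimately show "chp p w' \<in> dil (of_int M) (zspan E')" by (rule E'(2))
      have "chp p w' - p - w' + (w' - of_int M \<star> v') \<in> lcs H (Suc k)"
        using chp_lcs(1)[OF H pH w'k] w'(3) by (rule asub_add[OF asub_lcs[OF H]])
      then show "chp p w' - of_int M \<star> v \<in> lcs H (Suc k)"
        by (simp add: p_def v'_def scale_right_diff_distrib algebra_simps del: lcs.simps)
    qed
  qed
qed

lemma uniform_approx:
  assumes "finite F" "F \<subseteq> lcs (lie_hull \<Delta>) k"
  shows "\<exists>N>0. \<exists>D. finite D \<and> D \<subseteq> \<Delta> \<inter> lcs (lie_hull \<Delta>) k \<and>
    (\<forall>x\<in>F. \<exists>v\<in>zspan D. of_int N \<star> x - v \<in> lcs (lie_hull \<Delta>) (Suc k))"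
  using assms
proof (induction F)
  case empty
  show ?case by (intro exI[of _ 1] conjI exI[of _ "{}"]) auto
next
  case (insert x F)
  let ?L = "lcs (lie_hull \<Delta>)"
  from insert obtain N D where ND: "N > 0" "finite D" "D \<subseteq> \<Delta> \<inter> ?L k"
    "\<forall>x\<in>F. \<exists>v\<in>zspan D. of_int N \<star> x - v \<in> ?L (Suc k)" by auto
  from insert.prems lcs_mod_next[of x k] obtain u where u: "u \<in> span (\<Delta> \<inter> ?L k)" "x - u \<in> ?L (Suc k)" by blast
  from clear_denominators[OF u(1)] obtain N' D' where ND': "N' > 0" "finite D'" "D' \<subseteq> \<Delta> \<inter> ?L k"
    "of_int N' \<star> u \<in> zspan D'" by blast
  note aL = asub_lcs[OF subalg_lie_hull]
  show ?case
  proof (intro exI[of _ "N * N'"] exI[of _ "D \<union> D'"] conjI ballI)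
    fix y assume "y \<in> insert x F"
    then show "\<exists>v\<in>zspan (D \<union> D'). of_int (N * N') \<star> y - v \<in> ?L (Suc k)"
    proof
      assume y: "y = x"
      have "of_int N \<star> of_int N' \<star> u \<in> zspan (D \<union> D')"
        using asub_scale_int[OF asub_zspan ND'(4)] zspan_mono[of D' "D \<union> D'"] by blast
      moreover have "of_int (N * N') \<star> y - of_int N \<star> of_int N' \<star> u \<in> ?L (Suc k)"
        using asub_scale_int[OF aL u(2), of "N * N'"] y by (simp add: scale_right_diff_distrib del: lcs.simps)
      ultimately show ?thesis by blast
    next
      assume "y \<in> F"
      then obtain v where v: "v \<in> zspan D" "of_int N \<star> y - v \<in> ?L (Suc k)" using ND by auto
      have "of_int N' \<star> v \<in> zspan (D \<union> D')"
        using asub_scale_int[OF asub_zspan v(1)] zspan_mono[of D "D \<union> D'"] by blast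
      moreover have "of_int (N * N') \<star> y - of_int N' \<star> v \<in> ?L (Suc k)"
        using asub_scale_int[OF aL v(2), of "N'"] by (simp add: scale_right_diff_distrib mult.commute del: lcs.simps)
      ultimately show ?thesis by blast
    qed
  qed (use ND ND' in auto)
qed

text \<open>Downward induction on the depth \<open>k\<close>. An element of the group approximates M
  N x modulo the next term; the factor that corrects it lies in that term and in \<open>M\<close>
  times a fixed lattice, hence in \<Delta> by the induction hypothesis, and the product of the two
  is M N x.\<close>

theorem lattice_in_image:
  assumes "finite F" "F \<subseteq> lcs (lie_hull \<Delta>) k"
  shows "\<exists>M>0. \<forall>x\<in>zspan F. of_int M \<star> x \<in> \<Delta>"
proof -
  obtain K where K: "\<And>H. lcs H K \<subseteq> {0}" using ex_lcs_trivial by blast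
  note sH = subalg_lie_hull[of \<Delta>]
  note aL = asub_lcs[OF sH]
  let ?L = "lcs (lie_hull \<Delta>)"
  show ?thesis using assms
  proof (induction "K - k" arbitrary: k F)
    case 0
    then have "?L k \<subseteq> {0}" using lcs_antimono[OF sH, of K k] K by fastforce
    with 0 have "F \<subseteq> {0}" by auto
    then have "zspan F \<subseteq> {0}" by (intro zspan_minimal) (auto simp: asub_def)
    then show ?case using zero_in_image by (intro exI[of _ 1]) auto
  next
    case (Suc d)
    have FL: "zspan F \<subseteq> ?L k" by (rule zspan_minimal[OF aL Suc.prems(2)])
    from uniform_approx[OF Suc.prems] obtain N D where ND: "N > 0" "finite D" "D \<subseteq> \<Delta> \<inter> ?L k"
      "\<forall>x\<in>F. \<exists>v\<in>zspan D. of_int N \<star> x - v \<in> ?L (Suc k)" by blast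
    have Nx: "\<exists>v\<in>zspan D. of_int N \<star> x - v \<in> ?L (Suc k)" if "x \<in> zspan F" for x
      using that
    proof (induction rule: zspan_induct)
      case zero
      show ?case by (intro bexI[of _ 0]) (auto simp: asub_zero asub_zspan aL simp del: lcs.simps)
    next
      case (diff x y)
      then obtain v w where "v \<in> zspan D" "w \<in> zspan D" "of_int N \<star> x - v \<in> ?L (Suc k)"
        "of_int N \<star> y - w \<in> ?L (Suc k)" by blast
      then have "v - w \<in> zspan D" "(of_int N \<star> x - v) - (of_int N \<star> y - w) \<in> ?L (Suc k)"
        using asub_diff[OF asub_zspan] asub_diff[OF aL] by blast+
      then show ?case by (intro bexI[of _ "v - w"]) (simp_all add: scale_right_diff_distrib algebra_simps del: lcs.simps)
    qed (use ND in blast)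
    from product_approx[OF sH ND(2,3)] obtain E where E: "finite E" "\<And>(M::int) v. v \<in> zspan D \<Longrightarrow>
      \<exists>w\<in>\<Delta>. w \<in> dil (of_int M) (zspan E) \<and> w - of_int M \<star> v \<in> ?L (Suc k)" by blast
    have "finite (F \<union> E)" using E Suc.prems by auto
    from sol_lattice[OF this, of K] obtain E2 where E2: "finite E2" "\<And>(M::int) w y. w \<in> zspan (F \<union> E) \<Longrightarrow>
      y - w \<in> dil (of_int M) (zspan (F \<union> E)) \<Longrightarrow> sol w y K \<in> dil (of_int M) (zspan E2)" by blast
    \<comment> \<open>The lattice of corrections need not lie in the next term. The projection moves
      its generators there and leaves the actual corrections unchanged.\<close>
    from ex_projection[OF subspace_lcs[OF sH, of "Suc k"]] obtain P where P: "range P \<subseteq> ?L (Suc k)"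
      "\<And>x y. P (x - y) = P x - P y" "\<And>w. w \<in> ?L (Suc k) \<Longrightarrow> P w = w" by metis
    have "d = K - Suc k" "finite (P ` E2)" "P ` E2 \<subseteq> ?L (Suc k)" using Suc.hyps(2) E2 P by auto
    \<comment> \<open>\<open>M\<close> is known only now, after the lattice \<open>E2\<close>. Hence
      all previous lattices had to be uniform in the multiplier.\<close>
    from Suc.hyps(1)[OF this] obtain M where M: "M > 0" "\<And>x. x \<in> zspan (P ` E2) \<Longrightarrow> of_int M \<star> x \<in> \<Delta>" by blast
    show ?case
    proof (intro exI[of _ "M * N"] conjI ballI)
      show "0 < M * N" using M ND by simp
      fix x assume x: "x \<in> zspan F"
      obtain v where v: "v \<in> zspan D" "of_int N \<star> x - v \<in> ?L (Suc k)" using Nx[OF x] by blast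
      obtain w where w: "w \<in> \<Delta>" "w \<in> dil (of_int M) (zspan E)" "w - of_int M \<star> v \<in> ?L (Suc k)"
        using E(2)[OF v(1)] by blast
      define y where "y = of_int M \<star> of_int N \<star> x"
      have wH: "w \<in> lie_hull \<Delta>" using w(1) lie_hull_superset by blast
      have "of_int M \<star> (of_int N \<star> x - v) - (w - of_int M \<star> v) \<in> ?L (Suc k)"
        by (intro asub_diff[OF aL] asub_scale_int[OF aL] v w)
      then have yw: "y - w \<in> ?L (Suc k)" by (simp add: y_def scale_right_diff_distrib algebra_simps del: lcs.simps)
      have s: "sol w y K \<in> ?L (Suc k)" by (rule sol_lcs[OF sH wH yw])
      have "w \<in> dil (of_int M) (zspan (F \<union> E))" using w(2) by (rule zspan_dil_subset[rotated]) auto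
      moreover have "of_int N \<star> x \<in> zspan (F \<union> E)"
        using asub_scale_int[OF asub_zspan x] zspan_mono[of F "F \<union> E"] by auto
      then have "y \<in> dil (of_int M) (zspan (F \<union> E))" unfolding y_def dil_def by (rule imageI)
      ultimately have "w \<in> zspan (F \<union> E)" "y - w \<in> dil (of_int M) (zspan (F \<union> E))"
        using dil_int_subset[OF asub_zspan] asub_diff[OF asub_dil[OF asub_zspan]] by blast+
      from E2(2)[OF this] obtain t where t: "t \<in> zspan E2" "sol w y K = of_int M \<star> t" by (auto simp: dil_def)
      have "t = (1 / of_int M) \<star> sol w y K" using t M by simp
      then have "t \<in> ?L (Suc k)" using s subspace_scale[OF subspace_lcs[OF sH]] by metis
      then have "t = P t" using P by simp
      moreover have "P t \<in> zspan (P ` E2)"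
        by (rule zspan_map[OF P(2) _ asub_zspan t(1)]) (auto intro: zspan_base)
      ultimately have "sol w y K \<in> \<Delta>" using M(2)[of t] t by simp
      then have "chp w (sol w y K) \<in> \<Delta>" using chp_in_image w(1) by blast
      then show "of_int (M * N) \<star> x \<in> \<Delta>" using chp_sol[OF K] by (simp add: y_def)
    qed
  qed
qed

end

section \<open>The image of a finitely generated group lies in a lattice\<close>

text \<open>Arbitrary parenthesizations of weight \<open>k\<close>, a family closed under the
  bracket, in contrast to the right-normed brackets of \<open>nest\<close>.\<close>

inductive bracket_mono :: "('v \<Rightarrow> 'v \<Rightarrow> 'v) \<Rightarrow> 'v set \<Rightarrow> nat \<Rightarrow> 'v \<Rightarrow> bool"
  for br :: "'v \<Rightarrow> 'v \<Rightarrow> 'v" and F :: "'v set" where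
  base: "x \<in> F \<Longrightarrow> bracket_mono br F 1 x"
| br: "bracket_mono br F i x \<Longrightarrow> bracket_mono br F j y \<Longrightarrow> bracket_mono br F (i + j) (br x y)"

lemma bracket_mono_pos: "bracket_mono br F k x \<Longrightarrow> k \<ge> 1"
  by (induction rule: bracket_mono.induct) auto

context nilpotent_lie
begin

lemma finite_bracket_mono: "finite F \<Longrightarrow> finite {x. bracket_mono br F k x}"
proof (induction k rule: less_induct)
  case (less k)
  have "{x. bracket_mono br F k x} \<subseteq> F \<union> (\<Union>i<k. \<Union>j<k. {br x y | x y. x \<in> {x. bracket_mono br F i x} \<and> y \<in> {y. bracket_mono br F j y}})"
  proof
    fix x assume "x \<in> {x. bracket_mono br F k x}"
    then have "bracket_mono br F k x" by simp
    then show "x \<in> F \<union> (\<Union>i<k. \<Union>j<k. {br x y | x y. x \<in> {x. bracket_mono br F i x} \<and> y \<in> {y. bracket_mono br F j y}})"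
    proof cases
      case (br i x j y)
      then have "i < k" "j < k" using bracket_mono_pos by fastforce+
      with br show ?thesis by blast
    qed auto
  qed
  moreover have "finite (F \<union> (\<Union>i<k. \<Union>j<k. {br x y | x y. x \<in> {x. bracket_mono br F i x} \<and> y \<in> {y. bracket_mono br F j y}}))"
    using less by (intro finite_UnI finite_UN_I finite_br_image) auto
  ultimately show ?case by (rule finite_subset)
qed

lemma bracket_mono_lcs: "bracket_mono br F k x \<Longrightarrow> x \<in> lcs UNIV (k - 1)"
proof (induction rule: bracket_mono.induct)
  case (br i x j y)
  then have "i \<ge> 1" "j \<ge> 1" using bracket_mono_pos by auto
  then have "Suc (i - 1 + (j - 1)) = i + j - 1" by simp
  with lcs_br[OF subalg_UNIV br.IH] show ?case by metis
qed simp

text \<open>Rescaling the brackets of weight \<open>k\<close> by \<open>N\<^bsup>d-2k\<^esup>\<close> absorbs the denominators of the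
  Campbell--Hausdorff formula, since its terms of degree \<open>d\<close> gain a factor \<open>N\<^bsup>d-1\<^esup>\<close>.\<close>

lemma chp_closed_lattice:
  assumes "finite F"
  shows "\<exists>E. finite E \<and> F \<subseteq> zspan E \<and> (\<forall>x\<in>zspan E. \<forall>y\<in>zspan E. chp x y \<in> zspan E)"
proof -
  obtain K where "\<And>H. lcs H K \<subseteq> {0}" using ex_lcs_trivial by blast
  then have K: "x = 0" if "bracket_mono br F k x" "k > K" for x k
    using bracket_mono_lcs[OF that(1)] lcs_antimono[OF subalg_UNIV, of K "k - 1"] that(2) by fastforce
  obtain Q where Q: "Q > 0" "\<And>ps. ps \<in> dyn_index T \<Longrightarrow> of_int Q * dyn_coeff ps \<in> \<int>"
    using dyn_coeff_denom[of T] by blast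
  define N :: rat where "N = of_int Q"
  have N0: "N \<noteq> 0" using Q by (simp add: N_def)
  \<comment> \<open>Monomials of weight above \<open>K\<close> vanish. The range nevertheless ends
    at \<open>Suc K\<close>, so that weight 1 is present when K = 0.\<close>
  define Gd where "Gd d = {(N powi (int d - 2 * int k)) \<star> x | k x. k \<in> {1..Suc K} \<and> x \<in> {x. bracket_mono br F k x}}" for d :: nat
  have fin: "finite (Gd d)" for d
  proof -
    have "Gd d = (\<Union>k\<in>{1..Suc K}. (\<lambda>x. (N powi (int d - 2 * int k)) \<star> x) ` {x. bracket_mono br F k x})"
      unfolding Gd_def by blast
    then show ?thesis using finite_bracket_mono[OF assms] by auto
  qed
  have br_Gd: "br x y \<in> zspan (Gd (Suc n))" if "x \<in> zspan (Gd 1)" "y \<in> zspan (Gd n)" for n x y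
  proof -
    have "{br x y | x y. x \<in> Gd 1 \<and> y \<in> Gd n} \<subseteq> zspan (Gd (Suc n))"
    proof clarify
      fix x y assume "x \<in> Gd 1" "y \<in> Gd n"
      then obtain k u l v where x: "x = (N powi (1 - 2 * int k)) \<star> u" "bracket_mono br F k u"
        and y: "y = (N powi (int n - 2 * int l)) \<star> v" "bracket_mono br F l v"
        unfolding Gd_def by auto
      have m: "bracket_mono br F (k + l) (br u v)" using x y by (intro bracket_mono.br)
      have e: "br x y = (N powi (int (Suc n) - 2 * int (k + l))) \<star> br u v"
      proof -
        have "int (Suc n) - 2 * int (k + l) = (1 - 2 * int k) + (int n - 2 * int l)" by simp
        then have "N powi (int (Suc n) - 2 * int (k + l)) = N powi (int n - 2 * int l) * N powi (1 - 2 * int k)"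
          using power_int_add[of N "int n - 2 * int l" "1 - 2 * int k"] N0 by (simp add: algebra_simps)
        then show ?thesis using x y by (simp add: br_scale_left br_scale_right)
      qed
      show "br x y \<in> zspan (Gd (Suc n))"
      proof (cases "k + l \<le> K")
        case True
        have "k + l \<in> {1..Suc K}" using True bracket_mono_pos[OF m] by auto
        with m have "br x y \<in> Gd (Suc n)" unfolding Gd_def e by blast
        then show ?thesis by (rule zspan_base)
      next
        case False
        then have "br u v = 0" using K[OF m] by simp
        then show ?thesis using e asub_zero[OF asub_zspan] by simp
      qed
    qed
    then show ?thesis using br_zspan[OF that] zspan_minimal[OF asub_zspan] by blast
  qed
  have chp: "chp x y \<in> zspan (Gd 1)" if xy: "x \<in> zspan (Gd 1)" "y \<in> zspan (Gd 1)" for x y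
  proof -
    have z: "0 \<in> zspan (Gd 1)" by (simp add: asub_zero asub_zspan)
    have "hi x y - hi 0 0 \<in> zspan (Gd 1)"
    proof (rule hi_variation[where A = "\<lambda>d. zspan (Gd d)" and J = "\<lambda>d. zspan (Gd d)"])
      show "dyn_coeff ps \<star> x \<in> zspan (Gd 1)"
        if ps: "ps \<in> dyn_index T" "dyn_deg ps \<ge> 2" and x: "x \<in> zspan (Gd (dyn_deg ps))" for ps x
      proof (rule zspan_map[OF _ _ asub_zspan x])
        fix x assume "x \<in> Gd (dyn_deg ps)"
        then obtain k u where x: "x = (N powi (int (dyn_deg ps) - 2 * int k)) \<star> u" "k \<in> {1..Suc K}" "bracket_mono br F k u"
          unfolding Gd_def by blast
        obtain e where e: "dyn_deg ps = Suc (Suc e)" using ps(2)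
          by (metis add_2_eq_Suc le_add_diff_inverse)
        obtain a where a: "of_int Q * dyn_coeff ps = of_int a" using Q(2)[OF ps(1)] by (elim Ints_cases)
        have "int (dyn_deg ps) - 2 * int k = int (Suc e) + (1 - 2 * int k)" using e by simp
        then have "dyn_coeff ps * N powi (int (dyn_deg ps) - 2 * int k) = dyn_coeff ps * (N powi int (Suc e) * N powi (1 - 2 * int k))"
          using power_int_add[of N "int (Suc e)" "1 - 2 * int k"] N0 by metis
        also have "\<dots> = (of_int Q * dyn_coeff ps) * of_int (Q ^ e) * N powi (1 - 2 * int k)"
          by (simp add: N_def power_int_of_nat del: of_nat_Suc)
        also have "\<dots> = of_int (a * Q ^ e) * N powi (1 - 2 * int k)" unfolding a by simp
        finally have "dyn_coeff ps \<star> x = of_int (a * Q ^ e) \<star> ((N powi (1 - 2 * int k)) \<star> u)"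
          unfolding x(1) scale_scale by simp
        moreover have "(N powi (1 - 2 * int k)) \<star> u \<in> zspan (Gd 1)"
        proof (rule zspan_base)
          show "(N powi (1 - 2 * int k)) \<star> u \<in> Gd 1"
            unfolding Gd_def of_nat_1 using x(2,3) by blast
        qed
        ultimately show "dyn_coeff ps \<star> x \<in> zspan (Gd 1)" by (simp only: asub_scale_int[OF asub_zspan])
      qed (rule scale_right_diff_distrib)
    qed (use br_Gd xy z in \<open>auto intro: asub_zspan\<close>)
    then show ?thesis using xy unfolding chp_hi by (intro asub_add asub_zspan) auto
  qed
  have "F \<subseteq> zspan (Gd 1)"
  proof
    fix x assume "x \<in> F"
    then have "bracket_mono br F 1 x" by (rule bracket_mono.base)
    then have "(N powi (int 1 - 2 * int 1)) \<star> x \<in> Gd 1" unfolding Gd_def by force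
    then have "of_int Q \<star> ((N powi (int 1 - 2 * int 1)) \<star> x) \<in> zspan (Gd 1)"
      by (intro asub_scale_int asub_zspan zspan_base)
    then show "x \<in> zspan (Gd 1)" using Q by (simp add: N_def)
  qed
  with chp fin show ?thesis by blast
qed

end

text \<open>A lattice that is closed under the product and contains the images of the generators and
  of their inverses contains the image of the whole group.\<close>

lemma (in malcev_hom) image_in_lattice:
  assumes "fin_gen_group G"
  shows "\<exists>E. finite E \<and> \<Delta> \<subseteq> zspan E"
proof -
  obtain S where S: "finite S" "S \<subseteq> carrier G" "generate G S = carrier G"
    using assms by (auto simp: fin_gen_group_def)
  have "finite (\<iota> ` S \<union> (\<lambda>s. \<iota> (inv s)) ` S)" using S by simp
  from chp_closed_lattice[OF this] obtain E where E: "finite E" "\<iota> ` S \<union> (\<lambda>s. \<iota> (inv s)) ` S \<subseteq> zspan E"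
    "\<forall>x\<in>zspan E. \<forall>y\<in>zspan E. chp x y \<in> zspan E" by (elim exE conjE) (rule that)
  have "g \<in> carrier G \<and> \<iota> g \<in> zspan E" if "g \<in> generate G S" for g
    using that
  proof (induction rule: generate.induct)
    case one
    then show ?case by (simp add: iota_one asub_zero asub_zspan)
  qed (use E S hom in auto)
  with S E show ?thesis by (intro exI[of _ E]) auto
qed

section \<open>Rigidity\<close>

text \<open>A homomorphism on a subgroup is extended by viewing its graph as a subgroup of the
  product algebra; the Lie algebra generated by the graph is again a graph.\<close>

context nilpotent_lie
begin

abbreviation (input) "pscale \<equiv> \<lambda>a p. (a \<star> fst p, a \<star> snd p)"
abbreviation (input) "pbr \<equiv> \<lambda>p q. (br (fst p) (fst q), br (snd p) (snd q))"

lemma nest_pbr: "nest pbr zs = (nest br (map fst zs), nest br (map snd zs))"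
  by (induction zs rule: induct_list012) (auto simp: zero_prod_def)

lemma nilpotent_lie_product: "nilpotent_lie pscale pbr T"
proof unfold_locales
  obtain K where K: "\<And>zs. length zs = Suc K \<Longrightarrow> nest br zs = 0" using nilpotent by blast
  then show "\<exists>K. \<forall>zs. length zs = Suc K \<longrightarrow> nest pbr zs = 0"
    unfolding nest_pbr by (intro exI[of _ K]) (auto simp: zero_prod_def)
qed (use T1 T2 jacobi in \<open>auto simp: br_add_left br_add_right br_scale_left br_scale_right
    scale_right_distrib scale_left_distrib zero_prod_def\<close>)

lemma chp_product:
  "nilpotent_lie.chp pscale pbr T p q = (chp (fst p) (fst q), chp (snd p) (snd q))"
proof -
  interpret P: nilpotent_lie pscale pbr T by (rule nilpotent_lie_product)
  have map: "map f (dyn_word u v ps) = dyn_word (f u) (f v) ps" for u v ps and f :: "'v \<times> 'v \<Rightarrow> 'v"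
    by (simp add: dyn_word_map[of u v] dyn_word_map[of "f u" "f v"] if_distrib)
  show ?thesis
    unfolding P.chp_def chp_def by (auto simp: prod_eq_iff fst_sum snd_sum nest_pbr map)
qed

end

text \<open>By \<open>lattice_in_image\<close> in the product algebra, each (x,y) of the algebra
  generated by the graph has a multiple of the form (\<iota> s, \<iota> (f s)). So x = 0 forces s to
  be trivial and y = 0, which makes the algebra a graph, and injectivity of \<open>f\<close> gives
  the converse. Roots exist up to multiples because every group element has a power in
  \<open>S\<close>, so the graph is defined on the whole hull.\<close>

lemma (in malcev_hom) rigidity:
  assumes inj: "inj_on \<iota> (carrier G)" and S: "subgroup S G"
    and pow: "\<And>g. g \<in> carrier G \<Longrightarrow> \<exists>j>0. g [^] (j::nat) \<in> S"
    and f: "\<And>s. s \<in> S \<Longrightarrow> f s \<in> carrier G" "\<And>s t. s \<in> S \<Longrightarrow> t \<in> S \<Longrightarrow> f (s \<otimes> t) = f s \<otimes> f t"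
      "inj_on f S"
  shows "\<exists>F. (\<forall>x\<in>lie_hull \<Delta>. F x \<in> lie_hull \<Delta>) \<and>
    (\<forall>x\<in>lie_hull \<Delta>. \<forall>y\<in>lie_hull \<Delta>. F (x + y) = F x + F y) \<and>
    (\<forall>a. \<forall>x\<in>lie_hull \<Delta>. F (a \<star> x) = a \<star> F x) \<and>
    (\<forall>x\<in>lie_hull \<Delta>. \<forall>y\<in>lie_hull \<Delta>. F (br x y) = br (F x) (F y)) \<and>
    (\<forall>x\<in>lie_hull \<Delta>. F x = 0 \<longrightarrow> x = 0) \<and> (\<forall>s\<in>S. F (\<iota> s) = \<iota> (f s)) \<and>
    (\<forall>x\<in>lie_hull \<Delta>. \<exists>M>0. of_int M \<star> x \<in> \<iota> ` S)"
proof -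
  interpret S: subgroup S G by (rule S)
  interpret P: nilpotent_lie pscale pbr T by (rule nilpotent_lie_product)
  define \<iota>' where "\<iota>' = (\<lambda>s. (\<iota> s, \<iota> (f s)))"
  interpret P: malcev_hom pscale pbr T "G\<lparr>carrier := S\<rparr>" \<iota>'
  proof (intro malcev_hom.intro malcev_hom_axioms.intro P.nilpotent_lie_axioms)
    show "group (G\<lparr>carrier := S\<rparr>)" by (rule S.subgroup_is_group) (rule is_group)
    fix g h assume "g \<in> carrier (G\<lparr>carrier := S\<rparr>)" "h \<in> carrier (G\<lparr>carrier := S\<rparr>)"
    then show "\<iota>' (g \<otimes>\<^bsub>G\<lparr>carrier := S\<rparr>\<^esub> h) = P.chp (\<iota>' g) (\<iota>' h)"
      unfolding \<iota>'_def chp_product by (auto simp: hom f S.mem_carrier)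
  qed
  let ?H = "lie_hull \<Delta>"
  define \<h> where "\<h> = P.lie_hull (\<iota>' ` S)"
  have sub\<h>: "P.subspace \<h>" and br\<h>: "\<And>p q. p \<in> \<h> \<Longrightarrow> q \<in> \<h> \<Longrightarrow> pbr p q \<in> \<h>"
    using P.subalg_lie_hull[of "\<iota>' ` S"] by (auto simp: P.subalg_def \<h>_def)
  have gr: "(\<iota> s, \<iota> (f s)) \<in> \<h>" if "s \<in> S" for s
    using P.lie_hull_superset[of "\<iota>' ` S"] that by (auto simp: \<h>_def \<iota>'_def)
  have mult: "\<exists>M>0. \<exists>s\<in>S. of_int M \<star> x = \<iota> s \<and> of_int M \<star> y = \<iota> (f s)" if "(x, y) \<in> \<h>" for x y
  proof -
    have "finite {(x, y)}" "{(x, y)} \<subseteq> P.lcs (P.lie_hull (\<iota>' ` carrier (G\<lparr>carrier := S\<rparr>))) 0"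
      using that by (auto simp: \<h>_def)
    from P.lattice_in_image[OF this] obtain M where M: "M > 0" "\<And>p. p \<in> zspan {(x, y)} \<Longrightarrow> pscale (of_int M) p \<in> \<iota>' ` S"
      by auto
    have "pscale (of_int M) (x, y) \<in> \<iota>' ` S" by (intro M zspan_base) simp
    with M(1) show ?thesis by (auto simp: \<iota>'_def)
  qed
  have f1: "f \<one> = \<one>"
  proof -
    have "f \<one> \<otimes> f \<one> = f \<one> \<otimes> \<one>" using f(2)[of \<one> \<one>] f(1)[of \<one>] by (simp add: S.one_closed)
    then show ?thesis using f(1)[of \<one>] by (simp add: S.one_closed)
  qed
  have iff: "s = \<one>" if "s \<in> carrier G" "\<iota> s = 0" for s
    using inj_onD[OF inj, of s \<one>] that by (simp add: iota_one)
  have fun0: "y = 0" if p: "(0, y) \<in> \<h>" for y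
  proof -
    obtain M s where M: "M > 0" "s \<in> S" "of_int M \<star> 0 = \<iota> s" "of_int M \<star> y = \<iota> (f s)" using mult[OF p] by blast
    then have "s = \<one>" by (intro iff) (auto simp: S.mem_carrier)
    with M f1 show ?thesis by (simp add: iota_one)
  qed
  have inj0: "x = 0" if p: "(x, 0) \<in> \<h>" for x
  proof -
    obtain M s where M: "M > 0" "s \<in> S" "of_int M \<star> x = \<iota> s" "of_int M \<star> 0 = \<iota> (f s)" using mult[OF p] by blast
    then have "f s = f \<one>" using iff[of "f s"] f f1 by simp
    then have "s = \<one>" using f(3) M(2) S.one_closed by (auto dest: inj_onD)
    with M show ?thesis by (simp add: iota_one)
  qed
  have unique: "y = y'" if "(x, y) \<in> \<h>" "(x, y') \<in> \<h>" for x y y'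
    using P.subspace_diff[OF sub\<h> that] fun0[of "y - y'"] by simp
  have multH: "\<exists>M>0. \<exists>s\<in>S. of_int M \<star> x = \<iota> s" if "x \<in> ?H" for x
  proof -
    have "finite {x}" "{x} \<subseteq> lcs ?H 0" using that by auto
    from lattice_in_image[OF this] obtain M where M: "M > 0" "\<And>p. p \<in> zspan {x} \<Longrightarrow> of_int M \<star> p \<in> \<Delta>" by auto
    have "of_int M \<star> x \<in> \<Delta>" by (intro M zspan_base) simp
    then obtain g where g: "g \<in> carrier G" "of_int M \<star> x = \<iota> g" by auto
    from pow[OF g(1)] obtain j :: nat where j: "j > 0" "g [^] j \<in> S" by auto
    have "of_int (int j * M) \<star> x = of_nat j \<star> (of_int M \<star> x)" by simp
    also have "\<dots> = \<iota> (g [^] j)" using iota_pow[OF g(1)] g(2) by simp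
    finally show ?thesis using j M by (intro exI[of _ "int j * M"] conjI bexI[of _ "g [^] j"]) auto
  qed
  have total: "\<exists>y. (x, y) \<in> \<h>" if x: "x \<in> ?H" for x
  proof -
    obtain M s where M: "M > 0" "s \<in> S" "of_int M \<star> x = \<iota> s" using multH[OF x] by blast
    have "pscale (1 / of_int M) (\<iota> s, \<iota> (f s)) \<in> \<h>" by (rule P.subspace_scale[OF sub\<h> gr[OF M(2)]])
    moreover have "(1 / of_int M) \<star> \<iota> s = x" using M(1) by (simp flip: M(3))
    ultimately show ?thesis unfolding fst_conv snd_conv by metis
  qed
  define F where "F x = (SOME y. (x, y) \<in> \<h>)" for x
  have F: "(x, F x) \<in> \<h>" if "x \<in> ?H" for x unfolding F_def using total[OF that] by (rule someI_ex)
  have FI: "F x = y" if "x \<in> ?H" "(x, y) \<in> \<h>" for x y using unique F[OF that(1)] that(2) by blast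
  have H: "subspace ?H" "\<And>x y. x \<in> ?H \<Longrightarrow> y \<in> ?H \<Longrightarrow> br x y \<in> ?H"
    using subalg_lie_hull[of \<Delta>] by (auto simp: subalg_def)
  have "P.subalg {p. snd p \<in> ?H}" unfolding P.subalg_def
    by (auto intro!: P.subspaceI H(2) subspace_add[OF H(1)] subspace_scale[OF H(1)] subspace_0[OF H(1)])
  then have "\<h> \<subseteq> {p. snd p \<in> ?H}" unfolding \<h>_def
    using lie_hull_superset[of \<Delta>] f by (intro P.lie_hull_minimal) (auto simp: \<iota>'_def)
  then have FH: "F x \<in> ?H" if "x \<in> ?H" for x using F[OF that] by auto
  show ?thesis
  proof (intro exI[of _ F] conjI ballI allI impI)
    fix x y assume x: "x \<in> ?H" and y: "y \<in> ?H"
    show "F (x + y) = F x + F y"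
      using P.subspace_add[OF sub\<h> F[OF x] F[OF y]] by (intro FI subspace_add H x y) simp
    show "F (br x y) = br (F x) (F y)"
      using br\<h>[OF F[OF x] F[OF y]] by (intro FI H x y) simp
  next
    fix a x assume x: "x \<in> ?H"
    show "F (a \<star> x) = a \<star> F x"
      using P.subspace_scale[OF sub\<h> F[OF x], of a] by (intro FI subspace_scale H x) simp
  next
    fix x assume "x \<in> ?H" "F x = 0"
    then show "x = 0" using F[of x] inj0 by simp
  next
    fix s assume s: "s \<in> S"
    then show "F (\<iota> s) = \<iota> (f s)" using gr[OF s] lie_hull_superset[of \<Delta>] S.mem_carrier by (intro FI) auto
  next
    fix x assume "x \<in> ?H" then show "\<exists>M>0. of_int M \<star> x \<in> \<iota> ` S" using multH by fastforce
  qed (use FH in auto)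
qed

section \<open>Linear algebra of one operator: functionals, annihilating polynomials, spectral
  projections\<close>

section \<open>Rational functionals\<close>

lemma ex_functional_single:
  fixes scale :: "rat \<Rightarrow> 'v::ab_group_add \<Rightarrow> 'v"
  assumes "vector_space scale" and W: "module.subspace scale W" and s: "s \<notin> W"
  shows "\<exists>h::'v \<Rightarrow> rat. (\<forall>x y. h (x + y) = h x + h y) \<and> (\<forall>a x. h (scale a x) = a * h x) \<and>
    (\<forall>w\<in>W. h w = 0) \<and> h s \<noteq> 0"
proof -
  interpret vector_space scale by fact
  interpret Q: vector_space "(*) :: rat \<Rightarrow> rat \<Rightarrow> rat" by unfold_locales (auto simp: algebra_simps)
  interpret vp: vector_space_pair scale "(*) :: rat \<Rightarrow> rat \<Rightarrow> rat" ..
  obtain B where B: "B \<subseteq> W" "independent B" "W \<subseteq> span B"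
    using maximal_independent_subset[of W] by blast
  have spB: "span B = W" using B span_minimal[OF B(1) W] by auto
  have "independent (insert s B)" using B(2) s spB by (metis independent_insertI)
  from vp.linear_independent_extend[OF this, of "\<lambda>x. if x = s then 1 else 0"]
  obtain g where g: "Vector_Spaces.linear scale (*) g" "\<forall>x\<in>insert s B. g x = (if x = s then 1 else 0)" by auto
  interpret g: Vector_Spaces.linear scale "(*)" g by (rule g)
  have "g w = 0" if "w \<in> W" for w
  proof -
    have "s \<notin> B" using s B by auto
    then have gB: "g x = 0" if "x \<in> B" for x using g(2) that by auto
    have "w \<in> span B" using that spB by simp
    then show ?thesis
      by (induction rule: span_induct_alt) (auto simp: g.zero g.add g.scale gB)
  qed
  then show ?thesis using g(2) g.add g.scale by (intro exI[of _ g]) auto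
qed

text \<open>Functionals are combined as h1 + t h2, where the rational t avoids the finitely many
  ratios at which some value would cancel.\<close>

lemma ex_functional:
  fixes scale :: "rat \<Rightarrow> 'v::ab_group_add \<Rightarrow> 'v"
  assumes vs: "vector_space scale" and W: "module.subspace scale W" and "finite S" "S \<inter> W = {}"
  shows "\<exists>h::'v \<Rightarrow> rat. (\<forall>x y. h (x + y) = h x + h y) \<and> (\<forall>a x. h (scale a x) = a * h x) \<and>
    (\<forall>w\<in>W. h w = 0) \<and> (\<forall>s\<in>S. h s \<noteq> 0)"
  using assms(3,4)
proof (induction S)
  case empty
  show ?case by (intro exI[of _ "\<lambda>_. 0"]) auto
next
  case (insert s S)
  then have "S \<inter> W = {}" by auto
  from insert.IH[OF this] obtain h1 :: "'v \<Rightarrow> rat" where h1: "\<forall>x y. h1 (x + y) = h1 x + h1 y" "\<forall>a x. h1 (scale a x) = a * h1 x"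
    "\<forall>w\<in>W. h1 w = 0" "\<forall>s\<in>S. h1 s \<noteq> 0" by (elim exE conjE) (rule that)
  from insert have "s \<notin> W" by auto
  from ex_functional_single[OF vs W this] obtain h2 :: "'v \<Rightarrow> rat" where
    h2: "\<forall>x y. h2 (x + y) = h2 x + h2 y" "\<forall>a x. h2 (scale a x) = a * h2 x"
    "\<forall>w\<in>W. h2 w = 0" "h2 s \<noteq> 0" by (elim exE conjE) (rule that)
  have "finite ((\<lambda>x. - h1 x / h2 x) ` insert s S)" using insert by auto
  then obtain t where t: "t \<notin> (\<lambda>x. - h1 x / h2 x) ` insert s S" "t \<noteq> 0"
    using ex_new_if_finite[of "insert 0 ((\<lambda>x. - h1 x / h2 x) ` insert s S)"] infinite_UNIV_char_0[where 'a = rat] by auto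
  have nz: "h1 x + t * h2 x \<noteq> 0" if "x \<in> insert s S" for x
  proof (cases "h2 x = 0")
    case True
    with that h1 h2 show ?thesis by auto
  next
    case False
    have "t \<noteq> - h1 x / h2 x" using t(1) that by blast
    with False show ?thesis by (auto simp: field_simps eq_neg_iff_add_eq_0)
  qed
  show ?case
    by (intro exI[of _ "\<lambda>x. h1 x + t * h2 x"]) (use h1 h2 nz in \<open>auto simp: algebra_simps\<close>)
qed

section \<open>Polynomials in an operator\<close>

text \<open>The operator is linear on the whole ambient type; \<open>W\<close> is the invariant
  subspace of interest, and annihilators refer to \<open>W\<close>.\<close>

locale lin_op = vector_space scale
  for scale :: "'a::field \<Rightarrow> 'v::ab_group_add \<Rightarrow> 'v" (infixr \<open>\<star>\<close> 75) +
  fixes T :: "'v \<Rightarrow> 'v" and W :: "'v set"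
  assumes T_add: "T (x + y) = T x + T y"
    and T_scale: "T (a \<star> x) = a \<star> T x"
    and subspace_W: "subspace W"
    and T_W: "x \<in> W \<Longrightarrow> T x \<in> W"
begin

lemma T_zero [simp]: "T 0 = 0"
  using T_scale[of 0 0] by simp

definition papp :: "'a poly \<Rightarrow> 'v \<Rightarrow> 'v" where
  "papp p v = (\<Sum>i\<le>degree p. coeff p i \<star> (T ^^ i) v)"

lemma papp_altdef: "degree p \<le> n \<Longrightarrow> papp p v = (\<Sum>i\<le>n. coeff p i \<star> (T ^^ i) v)"
  unfolding papp_def by (intro sum.mono_neutral_left) (auto simp: coeff_eq_0)

lemma T_sum: "T (sum f J) = (\<Sum>i\<in>J. T (f i))"
  by (induction J rule: infinite_finite_induct) (auto simp: T_add)

lemma papp_0 [simp]: "papp 0 v = 0"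
  by (simp add: papp_def)

lemma papp_pCons [simp]: "papp (pCons a p) v = a \<star> v + T (papp p v)"
proof -
  have "papp (pCons a p) v = (\<Sum>i\<le>Suc (degree p). coeff (pCons a p) i \<star> (T ^^ i) v)"
    by (intro papp_altdef) (rule degree_pCons_le)
  also have "\<dots> = a \<star> v + (\<Sum>i\<le>degree p. coeff p i \<star> (T ^^ Suc i) v)"
    by (subst sum.atMost_Suc_shift) simp
  also have "(\<Sum>i\<le>degree p. coeff p i \<star> (T ^^ Suc i) v) = T (papp p v)"
    by (simp add: papp_def T_sum T_scale)
  finally show ?thesis .
qed

lemma papp_1 [simp]: "papp 1 v = v"
  by (simp add: one_pCons)

lemma papp_add: "papp (p + q) v = papp p v + papp q v"
proof -
  let ?n = "max (degree p) (degree q)"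
  have "papp (p + q) v = (\<Sum>i\<le>?n. coeff (p + q) i \<star> (T ^^ i) v)"
    by (intro papp_altdef degree_add_le) auto
  then show ?thesis
    by (simp add: papp_altdef[of p ?n] papp_altdef[of q ?n] scale_left_distrib sum.distrib)
qed

lemma papp_smult: "papp (smult a p) v = a \<star> papp p v"
  by (induction p) (auto simp: scale_right_distrib T_scale)

lemma papp_minus: "papp (- p) v = - papp p v"
  using papp_smult[of "-1" p v] by simp

lemma papp_diff: "papp (p - q) v = papp p v - papp q v"
  using papp_add[of p "- q" v] by (simp add: papp_minus)

lemma papp_sum: "papp (sum f J) v = (\<Sum>i\<in>J. papp (f i) v)"
  by (induction J rule: infinite_finite_induct) (auto simp: papp_add)

lemma papp_mult: "papp (p * q) v = papp p (papp q v)"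
  by (induction p) (auto simp: papp_add papp_smult)

lemma papp_commute: "papp p (papp q v) = papp q (papp p v)"
  by (metis papp_mult mult.commute)

lemma papp_vadd: "papp p (v + w) = papp p v + papp p w"
  by (induction p) (auto simp: T_add scale_right_distrib)

lemma papp_vscale: "papp p (a \<star> v) = a \<star> papp p v"
  by (induction p) (auto simp: T_scale scale_right_distrib mult.commute)

lemma papp_vzero [simp]: "papp p 0 = 0"
  using papp_vscale[of p 0 0] by simp

lemma papp_vdiff: "papp p (v - w) = papp p v - papp p w"
  using papp_vadd[of p "v - w" w] by (simp add: algebra_simps)

lemma papp_vsum: "papp p (sum f J) = (\<Sum>i\<in>J. papp p (f i))"
  by (induction J rule: infinite_finite_induct) (auto simp: papp_vadd)

lemma papp_W: "v \<in> W \<Longrightarrow> papp p v \<in> W"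
  by (induction p) (auto simp: subspace_0 subspace_W intro!: subspace_add subspace_scale T_W)

lemma papp_dvd: "p dvd q \<Longrightarrow> papp p v = 0 \<Longrightarrow> papp q v = 0"
  by (metis dvd_def papp_mult papp_vzero mult.commute)

lemma papp_monom: "papp (monom a n) v = a \<star> (T ^^ n) v"
  by (induction n) (auto simp: monom_0 monom_Suc T_scale)

lemma ex_annihilator_vector:
  assumes "finite B" "W \<subseteq> span B" "w \<in> W"
  shows "\<exists>p. p \<noteq> 0 \<and> papp p w = 0"
proof -
  let ?n = "card B" and ?f = "\<lambda>i. (T ^^ i) w"
  have inW: "?f i \<in> W" for i by (induction i) (auto simp: assms T_W)
  show ?thesis
  \<comment> \<open>A repeated power is treated apart, since linear dependence is a property of sets
    and would not see the repetition.\<close>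
  proof (cases "inj_on ?f {..?n}")
    case False
    then obtain i j where ij: "i \<noteq> j" "?f i = ?f j" by (auto simp: inj_on_def)
    then have "papp (monom 1 i - monom 1 j) w = 0" by (simp add: papp_diff papp_monom)
    moreover have "monom 1 i - monom 1 j \<noteq> (0 :: 'a poly)" using ij by (simp add: monom_eq_iff')
    ultimately show ?thesis by blast
  next
    case True
    have "dependent (?f ` {..?n})"
    proof (rule ccontr)
      assume "independent (?f ` {..?n})"
      moreover have "?f ` {..?n} \<subseteq> span B" using inW assms(2) by blast
      ultimately have "card (?f ` {..?n}) \<le> card B" using independent_span_bound[OF assms(1)] by blast
      with card_image[OF True] show False by simp
    qed
    then obtain u where u: "\<exists>v\<in>?f ` {..?n}. u v \<noteq> 0" "(\<Sum>v\<in>?f ` {..?n}. u v \<star> v) = 0"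
      by (subst (asm) dependent_finite) auto
    define p where "p = (\<Sum>i\<le>?n. monom (u (?f i)) i)"
    have "papp p w = (\<Sum>i\<le>?n. u (?f i) \<star> ?f i)" by (simp add: p_def papp_sum papp_monom)
    also have "\<dots> = 0" using u(2) by (subst (asm) sum.reindex[OF True]) simp
    finally have "papp p w = 0" .
    moreover obtain i where i: "i \<le> ?n" "u (?f i) \<noteq> 0" using u(1) by auto
    have "coeff p i = u (?f i)" using i(1) by (simp add: p_def coeff_sum)
    then have "p \<noteq> 0" using i by auto
    ultimately show ?thesis by blast
  qed
qed

lemma ex_annihilator:
  assumes "finite B" "B \<subseteq> W" "W \<subseteq> span B"
  shows "\<exists>p. p \<noteq> 0 \<and> (\<forall>w\<in>W. papp p w = 0)"
proof -
  have "\<forall>b\<in>B. \<exists>p. p \<noteq> 0 \<and> papp p b = 0" using assms ex_annihilator_vector by blast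
  then obtain P where P: "\<And>b. b \<in> B \<Longrightarrow> P b \<noteq> 0" "\<And>b. b \<in> B \<Longrightarrow> papp (P b) b = 0" by metis
  have "papp (prod P B) w = 0" if "w \<in> span B" for w
    using that
  proof (induction rule: span_induct_alt)
    case (step c x y)
    have "P x dvd prod P B" using assms(1) step by (intro dvd_prodI) auto
    then have "papp (prod P B) x = 0" using P(2) step papp_dvd by blast
    with step show ?case by (simp add: papp_vadd papp_vscale)
  qed simp
  then show ?thesis using P(1) assms by (intro exI[of _ "prod P B"]) auto
qed

definition annih :: "'a poly \<Rightarrow> bool" where
  "annih p \<longleftrightarrow> (\<forall>w\<in>W. papp p w = 0)"

lemma ex_minimal_annihilator:
  assumes "finite B" "B \<subseteq> W" "W \<subseteq> span B"
  obtains p where "lead_coeff p = 1" "annih p" "\<And>q. annih q \<Longrightarrow> q \<noteq> 0 \<Longrightarrow> degree p \<le> degree q"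
proof -
  obtain p0 where "p0 \<noteq> 0" "annih p0" using ex_annihilator[OF assms] by (auto simp: annih_def)
  then obtain p where p: "p \<noteq> 0 \<and> annih p" "\<And>q. q \<noteq> 0 \<and> annih q \<Longrightarrow> degree p \<le> degree q"
    using ex_has_least_nat[of "\<lambda>p. p \<noteq> 0 \<and> annih p" p0 degree] by blast
  let ?p = "smult (1 / lead_coeff p) p"
  show thesis
  proof (rule that[of ?p])
    show "lead_coeff ?p = 1" using p by simp
    show "annih ?p" using p by (simp add: annih_def papp_smult)
    show "degree ?p \<le> degree q" if "annih q" "q \<noteq> 0" for q using p that by auto
  qed
qed

text \<open>The quotient of p by X - \<alpha> no longer annihilates, and any nonzero value it takes
  is an eigenvector.\<close>

lemma minimal_annihilator_eigenvector:
  assumes "annih p" "p \<noteq> 0" "\<And>q. annih q \<Longrightarrow> q \<noteq> 0 \<Longrightarrow> degree p \<le> degree q" "poly p \<alpha> = 0"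
  obtains v where "v \<in> W" "v \<noteq> 0" "T v = \<alpha> \<star> v"
proof -
  obtain q where q: "p = [:-\<alpha>, 1:] * q" using assms(4) by (auto simp: poly_eq_0_iff_dvd)
  with assms(2) have q0: "q \<noteq> 0" by auto
  then have "degree p = Suc (degree q)"
    using degree_mult_eq[of "[:-\<alpha>, 1:]" q] by (simp add: q del: mult_pCons_left)
  then have "\<not> annih q" using assms(3)[of q] q0 by auto
  then obtain w where w: "w \<in> W" "papp q w \<noteq> 0" by (auto simp: annih_def)
  have "papp p w = 0" using assms(1) w by (auto simp: annih_def)
  then have "T (papp q w) = \<alpha> \<star> papp q w" unfolding q papp_mult by simp
  with w papp_W show thesis by (intro that[of "papp q w"]) auto
qed

text \<open>Induction on \<open>i\<close> reduces to an eigenvector for a, on which the power of T -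
  b acts as the nonzero scalar (a - b)^j.\<close>

lemma coprime_kernels:
  assumes "a \<noteq> b" "papp ([:-a, 1:] ^ i) u = 0" "papp ([:-b, 1:] ^ j) u = 0"
  shows "u = 0"
  using assms(2,3)
proof (induction i arbitrary: u)
  case (Suc i)
  let ?u = "papp [:-a, 1:] u"
  have "papp ([:-a, 1:] ^ i) ?u = 0" using Suc.prems(1) by (simp only: power_Suc2 papp_mult)
  moreover have "papp ([:-b, 1:] ^ j) ?u = 0" using Suc.prems(2) papp_commute papp_vzero by metis
  ultimately have "?u = 0" by (rule Suc.IH)
  then have Tu: "T u = a \<star> u" by simp
  have "papp ([:-b, 1:] ^ k) u = ((a - b) ^ k) \<star> u" for k
  proof (induction k)
    case (Suc k)
    have "papp ([:-b, 1:] ^ Suc k) u = papp [:-b, 1:] (papp ([:-b, 1:] ^ k) u)"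
      by (simp only: power_Suc papp_mult)
    also have "\<dots> = ((a - b) ^ k) \<star> papp [:-b, 1:] u" unfolding Suc by (rule papp_vscale)
    also have "papp [:-b, 1:] u = (a - b) \<star> u" using Tu by (simp add: scale_left_diff_distrib)
    finally show ?case by (simp add: mult.commute)
  qed simp
  with Suc.prems(2) assms(1) show ?case by simp
qed simp

end

section \<open>Spectral projections\<close>

definition lag :: "complex set \<Rightarrow> complex \<Rightarrow> complex poly" where
  "lag \<Lambda> \<alpha> = smult (1 / (\<Prod>\<beta>\<in>\<Lambda> - {\<alpha>}. \<alpha> - \<beta>)) (\<Prod>\<beta>\<in>\<Lambda> - {\<alpha>}. [:-\<beta>, 1:])"

text \<open>With y the Lagrange polynomial of \<alpha>, the expression 1 - (1 - y^n)^n is divisible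
  by y^n, hence by (X - \<beta>)^n for the other \<beta>, and it is 1 modulo (X - \<alpha>)^n. It is
  thus the projection to a generalized eigenspace, given by a formula in the roots that is visibly
  Galois equivariant.\<close>

definition eproj :: "complex set \<Rightarrow> nat \<Rightarrow> complex \<Rightarrow> complex poly" where
  "eproj \<Lambda> n \<alpha> = 1 - (1 - lag \<Lambda> \<alpha> ^ n) ^ n"

lemma one_minus_power_dvd: "(y :: 'a::comm_ring_1) dvd 1 - (1 - y) ^ n"
proof (induction n)
  case (Suc n)
  have "1 - (1 - y) ^ Suc n = (1 - (1 - y) ^ n) + y * (1 - y) ^ n" by (simp add: algebra_simps)
  with Suc show ?case by (metis dvd_add dvd_triv_left)
qed simp

lemma poly_lag_self: "finite \<Lambda> \<Longrightarrow> poly (lag \<Lambda> \<alpha>) \<alpha> = 1"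
  by (simp add: lag_def poly_prod)

lemma lag_root_dvd:
  assumes "finite \<Lambda>" "\<alpha> \<in> \<Lambda>"
  shows "(\<Prod>\<beta>\<in>\<Lambda>. [:-\<beta>, 1:]) dvd [:-\<alpha>, 1:] * lag \<Lambda> \<alpha>"
proof -
  have "[:-\<alpha>, 1:] * lag \<Lambda> \<alpha> = smult (1 / (\<Prod>\<beta>\<in>\<Lambda> - {\<alpha>}. \<alpha> - \<beta>)) (\<Prod>\<beta>\<in>\<Lambda>. [:-\<beta>, 1:])"
    unfolding prod.remove[OF assms] by (simp only: lag_def mult_smult_right)
  then show ?thesis by (simp add: dvd_smult)
qed

lemma lag_mult_dvd:
  assumes "finite \<Lambda>" "\<alpha> \<in> \<Lambda>" "\<beta> \<in> \<Lambda>" "\<alpha> \<noteq> \<beta>"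
  shows "(\<Prod>\<beta>\<in>\<Lambda>. [:-\<beta>, 1:]) dvd lag \<Lambda> \<alpha> * lag \<Lambda> \<beta>"
proof -
  have "[:-\<alpha>, 1:] dvd (\<Prod>\<gamma>\<in>\<Lambda> - {\<beta>}. [:-\<gamma>, 1:])" using assms by (intro dvd_prodI) auto
  then have "[:-\<alpha>, 1:] dvd lag \<Lambda> \<beta>" unfolding lag_def by (rule dvd_smult)
  then have "[:-\<alpha>, 1:] * lag \<Lambda> \<alpha> dvd lag \<Lambda> \<beta> * lag \<Lambda> \<alpha>" by (rule mult_dvd_mono) simp
  with lag_root_dvd[OF assms(1,2)] show ?thesis unfolding mult.commute[of "lag \<Lambda> \<beta>"] by (rule dvd_trans)
qed

locale spectral = lin_op scale T W
  for scale :: "complex \<Rightarrow> 'v::ab_group_add \<Rightarrow> 'v" (infixr \<open>\<star>\<close> 75) and T :: "'v \<Rightarrow> 'v" and W :: "'v set" +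
  fixes \<Lambda> :: "complex set" and n :: nat
  assumes finite_X: "finite \<Lambda>"
    and n_pos: "n > 0"
    and annih_X: "annih ((\<Prod>\<beta>\<in>\<Lambda>. [:-\<beta>, 1:]) ^ n)"
begin

definition E :: "complex \<Rightarrow> 'v \<Rightarrow> 'v" where
  "E \<alpha> v = papp (eproj \<Lambda> n \<alpha>) v"

lemma E_add: "E \<alpha> (v + w) = E \<alpha> v + E \<alpha> w"
  and E_scale: "E \<alpha> (a \<star> v) = a \<star> E \<alpha> v"
  and E_sum: "E \<alpha> (sum f J) = (\<Sum>i\<in>J. E \<alpha> (f i))"
  and E_zero [simp]: "E \<alpha> 0 = 0"
  and E_W: "v \<in> W \<Longrightarrow> E \<alpha> v \<in> W"
  unfolding E_def by (rule papp_vadd papp_vscale papp_vsum papp_vzero papp_W; assumption?)+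

lemma annih_dvd: "v \<in> W \<Longrightarrow> (\<Prod>\<beta>\<in>\<Lambda>. [:-\<beta>, 1:]) ^ n dvd p \<Longrightarrow> papp p v = 0"
  using annih_X papp_dvd by (auto simp: annih_def)

lemma lag_dvd_eproj: "lag \<Lambda> \<alpha> ^ n dvd eproj \<Lambda> n \<alpha>"
  unfolding eproj_def by (rule one_minus_power_dvd)

lemma E_gen_eigen:
  assumes "\<alpha> \<in> \<Lambda>" "v \<in> W"
  shows "papp ([:-\<alpha>, 1:] ^ n) (E \<alpha> v) = 0"
proof -
  have "(\<Prod>\<beta>\<in>\<Lambda>. [:-\<beta>, 1:]) ^ n dvd ([:-\<alpha>, 1:] * lag \<Lambda> \<alpha>) ^ n"
    using lag_root_dvd[OF finite_X assms(1)] by (rule dvd_power_same)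
  also have "\<dots> dvd [:-\<alpha>, 1:] ^ n * eproj \<Lambda> n \<alpha>"
    unfolding power_mult_distrib by (intro mult_dvd_mono lag_dvd_eproj) simp
  finally show ?thesis using annih_dvd[OF assms(2)] by (simp only: E_def flip: papp_mult)
qed

lemma eproj_mult_dvd:
  assumes "\<alpha> \<in> \<Lambda>" "\<beta> \<in> \<Lambda>" "\<alpha> \<noteq> \<beta>"
  shows "(\<Prod>\<beta>\<in>\<Lambda>. [:-\<beta>, 1:]) ^ n dvd eproj \<Lambda> n \<alpha> * eproj \<Lambda> n \<beta>"
proof -
  have "(\<Prod>\<beta>\<in>\<Lambda>. [:-\<beta>, 1:]) ^ n dvd (lag \<Lambda> \<alpha> * lag \<Lambda> \<beta>) ^ n"
    using lag_mult_dvd[OF finite_X assms] by (rule dvd_power_same)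
  also have "\<dots> dvd eproj \<Lambda> n \<alpha> * eproj \<Lambda> n \<beta>"
    unfolding power_mult_distrib by (intro mult_dvd_mono lag_dvd_eproj)
  finally show ?thesis .
qed

lemma E_orth: "\<alpha> \<in> \<Lambda> \<Longrightarrow> \<beta> \<in> \<Lambda> \<Longrightarrow> \<alpha> \<noteq> \<beta> \<Longrightarrow> v \<in> W \<Longrightarrow> E \<alpha> (E \<beta> v) = 0"
  using annih_dvd[OF _ eproj_mult_dvd] by (simp only: E_def flip: papp_mult)

text \<open>Products of two different projections vanish modulo the annihilator, so the product of
  all 1 - e(\<alpha>) is 1 minus the sum of the e(\<alpha>). That product itself is divisible by the
  annihilator, because (X - \<alpha>)^n divides 1 - e(\<alpha>).\<close>

lemma E_complete:
  assumes "v \<in> W"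
  shows "(\<Sum>\<alpha>\<in>\<Lambda>. E \<alpha> v) = v"
proof -
  let ?Q = "(\<Prod>\<beta>\<in>\<Lambda>. [:-\<beta>, 1:]) ^ n" and ?e = "eproj \<Lambda> n"
  have "?Q dvd (\<Prod>\<alpha>\<in>S. 1 - ?e \<alpha>) - (1 - (\<Sum>\<alpha>\<in>S. ?e \<alpha>))" if "S \<subseteq> \<Lambda>" for S
    using finite_subset[OF that finite_X] that
  proof (induction S)
    case (insert \<beta> S)
    have "(\<Prod>\<alpha>\<in>insert \<beta> S. 1 - ?e \<alpha>) - (1 - (\<Sum>\<alpha>\<in>insert \<beta> S. ?e \<alpha>)) =
        (1 - ?e \<beta>) * ((\<Prod>\<alpha>\<in>S. 1 - ?e \<alpha>) - (1 - (\<Sum>\<alpha>\<in>S. ?e \<alpha>))) + (\<Sum>\<alpha>\<in>S. ?e \<beta> * ?e \<alpha>)"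
      using insert unfolding sum_distrib_left[symmetric] by (simp add: algebra_simps)
    moreover have "?Q dvd (\<Sum>\<alpha>\<in>S. ?e \<beta> * ?e \<alpha>)"
      using insert by (intro dvd_sum eproj_mult_dvd) auto
    moreover have "?Q dvd (1 - ?e \<beta>) * ((\<Prod>\<alpha>\<in>S. 1 - ?e \<alpha>) - (1 - (\<Sum>\<alpha>\<in>S. ?e \<alpha>)))"
      using insert by (intro dvd_mult) auto
    ultimately show ?case by (metis dvd_add)
  qed simp
  then have 1: "?Q dvd (\<Prod>\<alpha>\<in>\<Lambda>. 1 - ?e \<alpha>) - (1 - (\<Sum>\<alpha>\<in>\<Lambda>. ?e \<alpha>))" by simp
  have "?Q = (\<Prod>\<beta>\<in>\<Lambda>. [:-\<beta>, 1:] ^ n)" by (rule prod_power_distrib)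
  also have "\<dots> dvd (\<Prod>\<alpha>\<in>\<Lambda>. 1 - ?e \<alpha>)"
  proof (rule prod_dvd_prod)
    fix \<alpha> assume "\<alpha> \<in> \<Lambda>"
    have "poly (1 - lag \<Lambda> \<alpha> ^ n) \<alpha> = 0" using poly_lag_self[OF finite_X] by simp
    then have "[:-\<alpha>, 1:] dvd 1 - lag \<Lambda> \<alpha> ^ n" unfolding poly_eq_0_iff_dvd .
    then show "[:-\<alpha>, 1:] ^ n dvd 1 - ?e \<alpha>" by (simp add: eproj_def dvd_power_same)
  qed
  finally have "?Q dvd 1 - (\<Sum>\<alpha>\<in>\<Lambda>. ?e \<alpha>)" using 1 by (metis dvd_diff_right_iff dvd_refl)
  from annih_dvd[OF assms this] have "papp (1 - (\<Sum>\<alpha>\<in>\<Lambda>. ?e \<alpha>)) v = 0" .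
  then show ?thesis by (simp add: E_def papp_diff papp_sum)
qed

lemma E_other:
  assumes "v \<in> W" "papp ([:-\<gamma>, 1:] ^ k) v = 0" "\<beta> \<in> \<Lambda>" "\<beta> \<noteq> \<gamma>"
  shows "E \<beta> v = 0"
proof (rule coprime_kernels)
  show "papp ([:-\<beta>, 1:] ^ n) (E \<beta> v) = 0" using E_gen_eigen assms by blast
  show "papp ([:-\<gamma>, 1:] ^ k) (E \<beta> v) = 0" unfolding E_def by (metis papp_commute assms(2) papp_vzero)
qed (rule assms)

end

lemma complex_poly_dvd_roots_power:
  fixes q :: "complex poly"
  assumes "q \<noteq> 0"
  shows "q dvd (\<Prod>\<beta>\<in>{z. poly q z = 0}. [:-\<beta>, 1:]) ^ degree q"
proof -
  have fin: "finite {z. poly q z = 0}" using poly_roots_finite[OF assms] .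
  have "\<forall>x. poly q x = 0 \<longrightarrow> poly (\<Prod>\<beta>\<in>{z. poly q z = 0}. [:-\<beta>, 1:]) x = 0"
    using fin by (auto simp: poly_prod)
  with nullstellensatz_univariate[of q "\<Prod>\<beta>\<in>{z. poly q z = 0}. [:-\<beta>, 1:]"] assms show ?thesis by auto
qed

section \<open>Coordinates\<close>

lemma sum_fun_apply: "(\<Sum>i\<in>J. f i) x = (\<Sum>i\<in>J. f i x)"
  by (induction J rule: infinite_finite_induct) auto

lemma vadd_plus: "vadd x y = x + y"
  by (auto simp: vadd_def fun_eq_iff)

lemma vscale_apply [simp]: "vscale a x i = a * x i"
  by (simp add: vscale_def)

lemma vector_space_vscale: "vector_space (vscale :: 'a::field \<Rightarrow> _)"
  by unfold_locales (auto simp: fun_eq_iff algebra_simps)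

lemma subspace_in_space: "module.subspace (vscale :: 'a::field \<Rightarrow> _) {x. in_space m x}"
proof -
  interpret vector_space "vscale :: 'a \<Rightarrow> _" by (rule vector_space_vscale)
  show ?thesis by (rule subspaceI) (auto simp: in_space_def)
qed

definition bilin :: "('k \<Rightarrow> 'v \<Rightarrow> 'v) \<Rightarrow> ('v \<Rightarrow> 'v \<Rightarrow> 'v::plus) \<Rightarrow> bool" where
  "bilin sc \<beta> \<longleftrightarrow> (\<forall>x x' y. \<beta> (x + x') y = \<beta> x y + \<beta> x' y) \<and> (\<forall>x y y'. \<beta> x (y + y') = \<beta> x y + \<beta> x y') \<and>
    (\<forall>a x y. \<beta> (sc a x) y = sc a (\<beta> x y)) \<and> (\<forall>a x y. \<beta> x (sc a y) = sc a (\<beta> x y))"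

lemma bilin_lie_br: "bilin vscale (lie_br m c :: (nat \<Rightarrow> 'a::field_char_0) \<Rightarrow> _)"
  unfolding bilin_def
  by (auto simp: lie_br_def fun_eq_iff algebra_simps sum.distrib sum_distrib_left)

lemma in_space_lie_br: "in_space m (lie_br m c x y)"
  by (auto simp: in_space_def lie_br_def)

definition unit_vec :: "nat \<Rightarrow> nat \<Rightarrow> 'a::zero_neq_one" where
  "unit_vec i = (\<lambda>j. if j = i then 1 else 0)"

lemma in_space_unit_vec: "i < m \<Longrightarrow> in_space m (unit_vec i)"
  by (auto simp: in_space_def unit_vec_def)

lemma in_space_expand:
  assumes "in_space m x" shows "x = (\<Sum>i<m. vscale (x i) (unit_vec i :: nat \<Rightarrow> 'a::field))"
proof
  fix j
  have "(\<Sum>i<m. vscale (x i) (unit_vec i)) j = (\<Sum>i<m. if i = j then x i else 0)"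
    unfolding sum_fun_apply by (intro sum.cong) (auto simp: unit_vec_def)
  also have "\<dots> = x j" using assms by (auto simp: in_space_def)
  finally show "x j = (\<Sum>i<m. vscale (x i) (unit_vec i)) j" by simp
qed

lemma in_space_span_unit: "{x. in_space m x} \<subseteq> module.span (vscale :: 'a::field \<Rightarrow> _) (unit_vec ` {..<m})"
proof
  interpret vector_space "vscale :: 'a \<Rightarrow> _" by (rule vector_space_vscale)
  fix x :: "nat \<Rightarrow> 'a" assume "x \<in> {x. in_space m x}"
  then have "x = (\<Sum>i<m. vscale (x i) (unit_vec i))" using in_space_expand by blast
  also have "\<dots> \<in> span (unit_vec ` {..<m})" by (intro span_sum span_scale span_base) auto
  finally show "x \<in> span (unit_vec ` {..<m})" .
qed

lemma bilin_sum:
  assumes "bilin sc \<beta>" "\<And>y. \<beta> 0 y = 0" "\<And>x. \<beta> x 0 = 0"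
  shows "\<beta> (sum f J) y = (\<Sum>i\<in>J. \<beta> (f i) y)" "\<beta> x (sum g K) = (\<Sum>i\<in>K. \<beta> x (g i))"
proof -
  show "\<beta> (sum f J) y = (\<Sum>i\<in>J. \<beta> (f i) y)"
    using assms by (induction J rule: infinite_finite_induct) (auto simp: bilin_def)
  show "\<beta> x (sum g K) = (\<Sum>i\<in>K. \<beta> x (g i))"
    using assms by (induction K rule: infinite_finite_induct) (auto simp: bilin_def)
qed

lemma bilin_zero:
  fixes \<beta> :: "(nat \<Rightarrow> 'a::field) \<Rightarrow> _ \<Rightarrow> nat \<Rightarrow> 'a"
  assumes b: "bilin vscale \<beta>" shows "\<beta> 0 y = 0" "\<beta> x 0 = 0"
proof -
  have *: "vscale 0 v = 0" for v :: "nat \<Rightarrow> 'a" by (auto simp: fun_eq_iff)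
  have "\<beta> (vscale 0 0) y = vscale 0 (\<beta> 0 y)" "\<beta> x (vscale 0 0) = vscale 0 (\<beta> x 0)"
    using b unfolding bilin_def by metis+
  then show "\<beta> 0 y = 0" "\<beta> x 0 = 0" unfolding * by auto
qed

text \<open>Identities known on rational vectors are known on unit vectors; this carries them to the
  complexification.\<close>

lemma bilin_ext:
  fixes \<beta> \<beta>' :: "(nat \<Rightarrow> 'a::field) \<Rightarrow> _ \<Rightarrow> nat \<Rightarrow> 'a"
  assumes b: "bilin vscale \<beta>" "bilin vscale \<beta>'"
    and eq: "\<And>i j. i < m \<Longrightarrow> j < m \<Longrightarrow> \<beta> (unit_vec i) (unit_vec j) = \<beta>' (unit_vec i) (unit_vec j)"
    and x: "in_space m x" and y: "in_space m y"
  shows "\<beta> x y = \<beta>' x y"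
proof -
  have exp: "\<gamma> x y = (\<Sum>i<m. \<Sum>j<m. vscale (y j) (vscale (x i) (\<gamma> (unit_vec i) (unit_vec j))))"
    if g: "bilin vscale \<gamma>" for \<gamma>
  proof -
    note z = bilin_zero[OF g]
    have "\<gamma> x y = (\<Sum>i<m. \<gamma> (vscale (x i) (unit_vec i)) y)"
      by (subst in_space_expand[OF x]) (rule bilin_sum(1)[OF g z])
    also have "\<dots> = (\<Sum>i<m. \<Sum>j<m. \<gamma> (vscale (x i) (unit_vec i)) (vscale (y j) (unit_vec j)))"
      by (subst in_space_expand[OF y]) (simp only: bilin_sum(2)[OF g z])
    finally show ?thesis using g by (simp add: bilin_def)
  qed
  show ?thesis unfolding exp[OF b(1)] exp[OF b(2)] using eq by simp
qed

definition rc :: "(nat \<Rightarrow> rat) \<Rightarrow> nat \<Rightarrow> 'a::field_char_0" where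
  "rc x = (\<lambda>i. of_rat (x i))"

lemma rc_unit_vec [simp]: "rc (unit_vec i) = unit_vec i"
  by (auto simp: rc_def unit_vec_def fun_eq_iff)

lemma lie_br_rc: "lie_br m c (rc x) (rc y) = (rc (lie_br m c x y) :: nat \<Rightarrow> 'a::field_char_0)"
  by (auto simp: lie_br_def rc_def fun_eq_iff of_rat_sum of_rat_mult)

text \<open>The rational matrix acts on vectors over any field of characteristic 0, so the same
  operator is available on the Lie algebra and on its complexification.\<close>

definition mv :: "nat \<Rightarrow> (nat \<Rightarrow> nat \<Rightarrow> rat) \<Rightarrow> (nat \<Rightarrow> 'a::field_char_0) \<Rightarrow> nat \<Rightarrow> 'a" where
  "mv m A v = (\<lambda>i. if i < m then \<Sum>j<m. of_rat (A i j) * v j else 0)"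

lemma mv_add: "mv m A (x + y) = mv m A x + mv m A y"
  by (auto simp: mv_def fun_eq_iff algebra_simps sum.distrib)

lemma mv_scale: "mv m A (vscale a x) = vscale a (mv m A x)"
  by (auto simp: mv_def fun_eq_iff algebra_simps sum_distrib_left)

lemma in_space_mv: "in_space m (mv m A v)"
  by (auto simp: in_space_def mv_def)

lemma mv_rc: "mv m A (rc x) = (rc (mv m A x) :: nat \<Rightarrow> 'a::field_char_0)"
  by (auto simp: mv_def rc_def fun_eq_iff of_rat_sum of_rat_mult)

lemma mv_of_linear:
  fixes F :: "(nat \<Rightarrow> rat) \<Rightarrow> nat \<Rightarrow> rat"
  assumes "\<And>x. in_space m x \<Longrightarrow> in_space m (F x)"
    "\<And>x y. in_space m x \<Longrightarrow> in_space m y \<Longrightarrow> F (x + y) = F x + F y"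
    "\<And>a x. in_space m x \<Longrightarrow> F (vscale a x) = vscale a (F x)"
    and x: "in_space m x"
  shows "F x = mv m (\<lambda>i j. F (unit_vec j) i) x"
proof -
  have z: "in_space m 0" by (simp add: in_space_def)
  have "F 0 = 0"
  proof -
    have "vscale 0 0 = (0 :: nat \<Rightarrow> rat)" by (auto simp: fun_eq_iff)
    moreover have "vscale 0 (F 0) = (0 :: nat \<Rightarrow> rat)" by (auto simp: fun_eq_iff)
    ultimately show ?thesis using assms(3)[OF z, of 0] by metis
  qed
  have "F (\<Sum>i\<in>J. vscale (x i) (unit_vec i)) = (\<Sum>i\<in>J. vscale (x i) (F (unit_vec i)))" if "finite J" "J \<subseteq> {..<m}" for J
    using that
  proof (induction J)
    case (insert i J)
    have "in_space m (vscale (x i) (unit_vec i))" using insert in_space_unit_vec[of i m, where 'a = rat] by (auto simp: in_space_def)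
    moreover have "in_space m (\<Sum>i\<in>J. vscale (x i) (unit_vec i :: nat \<Rightarrow> rat))"
      using insert.prems by (auto simp: in_space_def sum_fun_apply unit_vec_def intro!: sum.neutral)
    moreover have "in_space m (unit_vec i :: nat \<Rightarrow> rat)" using insert by (intro in_space_unit_vec) auto
    moreover have "F (\<Sum>i\<in>J. vscale (x i) (unit_vec i)) = (\<Sum>i\<in>J. vscale (x i) (F (unit_vec i)))"
      using insert by blast
    ultimately show ?case by (simp only: sum.insert[OF insert.hyps] assms(2,3))
  qed (simp add: \<open>F 0 = 0\<close>)
  from this[of "{..<m}"] have "F x = (\<Sum>i<m. vscale (x i) (F (unit_vec i)))"
    using in_space_expand[OF x] by simp
  moreover have "in_space m (F x)" by (rule assms(1)[OF x])
  ultimately show ?thesis by (auto simp: mv_def fun_eq_iff sum_fun_apply in_space_def mult.commute)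
qed

section \<open>The nilpotent Lie algebra of a Malcev completion\<close>

definition trunc :: "nat \<Rightarrow> (nat \<Rightarrow> 'a::zero) \<Rightarrow> nat \<Rightarrow> 'a" where
  "trunc m x = (\<lambda>i. if i < m then x i else 0)"

lemma in_space_trunc: "in_space m (trunc m x)"
  by (auto simp: in_space_def trunc_def)

lemma lie_br_trunc: "lie_br m c x y = lie_br m c (trunc m x) (trunc m y)"
  by (auto simp: lie_br_def trunc_def fun_eq_iff)

lemma lie_br_trunc_left: "lie_br m c (trunc m x) y = lie_br m c x y"
  and lie_br_trunc_right: "lie_br m c x (trunc m y) = lie_br m c x y"
  by (auto simp: lie_br_def trunc_def fun_eq_iff)

lemma nest_br_nest: "nest_br m c zs = nest (lie_br m c) zs"
  by (induction zs rule: induct_list012) (auto simp: zero_fun_def)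

text \<open>The bracket ignores the coordinates from \<open>m\<close> on. The axioms, assumed for
  vectors of Q^m, hence hold for all sequences by truncation.\<close>

lemma nilpotent_lie_coord:
  assumes "is_lie_algebra m c" "is_nilpotent_lie m c"
  shows "nilpotent_lie vscale (lie_br m c) (m + 1)"
proof -
  interpret vector_space "vscale :: rat \<Rightarrow> _" by (rule vector_space_vscale)
  have L: "lie_br m c x x = 0" "lie_br m c x (lie_br m c y z) + lie_br m c y (lie_br m c z x) + lie_br m c z (lie_br m c x y) = 0"
    if "in_space m x" "in_space m y" "in_space m z" for x y z :: "nat \<Rightarrow> rat"
    using assms(1) that by (auto simp: is_lie_algebra_def vadd_plus zero_fun_def)
  have bl: "bilin vscale (lie_br m c :: (nat \<Rightarrow> rat) \<Rightarrow> _)" by (rule bilin_lie_br)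
  obtain N where N: "\<And>zs :: (nat \<Rightarrow> rat) list. length zs = Suc N \<Longrightarrow> \<forall>z\<in>set zs. in_space m z \<Longrightarrow> nest_br m c zs = (\<lambda>_. 0)"
    using assms(2) by (auto simp: is_nilpotent_lie_def)
  have nt: "nest (lie_br m c) zs = nest (lie_br m c) (map (trunc m) zs)" if "length zs \<ge> 2" for zs :: "(nat \<Rightarrow> rat) list"
    using that
  proof (induction zs rule: induct_list012)
    case (3 x y zs)
    show ?case
    proof (cases "zs = []")
      case True
      then show ?thesis using lie_br_trunc by simp
    next
      case False
      then have "nest (lie_br m c) (y # zs) = nest (lie_br m c) (map (trunc m) (y # zs))"
        using 3 by (cases zs) auto
      then show ?thesis by (simp add: lie_br_trunc_left)
    qed
  qed auto
  show ?thesis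
  proof unfold_locales
    fix x y z :: "nat \<Rightarrow> rat"
    show "lie_br m c x x = 0"
      using L(1)[of "trunc m x" "trunc m x" "trunc m x"] by (simp only: in_space_trunc lie_br_trunc_left lie_br_trunc_right)
    show "lie_br m c x (lie_br m c y z) + lie_br m c y (lie_br m c z x) + lie_br m c z (lie_br m c x y) = 0"
      using L(2)[of "trunc m x" "trunc m y" "trunc m z"]
      by (simp only: in_space_trunc lie_br_trunc_left lie_br_trunc_right)
    show "\<exists>K. \<forall>zs. length zs = Suc K \<longrightarrow> nest (lie_br m c) zs = (0 :: nat \<Rightarrow> rat)"
    \<comment> \<open>One letter more than in the hypothesis: \<open>nest\<close> returns a single
      letter untruncated, so the vanishing is applied to the tail of the truncated list.\<close>
    proof (intro exI[of _ "Suc N"] allI impI)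
      fix zs :: "(nat \<Rightarrow> rat) list" assume l: "length zs = Suc (Suc N)"
      then obtain w ws where w: "map (trunc m) zs = w # ws" "length ws = Suc N" "\<forall>z\<in>set ws. in_space m z"
        using in_space_trunc[of m] by (cases zs) auto
      have "nest_br m c ws = (\<lambda>_. 0)" by (rule N[OF w(2,3)])
      then have "nest (lie_br m c) ws = 0" unfolding nest_br_nest zero_fun_def .
      moreover have "ws \<noteq> []" using w(2) by auto
      moreover have "nest (lie_br m c) zs = nest (lie_br m c) (w # ws)"
        unfolding w(1)[symmetric] by (rule nt) (simp add: l)
      ultimately show "nest (lie_br m c) zs = 0"
        using bilin_zero(2)[OF bl, of w] nest_Cons[of ws "lie_br m c" w] by metis
    qed
    show "m + 1 \<ge> 2 \<or> (\<forall>x y :: nat \<Rightarrow> rat. lie_br m c x y = 0)"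
      by (cases m) (auto simp: lie_br_def fun_eq_iff)
  qed (use bl in \<open>auto simp: bilin_def\<close>)
qed

lemma ch_product_chp:
  assumes "is_lie_algebra m c" "is_nilpotent_lie m c"
  shows "ch_product m c u v = nilpotent_lie.chp vscale (lie_br m c) (m + 1) u v"
proof -
  interpret nilpotent_lie vscale "lie_br m c" "m + 1" by (rule nilpotent_lie_coord[OF assms])
  have "chp u v = (\<Sum>ps\<in>dyn_index (m + 1). vscale (dyn_coeff ps) (nest (lie_br m c) (dyn_word u v ps)))"
    by (rule chp_def)
  then show ?thesis unfolding ch_product_def by (simp only:) (simp add: fun_eq_iff sum_fun_apply nest_br_nest)
qed

lemma lie_hull_coord:
  assumes "is_lie_algebra m c" "is_nilpotent_lie m c" "lie_subalgebra_generated_is_all m c S"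
    "\<forall>x\<in>S. in_space m x"
  shows "nilpotent_lie.lie_hull vscale (lie_br m c) S = {x. in_space m x}"
proof -
  interpret nilpotent_lie vscale "lie_br m c" "m + 1" by (rule nilpotent_lie_coord[OF assms(1,2)])
  have "subalg {x. in_space m x}"
    using subspace_in_space in_space_lie_br by (auto simp: subalg_def)
  then have 1: "lie_hull S \<subseteq> {x. in_space m x}" using assms(4) by (intro lie_hull_minimal) auto
  have H: "subspace (lie_hull S)" "\<forall>x\<in>lie_hull S. \<forall>y\<in>lie_hull S. lie_br m c x y \<in> lie_hull S"
    using subalg_lie_hull[of S] by (auto simp: subalg_def)
  have 0: "(\<lambda>_. 0) \<in> lie_hull S" using subspace_0[OF H(1)] by (simp add: zero_fun_def)
  have "{x. in_space m x} \<subseteq> lie_hull S"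
    using assms(3) unfolding lie_subalgebra_generated_is_all_def
    by (rule allE[of _ "lie_hull S"])
      (use 1 0 H lie_hull_superset[of S] subspace_add[OF H(1)] subspace_scale[OF H(1)] in \<open>auto simp: vadd_plus\<close>)
  with 1 show ?thesis by blast
qed

section \<open>Generalized eigenspaces of automorphisms and derivations\<close>

context spectral
begin

lemma papp_shift: "papp [:-a, 1:] v = T v - a \<star> v"
  by simp

lemma gen_eigen_shift: "papp ([:-a, 1:] ^ Suc k) v = papp ([:-a, 1:] ^ k) (T v - a \<star> v)"
  unfolding power_Suc2 papp_mult papp_shift ..

lemma gen_eigen_T: "papp p v = 0 \<Longrightarrow> papp p (T v) = 0"
proof -
  assume *: "papp p v = 0"
  have "T v = papp [:0, 1:] v" by simp
  then show ?thesis using papp_commute[of p "[:0, 1:]" v] * by (metis papp_vzero)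
qed

text \<open>Induction on i + j with the identity (T - a a')[x,y] = [(T - a)x, T y] + a
  [x, (T - a')y], valid for an automorphism.\<close>

lemma gen_eigen_mult:
  assumes b: "bilin scale \<beta>" and z: "\<And>y. \<beta> 0 y = 0" "\<And>x. \<beta> x 0 = 0"
    and mult: "\<And>x y. x \<in> W \<Longrightarrow> y \<in> W \<Longrightarrow> T (\<beta> x y) = \<beta> (T x) (T y)"
  shows "x \<in> W \<Longrightarrow> y \<in> W \<Longrightarrow> papp ([:-a, 1:] ^ i) x = 0 \<Longrightarrow> papp ([:-a', 1:] ^ j) y = 0 \<Longrightarrow>
    papp ([:-(a * a'), 1:] ^ (i + j)) (\<beta> x y) = 0"
proof (induction "i + j" arbitrary: i j x y)
  case (Suc k)
  consider "i = 0" | "j = 0" | i' j' where "i = Suc i'" "j = Suc j'" by (cases i; cases j) auto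
  then show ?case
  proof cases
    case 3
    have bl: "\<beta> (u - u') w = \<beta> u w - \<beta> u' w" "\<beta> u (w - w') = \<beta> u w - \<beta> u w'" for u u' w w'
      using b unfolding bilin_def by (metis add_diff_cancel diff_add_cancel)+
    let ?x = "T x - a \<star> x" and ?y = "T y - a' \<star> y"
    have W: "?x \<in> W" "?y \<in> W" "T y \<in> W"
      using Suc.prems T_W subspace_W by (auto intro: subspace_diff subspace_scale)
    have "papp ([:-(a * a'), 1:] ^ (i' + j)) (\<beta> ?x (T y)) = 0"
    proof (rule Suc.hyps(1))
      show "papp ([:-a, 1:] ^ i') ?x = 0" using Suc.prems(3) 3 by (simp only: gen_eigen_shift)
      show "papp ([:-a', 1:] ^ j) (T y) = 0" using Suc.prems(4) by (rule gen_eigen_T)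
    qed (use Suc 3 W in auto)
    moreover have "papp ([:-(a * a'), 1:] ^ (i + j')) (\<beta> x ?y) = 0"
    proof (rule Suc.hyps(1))
      show "papp ([:-a', 1:] ^ j') ?y = 0" using Suc.prems(4) 3 by (simp only: gen_eigen_shift)
    qed (use Suc 3 W in auto)
    moreover have "T (\<beta> x y) - (a * a') \<star> \<beta> x y = \<beta> ?x (T y) + a \<star> \<beta> x ?y"
      using mult[OF Suc.prems(1,2)] b
      by (simp add: bl bilin_def scale_right_diff_distrib)
    moreover have "i + j = Suc (i' + j)" "i + j' = i' + j" using 3 by auto
    ultimately show ?thesis by (simp only: gen_eigen_shift papp_vadd papp_vscale) simp
  qed (use Suc.prems z in auto)
qed (use z in auto)

text \<open>Induction on i + j with the identity (T - a - a')[x,y] = [(T - a)x, y] + [x, (T - a')y],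
  valid for a derivation.\<close>

lemma gen_eigen_deriv:
  assumes b: "bilin scale \<beta>" and z: "\<And>y. \<beta> 0 y = 0" "\<And>x. \<beta> x 0 = 0"
    and deriv: "\<And>x y. x \<in> W \<Longrightarrow> y \<in> W \<Longrightarrow> T (\<beta> x y) = \<beta> (T x) y + \<beta> x (T y)"
  shows "x \<in> W \<Longrightarrow> y \<in> W \<Longrightarrow> papp ([:-a, 1:] ^ i) x = 0 \<Longrightarrow> papp ([:-a', 1:] ^ j) y = 0 \<Longrightarrow>
    papp ([:-(a + a'), 1:] ^ (i + j)) (\<beta> x y) = 0"
proof (induction "i + j" arbitrary: i j x y)
  case (Suc k)
  consider "i = 0" | "j = 0" | i' j' where "i = Suc i'" "j = Suc j'" by (cases i; cases j) auto
  then show ?case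
  proof cases
    case 3
    have bl: "\<beta> (u - u') w = \<beta> u w - \<beta> u' w" "\<beta> u (w - w') = \<beta> u w - \<beta> u w'" for u u' w w'
      using b unfolding bilin_def by (metis add_diff_cancel diff_add_cancel)+
    let ?x = "T x - a \<star> x" and ?y = "T y - a' \<star> y"
    have W: "?x \<in> W" "?y \<in> W"
      using Suc.prems T_W subspace_W by (auto intro: subspace_diff subspace_scale)
    have "papp ([:-(a + a'), 1:] ^ (i' + j)) (\<beta> ?x y) = 0"
    proof (rule Suc.hyps(1))
      show "papp ([:-a, 1:] ^ i') ?x = 0" using Suc.prems(3) 3 by (simp only: gen_eigen_shift)
    qed (use Suc 3 W in auto)
    moreover have "papp ([:-(a + a'), 1:] ^ (i + j')) (\<beta> x ?y) = 0"
    proof (rule Suc.hyps(1))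
      show "papp ([:-a', 1:] ^ j') ?y = 0" using Suc.prems(4) 3 by (simp only: gen_eigen_shift)
    qed (use Suc 3 W in auto)
    moreover have "T (\<beta> x y) - (a + a') \<star> \<beta> x y = \<beta> ?x y + \<beta> x ?y"
      using deriv[OF Suc.prems(1,2)] b
      by (simp add: bl bilin_def scale_left_distrib)
    moreover have "i + j = Suc (i' + j)" "i + j' = i' + j" using 3 by auto
    ultimately show ?thesis by (simp only: gen_eigen_shift papp_vadd) simp
  qed (use Suc.prems z in auto)
qed (use z in auto)

end

section \<open>A character of the eigenvalues\<close>

text \<open>\<open>R\<close> consists of the rational multiples of exponent vectors of
  multiplicative relations in \<Lambda>. The vector of a single element a lies outside
  \<open>R\<close>, since otherwise a power of a would be 1. A functional that kills
  \<open>R\<close> and no such vector, scaled to integral values, is the character; the relation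
  between a, b and a b gives additivity.\<close>

lemma ex_multiplicative_character:
  fixes \<Lambda> :: "complex set"
  assumes fin: "finite \<Lambda>" and nz: "\<And>a. a \<in> \<Lambda> \<Longrightarrow> a \<noteq> 0"
    and tor: "\<And>a N. a \<in> \<Lambda> \<Longrightarrow> N > 0 \<Longrightarrow> a ^ N \<noteq> 1"
  shows "\<exists>\<psi>::complex \<Rightarrow> int. (\<forall>a\<in>\<Lambda>. \<psi> a \<noteq> 0) \<and>
    (\<forall>a\<in>\<Lambda>. \<forall>b\<in>\<Lambda>. a * b \<in> \<Lambda> \<longrightarrow> \<psi> (a * b) = \<psi> a + \<psi> b)"
proof -
  let ?sc = "\<lambda>(q::rat) (f::complex \<Rightarrow> rat) z. q * f z"
  define \<delta> :: "complex \<Rightarrow> complex \<Rightarrow> rat" where "\<delta> a = (\<lambda>z. if z = a then 1 else 0)" for a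
  define P where "P w N k \<longleftrightarrow> N > 0 \<and> (\<forall>z\<in>\<Lambda>. of_nat N * w z = of_int (k z)) \<and> (\<Prod>z\<in>\<Lambda>. z powi k z) = 1"
    for w :: "complex \<Rightarrow> rat" and N :: nat and k :: "complex \<Rightarrow> int"
  define R where "R = {w. \<exists>N k. P w N k}"
  interpret vector_space ?sc by unfold_locales (auto simp: fun_eq_iff algebra_simps)
  have "subspace R"
  proof (rule subspaceI)
    have "P 0 1 (\<lambda>_. 0)" by (simp add: P_def)
    then show "0 \<in> R" unfolding R_def by blast
  next
    fix w w' assume "w \<in> R" "w' \<in> R"
    then obtain N k N' k' where *: "P w N k" "P w' N' k'" by (auto simp: R_def)
    have "P (w + w') (N * N') (\<lambda>z. k z * int N' + k' z * int N)"
      unfolding P_def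
    proof (intro conjI ballI)
      show "0 < N * N'" using * by (simp add: P_def)
      fix z assume "z \<in> \<Lambda>"
      with * have "of_nat N * w z = of_int (k z)" "of_nat N' * w' z = of_int (k' z)" by (auto simp: P_def)
      then show "of_nat (N * N') * (w + w') z = of_int (k z * int N' + k' z * int N)"
        by (simp add: algebra_simps flip: of_int_mult) (simp add: algebra_simps)
    next
      have "(\<Prod>z\<in>\<Lambda>. z powi (k z * int N' + k' z * int N)) =
          (\<Prod>z\<in>\<Lambda>. (z powi k z) powi int N' * (z powi k' z) powi int N)"
        using nz by (intro prod.cong) (auto simp: power_int_add power_int_mult)
      also have "\<dots> = (\<Prod>z\<in>\<Lambda>. z powi k z) ^ N' * (\<Prod>z\<in>\<Lambda>. z powi k' z) ^ N"
        by (simp add: prod.distrib prod_power_distrib)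
      also have "\<dots> = 1" using * by (simp add: P_def)
      finally show "(\<Prod>z\<in>\<Lambda>. z powi (k z * int N' + k' z * int N)) = 1" .
    qed
    then show "w + w' \<in> R" unfolding R_def by blast
  next
    fix q w assume "w \<in> R"
    then obtain N k where *: "P w N k" by (auto simp: R_def)
    obtain a b where ab: "quotient_of q = (a, b)" by fastforce
    then have b: "b > 0" "q = of_int a / of_int b"
      using quotient_of_denom_pos quotient_of_div by auto
    have "P (?sc q w) (N * nat b) (\<lambda>z. a * k z)"
      unfolding P_def
    proof (intro conjI ballI)
      show "0 < N * nat b" using * b by (simp add: P_def)
      fix z assume "z \<in> \<Lambda>"
      with * have "of_nat N * w z = of_int (k z)" by (auto simp: P_def)
      then have "of_int (a * k z) = of_int a * (of_nat N * w z)" by simp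
      moreover have "of_int b * q = of_int a" using b by simp
      ultimately have "of_int (a * k z) = of_int b * q * (of_nat N * w z)" by simp
      then show "of_nat (N * nat b) * (q * w z) = of_int (a * k z)"
        using b(1) by (simp add: mult_ac)
    next
      have "(\<Prod>z\<in>\<Lambda>. z powi (a * k z)) = (\<Prod>z\<in>\<Lambda>. (z powi k z) powi a)"
        by (intro prod.cong) (auto simp: power_int_mult mult.commute[of a])
      also have "\<dots> = (\<Prod>z\<in>\<Lambda>. z powi k z) powi a"
        by (induction \<Lambda> rule: infinite_finite_induct) (auto simp: power_int_mult_distrib)
      also have "\<dots> = 1" using * by (simp add: P_def)
      finally show "(\<Prod>z\<in>\<Lambda>. z powi (a * k z)) = 1" .
    qed
    then show "?sc q w \<in> R" unfolding R_def by blast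
  qed
  note subR = this
  have "\<delta> a \<notin> R" if a: "a \<in> \<Lambda>" for a
  proof
    assume "\<delta> a \<in> R"
    then obtain N k where *: "P (\<delta> a) N k" by (auto simp: R_def)
    have k: "k z = (if z = a then int N else 0)" if "z \<in> \<Lambda>" for z
    proof -
      have "of_int (k z) = of_nat N * \<delta> a z" using * that by (simp add: P_def)
      also have "\<dots> = of_int (if z = a then int N else 0)" by (simp add: \<delta>_def)
      finally show ?thesis by (simp only: of_int_eq_iff)
    qed
    have "(\<Prod>z\<in>\<Lambda>. z powi k z) = (\<Prod>z\<in>\<Lambda>. if z = a then z ^ N else 1)"
      by (intro prod.cong) (auto simp: k)
    also have "\<dots> = a ^ N" using fin a by simp
    finally show False using * tor[OF a, of N] by (auto simp: P_def)
  qed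
  then have disj: "\<delta> ` \<Lambda> \<inter> R = {}" by auto
  from ex_functional[OF vector_space_axioms subR finite_imageI[OF fin] disj] obtain h :: "(complex \<Rightarrow> rat) \<Rightarrow> rat" where h: "\<forall>x y. h (x + y) = h x + h y"
    "\<forall>q x. h (?sc q x) = q * h x" "\<forall>w\<in>R. h w = 0" "\<forall>s\<in>\<delta> ` \<Lambda>. h s \<noteq> 0"
    by (elim exE conjE) (rule that)
  obtain Q :: int where Q: "Q > 0" "\<forall>x\<in>(\<lambda>a. h (\<delta> a)) ` \<Lambda>. of_int Q * x \<in> \<int>"
    using common_denominator[of "(\<lambda>a. h (\<delta> a)) ` \<Lambda>"] fin by auto
  define \<psi> where "\<psi> a = \<lfloor>of_int Q * h (\<delta> a)\<rfloor>" for a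
  have chi: "of_int (\<psi> a) = of_int Q * h (\<delta> a)" if "a \<in> \<Lambda>" for a
    using Q(2) that by (auto simp: \<psi>_def elim: Ints_cases)
  show ?thesis
  proof (intro exI[of _ \<psi>] conjI ballI impI)
    fix a assume a: "a \<in> \<Lambda>"
    then have "of_int (\<psi> a) \<noteq> (0 :: rat)" using chi[OF a] Q h(4) by auto
    then show "\<psi> a \<noteq> 0" by auto
  next
    fix a b assume ab: "a \<in> \<Lambda>" "b \<in> \<Lambda>" "a * b \<in> \<Lambda>"
    let ?w = "\<delta> a + \<delta> b + ?sc (-1) (\<delta> (a * b))"
    have "P ?w 1 (\<lambda>z. (if z = a then 1 else 0) + (if z = b then 1 else 0) - (if z = a * b then 1 else 0))"
      unfolding P_def
    proof (intro conjI ballI)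
      have "(\<Prod>z\<in>\<Lambda>. z powi ((if z = a then 1 else 0) + (if z = b then 1 else 0) - (if z = a * b then 1 else 0))) =
          (\<Prod>z\<in>\<Lambda>. (if z = a then z else 1) * (if z = b then z else 1) / (if z = a * b then z else 1))"
        using nz by (intro prod.cong) (auto simp: power_int_add power_int_diff)
      also have "\<dots> = 1" using fin ab nz by (simp add: prod.distrib prod_dividef)
      finally show "(\<Prod>z\<in>\<Lambda>. z powi ((if z = a then 1 else 0) + (if z = b then 1 else 0) - (if z = a * b then 1 else 0))) = 1" .
    qed (auto simp: \<delta>_def)
    then have "?w \<in> R" unfolding R_def by blast
    then have "h ?w = 0" using h(3) by blast
    moreover have "h ?w = h (\<delta> a) + h (\<delta> b) - h (\<delta> (a * b))"
      using h(1) h(2)[THEN spec, of "-1"] by simp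
    ultimately have "of_int (\<psi> (a * b)) = (of_int (\<psi> a + \<psi> b) :: rat)"
      using chi ab by (simp add: distrib_left[symmetric])
    then show "\<psi> (a * b) = \<psi> a + \<psi> b" by (simp only: of_int_eq_iff)
  qed
qed

section \<open>Passing from complex to rational vectors, and the grading by eigenvalues\<close>

lemma ex_rational_functional:
  fixes z :: complex assumes "z \<noteq> 0"
  shows "\<exists>\<pi>::complex \<Rightarrow> rat. (\<forall>x y. \<pi> (x + y) = \<pi> x + \<pi> y) \<and> (\<forall>q x. \<pi> (of_rat q * x) = q * \<pi> x) \<and> \<pi> z \<noteq> 0"
proof -
  have vs: "vector_space (\<lambda>q (x::complex). of_rat q * x)"
    by unfold_locales (auto simp: algebra_simps of_rat_add of_rat_mult)
  then interpret vector_space "\<lambda>q (x::complex). of_rat q * x" .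
  show ?thesis using ex_functional_single[OF vs subspace_single_0, of z] assms by auto
qed

text \<open>Applied coordinatewise, a functional that is linear over Q commutes with rational
  matrices; complex solutions of rational linear equations thereby yield rational ones.\<close>

lemma functional_mv:
  fixes v :: "nat \<Rightarrow> complex" and \<pi> :: "complex \<Rightarrow> rat"
  assumes add: "\<And>x y. \<pi> (x + y) = \<pi> x + \<pi> y" and scale: "\<And>q x. \<pi> (of_rat q * x) = q * \<pi> x"
  shows "(\<lambda>i. \<pi> (mv m A v i)) = mv m A (\<lambda>i. \<pi> (v i))"
proof -
  have z: "\<pi> 0 = 0" using scale[of 0 0] by simp
  have "\<pi> (sum f J) = (\<Sum>j\<in>J. \<pi> (f j))" for f and J :: "nat set"
    by (induction J rule: infinite_finite_induct) (auto simp: z add)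
  then show ?thesis by (auto simp: mv_def fun_eq_iff z scale)
qed

lemma lin_op_mv: "lin_op (vscale :: 'a::field_char_0 \<Rightarrow> _) (mv m A) {x. in_space m x}"
proof -
  interpret vector_space "vscale :: 'a \<Rightarrow> _" by (rule vector_space_vscale)
  show ?thesis
    by unfold_locales (use subspace_in_space in \<open>auto simp: mv_add mv_scale in_space_mv\<close>)
qed

lemma ex_spectral_mv:
  fixes A :: "nat \<Rightarrow> nat \<Rightarrow> rat"
  obtains \<Lambda> n where "spectral vscale (mv m A) {x. in_space m x} \<Lambda> n"
    "\<And>\<alpha>. \<alpha> \<in> \<Lambda> \<Longrightarrow> \<exists>v. in_space m v \<and> v \<noteq> 0 \<and> mv m A v = vscale \<alpha> v"
proof -
  interpret lin_op "vscale :: complex \<Rightarrow> _" "mv m A" "{x. in_space m x}" by (rule lin_op_mv)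
  have "finite (unit_vec ` {..<m} :: (nat \<Rightarrow> complex) set)" "unit_vec ` {..<m} \<subseteq> {x :: nat \<Rightarrow> complex. in_space m x}"
    by (auto simp: in_space_unit_vec)
  from ex_minimal_annihilator[OF this in_space_span_unit] obtain p where p: "lead_coeff p = 1" "annih p"
    "\<And>q. annih q \<Longrightarrow> q \<noteq> 0 \<Longrightarrow> degree p \<le> degree q" by blast
  have p0: "p \<noteq> 0" using p(1) by auto
  let ?L = "{z. poly p z = 0}"
  show thesis
  proof (rule that[of ?L "Suc (degree p)"])
    show "spectral vscale (mv m A) {x. in_space m x} ?L (Suc (degree p))"
    proof unfold_locales
      show "finite ?L" by (rule poly_roots_finite[OF p0])
      have "p dvd (\<Prod>\<beta>\<in>?L. [:-\<beta>, 1:]) ^ Suc (degree p)"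
        using complex_poly_dvd_roots_power[OF p0] by (simp add: dvd_mult)
      then show "annih ((\<Prod>\<beta>\<in>?L. [:-\<beta>, 1:]) ^ Suc (degree p))"
        using p(2) papp_dvd unfolding annih_def by blast
    qed simp
    fix \<alpha> assume "\<alpha> \<in> ?L"
    then have "poly p \<alpha> = 0" by simp
    from minimal_annihilator_eigenvector[OF p(2) p0 p(3) this]
    obtain v where "v \<in> {x. in_space m x}" "v \<noteq> 0" "mv m A v = vscale \<alpha> v" by blast
    then show "\<exists>v. in_space m v \<and> v \<noteq> 0 \<and> mv m A v = vscale \<alpha> v" by blast
  qed
qed

lemma mv_bracket_complex:
  assumes "\<And>x y :: nat \<Rightarrow> rat. in_space m x \<Longrightarrow> in_space m y \<Longrightarrow> mv m A (lie_br m c x y) = lie_br m c (mv m A x) (mv m A y)"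
    and x: "in_space m x" and y: "in_space m (y :: nat \<Rightarrow> complex)"
  shows "mv m A (lie_br m c x y) = lie_br m c (mv m A x) (mv m A y)"
proof (rule bilin_ext[OF _ _ _ x y])
  have b: "bilin vscale (lie_br m c :: (nat \<Rightarrow> complex) \<Rightarrow> _)" by (rule bilin_lie_br)
  show "bilin vscale (\<lambda>x y. mv m A (lie_br m c x y) :: nat \<Rightarrow> complex)"
    using b by (simp add: bilin_def mv_add mv_scale)
  show "bilin vscale (\<lambda>x y. lie_br m c (mv m A x) (mv m A y) :: nat \<Rightarrow> complex)"
    using b by (simp add: bilin_def mv_add mv_scale)
  fix i j assume "i < m" "j < m"
  then have *: "mv m A (lie_br m c (unit_vec i) (unit_vec j)) = (lie_br m c (mv m A (unit_vec i)) (mv m A (unit_vec j)) :: nat \<Rightarrow> rat)"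
    by (intro assms(1) in_space_unit_vec)
  have "mv m A (lie_br m c (rc (unit_vec i)) (rc (unit_vec j))) = (lie_br m c (mv m A (rc (unit_vec i))) (mv m A (rc (unit_vec j))) :: nat \<Rightarrow> complex)"
    unfolding mv_rc lie_br_rc * ..
  then show "mv m A (lie_br m c (unit_vec i) (unit_vec j)) = (lie_br m c (mv m A (unit_vec i)) (mv m A (unit_vec j)) :: nat \<Rightarrow> complex)"
    by simp
qed

theorem grading_from_automorphism:
  fixes A :: "nat \<Rightarrow> nat \<Rightarrow> rat"
  assumes br: "\<And>x y :: nat \<Rightarrow> rat. in_space m x \<Longrightarrow> in_space m y \<Longrightarrow> mv m A (lie_br m c x y) = lie_br m c (mv m A x) (mv m A y)"
    and inj: "\<And>x :: nat \<Rightarrow> rat. in_space m x \<Longrightarrow> mv m A x = 0 \<Longrightarrow> x = 0"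
    and nofix: "\<And>(x :: nat \<Rightarrow> rat) N. in_space m x \<Longrightarrow> N > 0 \<Longrightarrow> (mv m A ^^ N) x = x \<Longrightarrow> x = 0"
  shows "has_very_special_grading_C m c"
proof -
  let ?T = "mv m A :: (nat \<Rightarrow> complex) \<Rightarrow> _" and ?W = "{x :: nat \<Rightarrow> complex. in_space m x}"
  obtain \<Lambda> n where sp: "spectral vscale ?T ?W \<Lambda> n"
    and ev: "\<And>\<alpha>. \<alpha> \<in> \<Lambda> \<Longrightarrow> \<exists>v. in_space m v \<and> v \<noteq> 0 \<and> mv m A v = vscale \<alpha> v"
    using ex_spectral_mv[of m A] by blast
  interpret spectral vscale ?T ?W \<Lambda> n by (rule sp)
  \<comment> \<open>For \<alpha> = 0 or a root of unity, a rational functional that is nonzero on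
    some coordinate turns the eigenvector into a nonzero rational vector that is killed by A or
    fixed by a power of A.\<close>
  have eig: "\<alpha> \<noteq> 0 \<and> (\<forall>N>0. \<alpha> ^ N \<noteq> 1)" if a: "\<alpha> \<in> \<Lambda>" for \<alpha>
  proof -
    obtain v where v: "in_space m v" "v \<noteq> 0" "?T v = vscale \<alpha> v" using ev[OF a] by blast
    then obtain j where j: "v j \<noteq> 0" by (auto simp: fun_eq_iff)
    from ex_rational_functional[OF this] obtain \<pi> :: "complex \<Rightarrow> rat" where
      pi: "\<And>x y. \<pi> (x + y) = \<pi> x + \<pi> y" "\<And>q x. \<pi> (of_rat q * x) = q * \<pi> x" "\<pi> (v j) \<noteq> 0" by blast
    have pi0: "\<pi> 0 = 0" using pi(2)[of 0 0] by simp
    define u where "u = (\<lambda>i. \<pi> (v i))"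
    have u: "in_space m u" "u \<noteq> 0" using v(1) pi pi0 by (auto simp: u_def in_space_def fun_eq_iff)
    have it: "(\<lambda>i. \<pi> ((?T ^^ N) v i)) = (mv m A ^^ N) u" for N
    proof (induction N)
      case (Suc N)
      have "(\<lambda>i. \<pi> ((?T ^^ Suc N) v i)) = mv m A (\<lambda>i. \<pi> ((?T ^^ N) v i))"
        using functional_mv[of \<pi> m A "(?T ^^ N) v"] pi by simp
      then show ?case using Suc by simp
    qed (simp add: u_def)
    have Tn: "(?T ^^ N) v = vscale (\<alpha> ^ N) v" for N
    proof (induction N)
      case (Suc N)
      have "(?T ^^ Suc N) v = ?T (vscale (\<alpha> ^ N) v)" using Suc by (simp del: vscale_apply)
      also have "\<dots> = vscale (\<alpha> ^ N) (vscale \<alpha> v)" by (simp only: mv_scale v(3))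
      finally show ?case by (simp add: fun_eq_iff)
    qed (simp add: fun_eq_iff)
    have "\<alpha> \<noteq> 0"
    proof
      assume "\<alpha> = 0"
      then have "mv m A u = 0" using it[of 1] Tn[of 1] pi0 by (auto simp: fun_eq_iff)
      then show False using inj u by blast
    qed
    moreover have "\<alpha> ^ N \<noteq> 1" if "N > 0" for N
    proof
      assume "\<alpha> ^ N = 1"
      with Tn[of N] have "(?T ^^ N) v = v" by (simp add: vscale_def)
      then have "(mv m A ^^ N) u = u" using it[of N] by (simp add: u_def)
      then show False using nofix u that by blast
    qed
    ultimately show ?thesis by blast
  qed
  obtain \<psi> :: "complex \<Rightarrow> int" where ps: "\<And>a. a \<in> \<Lambda> \<Longrightarrow> \<psi> a \<noteq> 0"
    "\<And>a b. a \<in> \<Lambda> \<Longrightarrow> b \<in> \<Lambda> \<Longrightarrow> a * b \<in> \<Lambda> \<Longrightarrow> \<psi> (a * b) = \<psi> a + \<psi> b"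
    using ex_multiplicative_character[OF finite_X] eig by metis
  \<comment> \<open>This is the sum of the generalized eigenspaces with \<psi> \<alpha> = k.
    Describing it by the vanishing of the other projections makes uniqueness of decompositions a
    computation with \<open>E\<close>.\<close>
  define V where "V k = {v \<in> ?W. \<forall>\<alpha>\<in>\<Lambda>. \<psi> \<alpha> \<noteq> k \<longrightarrow> E \<alpha> v = 0}" for k
  have Vsub: "complex_subspace m (V k)" for k
    unfolding complex_subspace_def vadd_plus zero_fun_def[symmetric]
    by (auto simp: V_def E_add E_scale in_space_def)
  have decomp: "v = (\<Sum>\<alpha>\<in>{\<alpha>\<in>\<Lambda>. \<psi> \<alpha> = k}. E \<alpha> v)" if "v \<in> V k" for v k
  proof -
    have "v = (\<Sum>\<alpha>\<in>\<Lambda>. E \<alpha> v)" using E_complete that by (simp add: V_def)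
    also have "\<dots> = (\<Sum>\<alpha>\<in>{\<alpha>\<in>\<Lambda>. \<psi> \<alpha> = k}. E \<alpha> v)"
      using that finite_X by (intro sum.mono_neutral_right) (auto simp: V_def)
    finally show ?thesis .
  qed
  have ex1: "\<exists>!f::int \<Rightarrow> nat \<Rightarrow> complex. finite {k. f k \<noteq> (\<lambda>_. 0)} \<and> (\<forall>k. f k \<in> V k) \<and>
             x = (\<lambda>i. \<Sum>k\<in>{k. f k \<noteq> (\<lambda>_. 0)}. f k i)" if x: "in_space m x" for x
  proof -
    define f where "f k = (\<Sum>\<alpha>\<in>{\<alpha>\<in>\<Lambda>. \<psi> \<alpha> = k}. E \<alpha> x)" for k
    have supp: "{k. f k \<noteq> 0} \<subseteq> \<psi> ` \<Lambda>"
    proof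
      fix k assume "k \<in> {k. f k \<noteq> 0}"
      then have "{\<alpha>\<in>\<Lambda>. \<psi> \<alpha> = k} \<noteq> {}" unfolding f_def by force
      then show "k \<in> \<psi> ` \<Lambda>" by auto
    qed
    have fin: "finite {k. f k \<noteq> 0}" using finite_subset[OF supp] finite_X by auto
    have fV: "f k \<in> V k" for k
    proof -
      have "E \<beta> (f k) = 0" if b: "\<beta> \<in> \<Lambda>" "\<psi> \<beta> \<noteq> k" for \<beta>
        unfolding f_def E_sum using b x by (intro sum.neutral) (auto intro!: E_orth)
      moreover have "f k \<in> ?W" unfolding f_def using x E_W by (intro subspace_sum[OF subspace_W]) auto
      ultimately show ?thesis by (auto simp: V_def)
    qed
    have "x = (\<Sum>\<alpha>\<in>\<Lambda>. E \<alpha> x)" using E_complete x by simp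
    also have "\<dots> = (\<Sum>k\<in>\<psi> ` \<Lambda>. f k)" unfolding f_def by (rule sum.image_gen[OF finite_X])
    also have "\<dots> = (\<Sum>k\<in>{k. f k \<noteq> 0}. f k)"
      using supp finite_X by (intro sum.mono_neutral_right) auto
    finally have xf: "x = (\<Sum>k\<in>{k. f k \<noteq> 0}. f k)" .
    have uniq: "g = f" if g: "finite {k. g k \<noteq> 0}" "\<forall>k. g k \<in> V k" "x = (\<Sum>k\<in>{k. g k \<noteq> 0}. g k)" for g
    proof
      fix k
      have Ex: "E \<alpha> x = E \<alpha> (g (\<psi> \<alpha>))" if a: "\<alpha> \<in> \<Lambda>" for \<alpha>
      proof -
        have "E \<alpha> x = (\<Sum>k\<in>{k. g k \<noteq> 0}. E \<alpha> (g k))" by (subst g(3)) (rule E_sum)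
        also have "\<dots> = (\<Sum>k\<in>{k. g k \<noteq> 0}. if k = \<psi> \<alpha> then E \<alpha> (g k) else 0)"
          using g(2) a by (intro sum.cong) (auto simp: V_def)
        also have "\<dots> = E \<alpha> (g (\<psi> \<alpha>))" using g(1) by (simp add: sum.delta')
        finally show ?thesis .
      qed
      have "g k = (\<Sum>\<alpha>\<in>{\<alpha>\<in>\<Lambda>. \<psi> \<alpha> = k}. E \<alpha> (g k))" using decomp g(2) by blast
      also have "\<dots> = f k" unfolding f_def by (intro sum.cong) (auto simp: Ex)
      finally show "g k = f k" .
    qed
    have cv: "(\<lambda>i. \<Sum>k\<in>{k. g k \<noteq> 0}. g k i) = (\<Sum>k\<in>{k. g k \<noteq> 0}. g k)" for g :: "int \<Rightarrow> nat \<Rightarrow> complex"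
      by (auto simp: fun_eq_iff sum_fun_apply)
    show ?thesis unfolding zero_fun_def[symmetric] cv
      by (rule ex1I[of _ f]) (use fin fV xf uniq in blast)+
  qed
  have brV: "lie_br m c x y \<in> V (k + l)" if x: "x \<in> V k" and y: "y \<in> V l" for x y k l
  proof -
    have b: "bilin vscale (lie_br m c :: (nat \<Rightarrow> complex) \<Rightarrow> _)" by (rule bilin_lie_br)
    note z = bilin_zero[OF b]
    have xW: "x \<in> ?W" and yW: "y \<in> ?W" using x y by (auto simp: V_def)
    have "E \<rho> (lie_br m c x y) = 0" if r: "\<rho> \<in> \<Lambda>" "\<psi> \<rho> \<noteq> k + l" for \<rho>
    proof -
      have "lie_br m c x y = lie_br m c (\<Sum>\<alpha>\<in>{\<alpha>\<in>\<Lambda>. \<psi> \<alpha> = k}. E \<alpha> x) (\<Sum>\<beta>\<in>{\<beta>\<in>\<Lambda>. \<psi> \<beta> = l}. E \<beta> y)"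
        using decomp[OF x] decomp[OF y] by simp
      also have "\<dots> = (\<Sum>\<alpha>\<in>{\<alpha>\<in>\<Lambda>. \<psi> \<alpha> = k}. \<Sum>\<beta>\<in>{\<beta>\<in>\<Lambda>. \<psi> \<beta> = l}. lie_br m c (E \<alpha> x) (E \<beta> y))"
        by (subst bilin_sum(1)[OF b z]) (simp only: bilin_sum(2)[OF b z])
      finally have "E \<rho> (lie_br m c x y) = (\<Sum>\<alpha>\<in>{\<alpha>\<in>\<Lambda>. \<psi> \<alpha> = k}. \<Sum>\<beta>\<in>{\<beta>\<in>\<Lambda>. \<psi> \<beta> = l}. E \<rho> (lie_br m c (E \<alpha> x) (E \<beta> y)))"
        by (simp only: E_sum)
      also have "\<dots> = 0"
      proof (intro sum.neutral ballI)
        fix \<alpha> \<beta> assume a: "\<alpha> \<in> {\<alpha>\<in>\<Lambda>. \<psi> \<alpha> = k}" and b': "\<beta> \<in> {\<beta>\<in>\<Lambda>. \<psi> \<beta> = l}"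
        have W: "E \<alpha> x \<in> ?W" "E \<beta> y \<in> ?W" using E_W[OF xW] E_W[OF yW] by auto
        have "papp ([:-(\<alpha> * \<beta>), 1:] ^ (n + n)) (lie_br m c (E \<alpha> x) (E \<beta> y)) = 0"
        proof (rule gen_eigen_mult[OF b z])
          show "mv m A (lie_br m c x y) = lie_br m c (mv m A x) (mv m A y)" if "x \<in> ?W" "y \<in> ?W" for x y
            using mv_bracket_complex[OF br] that by simp
        qed (use W a b' xW yW E_gen_eigen in auto)
        \<comment> \<open>Equality would put \<alpha> \<beta> into \<Lambda>, where \<psi> is
          additive, and force \<psi> \<rho> = k + l. If the product is not an eigenvalue, every
          projection kills the bracket.\<close>
        moreover have "\<rho> \<noteq> \<alpha> * \<beta>" using ps(2)[of \<alpha> \<beta>] a b' r by auto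
        moreover have "lie_br m c (E \<alpha> x) (E \<beta> y) \<in> ?W" by (simp add: in_space_lie_br)
        ultimately show "E \<rho> (lie_br m c (E \<alpha> x) (E \<beta> y)) = 0" using E_other r(1) by blast
      qed
      finally show ?thesis .
    qed
    then show ?thesis by (auto simp: V_def in_space_lie_br)
  qed
  have V0: "V 0 = {\<lambda>_. 0}"
  proof -
    have "v = 0" if "v \<in> V 0" for v
    proof -
      have "{\<alpha>\<in>\<Lambda>. \<psi> \<alpha> = 0} = {}" using ps(1) by auto
      then show ?thesis using decomp[OF that] by (simp only: sum.empty)
    qed
    moreover have "0 \<in> V 0" using Vsub[of 0] by (simp add: complex_subspace_def zero_fun_def)
    ultimately have "V 0 = {0}" by auto
    then show ?thesis by (simp add: zero_fun_def)
  qed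
  have "is_grading_C m c V" unfolding is_grading_C_def using Vsub ex1 brV by blast
  with V0 show ?thesis unfolding has_very_special_grading_C_def by blast
qed

section \<open>From a free self-similar action to an automorphism\<close>

lemma wcons_in_words: "a < d \<Longrightarrow> w \<in> inf_words d \<Longrightarrow> wcons a w \<in> inf_words d"
  by (auto simp: inf_words_def wcons_def)

lemma wcons_split: "w \<in> inf_words d \<Longrightarrow> w = wcons (w 0) (\<lambda>i. w (Suc i)) \<and> w 0 < d \<and> (\<lambda>i. w (Suc i)) \<in> inf_words d"
  by (auto simp: inf_words_def wcons_def fun_eq_iff)

lemma wcons_inject [simp]: "wcons a w = wcons b v \<longleftrightarrow> a = b \<and> w = v"
proof
  assume *: "wcons a w = wcons b v"
  then have "wcons a w 0 = wcons b v 0" "wcons a w (Suc i) = wcons b v (Suc i)" for i by simp_all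
  then show "a = b \<and> w = v" by (auto simp: wcons_def fun_eq_iff)
qed simp

lemma wcons_simps [simp]: "wcons a w 0 = a" "wcons a w (Suc i) = w i"
  by (auto simp: wcons_def)

locale free_self_similar = group G for G :: "('g, 'b) monoid_scheme" (structure) +
  fixes d :: nat and \<phi> :: "'g \<Rightarrow> (nat \<Rightarrow> nat) \<Rightarrow> nat \<Rightarrow> nat"
  assumes d1: "d \<ge> 1" and ss: "self_similar_action G d \<phi>" and free: "free_action G d \<phi>"
begin

sublocale act: group_action G "inf_words d" \<phi>
  using ss by (simp add: self_similar_action_def)

abbreviation "zw \<equiv> (\<lambda>_. 0) :: nat \<Rightarrow> nat"

lemma zw: "zw \<in> inf_words d"
  using d1 by (auto simp: inf_words_def)

lemma act_closed: "g \<in> carrier G \<Longrightarrow> w \<in> inf_words d \<Longrightarrow> \<phi> g w \<in> inf_words d"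
  using act.element_image by blast

lemma act_one: "w \<in> inf_words d \<Longrightarrow> \<phi> \<one> w = w"
  using act.id_eq_one by (metis restrict_apply')

lemma act_mult: "g \<in> carrier G \<Longrightarrow> h \<in> carrier G \<Longrightarrow> w \<in> inf_words d \<Longrightarrow> \<phi> (g \<otimes> h) w = \<phi> g (\<phi> h w)"
  using act.composition_rule by blast

lemma act_inv: "g \<in> carrier G \<Longrightarrow> w \<in> inf_words d \<Longrightarrow> \<phi> (inv g) (\<phi> g w) = w"
  using act_mult[of "inv g" g w] by (simp add: act_one)

lemma act_inv': "g \<in> carrier G \<Longrightarrow> w \<in> inf_words d \<Longrightarrow> \<phi> g (\<phi> (inv g) w) = w"
  using act_mult[of g "inv g" w] by (simp add: act_one)

lemma fixed_imp_one: "g \<in> carrier G \<Longrightarrow> w \<in> inf_words d \<Longrightarrow> \<phi> g w = w \<Longrightarrow> g = \<one>"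
  using free unfolding free_action_def by blast

lemma agree_imp_eq:
  assumes "g \<in> carrier G" "h \<in> carrier G" "w \<in> inf_words d" "\<phi> g w = \<phi> h w"
  shows "g = h"
proof -
  have "\<phi> (inv h \<otimes> g) w = w" using assms by (simp add: act_mult act_inv)
  then have "inv h \<otimes> g = \<one>" using assms by (intro fixed_imp_one[of _ w]) auto
  then show ?thesis using assms by (metis inv_closed inv_equality inv_inv)
qed

lemma section_exists:
  assumes "g \<in> carrier G" "a < d"
  obtains h b where "h \<in> carrier G" "b < d" "\<And>w. w \<in> inf_words d \<Longrightarrow> \<phi> g (wcons a w) = wcons b (\<phi> h w)"
  using ss assms unfolding self_similar_action_def by blast

lemma first_letter:
  assumes "g \<in> carrier G" "x \<in> inf_words d" "y \<in> inf_words d" "x 0 = y 0"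
  shows "\<phi> g x 0 = \<phi> g y 0"
proof -
  note x = wcons_split[OF assms(2)] and y = wcons_split[OF assms(3)]
  obtain h b where hb: "h \<in> carrier G" "b < d" "\<And>w. w \<in> inf_words d \<Longrightarrow> \<phi> g (wcons (x 0) w) = wcons b (\<phi> h w)"
    using section_exists[OF assms(1), of "x 0"] x by metis
  have "\<phi> g x 0 = b" using hb(3)[of "\<lambda>i. x (Suc i)"] x by (metis wcons_simps(1))
  moreover have "\<phi> g y 0 = b" using hb(3)[of "\<lambda>i. y (Suc i)"] y assms(4) by (metis wcons_simps(1))
  ultimately show ?thesis by simp
qed

text \<open>\<open>Stab\<close> is the stabilizer of the cylinder of the letter 0, which exists
  because d \<ge> 1. The section \<open>sec\<close> at this letter is the virtual endomorphism of
  the action.\<close>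

definition "Stab = {g \<in> carrier G. \<exists>h\<in>carrier G. \<forall>w\<in>inf_words d. \<phi> g (wcons 0 w) = wcons 0 (\<phi> h w)}"

definition "sec g = (SOME h. h \<in> carrier G \<and> (\<forall>w\<in>inf_words d. \<phi> g (wcons 0 w) = wcons 0 (\<phi> h w)))"

lemma sec: "g \<in> Stab \<Longrightarrow> sec g \<in> carrier G"
  and act_sec: "g \<in> Stab \<Longrightarrow> w \<in> inf_words d \<Longrightarrow> \<phi> g (wcons 0 w) = wcons 0 (\<phi> (sec g) w)"
proof -
  have *: "sec g \<in> carrier G \<and> (\<forall>w\<in>inf_words d. \<phi> g (wcons 0 w) = wcons 0 (\<phi> (sec g) w))" if "g \<in> Stab" for g
    unfolding sec_def by (rule someI_ex) (use that in \<open>auto simp: Stab_def\<close>)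
  show "g \<in> Stab \<Longrightarrow> sec g \<in> carrier G" using * by blast
  show "g \<in> Stab \<Longrightarrow> w \<in> inf_words d \<Longrightarrow> \<phi> g (wcons 0 w) = wcons 0 (\<phi> (sec g) w)" using * by blast
qed

lemma Stab_carrier: "g \<in> Stab \<Longrightarrow> g \<in> carrier G"
  by (simp add: Stab_def)

lemma StabI: "g \<in> carrier G \<Longrightarrow> h \<in> carrier G \<Longrightarrow> (\<And>w. w \<in> inf_words d \<Longrightarrow> \<phi> g (wcons 0 w) = wcons 0 (\<phi> h w)) \<Longrightarrow> g \<in> Stab"
  by (auto simp: Stab_def)

lemma wcons0: "w \<in> inf_words d \<Longrightarrow> wcons 0 w \<in> inf_words d"
  using d1 by (intro wcons_in_words) auto

lemma subgroup_Stab: "subgroup Stab G"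
proof (rule subgroupI)
  show "Stab \<subseteq> carrier G" by (auto simp: Stab_def)
  have "\<one> \<in> Stab" by (rule StabI[of _ \<one>]) (auto simp: act_one wcons0)
  then show "Stab \<noteq> {}" by blast
  fix g assume g: "g \<in> Stab"
  show "inv g \<in> Stab"
  proof (rule StabI[of _ "inv (sec g)"])
    fix w assume w: "w \<in> inf_words d"
    let ?v = "\<phi> (inv (sec g)) w"
    have v: "?v \<in> inf_words d" using g w sec by (auto intro: act_closed)
    have "\<phi> g (wcons 0 ?v) = wcons 0 w" using act_sec[OF g v] act_inv'[OF sec[OF g] w] by simp
    then show "\<phi> (inv g) (wcons 0 w) = wcons 0 ?v"
      using act_inv[OF Stab_carrier[OF g] wcons0[OF v]] by simp
  qed (use g sec Stab_carrier in auto)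
  fix h assume h: "h \<in> Stab"
  show "g \<otimes> h \<in> Stab"
  proof (rule StabI[of _ "sec g \<otimes> sec h"])
    fix w assume w: "w \<in> inf_words d"
    have "\<phi> (sec h) w \<in> inf_words d" using sec[OF h] w by (rule act_closed)
    then show "\<phi> (g \<otimes> h) (wcons 0 w) = wcons 0 (\<phi> (sec g \<otimes> sec h) w)"
      using g h w by (simp add: act_mult Stab_carrier wcons0 act_sec sec)
  qed (use g h sec Stab_carrier in auto)
qed

text \<open>Elements of a free action that agree on one word are equal. So sections are unique, and
  the choice made in \<open>sec\<close> is multiplicative.\<close>

lemma sec_mult:
  assumes g: "g \<in> Stab" and h: "h \<in> Stab" shows "sec (g \<otimes> h) = sec g \<otimes> sec h"
proof (rule agree_imp_eq[OF _ _ zw])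
  have gh: "g \<otimes> h \<in> Stab" using subgroup.m_closed[OF subgroup_Stab g h] .
  show "sec (g \<otimes> h) \<in> carrier G" by (rule sec[OF gh])
  show "sec g \<otimes> sec h \<in> carrier G" using g h sec by auto
  have "\<phi> (sec h) zw \<in> inf_words d" using sec[OF h] zw by (rule act_closed)
  then have "wcons 0 (\<phi> (sec (g \<otimes> h)) zw) = wcons 0 (\<phi> (sec g \<otimes> sec h) zw)"
    using g h zw act_sec[OF gh zw] by (simp add: act_mult Stab_carrier wcons0 act_sec sec)
  then show "\<phi> (sec (g \<otimes> h)) zw = \<phi> (sec g \<otimes> sec h) zw" by simp
qed

lemma sec_inj: "inj_on sec Stab"
proof (rule inj_onI)
  fix g h assume g: "g \<in> Stab" and h: "h \<in> Stab" and eq: "sec g = sec h"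
  then have "\<phi> g (wcons 0 zw) = \<phi> h (wcons 0 zw)" using act_sec zw by simp
  then show "g = h" using g h by (intro agree_imp_eq[of g h "wcons 0 zw"]) (auto simp: Stab_carrier wcons0 zw)
qed

lemma first_letter_zero_Stab:
  assumes "g \<in> carrier G" "\<phi> g zw 0 = 0" shows "g \<in> Stab"
proof -
  obtain h b where hb: "h \<in> carrier G" "b < d" "\<And>w. w \<in> inf_words d \<Longrightarrow> \<phi> g (wcons 0 w) = wcons b (\<phi> h w)"
    using section_exists[OF assms(1), of 0] d1 by auto
  have "zw = wcons 0 zw" by (auto simp: wcons_def)
  then have "b = 0" using hb(3)[OF zw] assms(2) by (metis wcons_simps(1))
  with hb assms show ?thesis by (intro StabI) auto
qed

text \<open>Pigeonhole on the first letter of the images of the zero word under the powers of g: if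
  it coincides for g^i and g^k, then g^(k-i) preserves the first letter 0.\<close>

lemma power_in_Stab:
  assumes g: "g \<in> carrier G" shows "\<exists>j>0. g [^] (j::nat) \<in> Stab"
proof -
  let ?b = "\<lambda>n::nat. \<phi> (g [^] n) zw 0"
  have "?b n < d" for n using act_closed[of "g [^] n" zw] g zw by (auto simp: inf_words_def)
  then have "\<not> inj ?b" using finite_subset[of "range ?b" "{..<d}"] finite_imageD[of ?b UNIV] by blast
  then obtain i k where ik: "i < k" "?b i = ?b k" by (auto simp: inj_def) (metis linorder_neqE_nat)
  define u where "u = \<phi> (g [^] (k - i)) zw"
  have u: "u \<in> inf_words d" unfolding u_def using g zw by (intro act_closed) auto
  have gi: "g [^] i \<in> carrier G" using g by simp
  have "\<phi> (g [^] i) u = \<phi> (g [^] k) zw"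
    using ik g zw by (simp add: u_def nat_pow_mult flip: act_mult)
  with ik(2) have "\<phi> (g [^] i) u 0 = \<phi> (g [^] i) zw 0" by simp
  then have "\<phi> (inv (g [^] i)) (\<phi> (g [^] i) u) 0 = \<phi> (inv (g [^] i)) (\<phi> (g [^] i) zw) 0"
    using gi u zw by (intro first_letter[of _ "\<phi> (g [^] i) u"] act_closed inv_closed)
  then have "u 0 = 0" by (simp only: act_inv[OF gi u] act_inv[OF gi zw])
  then have "g [^] (k - i) \<in> Stab" unfolding u_def using g by (intro first_letter_zero_Stab) auto
  with ik show ?thesis by (intro exI[of _ "k - i"]) auto
qed

text \<open>If all iterated sections exist along the letter 0, the element fixes the word of
  zeros.\<close>

lemma sec_orbit_trivial:
  assumes "\<And>i::nat. \<gamma> i \<in> Stab" "\<And>i. sec (\<gamma> i) = \<gamma> (Suc i)"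
  shows "\<gamma> 0 = \<one>"
proof -
  have z: "zw = wcons 0 zw" by (auto simp: wcons_def)
  have step: "\<phi> (\<gamma> i) zw = wcons 0 (\<phi> (\<gamma> (Suc i)) zw)" for i
    using act_sec[OF assms(1) zw, of i] assms(2) z by simp
  have "\<phi> (\<gamma> i) zw k = 0" for i k
    by (induction k arbitrary: i) (use step in \<open>metis wcons_simps\<close>)+
  then have "\<phi> (\<gamma> 0) zw = zw" by auto
  then show ?thesis using zw Stab_carrier[OF assms(1)] by (intro fixed_imp_one)
qed

end

section \<open>From a free self-similar action to a grading\<close>

lemma malcev_embedding:
  assumes "group G" "malcev_lie_algebra G m c"
  obtains \<iota> where "malcev_hom vscale (lie_br m c) (m + 1) G \<iota>" "inj_on \<iota> (carrier G)"
    "\<And>g. g \<in> carrier G \<Longrightarrow> in_space m (\<iota> g)"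
    "nilpotent_lie.lie_hull vscale (lie_br m c) (\<iota> ` carrier G) = {x. in_space m x}" "fin_gen_group G"
proof -
  have L: "is_lie_algebra m c" "is_nilpotent_lie m c" using assms(2) by (auto simp: malcev_lie_algebra_def)
  obtain \<iota> where i: "\<And>g. g \<in> carrier G \<Longrightarrow> in_space m (\<iota> g)" "inj_on \<iota> (carrier G)"
    "\<And>g h. g \<in> carrier G \<Longrightarrow> h \<in> carrier G \<Longrightarrow> \<iota> (g \<otimes>\<^bsub>G\<^esub> h) = ch_product m c (\<iota> g) (\<iota> h)"
    "fin_gen_group G" "lie_subalgebra_generated_is_all m c (\<iota> ` carrier G)"
    using assms(2) unfolding malcev_lie_algebra_def by blast
  show thesis
  proof (rule that[OF _ i(2,1) _ i(4)])
    show "malcev_hom vscale (lie_br m c) (m + 1) G \<iota>"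
      using i(3) ch_product_chp[OF L]
      by (intro malcev_hom.intro malcev_hom_axioms.intro nilpotent_lie_coord L assms(1)) simp
    show "nilpotent_lie.lie_hull vscale (lie_br m c) (\<iota> ` carrier G) = {x. in_space m x}"
      using i by (intro lie_hull_coord L) auto
  qed
qed

theorem self_similar_imp_grading:
  assumes G: "group G" and mal: "malcev_lie_algebra G m c" and fs: "freely_self_similar G"
  shows "has_very_special_grading_C m c"
proof -
  obtain d \<phi> where "d \<ge> 1" "self_similar_action G d \<phi>" "free_action G d \<phi>"
    using fs by (auto simp: freely_self_similar_def)
  then interpret A: free_self_similar G d \<phi>
    by (intro free_self_similar.intro free_self_similar_axioms.intro G)
  obtain \<iota> where mh: "malcev_hom vscale (lie_br m c) (m + 1) G \<iota>" and inj: "inj_on \<iota> (carrier G)"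
    and "\<And>g. g \<in> carrier G \<Longrightarrow> in_space m (\<iota> g)"
    and hull: "nilpotent_lie.lie_hull vscale (lie_br m c) (\<iota> ` carrier G) = {x. in_space m x}"
    using malcev_embedding[OF G mal] by metis
  interpret M: malcev_hom vscale "lie_br m c" "m + 1" G \<iota> by (rule mh)
  note rigid = M.rigidity[OF inj A.subgroup_Stab, of A.sec, unfolded hull]
  obtain F where F: "\<forall>x\<in>{x. in_space m x}. F x \<in> {x. in_space m x}"
    "\<forall>x\<in>{x. in_space m x}. \<forall>y\<in>{x. in_space m x}. F (x + y) = F x + F y"
    "\<forall>a. \<forall>x\<in>{x. in_space m x}. F (vscale a x) = vscale a (F x)"
    "\<forall>x\<in>{x. in_space m x}. \<forall>y\<in>{x. in_space m x}. F (lie_br m c x y) = lie_br m c (F x) (F y)"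
    "\<forall>x\<in>{x. in_space m x}. F x = 0 \<longrightarrow> x = 0" "\<forall>s\<in>A.Stab. F (\<iota> s) = \<iota> (A.sec s)"
    "\<forall>x\<in>{x. in_space m x}. \<exists>M>0. vscale (of_int M) x \<in> \<iota> ` A.Stab"
    by (rule exE[OF rigid], erule A.power_in_Stab, erule A.sec, erule (1) A.sec_mult, rule A.sec_inj,
        elim conjE, rule that)
  define B where "B = (\<lambda>i j. F (unit_vec j) i)"
  have FB: "F x = mv m B x" if "in_space m x" for x
    unfolding B_def by (rule mv_of_linear[OF _ _ _ that]) (use F in blast)+
  show ?thesis
  proof (rule grading_from_automorphism[of m B])
    fix x y :: "nat \<Rightarrow> rat" assume "in_space m x" "in_space m y"
    then show "mv m B (lie_br m c x y) = lie_br m c (mv m B x) (mv m B y)"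
      using F(4) by (simp flip: FB add: in_space_lie_br)
  next
    fix x :: "nat \<Rightarrow> rat" assume "in_space m x" "mv m B x = 0"
    then show "x = 0" using F(5) by (simp flip: FB)
  next
    fix x :: "nat \<Rightarrow> rat" and N :: nat assume x: "in_space m x" and N: "N > 0" and per: "(mv m B ^^ N) x = x"
    let ?y = "\<lambda>i. (mv m B ^^ i) x"
    have ysp: "in_space m (?y i)" for i by (cases i) (auto simp: x in_space_mv)
    have "\<forall>i. \<exists>M::int. M > 0 \<and> vscale (of_int M) (?y i) \<in> \<iota> ` A.Stab" using F(7) ysp by blast
    then obtain Mi :: "nat \<Rightarrow> int" where Mi: "\<And>i. Mi i > 0" "\<And>i. vscale (of_int (Mi i)) (?y i) \<in> \<iota> ` A.Stab" by metis
    \<comment> \<open>One multiplier for a whole period, the product of the individual ones.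
      Periodicity then brings the multiples of all iterates into the image of the
      stabilizer.\<close>
    define M where "M = (\<Prod>i<N. Mi i)"
    have M0: "M > 0" unfolding M_def using Mi by (intro prod_pos) auto
    have pc: "s [^]\<^bsub>G\<^esub> (k::nat) \<in> A.Stab" if "s \<in> A.Stab" for s k
      by (induction k) (use that A.subgroup_Stab in \<open>auto simp: subgroup.one_closed subgroup.m_closed\<close>)
    have Mlt: "vscale (of_int M) (?y i) \<in> \<iota> ` A.Stab" if "i < N" for i
    proof -
      obtain s where s: "s \<in> A.Stab" "vscale (of_int (Mi i)) (?y i) = \<iota> s" using Mi(2)[of i] by auto
      have "M = Mi i * (\<Prod>j\<in>{..<N} - {i}. Mi j)" unfolding M_def using that by (intro prod.remove) auto
      moreover have "(\<Prod>j\<in>{..<N} - {i}. Mi j) > 0" using Mi by (intro prod_pos) auto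
      ultimately obtain k :: nat where k: "M = Mi i * int k" by (metis zero_less_imp_eq_int)
      have "vscale (of_int M) (?y i) = vscale (of_nat k) (vscale (of_int (Mi i)) (?y i))"
        unfolding k by (simp add: fun_eq_iff)
      also have "\<dots> = \<iota> (s [^]\<^bsub>G\<^esub> k)" using s M.iota_pow A.Stab_carrier by simp
      finally show ?thesis using pc[OF s(1)] by auto
    qed
    have ym: "?y (i mod N) = ?y i" for i using per by (rule funpow_mod_eq)
    have "vscale (of_int M) (?y i) \<in> \<iota> ` A.Stab" for i
      using Mlt[of "i mod N"] N unfolding ym by simp
    then have "\<forall>i. \<exists>s. s \<in> A.Stab \<and> vscale (of_int M) (?y i) = \<iota> s" by blast
    then obtain \<gamma> where g: "\<And>i. \<gamma> i \<in> A.Stab" "\<And>i. vscale (of_int M) (?y i) = \<iota> (\<gamma> i)" by metis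
    have "A.sec (\<gamma> i) = \<gamma> (Suc i)" for i
    proof (rule inj_onD[OF inj])
      have "\<iota> (A.sec (\<gamma> i)) = F (vscale (of_int M) (?y i))" unfolding g(2) using F(6) g(1) by metis
      also have "\<dots> = vscale (of_int M) (F (?y i))" using F(3) ysp by blast
      also have "\<dots> = vscale (of_int M) (?y (Suc i))" unfolding FB[OF ysp] by simp
      finally show "\<iota> (A.sec (\<gamma> i)) = \<iota> (\<gamma> (Suc i))" unfolding g(2) .
    qed (use g A.sec A.Stab_carrier in auto)
    then have "\<gamma> 0 = \<one>\<^bsub>G\<^esub>" by (intro A.sec_orbit_trivial g)
    then have "vscale (of_int M) (?y 0) = 0" unfolding g(2) by (simp only: M.iota_one)
    then show "x = 0" using M0 by (auto simp: fun_eq_iff)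
  qed
qed

section \<open>Algebraic numbers behind rational automorphisms\<close>

section \<open>Number fields inside the complex numbers\<close>

abbreviation ratsc :: "rat \<Rightarrow> complex \<Rightarrow> complex" where
  "ratsc q z \<equiv> of_rat q * z"

interpretation QC: rational_space ratsc
  by unfold_locales (auto simp: algebra_simps of_rat_add of_rat_mult)

definition subring_C :: "complex set \<Rightarrow> bool" where
  "subring_C K \<longleftrightarrow> (\<forall>q. of_rat q \<in> K) \<and> (\<forall>x\<in>K. \<forall>y\<in>K. x + y \<in> K \<and> x * y \<in> K)"

definition subfield_C :: "complex set \<Rightarrow> bool" where
  "subfield_C K \<longleftrightarrow> subring_C K \<and> (\<forall>x\<in>K. inverse x \<in> K)"

definition fdQ :: "complex set \<Rightarrow> bool" where
  "fdQ K \<longleftrightarrow> (\<exists>B. finite B \<and> K \<subseteq> QC.span B)"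

lemma subring_add: "subring_C K \<Longrightarrow> x \<in> K \<Longrightarrow> y \<in> K \<Longrightarrow> x + y \<in> K"
  and subring_mult: "subring_C K \<Longrightarrow> x \<in> K \<Longrightarrow> y \<in> K \<Longrightarrow> x * y \<in> K"
  and subring_rat: "subring_C K \<Longrightarrow> of_rat r \<in> K"
  by (auto simp: subring_C_def)

lemma subring_0: "subring_C K \<Longrightarrow> 0 \<in> K"
  and subring_1: "subring_C K \<Longrightarrow> 1 \<in> K"
  and subring_int: "subring_C K \<Longrightarrow> of_int i \<in> K"
  using subring_rat[of K 0] subring_rat[of K 1] subring_rat[of K "of_int i"] by auto

lemma subring_uminus: "subring_C K \<Longrightarrow> x \<in> K \<Longrightarrow> - x \<in> K"
  using subring_mult[of K "of_rat (-1)" x] subring_rat[of K "-1"] by (simp add: of_rat_minus)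

lemma subring_diff: "subring_C K \<Longrightarrow> x \<in> K \<Longrightarrow> y \<in> K \<Longrightarrow> x - y \<in> K"
  using subring_add[of K x "- y"] subring_uminus[of K y] by simp

lemma subring_sum: "subring_C K \<Longrightarrow> (\<And>i. i \<in> J \<Longrightarrow> f i \<in> K) \<Longrightarrow> sum f J \<in> K"
  by (induction J rule: infinite_finite_induct) (auto simp: subring_0 subring_add)

lemma subring_prod: "subring_C K \<Longrightarrow> (\<And>i. i \<in> J \<Longrightarrow> f i \<in> K) \<Longrightarrow> prod f J \<in> K"
  by (induction J rule: infinite_finite_induct) (auto simp: subring_1 subring_mult)

lemma subring_power: "subring_C K \<Longrightarrow> x \<in> K \<Longrightarrow> x ^ n \<in> K"
  by (induction n) (auto simp: subring_1 subring_mult)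

lemma subfield_ring: "subfield_C K \<Longrightarrow> subring_C K"
  by (simp add: subfield_C_def)

lemma subfield_divide: "subfield_C K \<Longrightarrow> x \<in> K \<Longrightarrow> y \<in> K \<Longrightarrow> x / y \<in> K"
  unfolding divide_inverse by (auto simp: subfield_C_def subring_mult)

lemma subspace_subring: "subring_C K \<Longrightarrow> QC.subspace K"
  by (rule QC.subspaceI) (auto simp: subring_0 subring_add subring_mult subring_rat)

lemma fdQ_basis:
  assumes "fdQ K" shows "\<exists>B. finite B \<and> B \<subseteq> K \<and> K \<subseteq> QC.span B"
proof -
  obtain B0 where B0: "finite B0" "K \<subseteq> QC.span B0" using assms by (auto simp: fdQ_def)
  obtain B where B: "B \<subseteq> K" "QC.independent B" "K \<subseteq> QC.span B"
    using QC.maximal_independent_subset[of K] by blast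
  have "B \<subseteq> QC.span B0" using B(1) B0(2) by blast
  then have "finite B" using QC.independent_span_bound[OF B0(1) B(2)] by blast
  with B show ?thesis by blast
qed

text \<open>Multiplication by a nonzero x is injective, so its minimal polynomial has a nonzero
  constant coefficient; solving for that coefficient expresses the inverse of x as a polynomial in
  x.\<close>

lemma fd_subring_subfield:
  assumes K: "subring_C K" and fd: "fdQ K"
  shows "subfield_C K"
  unfolding subfield_C_def
proof (intro conjI ballI K)
  fix x assume x: "x \<in> K"
  show "inverse x \<in> K"
  proof (cases "x = 0")
    case False
    interpret lin_op ratsc "\<lambda>y. x * y" K
      by unfold_locales (use subspace_subring[OF K] K x in \<open>auto simp: algebra_simps subring_mult\<close>)
    obtain B where B: "finite B" "B \<subseteq> K" "K \<subseteq> QC.span B" using fdQ_basis[OF fd] by blast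
    obtain p where p: "lead_coeff p = 1" "annih p" "\<And>q. annih q \<Longrightarrow> q \<noteq> 0 \<Longrightarrow> degree p \<le> degree q"
      by (rule ex_minimal_annihilator[OF B]) blast
    obtain a r where pr: "p = pCons a r" by (cases p)
    have 1: "1 \<in> K" by (rule subring_1[OF K])
    have a: "a \<noteq> 0"
    proof
      assume a0: "a = 0"
      then have "annih r" using p(2) False by (simp add: pr annih_def)
      moreover have "r \<noteq> 0" using p(1) a0 pr by auto
      ultimately show False using p(3)[of r] pr by simp
    qed
    let ?y = "papp r 1"
    have "of_rat a + x * ?y = 0" using bspec[OF p(2)[unfolded annih_def] 1] by (simp add: pr)
    then have "x * (of_rat (- 1 / a) * ?y) = 1"
      using a by (simp add: of_rat_divide of_rat_minus field_simps add_eq_0_iff)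
    then have "inverse x = of_rat (- 1 / a) * ?y" by (rule inverse_unique)
    moreover have "?y \<in> K" by (rule papp_W[OF 1])
    ultimately show ?thesis using subring_mult[OF K subring_rat[OF K]] by metis
  qed (simp add: subring_0[OF K])
qed

section \<open>Polynomials over a subring, adjunction\<close>

definition cpoly :: "complex set \<Rightarrow> complex poly \<Rightarrow> bool" where
  "cpoly K p \<longleftrightarrow> (\<forall>i. coeff p i \<in> K)"

lemma cpoly_mono: "K \<subseteq> K' \<Longrightarrow> cpoly K p \<Longrightarrow> cpoly K' p"
  by (auto simp: cpoly_def)

lemma cpoly_pCons [simp]: "cpoly K (pCons a p) \<longleftrightarrow> a \<in> K \<and> cpoly K p"
  by (auto simp: cpoly_def coeff_pCons split: nat.splits)

lemma cpoly_0: "subring_C K \<Longrightarrow> cpoly K 0"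
  by (simp add: cpoly_def subring_0)

lemma cpoly_1: "subring_C K \<Longrightarrow> cpoly K 1"
  by (simp add: one_pCons cpoly_0 subring_1)

lemma cpoly_add: "subring_C K \<Longrightarrow> cpoly K p \<Longrightarrow> cpoly K q \<Longrightarrow> cpoly K (p + q)"
  and cpoly_diff: "subring_C K \<Longrightarrow> cpoly K p \<Longrightarrow> cpoly K q \<Longrightarrow> cpoly K (p - q)"
  and cpoly_smult: "subring_C K \<Longrightarrow> a \<in> K \<Longrightarrow> cpoly K p \<Longrightarrow> cpoly K (smult a p)"
  and cpoly_monom: "subring_C K \<Longrightarrow> a \<in> K \<Longrightarrow> cpoly K (monom a n)"
  and cpoly_mult: "subring_C K \<Longrightarrow> cpoly K p \<Longrightarrow> cpoly K q \<Longrightarrow> cpoly K (p * q)"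
  by (auto simp: cpoly_def subring_add subring_diff subring_mult subring_0 coeff_mult intro!: subring_sum)

lemma cpoly_sum: "subring_C K \<Longrightarrow> (\<And>i. i \<in> J \<Longrightarrow> cpoly K (f i)) \<Longrightarrow> cpoly K (sum f J)"
  by (induction J rule: infinite_finite_induct) (auto simp: cpoly_0 cpoly_add)

lemma cpoly_prod: "subring_C K \<Longrightarrow> (\<And>i. i \<in> J \<Longrightarrow> cpoly K (f i)) \<Longrightarrow> cpoly K (prod f J)"
  by (induction J rule: infinite_finite_induct) (auto simp: cpoly_1 cpoly_mult)

lemma cpoly_power: "subring_C K \<Longrightarrow> cpoly K p \<Longrightarrow> cpoly K (p ^ n)"
  by (induction n) (auto simp: cpoly_1 cpoly_mult)

lemma poly_in_subring: "subring_C K \<Longrightarrow> cpoly K p \<Longrightarrow> x \<in> K \<Longrightarrow> poly p x \<in> K"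
  by (induction p) (auto simp: subring_0 subring_add subring_mult)

lemma cpoly_divide:
  assumes K: "subring_C K" and P: "cpoly K P" "lead_coeff P = 1"
  shows "cpoly K p \<Longrightarrow> \<exists>q r. cpoly K q \<and> cpoly K r \<and> p = q * P + r \<and> (r = 0 \<or> degree r < degree P)"
proof (induction "degree p" arbitrary: p rule: less_induct)
  case less
  show ?case
  proof (cases "degree p < degree P")
    case True
    then show ?thesis using less.prems cpoly_0[OF K] by (intro exI[of _ 0] exI[of _ p]) auto
  next
    case ge: False
    let ?m = "monom (lead_coeff p) (degree p - degree P)"
    let ?p = "p - ?m * P"
    have m: "cpoly K ?m" using less.prems by (intro cpoly_monom K) (auto simp: cpoly_def)
    have p': "cpoly K ?p" using less.prems m P by (intro cpoly_diff cpoly_mult K)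
    have "degree (?m * P) \<le> (degree p - degree P) + degree P"
      by (rule order_trans[OF degree_mult_le]) (simp add: degree_monom_le)
    then have dm: "degree ?p \<le> degree p" using ge by (intro degree_diff_le) auto
    have "coeff (?m * P) (degree p) = lead_coeff p"
      using ge P(2) by (simp add: coeff_monom_mult)
    then have "coeff ?p (degree p) = 0" by simp
    with dm consider "?p = 0" | "degree ?p < degree p" using eq_zero_or_degree_less by blast
    then show ?thesis
    proof cases
      case 1
      then show ?thesis using m cpoly_0[OF K] by (intro exI[of _ ?m] exI[of _ 0]) auto
    next
      case 2
      from less.hyps[OF 2 p'] obtain q r where "cpoly K q" "cpoly K r" "?p = q * P + r"
        "r = 0 \<or> degree r < degree P" by blast
      then show ?thesis using m K
        by (intro exI[of _ "?m + q"] exI[of _ r]) (auto simp: cpoly_add algebra_simps)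
    qed
  qed
qed

definition Adj :: "complex set \<Rightarrow> complex \<Rightarrow> complex set" where
  "Adj K z = {poly p z | p. cpoly K p}"

lemma AdjI: "cpoly K p \<Longrightarrow> poly p z \<in> Adj K z"
  by (auto simp: Adj_def)

lemma Adj_superset: "subring_C K \<Longrightarrow> K \<subseteq> Adj K z"
proof
  fix x assume "subring_C K" "x \<in> K"
  then show "x \<in> Adj K z" using AdjI[of K "[:x:]" z] by (simp add: cpoly_0)
qed

lemma Adj_self: "subring_C K \<Longrightarrow> z \<in> Adj K z"
  using AdjI[of K "[:0, 1:]" z] by (simp add: subring_0 subring_1 cpoly_0)

lemma subring_Adj:
  assumes K: "subring_C K" shows "subring_C (Adj K z)"
  unfolding subring_C_def
proof (intro conjI allI ballI)
  fix q show "of_rat q \<in> Adj K z" using Adj_superset[OF K] subring_rat[OF K] by blast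
next
  fix x y assume "x \<in> Adj K z" "y \<in> Adj K z"
  then obtain p q where "x = poly p z" "cpoly K p" "y = poly q z" "cpoly K q" by (auto simp: Adj_def)
  then show "x + y \<in> Adj K z" "x * y \<in> Adj K z"
    using AdjI[of K "p + q" z] AdjI[of K "p * q" z] K by (auto simp: cpoly_add cpoly_mult)
qed

lemma Adj_minimal: "subring_C S \<Longrightarrow> K \<subseteq> S \<Longrightarrow> z \<in> S \<Longrightarrow> Adj K z \<subseteq> S"
  using poly_in_subring cpoly_mono by (auto simp: Adj_def)

lemma fdQ_Adj:
  assumes K: "subring_C K" "fdQ K" and P: "cpoly K P" "lead_coeff P = 1" "poly P z = 0"
  shows "fdQ (Adj K z)"
proof -
  obtain B where B: "finite B" "K \<subseteq> QC.span B" using K(2) by (auto simp: fdQ_def)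
  let ?B = "(\<lambda>(b, i). b * z ^ i) ` (B \<times> {..degree P})"
  have mul: "x * z ^ i \<in> QC.span ?B" if "x \<in> QC.span B" "i \<le> degree P" for x i
    using that(1)
  proof (induction rule: QC.span_induct_alt)
    case base show ?case by (simp add: QC.span_zero)
  next
    case (step c b y)
    then have "b * z ^ i \<in> ?B" using that(2) by auto
    then have "ratsc c (b * z ^ i) + y * z ^ i \<in> QC.span ?B"
      using QC.span_add[OF QC.span_scale[OF QC.span_base] step(2)] by blast
    then show ?case by (simp add: algebra_simps)
  qed
  have "Adj K z \<subseteq> QC.span ?B"
  proof
    fix x assume "x \<in> Adj K z"
    then obtain p where p: "cpoly K p" "x = poly p z" by (auto simp: Adj_def)
    obtain q r where qr: "cpoly K r" "p = q * P + r" "r = 0 \<or> degree r < degree P"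
      using cpoly_divide[OF K(1) P(1,2) p(1)] by blast
    have "x = poly r z" using p qr P by simp
    also have "\<dots> = (\<Sum>i\<le>degree r. coeff r i * z ^ i)" by (rule poly_altdef)
    also have "\<dots> \<in> QC.span ?B"
    proof (rule QC.span_sum)
      fix i assume "i \<in> {..degree r}"
      then have "i \<le> degree P" using qr(3) by auto
      moreover have "coeff r i \<in> QC.span B" using qr(1) B(2) by (auto simp: cpoly_def)
      ultimately show "coeff r i * z ^ i \<in> QC.span ?B" using mul by blast
    qed
    finally show "x \<in> QC.span ?B" .
  qed
  moreover have "finite ?B" using B(1) by simp
  ultimately show ?thesis unfolding fdQ_def by (intro exI[of _ ?B] conjI)
qed

section \<open>Embeddings\<close>

text \<open>Apart from the value at 1, the conditions concern elements of \<open>K\<close>; the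
  values outside \<open>K\<close> are arbitrary.\<close>

definition emb :: "complex set \<Rightarrow> (complex \<Rightarrow> complex) \<Rightarrow> bool" where
  "emb K \<sigma> \<longleftrightarrow> (\<forall>x\<in>K. \<forall>y\<in>K. \<sigma> (x + y) = \<sigma> x + \<sigma> y \<and> \<sigma> (x * y) = \<sigma> x * \<sigma> y) \<and> \<sigma> 1 = 1"

context
  fixes K \<sigma> assumes K: "subring_C K" and e: "emb K \<sigma>"
begin

lemma emb_add: "x \<in> K \<Longrightarrow> y \<in> K \<Longrightarrow> \<sigma> (x + y) = \<sigma> x + \<sigma> y"
  and emb_mult: "x \<in> K \<Longrightarrow> y \<in> K \<Longrightarrow> \<sigma> (x * y) = \<sigma> x * \<sigma> y"
  and emb_1: "\<sigma> 1 = 1"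
  using e by (auto simp: emb_def)

lemma emb_0: "\<sigma> 0 = 0"
  using emb_add[of 0 0] subring_0[OF K] by simp

lemma emb_uminus: "x \<in> K \<Longrightarrow> \<sigma> (- x) = - \<sigma> x"
  using emb_add[of x "- x"] subring_uminus[OF K, of x] by (simp add: emb_0 add_eq_0_iff)

lemma emb_diff: "x \<in> K \<Longrightarrow> y \<in> K \<Longrightarrow> \<sigma> (x - y) = \<sigma> x - \<sigma> y"
  using emb_add[of x "- y"] subring_uminus[OF K, of y] by (simp add: emb_uminus)

lemma emb_sum: "(\<And>i. i \<in> J \<Longrightarrow> f i \<in> K) \<Longrightarrow> \<sigma> (sum f J) = (\<Sum>i\<in>J. \<sigma> (f i))"
  by (induction J rule: infinite_finite_induct) (auto simp: emb_0 emb_add subring_sum[OF K])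

lemma emb_prod: "(\<And>i. i \<in> J \<Longrightarrow> f i \<in> K) \<Longrightarrow> \<sigma> (prod f J) = (\<Prod>i\<in>J. \<sigma> (f i))"
  by (induction J rule: infinite_finite_induct) (auto simp: emb_1 emb_mult subring_prod[OF K])

lemma emb_power: "x \<in> K \<Longrightarrow> \<sigma> (x ^ n) = \<sigma> x ^ n"
  by (induction n) (auto simp: emb_1 emb_mult subring_power[OF K])

lemma emb_of_nat: "\<sigma> (of_nat n) = of_nat n"
proof (induction n)
  case (Suc n)
  have "of_nat n \<in> K" using subring_int[OF K, of "int n"] by simp
  then show ?case using Suc by (simp add: emb_add emb_1 subring_1[OF K])
qed (simp add: emb_0)

lemma emb_of_int: "\<sigma> (of_int i) = of_int i"
proof (cases i)
  case (neg n)
  have "of_nat (Suc n) \<in> K" using subring_int[OF K, of "int (Suc n)"] by simp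
  then have "\<sigma> (- of_nat (Suc n)) = - of_nat (Suc n)" by (simp only: emb_uminus emb_of_nat)
  then show ?thesis using neg by simp
qed (simp add: emb_of_nat)

lemma emb_of_rat: "\<sigma> (of_rat r) = of_rat r"
proof -
  obtain a b where ab: "quotient_of r = (a, b)" by fastforce
  then have b: "b > 0" "r = of_int a / of_int b"
    using quotient_of_denom_pos quotient_of_div by auto
  have ra: "of_rat r * of_int b = (of_int a :: complex)"
    using b by (simp add: of_rat_divide)
  have "\<sigma> (of_rat r) * of_int b = \<sigma> (of_rat r * of_int b)"
    using emb_mult[OF subring_rat[OF K] subring_int[OF K], of r b] by (simp only: emb_of_int)
  also have "\<dots> = of_rat r * of_int b" unfolding ra by (rule emb_of_int)
  finally show ?thesis using b(1) by simp
qed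

lemma emb_inverse:
  assumes "subfield_C K" "x \<in> K" shows "\<sigma> (inverse x) = inverse (\<sigma> x)"
proof (cases "x = 0")
  case False
  have "inverse x \<in> K" using assms by (simp add: subfield_C_def)
  then have "\<sigma> x * \<sigma> (inverse x) = 1" using emb_mult[of x "inverse x"] False assms(2) by (simp add: emb_1)
  then show ?thesis by (metis inverse_unique)
qed (simp add: emb_0)

lemma emb_eq_0: 
  assumes "subfield_C K" "x \<in> K" "\<sigma> x = 0" shows "x = 0"
proof (rule ccontr)
  assume "x \<noteq> 0"
  moreover have "inverse x \<in> K" using assms by (simp add: subfield_C_def)
  ultimately have "\<sigma> x * \<sigma> (inverse x) = 1" using emb_mult[of x "inverse x"] assms(2) by (simp add: emb_1)
  with assms(3) show False by simp
qed

lemma emb_inj: "subfield_C K \<Longrightarrow> x \<in> K \<Longrightarrow> y \<in> K \<Longrightarrow> \<sigma> x = \<sigma> y \<Longrightarrow> x = y"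
  using emb_eq_0[of "x - y"] subring_diff[OF K, of x y] by (simp add: emb_diff)

lemma coeff_emb: "coeff (map_poly \<sigma> p) i = \<sigma> (coeff p i)"
  by (simp add: coeff_map_poly emb_0)

lemma map_poly_emb_add: "cpoly K p \<Longrightarrow> cpoly K q \<Longrightarrow> map_poly \<sigma> (p + q) = map_poly \<sigma> p + map_poly \<sigma> q"
  by (auto simp: poly_eq_iff coeff_emb cpoly_def emb_add)

lemma map_poly_emb_diff: "cpoly K p \<Longrightarrow> cpoly K q \<Longrightarrow> map_poly \<sigma> (p - q) = map_poly \<sigma> p - map_poly \<sigma> q"
  by (auto simp: poly_eq_iff coeff_emb cpoly_def emb_diff)

lemma map_poly_emb_smult: "a \<in> K \<Longrightarrow> cpoly K p \<Longrightarrow> map_poly \<sigma> (smult a p) = smult (\<sigma> a) (map_poly \<sigma> p)"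
  by (auto simp: poly_eq_iff coeff_emb cpoly_def emb_mult)

lemma map_poly_emb_mult: "cpoly K p \<Longrightarrow> cpoly K q \<Longrightarrow> map_poly \<sigma> (p * q) = map_poly \<sigma> p * map_poly \<sigma> q"
  by (auto simp: poly_eq_iff coeff_emb cpoly_def coeff_mult emb_sum emb_mult subring_mult[OF K])

lemma map_poly_emb_1: "map_poly \<sigma> 1 = 1"
  by (simp add: map_poly_1 emb_1)

lemma map_poly_emb_sum: "(\<And>i. i \<in> J \<Longrightarrow> cpoly K (f i)) \<Longrightarrow> map_poly \<sigma> (sum f J) = (\<Sum>i\<in>J. map_poly \<sigma> (f i))"
  by (induction J rule: infinite_finite_induct) (auto simp: map_poly_emb_add cpoly_sum[OF K])

lemma map_poly_emb_prod: "(\<And>i. i \<in> J \<Longrightarrow> cpoly K (f i)) \<Longrightarrow> map_poly \<sigma> (prod f J) = (\<Prod>i\<in>J. map_poly \<sigma> (f i))"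
  by (induction J rule: infinite_finite_induct) (auto simp: map_poly_emb_1 map_poly_emb_mult cpoly_prod[OF K])

lemma map_poly_emb_power: "cpoly K p \<Longrightarrow> map_poly \<sigma> (p ^ n) = map_poly \<sigma> p ^ n"
  by (induction n) (auto simp: map_poly_emb_1 map_poly_emb_mult cpoly_power[OF K])

lemma emb_poly: "cpoly K p \<Longrightarrow> x \<in> K \<Longrightarrow> \<sigma> (poly p x) = poly (map_poly \<sigma> p) (\<sigma> x)"
proof (induction p)
  case (pCons a p)
  then show ?case
    by (simp add: map_poly_pCons[where f = \<sigma>, OF emb_0] emb_add emb_mult poly_in_subring[OF K] subring_mult[OF K])
qed (simp add: emb_0)

lemma map_poly_emb_rat: "cpoly \<rat> p \<Longrightarrow> map_poly \<sigma> p = p"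
proof (rule poly_eqI)
  fix n assume "cpoly \<rat> p"
  then have "coeff p n \<in> \<rat>" by (simp add: cpoly_def)
  then obtain r where "coeff p n = of_rat r" by (rule Rats_cases)
  then show "coeff (map_poly \<sigma> p) n = coeff p n" by (simp add: coeff_emb emb_of_rat)
qed

end

definition minpoly_over :: "complex set \<Rightarrow> complex \<Rightarrow> complex poly \<Rightarrow> bool" where
  "minpoly_over K z P \<longleftrightarrow> cpoly K P \<and> lead_coeff P = 1 \<and> poly P z = 0 \<and>
    (\<forall>p. cpoly K p \<longrightarrow> p \<noteq> 0 \<longrightarrow> poly p z = 0 \<longrightarrow> degree P \<le> degree p)"

lemma ex_minpoly_over:
  assumes K: "subfield_C K" and "cpoly K p" "p \<noteq> 0" "poly p z = 0"
  shows "\<exists>P. minpoly_over K z P"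
proof -
  obtain P where P: "cpoly K P \<and> P \<noteq> 0 \<and> poly P z = 0"
    "\<And>p. cpoly K p \<and> p \<noteq> 0 \<and> poly p z = 0 \<Longrightarrow> degree P \<le> degree p"
    using ex_has_least_nat[of "\<lambda>p. cpoly K p \<and> p \<noteq> 0 \<and> poly p z = 0" p degree] assms by blast
  have "lead_coeff P \<in> K" using P by (auto simp: cpoly_def)
  then have "1 / lead_coeff P \<in> K" using subfield_divide[OF K subring_1[OF subfield_ring[OF K]]] by blast
  then have "minpoly_over K z (smult (1 / lead_coeff P) P)"
    using P cpoly_smult[OF subfield_ring[OF K]] by (auto simp: minpoly_over_def)
  then show ?thesis by blast
qed

lemma minpoly_over_dvd:
  assumes K: "subring_C K" and P: "minpoly_over K z P" and p: "cpoly K p" "poly p z = 0"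
  obtains q where "cpoly K q" "p = q * P"
proof -
  obtain q r where qr: "cpoly K q" "cpoly K r" "p = q * P + r" "r = 0 \<or> degree r < degree P"
    using cpoly_divide[OF K _ _ p(1), of P] P by (auto simp: minpoly_over_def)
  have "poly r z = 0" using qr p P by (simp add: minpoly_over_def)
  then have "r = 0" using P qr by (auto simp: minpoly_over_def)
  with qr that show thesis by auto
qed

lemma minpoly_over_degree: "minpoly_over K z P \<Longrightarrow> degree P \<ge> 1"
proof (rule ccontr)
  assume P: "minpoly_over K z P" and "\<not> degree P \<ge> 1"
  then have "degree P = 0" by simp
  then obtain a where "P = [:a:]" by (rule degree_eq_zeroE)
  with P show False by (auto simp: minpoly_over_def)
qed

text \<open>The extension sends p(z) to the transported polynomial at z'. It is well defined because
  two polynomials with the same value at z differ by a multiple of the minimal polynomial, whose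
  transport vanishes at z'.\<close>

lemma emb_extend_root:
  assumes K: "subring_C K" and e: "emb K \<sigma>" and P: "minpoly_over K z P"
    and z': "poly (map_poly \<sigma> P) z' = 0"
  shows "\<exists>\<sigma>'. emb (Adj K z) \<sigma>' \<and> (\<forall>x\<in>K. \<sigma>' x = \<sigma> x) \<and> \<sigma>' z = z'"
proof -
  define \<sigma>' where "\<sigma>' x = poly (map_poly \<sigma> (SOME p. cpoly K p \<and> poly p z = x)) z'" for x
  have val: "\<sigma>' (poly p z) = poly (map_poly \<sigma> p) z'" if p: "cpoly K p" for p
  proof -
    define p' where "p' = (SOME p'. cpoly K p' \<and> poly p' z = poly p z)"
    have p': "cpoly K p' \<and> poly p' z = poly p z" unfolding p'_def by (rule someI_ex) (use p in blast)
    have "cpoly K (p' - p)" "poly (p' - p) z = 0" using p p' K by (auto simp: cpoly_diff)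
    from minpoly_over_dvd[OF K P this] obtain q where q: "cpoly K q" "p' - p = q * P" .
    have "map_poly \<sigma> p' - map_poly \<sigma> p = map_poly \<sigma> q * map_poly \<sigma> P"
      using q p p' P map_poly_emb_diff[OF K e, of p' p] map_poly_emb_mult[OF K e, of q P] by (simp add: minpoly_over_def)
    then have "poly (map_poly \<sigma> p') z' - poly (map_poly \<sigma> p) z' = 0" using z' by (metis poly_diff poly_mult mult_zero_right)
    then show ?thesis unfolding \<sigma>'_def p'_def by simp
  qed
  have K_eq: "\<sigma>' x = \<sigma> x" if "x \<in> K" for x
    using val[of "[:x:]"] that cpoly_0[OF K] by (simp add: map_poly_pCons emb_0[OF K e])
  have "\<sigma>' z = z'"
    using val[of "[:0, 1:]"] K cpoly_0[OF K]
    by (simp add: map_poly_pCons emb_0[OF K e] emb_1[OF K e] subring_0 subring_1)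
  moreover have "emb (Adj K z) \<sigma>'"
    unfolding emb_def
  proof (intro conjI ballI)
    fix x y assume "x \<in> Adj K z" "y \<in> Adj K z"
    then obtain p q where pq: "x = poly p z" "cpoly K p" "y = poly q z" "cpoly K q" by (auto simp: Adj_def)
    show "\<sigma>' (x + y) = \<sigma>' x + \<sigma>' y"
      using val[of "p + q"] pq val[of p] val[of q] by (simp add: cpoly_add K map_poly_emb_add[OF K e])
    show "\<sigma>' (x * y) = \<sigma>' x * \<sigma>' y"
      using val[of "p * q"] pq val[of p] val[of q] by (simp add: cpoly_mult K map_poly_emb_mult[OF K e])
  qed (simp add: K_eq subring_1[OF K] emb_1[OF K e])
  ultimately show ?thesis using K_eq by blast
qed

text \<open>The transported minimal polynomial is not constant, so it has a complex root to which z
  can be sent.\<close>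

lemma emb_extend:
  assumes K: "subfield_C K" and e: "emb K \<sigma>" and p: "cpoly K p" "p \<noteq> 0" "poly p z = 0"
  shows "\<exists>\<sigma>'. emb (Adj K z) \<sigma>' \<and> (\<forall>x\<in>K. \<sigma>' x = \<sigma> x)"
proof -
  note R = subfield_ring[OF K]
  obtain P where P: "minpoly_over K z P" using ex_minpoly_over[OF K p] by blast
  have "coeff (map_poly \<sigma> P) (degree P) = 1"
    using P by (simp add: coeff_emb[OF R e] emb_1[OF R e] minpoly_over_def)
  then have "degree (map_poly \<sigma> P) \<ge> 1"
    using minpoly_over_degree[OF P] le_degree[of "map_poly \<sigma> P" "degree P"] by simp
  then have "\<not> constant (poly (map_poly \<sigma> P))" by (simp add: constant_degree)
  then obtain z' where "poly (map_poly \<sigma> P) z' = 0" using fundamental_theorem_of_algebra by blast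
  from emb_extend_root[OF R e P this] show ?thesis by blast
qed

fun adjs :: "complex set \<Rightarrow> complex list \<Rightarrow> complex set" where
  "adjs K [] = K"
| "adjs K (x # xs) = adjs (Adj K x) xs"

definition algQ :: "complex \<Rightarrow> bool" where
  "algQ z \<longleftrightarrow> (\<exists>P. cpoly \<rat> P \<and> lead_coeff P = 1 \<and> poly P z = 0)"

lemma Rats_subset_subring: "subring_C K \<Longrightarrow> \<rat> \<subseteq> K"
  by (auto simp: subring_rat elim!: Rats_cases)

lemma Adj_field:
  assumes "subfield_C K" "fdQ K" "algQ z"
  shows "subfield_C (Adj K z)" "fdQ (Adj K z)"
proof -
  note R = subfield_ring[OF assms(1)]
  obtain P where P: "cpoly \<rat> P" "lead_coeff P = 1" "poly P z = 0" using assms(3) by (auto simp: algQ_def)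
  have "cpoly K P" using cpoly_mono[OF Rats_subset_subring[OF R]] P by blast
  then show fd: "fdQ (Adj K z)" using fdQ_Adj[OF R assms(2)] P by blast
  show "subfield_C (Adj K z)" by (rule fd_subring_subfield[OF subring_Adj[OF R] fd])
qed

lemma adjs_field:
  "subfield_C K \<Longrightarrow> fdQ K \<Longrightarrow> (\<And>x. x \<in> set xs \<Longrightarrow> algQ x) \<Longrightarrow>
    subfield_C (adjs K xs) \<and> fdQ (adjs K xs) \<and> K \<subseteq> adjs K xs \<and> set xs \<subseteq> adjs K xs"
proof (induction xs arbitrary: K)
  case (Cons x xs)
  have "subfield_C (Adj K x)" "fdQ (Adj K x)" using Adj_field[of K x] Cons.prems by auto
  from Cons.IH[OF this] Cons.prems Adj_superset[OF subfield_ring[OF Cons.prems(1)], of x]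
    Adj_self[OF subfield_ring[OF Cons.prems(1)], of x] show ?case by auto
qed auto

lemma adjs_minimal: "subring_C S \<Longrightarrow> K \<subseteq> S \<Longrightarrow> set xs \<subseteq> S \<Longrightarrow> adjs K xs \<subseteq> S"
  by (induction xs arbitrary: K) (auto simp: Adj_minimal)

lemma emb_extend_adjs:
  "subfield_C K \<Longrightarrow> fdQ K \<Longrightarrow> (\<And>x. x \<in> set xs \<Longrightarrow> algQ x) \<Longrightarrow> emb K \<sigma> \<Longrightarrow>
    \<exists>\<sigma>'. emb (adjs K xs) \<sigma>' \<and> (\<forall>x\<in>K. \<sigma>' x = \<sigma> x)"
proof (induction xs arbitrary: K \<sigma>)
  case (Cons x xs)
  note R = subfield_ring[OF Cons.prems(1)]
  have "algQ x" using Cons.prems by simp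
  then obtain P where P: "cpoly \<rat> P" "lead_coeff P = 1" "poly P x = 0" by (auto simp: algQ_def)
  have "cpoly K P" using cpoly_mono[OF Rats_subset_subring[OF R]] P by blast
  moreover have "P \<noteq> 0" using P by auto
  ultimately obtain \<sigma>1 where s1: "emb (Adj K x) \<sigma>1" "\<forall>y\<in>K. \<sigma>1 y = \<sigma> y"
    using emb_extend[OF Cons.prems(1,4)] P by blast
  have "subfield_C (Adj K x)" "fdQ (Adj K x)" using Adj_field Cons.prems \<open>algQ x\<close> by auto
  from Cons.IH[OF this _ s1(1)] Cons.prems obtain \<sigma>' where
    "emb (adjs (Adj K x) xs) \<sigma>'" "\<forall>y\<in>Adj K x. \<sigma>' y = \<sigma>1 y" by auto
  with s1 Adj_superset[OF R, of x] show ?case by (intro exI[of _ \<sigma>']) auto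
qed auto

section \<open>The Galois group of a rational polynomial\<close>

text \<open>\<Lambda> is the root set of a monic rational polynomial and \<open>K\<close> its
  splitting field. Elements of \<open>Gal\<close> are set to 0 outside \<open>K\<close>, so that
  embeddings equal on \<open>K\<close> are equal as functions; \<open>comp\<close> restores this
  convention after composition.\<close>

locale galois =
  fixes q :: "complex poly" and \<Lambda> :: "complex set" and K :: "complex set" and Gal :: "(complex \<Rightarrow> complex) set"
  assumes q: "cpoly \<rat> q" "lead_coeff q = 1"
  defines "\<Lambda> \<equiv> {z. poly q z = 0}"
    and "K \<equiv> adjs \<rat> (SOME xs. set xs = {z. poly q z = 0})"
    and "Gal \<equiv> {\<sigma>. emb K \<sigma> \<and> (\<forall>x. x \<notin> K \<longrightarrow> \<sigma> x = 0)}"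
begin

lemma finite_roots: "finite \<Lambda>"
proof -
  have "q \<noteq> 0" using q by auto
  then show ?thesis unfolding \<Lambda>_def by (rule poly_roots_finite)
qed

definition "xs = (SOME xs. set xs = \<Lambda>)"

lemma set_xs: "set xs = \<Lambda>"
  unfolding xs_def by (rule someI_ex) (rule finite_list[OF finite_roots])

lemma K_def': "K = adjs \<rat> xs"
  by (simp add: K_def xs_def \<Lambda>_def)

lemma algQ_roots: "x \<in> set xs \<Longrightarrow> algQ x"
  unfolding set_xs using q by (auto simp: algQ_def \<Lambda>_def)

lemma subfield_Rats: "subfield_C \<rat>" and fdQ_Rats: "fdQ \<rat>"
proof -
  show "subfield_C \<rat>" by (auto simp: subfield_C_def subring_C_def)
  have "\<rat> \<subseteq> QC.span {1}"
  proof
    fix x :: complex assume "x \<in> \<rat>"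
    then obtain r where "x = ratsc r 1" by (auto elim: Rats_cases)
    then show "x \<in> QC.span {1}" using QC.span_scale[OF QC.span_base[of 1 "{1}"], of r] by simp
  qed
  then show "fdQ \<rat>" unfolding fdQ_def by (intro exI[of _ "{1}"]) auto
qed

lemma K: "subfield_C K" "fdQ K" "\<Lambda> \<subseteq> K" "\<rat> \<subseteq> K"
proof -
  have "subfield_C (adjs \<rat> xs) \<and> fdQ (adjs \<rat> xs) \<and> \<rat> \<subseteq> adjs \<rat> xs \<and> set xs \<subseteq> adjs \<rat> xs"
    by (rule adjs_field[OF subfield_Rats fdQ_Rats]) (rule algQ_roots)
  then show "subfield_C K" "fdQ K" "\<Lambda> \<subseteq> K" "\<rat> \<subseteq> K" by (simp_all add: K_def' set_xs)
qed

lemma K_ring: "subring_C K"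
  by (rule subfield_ring[OF K(1)])

lemma K_minimal: "subring_C S \<Longrightarrow> \<Lambda> \<subseteq> S \<Longrightarrow> K \<subseteq> S"
  unfolding K_def' by (intro adjs_minimal) (auto simp: set_xs Rats_subset_subring)

lemma Gal_emb: "\<sigma> \<in> Gal \<Longrightarrow> emb K \<sigma>"
  by (simp add: Gal_def)

lemma Gal_agree:
  assumes "\<sigma> \<in> Gal" "\<tau> \<in> Gal" "\<And>x. x \<in> \<Lambda> \<Longrightarrow> \<sigma> x = \<tau> x"
  shows "\<sigma> = \<tau>"
proof
  note s = Gal_emb[OF assms(1)] and t = Gal_emb[OF assms(2)]
  have "K \<subseteq> {x \<in> K. \<sigma> x = \<tau> x}"
  proof (rule K_minimal)
    show "subring_C {x \<in> K. \<sigma> x = \<tau> x}" unfolding subring_C_def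
      using K_ring by (auto simp: subring_rat subring_add subring_mult emb_of_rat[OF K_ring s] emb_of_rat[OF K_ring t]
          emb_add[OF K_ring s] emb_add[OF K_ring t] emb_mult[OF K_ring s] emb_mult[OF K_ring t])
  qed (use K assms in auto)
  moreover have "\<sigma> x = \<tau> x" if "x \<notin> K" for x using assms that by (simp add: Gal_def)
  ultimately show "\<sigma> x = \<tau> x" for x by blast
qed

lemma emb_roots: "emb K \<sigma> \<Longrightarrow> x \<in> \<Lambda> \<Longrightarrow> \<sigma> x \<in> \<Lambda>"
proof -
  assume s: "emb K \<sigma>" and x: "x \<in> \<Lambda>"
  have "\<sigma> (poly q x) = poly (map_poly \<sigma> q) (\<sigma> x)"
    using x K(3) by (intro emb_poly[OF K_ring s] cpoly_mono[OF K(4) q(1)]) auto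
  then have "\<sigma> (poly q x) = poly q (\<sigma> x)" by (simp only: map_poly_emb_rat[OF K_ring s q(1)])
  then show "\<sigma> x \<in> \<Lambda>" using x by (simp add: \<Lambda>_def emb_0[OF K_ring s])
qed

lemma emb_K: "emb K \<sigma> \<Longrightarrow> x \<in> K \<Longrightarrow> \<sigma> x \<in> K"
proof -
  assume s: "emb K \<sigma>" and "x \<in> K"
  have "K \<subseteq> {x \<in> K. \<sigma> x \<in> K}"
  proof (rule K_minimal)
    show "subring_C {x \<in> K. \<sigma> x \<in> K}" unfolding subring_C_def
      using K_ring by (auto simp: subring_rat subring_add subring_mult emb_of_rat[OF K_ring s]
          emb_add[OF K_ring s] emb_mult[OF K_ring s])
  qed (use K emb_roots[OF s] in auto)
  with \<open>x \<in> K\<close> show ?thesis by auto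
qed

lemma finite_Gal: "finite Gal"
proof (rule finite_imageD)
  show "finite ((\<lambda>\<sigma>. restrict \<sigma> \<Lambda>) ` Gal)"
  proof (rule finite_subset)
    show "(\<lambda>\<sigma>. restrict \<sigma> \<Lambda>) ` Gal \<subseteq> \<Lambda> \<rightarrow>\<^sub>E \<Lambda>" using emb_roots Gal_emb by auto
  qed (simp add: finite_PiE finite_roots)
  show "inj_on (\<lambda>\<sigma>. restrict \<sigma> \<Lambda>) Gal"
    by (intro inj_onI Gal_agree) (auto dest!: fun_cong simp: restrict_def split: if_splits)
qed

definition comp :: "(complex \<Rightarrow> complex) \<Rightarrow> (complex \<Rightarrow> complex) \<Rightarrow> complex \<Rightarrow> complex" where
  "comp \<sigma> \<tau> = (\<lambda>x. if x \<in> K then \<sigma> (\<tau> x) else 0)"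

lemma comp_Gal:
  assumes "\<sigma> \<in> Gal" "\<tau> \<in> Gal" shows "comp \<sigma> \<tau> \<in> Gal"
proof -
  note s = Gal_emb[OF assms(1)] and t = Gal_emb[OF assms(2)]
  have "emb K (comp \<sigma> \<tau>)" unfolding emb_def
    using K_ring by (auto simp: comp_def subring_add subring_mult subring_1 emb_K[OF t]
        emb_add[OF K_ring s] emb_add[OF K_ring t] emb_mult[OF K_ring s] emb_mult[OF K_ring t]
        emb_1[OF K_ring s] emb_1[OF K_ring t])
  then show ?thesis by (simp add: Gal_def comp_def)
qed

lemma id_Gal: "(\<lambda>x. if x \<in> K then x else 0) \<in> Gal"
  using K_ring by (auto simp: Gal_def emb_def subring_add subring_mult subring_1)

text \<open>The group structure of \<open>Gal\<close> comes from finiteness: composition with a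
  fixed element is injective, hence bijective, and the identity is attained.\<close>

lemma comp_bij_left: "\<sigma> \<in> Gal \<Longrightarrow> bij_betw (comp \<sigma>) Gal Gal"
proof -
  assume s: "\<sigma> \<in> Gal"
  have inj: "inj_on (comp \<sigma>) Gal"
  proof (rule inj_onI)
    fix \<tau> \<tau>' assume t: "\<tau> \<in> Gal" "\<tau>' \<in> Gal" "comp \<sigma> \<tau> = comp \<sigma> \<tau>'"
    show "\<tau> = \<tau>'"
    proof (rule Gal_agree[OF t(1,2)])
      fix x assume "x \<in> \<Lambda>"
      then have "x \<in> K" using K by blast
      moreover then have "\<sigma> (\<tau> x) = \<sigma> (\<tau>' x)" using fun_cong[OF t(3), of x] by (simp add: comp_def)
      ultimately show "\<tau> x = \<tau>' x"
        using emb_inj[OF K_ring Gal_emb[OF s] K(1) emb_K[OF Gal_emb[OF t(1)]] emb_K[OF Gal_emb[OF t(2)]]] by blast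
    qed
  qed
  have "comp \<sigma> ` Gal \<subseteq> Gal" using comp_Gal[OF s] by blast
  then show ?thesis using endo_inj_surj[OF finite_Gal _ inj] inj by (simp add: bij_betw_def)
qed

lemma Gal_inverse:
  assumes s: "\<sigma> \<in> Gal"
  obtains \<tau> where "\<tau> \<in> Gal" "\<And>x. x \<in> K \<Longrightarrow> \<sigma> (\<tau> x) = x" "\<And>x. x \<in> K \<Longrightarrow> \<tau> (\<sigma> x) = x"
proof -
  obtain \<tau> where t: "\<tau> \<in> Gal" "comp \<sigma> \<tau> = (\<lambda>x. if x \<in> K then x else 0)"
  proof -
    have "(\<lambda>x. if x \<in> K then x else 0) \<in> comp \<sigma> ` Gal"
      using comp_bij_left[OF s] id_Gal by (simp add: bij_betw_def)
    then show thesis by (elim imageE) (rule that, assumption, rule sym)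
  qed
  have 1: "\<sigma> (\<tau> x) = x" if "x \<in> K" for x using fun_cong[OF t(2), of x] that by (simp add: comp_def)
  have "\<tau> (\<sigma> x) = x" if "x \<in> K" for x
  proof -
    have sx: "\<sigma> x \<in> K" by (rule emb_K[OF Gal_emb[OF s] that])
    have "\<tau> (\<sigma> x) \<in> K" by (rule emb_K[OF Gal_emb[OF t(1)] sx])
    from emb_inj[OF K_ring Gal_emb[OF s] K(1) this that 1[OF sx]] show ?thesis .
  qed
  from that[OF t(1) 1 this] show thesis .
qed

lemma comp_bij_right: "\<tau> \<in> Gal \<Longrightarrow> bij_betw (\<lambda>\<sigma>. comp \<sigma> \<tau>) Gal Gal"
proof -
  assume t: "\<tau> \<in> Gal"
  obtain \<rho> where r: "\<rho> \<in> Gal" "\<And>x. x \<in> K \<Longrightarrow> \<tau> (\<rho> x) = x"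
    "\<And>x. x \<in> K \<Longrightarrow> \<rho> (\<tau> x) = x" by (rule Gal_inverse[OF t]) (rule that; assumption)
  have inj: "inj_on (\<lambda>\<sigma>. comp \<sigma> \<tau>) Gal"
  proof (rule inj_onI)
    fix \<sigma> \<sigma>' assume s: "\<sigma> \<in> Gal" "\<sigma>' \<in> Gal" "comp \<sigma> \<tau> = comp \<sigma>' \<tau>"
    show "\<sigma> = \<sigma>'"
    proof (rule Gal_agree[OF s(1,2)])
      fix x assume "x \<in> \<Lambda>"
      then have x: "x \<in> K" using K by blast
      then have "\<rho> x \<in> K" by (rule emb_K[OF Gal_emb[OF r(1)]])
      then have "\<sigma> (\<tau> (\<rho> x)) = \<sigma>' (\<tau> (\<rho> x))" using fun_cong[OF s(3), of "\<rho> x"] by (simp add: comp_def)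
      then show "\<sigma> x = \<sigma>' x" using r(2)[OF x] by simp
    qed
  qed
  have "(\<lambda>\<sigma>. comp \<sigma> \<tau>) ` Gal \<subseteq> Gal" using comp_Gal t by blast
  then show ?thesis using endo_inj_surj[OF finite_Gal _ inj] inj by (simp add: bij_betw_def)
qed

lemma Gal_bij_roots: "\<sigma> \<in> Gal \<Longrightarrow> bij_betw \<sigma> \<Lambda> \<Lambda>"
proof -
  assume s: "\<sigma> \<in> Gal"
  have inj: "inj_on \<sigma> \<Lambda>" using emb_inj[OF K_ring Gal_emb[OF s] K(1)] K(3) by (intro inj_onI) blast
  have "\<sigma> ` \<Lambda> \<subseteq> \<Lambda>" using emb_roots[OF Gal_emb[OF s]] by blast
  then show ?thesis using endo_inj_surj[OF finite_roots _ inj] inj by (simp add: bij_betw_def)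
qed

text \<open>An irrational x has a minimal polynomial of degree at least 2 in which x is a simple
  root, the derivative having smaller degree. Another root z' gives an embedding of Q(x) moving x to
  z'. It is extended to the field obtained by adjoining \<Lambda> to Q(x), which contains
  \<open>K\<close>, and restricted to \<open>K\<close>.\<close>

theorem Gal_fixed_rational:
  assumes x: "x \<in> K" and fixed: "\<And>\<sigma>. \<sigma> \<in> Gal \<Longrightarrow> \<sigma> x = x"
  shows "x \<in> \<rat>"
proof (rule ccontr)
  assume nr: "x \<notin> \<rat>"
  interpret lin_op ratsc "\<lambda>y. x * y" K
    by unfold_locales (use subspace_subring[OF K_ring] K_ring x in \<open>auto simp: algebra_simps subring_mult\<close>)
  obtain B where "finite B" "B \<subseteq> K" "K \<subseteq> QC.span B" using fdQ_basis[OF K(2)] by blast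
  then obtain p where p: "p \<noteq> 0" "\<forall>w\<in>K. papp p w = 0" using ex_annihilator by blast
  have "papp p 1 = poly (map_poly of_rat p) x"
    by (induction p) (auto simp: map_poly_pCons)
  then have px: "poly (map_poly of_rat p) x = 0" using p subring_1[OF K_ring] by simp
  have cp: "cpoly \<rat> (map_poly of_rat p)" by (simp add: cpoly_def coeff_map_poly)
  have "map_poly of_rat p \<noteq> (0 :: complex poly)"
  proof
    assume "map_poly of_rat p = (0 :: complex poly)"
    then have "of_rat (coeff p (degree p)) = (0 :: complex)" by (metis coeff_0 coeff_map_poly of_rat_0)
    with p show False by simp
  qed
  from ex_minpoly_over[OF subfield_Rats cp this px] obtain P where P: "minpoly_over \<rat> x P" by blast
  have Px: "poly P x = 0" and P1: "lead_coeff P = 1" and cP: "cpoly \<rat> P" using P by (auto simp: minpoly_over_def)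
  then obtain R where R: "P = [:-x, 1:] * R" by (auto simp: poly_eq_0_iff_dvd)
  have P0: "P \<noteq> 0" using P1 by auto
  then have R0: "R \<noteq> 0" using R by auto
  then have dP: "degree P = Suc (degree R)"
    using degree_mult_eq[of "[:-x, 1:]" R] by (simp add: R del: mult_pCons_left)
  have "degree R \<noteq> 0"
  proof
    assume "degree R = 0"
    then obtain a where "R = [:a:]" by (rule degree_eq_zeroE)
    then have "P = [:-x * a, a:]" using R by simp
    with P1 cP have "a = 1" "- x \<in> \<rat>" by (auto split: if_splits)
    with nr show False by (metis Rats_minus_iff)
  qed
  then obtain z' where z': "poly R z' = 0"
    using fundamental_theorem_of_algebra[of R] by (auto simp: constant_degree)
  have "poly R x \<noteq> 0"
  proof
    assume Rx: "poly R x = 0"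
    have "cpoly \<rat> (pderiv P)" using cP by (auto simp: cpoly_def coeff_pderiv)
    moreover have "poly (pderiv P) x = 0" unfolding R pderiv_mult by (simp add: Rx)
    moreover have "pderiv P \<noteq> 0" using dP by (simp add: pderiv_eq_0_iff)
    ultimately have "degree P \<le> degree (pderiv P)" using P by (auto simp: minpoly_over_def)
    then show False using dP by (simp add: degree_pderiv)
  qed
  with z' have zx: "z' \<noteq> x" by auto
  have e: "emb \<rat> (\<lambda>y. y)" by (simp add: emb_def)
  have "map_poly (\<lambda>y. y) P = P" by (simp add: poly_eq_iff coeff_map_poly)
  then have "poly (map_poly (\<lambda>y. y) P) z' = 0" using z' R by simp
  from emb_extend_root[OF subfield_ring[OF subfield_Rats] e P this] obtain \<sigma>1 where
    s1: "emb (Adj \<rat> x) \<sigma>1" "\<sigma>1 x = z'" by blast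
  have ax: "algQ x" using P by (auto simp: minpoly_over_def algQ_def)
  have fA: "subfield_C (Adj \<rat> x)" "fdQ (Adj \<rat> x)" using Adj_field[OF subfield_Rats fdQ_Rats ax] .
  from emb_extend_adjs[OF fA algQ_roots s1(1)] obtain \<sigma>2 where
    s2: "emb (adjs (Adj \<rat> x) xs) \<sigma>2" "\<forall>y\<in>Adj \<rat> x. \<sigma>2 y = \<sigma>1 y" by blast
  have "subfield_C (adjs (Adj \<rat> x) xs) \<and> fdQ (adjs (Adj \<rat> x) xs) \<and> Adj \<rat> x \<subseteq> adjs (Adj \<rat> x) xs \<and>
      set xs \<subseteq> adjs (Adj \<rat> x) xs"
    by (rule adjs_field[OF fA]) (rule algQ_roots)
  then have big: "subfield_C (adjs (Adj \<rat> x) xs)" "set xs \<subseteq> adjs (Adj \<rat> x) xs" by blast+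
  then have KA: "K \<subseteq> adjs (Adj \<rat> x) xs" by (intro K_minimal subfield_ring) (auto simp: set_xs)
  define \<tau> where "\<tau> = (\<lambda>y. if y \<in> K then \<sigma>2 y else 0)"
  have "emb K \<tau>" using s2(1) KA K_ring
    by (auto simp: emb_def \<tau>_def subring_add subring_mult subring_1 subset_iff)
  then have "\<tau> \<in> Gal" by (simp add: Gal_def \<tau>_def)
  moreover have "\<tau> x = z'" using s2(2) s1(2) x Adj_self[OF subfield_ring[OF subfield_Rats], of x] by (simp add: \<tau>_def)
  ultimately show False using fixed zx by auto
qed

end

section \<open>A rational derivation\<close>

definition cmv :: "nat \<Rightarrow> (nat \<Rightarrow> nat \<Rightarrow> complex) \<Rightarrow> (nat \<Rightarrow> complex) \<Rightarrow> nat \<Rightarrow> complex" where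
  "cmv m A v = (\<lambda>i. if i < m then \<Sum>j<m. A i j * v j else 0)"

lemma cmv_add: "cmv m A (x + y) = cmv m A x + cmv m A y"
  by (auto simp: cmv_def fun_eq_iff algebra_simps sum.distrib)

lemma cmv_scale: "cmv m A (vscale a x) = vscale a (cmv m A x)"
  by (auto simp: cmv_def fun_eq_iff algebra_simps sum_distrib_left)

lemma in_space_cmv: "in_space m (cmv m A v)"
  by (auto simp: in_space_def cmv_def)

lemma lin_op_vscale:
  assumes "\<And>x y. T (x + y) = T x + T y" "\<And>a x. T (vscale a x) = vscale a (T x)"
    "\<And>x. in_space m x \<Longrightarrow> in_space m (T x)"
  shows "lin_op (vscale :: complex \<Rightarrow> _) T {x. in_space m x}"
proof -
  interpret vector_space "vscale :: complex \<Rightarrow> _" by (rule vector_space_vscale)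
  show ?thesis by unfold_locales (use subspace_in_space assms in auto)
qed

lemma (in lin_op) papp_eigen: "T v = k \<star> v \<Longrightarrow> papp p v = poly p k \<star> v"
  by (induction p) (auto simp: T_scale scale_left_distrib)

lemma (in lin_op) ex_polynomial_left_inverse:
  assumes "finite B" "B \<subseteq> W" "W \<subseteq> span B" and inj: "\<And>w. w \<in> W \<Longrightarrow> T w = 0 \<Longrightarrow> w = 0"
  shows "\<exists>p. \<forall>w\<in>W. papp p (T w) = w"
proof -
  obtain p where p: "lead_coeff p = 1" "annih p" "\<And>q. annih q \<Longrightarrow> q \<noteq> 0 \<Longrightarrow> degree p \<le> degree q"
    by (rule ex_minimal_annihilator[OF assms(1-3)]) blast
  obtain a r where pr: "p = pCons a r" by (cases p)
  have a: "a \<noteq> 0"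
  proof
    assume a0: "a = 0"
    then have "annih r" using p(2) inj papp_W by (auto simp: pr annih_def)
    moreover have "r \<noteq> 0" using p(1) a0 pr by auto
    ultimately show False using p(3)[of r] pr by simp
  qed
  have "papp (smult (- 1 / a) r) (T w) = w" if w: "w \<in> W" for w
  proof -
    have T: "T w = papp [:0, 1:] w" by simp
    have "papp r (T w) = T (papp r w)" unfolding T by (subst papp_commute) simp
    moreover have "a \<star> w + T (papp r w) = 0" using p(2) w by (simp add: pr annih_def)
    ultimately have "papp r (T w) = (- a) \<star> w" by (simp add: eq_neg_iff_add_eq_0 add.commute)
    then show ?thesis using a by (simp add: papp_smult papp_minus)
  qed
  then show ?thesis by blast
qed

lemma in_space_basis:
  "finite (unit_vec ` {..<m} :: (nat \<Rightarrow> 'a::field) set)"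
  "unit_vec ` {..<m} \<subseteq> {x :: nat \<Rightarrow> 'a. in_space m x}"
  by (auto simp: in_space_unit_vec)

text \<open>Write M = A + z B and let N be B followed by the inverse of M, a polynomial in M. If A +
  r B kills v, then N v = v / (z - r), so r is determined by an eigenvalue of N; finitely many r are
  excluded.\<close>

lemma perturb_injective:
  assumes inj: "\<And>v. in_space m v \<Longrightarrow> cmv m (\<lambda>i j. A i j + z * B i j) v = 0 \<Longrightarrow> v = 0"
  shows "\<exists>r::rat. \<forall>v. in_space m v \<longrightarrow> cmv m (\<lambda>i j. A i j + of_rat r * B i j) v = 0 \<longrightarrow> v = 0"
proof -
  let ?M = "cmv m (\<lambda>i j. A i j + z * B i j)"
  interpret M: lin_op "vscale :: complex \<Rightarrow> _" ?M "{x. in_space m x}"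
    by (rule lin_op_vscale) (rule cmv_add cmv_scale in_space_cmv)+
  have "\<And>w. w \<in> {x. in_space m x} \<Longrightarrow> ?M w = 0 \<Longrightarrow> w = 0" using inj by blast
  from M.ex_polynomial_left_inverse[OF in_space_basis in_space_span_unit this]
  obtain p where p: "\<And>w. in_space m w \<Longrightarrow> M.papp p (?M w) = w" by blast
  define N where "N v = M.papp p (cmv m B v)" for v
  have Nsp: "in_space m (N v)" for v unfolding N_def using M.papp_W[of "cmv m B v" p] in_space_cmv by simp
  interpret N: lin_op "vscale :: complex \<Rightarrow> _" N "{x. in_space m x}"
    by (rule lin_op_vscale) (simp only: N_def cmv_add cmv_scale M.papp_vadd M.papp_vscale, simp only: N_def cmv_add cmv_scale M.papp_vadd M.papp_vscale, rule Nsp)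
  obtain p' where p': "p' \<noteq> 0" "\<And>w. in_space m w \<Longrightarrow> N.papp p' w = 0"
    using N.ex_annihilator[OF in_space_basis in_space_span_unit] by blast
  have "finite ((\<lambda>k. z - 1 / k) ` {k. poly p' k = 0} \<union> {z})" using poly_roots_finite[OF p'(1)] by simp
  then have fin: "finite ((of_rat :: rat \<Rightarrow> complex) -` ((\<lambda>k. z - 1 / k) ` {k. poly p' k = 0} \<union> {z}))"
    by (rule finite_vimageI) (auto simp: inj_def)
  obtain r :: rat where r: "of_rat r \<notin> (\<lambda>k. z - 1 / k) ` {k. poly p' k = 0} \<union> {z}"
    using ex_new_if_finite[OF infinite_UNIV_char_0 fin] by blast
  show ?thesis
  proof (intro exI[of _ r] allI impI, rule ccontr)
    fix v assume v: "in_space m v" "cmv m (\<lambda>i j. A i j + of_rat r * B i j) v = 0" "v \<noteq> 0"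
    have zr: "z - of_rat r \<noteq> 0" using r by auto
    have "?M v = cmv m (\<lambda>i j. A i j + of_rat r * B i j) v + vscale (z - of_rat r) (cmv m B v)"
      by (auto simp: cmv_def fun_eq_iff algebra_simps sum.distrib sum_subtractf sum_distrib_left)
    then have "?M v = vscale (z - of_rat r) (cmv m B v)" using v(2) by simp
    then have "v = vscale (z - of_rat r) (N v)" using p[OF v(1)] by (simp only: N_def M.papp_vscale)
    then have "N v = vscale (1 / (z - of_rat r)) v" using zr by (simp add: fun_eq_iff)
    from N.papp_eigen[OF this, of p'] have "vscale (poly p' (1 / (z - of_rat r))) v = 0" using p'(2)[OF v(1)] by simp
    then have "poly p' (1 / (z - of_rat r)) = 0" using v(3) by (auto simp: fun_eq_iff)
    moreover have "of_rat r = z - 1 / (1 / (z - of_rat r))" by simp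
    ultimately show False using r by blast
  qed
qed

lemma functional_lie_br:
  fixes v :: "nat \<Rightarrow> complex" and \<pi> :: "complex \<Rightarrow> rat"
  assumes add: "\<And>x y. \<pi> (x + y) = \<pi> x + \<pi> y" and scale: "\<And>q x. \<pi> (of_rat q * x) = q * \<pi> x"
  shows "(\<lambda>i. \<pi> (lie_br m c v (rc y) i)) = lie_br m c (\<lambda>i. \<pi> (v i)) y"
    "(\<lambda>i. \<pi> (lie_br m c (rc y) v i)) = lie_br m c y (\<lambda>i. \<pi> (v i))"
proof -
  have z: "\<pi> 0 = 0" using scale[of 0 0] by simp
  have s: "\<pi> (sum f J) = (\<Sum>j\<in>J. \<pi> (f j))" for f and J :: "nat set"
    by (induction J rule: infinite_finite_induct) (auto simp: z add)
  have 1: "\<pi> (of_rat a * x * of_rat b) = a * \<pi> x * b" for a b x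
    using scale[of "a * b" x] by (simp add: of_rat_mult mult_ac)
  have 2: "\<pi> (of_rat a * of_rat b * x) = a * b * \<pi> x" for a b x
    using scale[of "a * b" x] by (simp add: of_rat_mult mult_ac)
  show "(\<lambda>i. \<pi> (lie_br m c v (rc y) i)) = lie_br m c (\<lambda>i. \<pi> (v i)) y"
    "(\<lambda>i. \<pi> (lie_br m c (rc y) v i)) = lie_br m c y (\<lambda>i. \<pi> (v i))"
    by (auto simp: lie_br_def fun_eq_iff z s 1 2 rc_def)
qed

text \<open>\<omega> is a maximal linearly independent subset over Q, and the \<pi> w are the
  coordinate functionals extended to all complex numbers.\<close>

lemma ex_coordinates:
  assumes "finite S"
  shows "\<exists>\<omega> (\<pi>::complex \<Rightarrow> complex \<Rightarrow> rat). finite \<omega> \<and>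
    (\<forall>w\<in>\<omega>. (\<forall>x y. \<pi> w (x + y) = \<pi> w x + \<pi> w y) \<and> (\<forall>q x. \<pi> w (of_rat q * x) = q * \<pi> w x)) \<and>
    (\<forall>x\<in>S. x = (\<Sum>w\<in>\<omega>. w * of_rat (\<pi> w x)))"
proof -
  interpret Q: vector_space "(*) :: rat \<Rightarrow> rat \<Rightarrow> rat" by unfold_locales (auto simp: algebra_simps)
  interpret vp: vector_space_pair ratsc "(*) :: rat \<Rightarrow> rat \<Rightarrow> rat" ..
  obtain \<omega> where w: "\<omega> \<subseteq> S" "QC.independent \<omega>" "S \<subseteq> QC.span \<omega>"
    using QC.maximal_independent_subset[of S] by blast
  have fin: "finite \<omega>" using finite_subset[OF w(1) assms] .
  have "\<forall>w. \<exists>g. Vector_Spaces.linear ratsc (*) g \<and> (\<forall>x\<in>\<omega>. g x = (if x = w then 1 else 0))"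
  proof
    fix w
    show "\<exists>g. Vector_Spaces.linear ratsc (*) g \<and> (\<forall>x\<in>\<omega>. g x = (if x = w then 1 else 0))"
      by (rule vp.linear_independent_extend[OF w(2)])
  qed
  then obtain \<pi> where pi: "\<And>w. Vector_Spaces.linear ratsc (*) (\<pi> w)" "\<And>w x. x \<in> \<omega> \<Longrightarrow> \<pi> w x = (if x = w then 1 else 0)"
    by metis
  have lin: "\<pi> w (x + y) = \<pi> w x + \<pi> w y" "\<pi> w (of_rat q * x) = q * \<pi> w x" for w x y q
  proof -
    interpret g: Vector_Spaces.linear ratsc "(*)" "\<pi> w" by (rule pi)
    show "\<pi> w (x + y) = \<pi> w x + \<pi> w y" "\<pi> w (of_rat q * x) = q * \<pi> w x" by (rule g.add, rule g.scale)
  qed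
  have "x = (\<Sum>w\<in>\<omega>. w * of_rat (\<pi> w x))" if "x \<in> QC.span \<omega>" for x
    using that
  proof (induction rule: QC.span_induct_alt)
    case base
    have "\<pi> w 0 = 0" for w using lin(2)[of w 0 0] by simp
    then show ?case by simp
  next
    case (step q u y)
    have "(\<Sum>w\<in>\<omega>. w * of_rat (\<pi> w (ratsc q u + y))) = of_rat q * (\<Sum>w\<in>\<omega>. w * of_rat (\<pi> w u)) + (\<Sum>w\<in>\<omega>. w * of_rat (\<pi> w y))"
      by (simp only: lin of_rat_add of_rat_mult) (simp add: algebra_simps sum.distrib sum_distrib_left)
    also have "(\<Sum>w\<in>\<omega>. w * of_rat (\<pi> w u)) = (\<Sum>w\<in>\<omega>. if w = u then u else 0)"
      using step(1) pi(2) by (intro sum.cong) auto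
    also have "\<dots> = u" using step(1) fin by simp
    finally show ?case using step(2) by simp
  qed
  with w(3) lin fin show ?thesis by (intro exI[of _ \<omega>] exI[of _ \<pi>]) auto
qed

text \<open>The derivation is multiplication by k on the component of degree k; it is injective
  because the component of degree 0 vanishes.\<close>

lemma derivation_from_grading:
  assumes "has_very_special_grading_C m c"
  obtains d where "\<And>x y. in_space m x \<Longrightarrow> in_space m y \<Longrightarrow>
      cmv m d (lie_br m c x y) = lie_br m c (cmv m d x) y + lie_br m c x (cmv m d y)"
    "\<And>x. in_space m x \<Longrightarrow> cmv m d x = 0 \<Longrightarrow> x = 0"
proof -
  obtain V where V: "is_grading_C m c V" "V 0 = {\<lambda>_. 0}"
    using assms by (auto simp: has_very_special_grading_C_def)
  define isdec where "isdec f x \<longleftrightarrow> finite {k. f k \<noteq> (0 :: nat \<Rightarrow> complex)} \<and> (\<forall>k. f k \<in> V k) \<and> x = (\<Sum>k\<in>{k. f k \<noteq> 0}. f k)"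
    for f :: "int \<Rightarrow> nat \<Rightarrow> complex" and x
  have cv: "(\<lambda>i. \<Sum>k\<in>{k. g k \<noteq> 0}. g k i) = (\<Sum>k\<in>{k. g k \<noteq> 0}. g k)" for g :: "int \<Rightarrow> nat \<Rightarrow> complex"
    by (auto simp: fun_eq_iff sum_fun_apply)
  have ex1: "\<exists>!f. isdec f x" if "in_space m x" for x
    using V(1)[unfolded is_grading_C_def, THEN conjunct2, THEN conjunct1, THEN spec, THEN mp, OF that]
    unfolding isdec_def zero_fun_def[symmetric] cv .
  have cs: "complex_subspace m (V k)" for k
    by (rule V(1)[unfolded is_grading_C_def, THEN conjunct1, THEN spec])
  have Vs: "0 \<in> V k" "\<And>x y. x \<in> V k \<Longrightarrow> y \<in> V k \<Longrightarrow> x + y \<in> V k" "\<And>a x. x \<in> V k \<Longrightarrow> vscale a x \<in> V k"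
    "\<And>x. x \<in> V k \<Longrightarrow> in_space m x" for k
    using cs[of k] unfolding complex_subspace_def vadd_plus zero_fun_def[symmetric] by blast+
  have Vbr: "\<And>k l x y. x \<in> V k \<Longrightarrow> y \<in> V l \<Longrightarrow> lie_br m c x y \<in> V (k + l)"
    using V(1)[unfolded is_grading_C_def, THEN conjunct2, THEN conjunct2] by blast
  define dec where "dec x = (THE f. isdec f x)" for x
  have dec: "isdec (dec x) x" if "in_space m x" for x unfolding dec_def by (rule theI'[OF ex1[OF that]])
  have decI: "dec x = f" if "isdec f x" "in_space m x" for f x
    using the1_equality[OF ex1[OF that(2)], of f] that(1) unfolding dec_def by metis
  \<comment> \<open>Sums may run over any finite set containing the support, so decompositions with
    different supports can be combined.\<close>
  have mono: "(\<Sum>k\<in>J. f k) = (\<Sum>k\<in>{k. f k \<noteq> 0}. f k)" if "finite J" "{k. f k \<noteq> 0} \<subseteq> J"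
    for f :: "int \<Rightarrow> nat \<Rightarrow> complex" and J using that by (intro sum.mono_neutral_right) blast+
  have sumJ: "(\<Sum>k\<in>J. f k) = x" if "isdec f x" "finite J" "{k. f k \<noteq> 0} \<subseteq> J" for f x J
    using that(1) mono[OF that(2,3)] unfolding isdec_def by metis
  have isdecI: "isdec f x" if J: "finite J" "{k. f k \<noteq> 0} \<subseteq> J" and f: "\<And>k. f k \<in> V k" "x = (\<Sum>k\<in>J. f k)" for f x J
    unfolding isdec_def using finite_subset[OF J(2,1)] f mono[OF J] by blast
  define D where "D x = (\<Sum>k\<in>{k. dec x k \<noteq> 0}. vscale (of_int k) (dec x k))" for x
  have DJ: "D x = (\<Sum>k\<in>J. vscale (of_int k) (dec x k))" if "finite J" "{k. dec x k \<noteq> 0} \<subseteq> J" for x J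
    unfolding D_def
  proof (rule sum.mono_neutral_left[OF that], intro ballI)
    fix k assume "k \<in> J - {k. dec x k \<noteq> 0}"
    then have "dec x k = 0" by blast
    then show "vscale (of_int k) (dec x k) = 0" by (simp add: fun_eq_iff)
  qed
  have sp: "in_space m x \<Longrightarrow> in_space m y \<Longrightarrow> in_space m (x + y)" "in_space m x \<Longrightarrow> in_space m (vscale a x)"
    for x y :: "nat \<Rightarrow> complex" and a by (auto simp: in_space_def)
  have fins: "finite {k. dec x k \<noteq> 0}" if "in_space m x" for x using dec[OF that] unfolding isdec_def by blast
  have dV: "dec x k \<in> V k" if "in_space m x" for x k using dec[OF that] unfolding isdec_def by blast
  have D_add: "D (x + y) = D x + D y" if x: "in_space m x" and y: "in_space m y" for x y
  proof -
    let ?J = "{k. dec x k \<noteq> 0} \<union> {k. dec y k \<noteq> 0}"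
    have J: "finite ?J" using fins x y by simp
    have "isdec (\<lambda>k. dec x k + dec y k) (x + y)"
    proof (rule isdecI[OF J])
      show "dec x k + dec y k \<in> V k" for k by (rule Vs(2)[OF dV[OF x] dV[OF y]])
      show "x + y = (\<Sum>k\<in>?J. dec x k + dec y k)"
        unfolding sum.distrib sumJ[OF dec[OF x] J Un_upper1] sumJ[OF dec[OF y] J Un_upper2] ..
    qed auto
    from decI[OF this sp(1)[OF x y]] have d: "dec (x + y) = (\<lambda>k. dec x k + dec y k)" .
    have "D (x + y) = (\<Sum>k\<in>?J. vscale (of_int k) (dec (x + y) k))" by (rule DJ[OF J]) (auto simp: d)
    also have "\<dots> = (\<Sum>k\<in>?J. vscale (of_int k) (dec x k)) + (\<Sum>k\<in>?J. vscale (of_int k) (dec y k))"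
      unfolding d sum.distrib[symmetric] by (intro sum.cong) (auto simp: fun_eq_iff algebra_simps)
    also have "\<dots> = D x + D y" unfolding DJ[OF J Un_upper1] DJ[OF J Un_upper2] ..
    finally show ?thesis .
  qed
  have D_scale: "D (vscale a x) = vscale a (D x)" if x: "in_space m x" for a x
  proof -
    let ?J = "{k. dec x k \<noteq> 0}"
    have J: "finite ?J" using fins x by simp
    have xs: "x = (\<Sum>k\<in>?J. dec x k)" using dec[OF x] unfolding isdec_def by blast
    have "isdec (\<lambda>k. vscale a (dec x k)) (vscale a x)"
    proof (rule isdecI[OF J])
      show "vscale a x = (\<Sum>k\<in>?J. vscale a (dec x k))"
        by (subst xs) (simp add: fun_eq_iff sum_fun_apply sum_distrib_left)
      show "vscale a (dec x k) \<in> V k" for k by (rule Vs(3)[OF dV[OF x]])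
    qed (auto simp: fun_eq_iff)
    from decI[OF this sp(2)[OF x]] have d: "dec (vscale a x) = (\<lambda>k. vscale a (dec x k))" .
    have "D (vscale a x) = (\<Sum>k\<in>?J. vscale (of_int k) (dec (vscale a x) k))"
      by (rule DJ[OF J]) (auto simp: d fun_eq_iff)
    also have "\<dots> = vscale a (D x)"
      unfolding d D_def by (auto simp: fun_eq_iff sum_fun_apply sum_distrib_left mult_ac)
    finally show ?thesis .
  qed
  have D_sp: "in_space m (D x)" if "in_space m x" for x
    using Vs(4)[OF dV[OF that]] by (auto simp: D_def in_space_def sum_fun_apply intro!: sum.neutral)
  have D_hom: "D x = vscale (of_int k) x" if x: "x \<in> V k" for x k
  proof -
    have "isdec (\<lambda>j. if j = k then x else 0) x"
      by (rule isdecI[of "{k}"]) (use x Vs(1) in auto)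
    from decI[OF this Vs(4)[OF x]] have d: "dec x = (\<lambda>j. if j = k then x else 0)" .
    have "D x = (\<Sum>j\<in>{k}. vscale (of_int j) (dec x j))" by (rule DJ) (auto simp: d)
    then show ?thesis by (simp add: d)
  qed
  have D_sum: "D (sum f J) = (\<Sum>j\<in>J. D (f j))" if "\<And>j. j \<in> J \<Longrightarrow> in_space m (f j)" for f and J :: "int set"
    using that
  proof (induction J rule: infinite_finite_induct)
    case (insert j J)
    have "in_space m (sum f J)" using insert.prems by (auto simp: in_space_def sum_fun_apply intro!: sum.neutral)
    moreover have "D (sum f J) = (\<Sum>j\<in>J. D (f j))" using insert by blast
    ultimately show ?case using insert.prems by (simp only: sum.insert[OF insert.hyps] D_add insertI1)
  qed (use D_hom[OF Vs(1)[of 0]] in \<open>auto simp: fun_eq_iff\<close>)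
  have bl: "bilin vscale (lie_br m c :: (nat \<Rightarrow> complex) \<Rightarrow> _)" by (rule bilin_lie_br)
  note bs = bilin_sum[OF bl bilin_zero[OF bl]]
  have D_br: "D (lie_br m c x y) = lie_br m c (D x) y + lie_br m c x (D y)" if x: "in_space m x" and y: "in_space m y" for x y
  proof -
    let ?J = "{k. dec x k \<noteq> 0}" and ?L = "{k. dec y k \<noteq> 0}"
    have xs: "x = (\<Sum>k\<in>?J. dec x k)" and ys: "y = (\<Sum>l\<in>?L. dec y l)"
      using dec[OF x] dec[OF y] unfolding isdec_def by blast+
    have sc: "lie_br m c (vscale a u) v = vscale a (lie_br m c u v)" "lie_br m c u (vscale a v) = vscale a (lie_br m c u v)"
      for a and u v :: "nat \<Rightarrow> complex" using bl by (auto simp: bilin_def)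
    have "lie_br m c (\<Sum>k\<in>?J. dec x k) (\<Sum>l\<in>?L. dec y l) = (\<Sum>k\<in>?J. \<Sum>l\<in>?L. lie_br m c (dec x k) (dec y l))"
      by (subst bs(1)) (simp only: bs(2))
    then have "lie_br m c x y = (\<Sum>k\<in>?J. \<Sum>l\<in>?L. lie_br m c (dec x k) (dec y l))"
      by (simp only: xs[symmetric] ys[symmetric])
    then have "D (lie_br m c x y) = (\<Sum>k\<in>?J. D (\<Sum>l\<in>?L. lie_br m c (dec x k) (dec y l)))"
      by (simp only:) (rule D_sum, auto simp: in_space_def sum_fun_apply lie_br_def intro!: sum.neutral)
    also have "\<dots> = (\<Sum>k\<in>?J. \<Sum>l\<in>?L. D (lie_br m c (dec x k) (dec y l)))"
      by (intro sum.cong refl D_sum in_space_lie_br)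
    also have "\<dots> = (\<Sum>k\<in>?J. \<Sum>l\<in>?L. lie_br m c (vscale (of_int k) (dec x k)) (dec y l) + lie_br m c (dec x k) (vscale (of_int l) (dec y l)))"
    proof (intro sum.cong refl)
      fix k l
      have "D (lie_br m c (dec x k) (dec y l)) = vscale (of_int (k + l)) (lie_br m c (dec x k) (dec y l))"
        by (rule D_hom[OF Vbr[OF dV[OF x] dV[OF y]]])
      then show "D (lie_br m c (dec x k) (dec y l)) = lie_br m c (vscale (of_int k) (dec x k)) (dec y l) + lie_br m c (dec x k) (vscale (of_int l) (dec y l))"
        unfolding sc by (auto simp: fun_eq_iff algebra_simps)
    qed
    also have "\<dots> = lie_br m c (D x) (\<Sum>l\<in>?L. dec y l) + lie_br m c (\<Sum>k\<in>?J. dec x k) (D y)"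
    proof -
      have 1: "lie_br m c (D x) (\<Sum>l\<in>?L. dec y l) = (\<Sum>k\<in>?J. \<Sum>l\<in>?L. lie_br m c (vscale (of_int k) (dec x k)) (dec y l))"
        unfolding D_def by (subst bs(1)) (simp only: bs(2))
      have 2: "lie_br m c (\<Sum>k\<in>?J. dec x k) (D y) = (\<Sum>k\<in>?J. \<Sum>l\<in>?L. lie_br m c (dec x k) (vscale (of_int l) (dec y l)))"
        unfolding D_def by (subst bs(1)) (simp only: bs(2))
      show ?thesis unfolding 1 2 sum.distrib ..
    qed
    finally show ?thesis by (simp only: xs[symmetric] ys[symmetric])
  qed
  have D_inj: "x = 0" if x: "in_space m x" and D0: "D x = 0" for x
  proof -
    let ?J = "{k. dec x k \<noteq> 0}"
    have z: "in_space m 0" by (simp add: in_space_def)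
    have "isdec (\<lambda>k. vscale (of_int k) (dec x k)) 0"
    proof (rule isdecI[OF fins[OF x]])
      show "vscale (of_int k) (dec x k) \<in> V k" for k by (rule Vs(3)[OF dV[OF x]])
      show "0 = (\<Sum>k\<in>?J. vscale (of_int k) (dec x k))" using D0 unfolding D_def by (rule sym)
    qed (auto simp: fun_eq_iff)
    moreover have "isdec (\<lambda>k. 0) 0" by (rule isdecI[of "{}"]) (use Vs(1) in auto)
    ultimately have eq: "(\<lambda>k. vscale (of_int k) (dec x k)) = (\<lambda>k. 0)" using decI[OF _ z] by metis
    have "vscale (of_int k) (dec x k) = 0" for k using fun_cong[OF eq] .
    then have "dec x k = 0" if "k \<noteq> 0" for k using that by (auto simp: fun_eq_iff)
    moreover have "dec x 0 = 0" using dV[OF x, of 0] V(2) by (simp add: zero_fun_def)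
    ultimately have "dec x k = 0" for k by metis
    then have "{k. dec x k \<noteq> 0} = {}" by blast
    with dec[OF x] show "x = 0" unfolding isdec_def by (metis sum.empty)
  qed
  define d where "d i j = D (unit_vec j) i" for i j
  have Dd: "D x = cmv m d x" if x: "in_space m x" for x
  proof -
    have "D (\<Sum>i\<in>J. vscale (x i) (unit_vec i)) = (\<Sum>i\<in>J. vscale (x i) (D (unit_vec i)))"
      if "finite J" "J \<subseteq> {..<m}" for J
      using that
    proof (induction J)
      case empty
      have "D 0 = vscale (of_int 0) 0" by (rule D_hom[OF Vs(1)])
      also have "\<dots> = (0 :: nat \<Rightarrow> complex)" by (rule ext) (simp only: vscale_apply of_int_0 mult_zero_left zero_fun_apply)
      finally show ?case by (simp only: sum.empty)
    next
      case (insert i J)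
      have u: "in_space m (unit_vec i :: nat \<Rightarrow> complex)" using insert.prems by (intro in_space_unit_vec) auto
      have s: "in_space m (\<Sum>i\<in>J. vscale (x i) (unit_vec i :: nat \<Rightarrow> complex))"
        using insert.prems by (auto simp: in_space_def sum_fun_apply unit_vec_def intro!: sum.neutral)
      have IH: "D (\<Sum>i\<in>J. vscale (x i) (unit_vec i)) = (\<Sum>i\<in>J. vscale (x i) (D (unit_vec i)))" using insert by blast
      show ?case by (simp only: sum.insert[OF insert.hyps] D_add[OF sp(2)[OF u] s] D_scale[OF u] IH)
    qed
    from this[of "{..<m}"] have "D x = (\<Sum>i<m. vscale (x i) (D (unit_vec i)))"
      using in_space_expand[OF x] by simp
    moreover have "in_space m (D x)" by (rule D_sp[OF x])
    ultimately show ?thesis by (auto simp: cmv_def d_def fun_eq_iff sum_fun_apply in_space_def mult.commute)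
  qed
  show thesis
  proof (rule that[of d])
    fix x y :: "nat \<Rightarrow> complex" assume "in_space m x" "in_space m y"
    then show "cmv m d (lie_br m c x y) = lie_br m c (cmv m d x) y + lie_br m c x (cmv m d y)"
      using D_br[of x y] by (simp only: Dd in_space_lie_br)
  next
    fix x assume "in_space m x" "cmv m d x = 0"
    then show "x = 0" using D_inj[of x] by (simp only: Dd)
  qed
qed

text \<open>Expanding the entries of d over rationally independent numbers w writes d as the sum of
  w times rational matrices. Each of these is a derivation, since the coordinate functionals commute
  with the rational structure constants. Any rational combination is again a derivation, and
  injectivity survives when the numbers w are replaced by suitable rationals one after the
  other.\<close>

theorem rational_derivation:
  assumes "has_very_special_grading_C m c"
  obtains D :: "nat \<Rightarrow> nat \<Rightarrow> rat" where
    "\<And>x y :: nat \<Rightarrow> rat. in_space m x \<Longrightarrow> in_space m y \<Longrightarrow>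
      mv m D (lie_br m c x y) = lie_br m c (mv m D x) y + lie_br m c x (mv m D y)"
    "\<And>x :: nat \<Rightarrow> rat. in_space m x \<Longrightarrow> mv m D x = 0 \<Longrightarrow> x = 0"
proof -
  obtain d where d: "\<And>x y. in_space m x \<Longrightarrow> in_space m y \<Longrightarrow>
      cmv m d (lie_br m c x y) = lie_br m c (cmv m d x) y + lie_br m c x (cmv m d y)"
    "\<And>x. in_space m x \<Longrightarrow> cmv m d x = 0 \<Longrightarrow> x = 0" using derivation_from_grading[OF assms] by metis
  have "finite ((\<lambda>(i, j). d i j) ` ({..<m} \<times> {..<m}))" by simp
  from ex_coordinates[OF this] obtain \<omega> and \<pi> :: "complex \<Rightarrow> complex \<Rightarrow> rat" where w: "finite \<omega>"
    "\<forall>w\<in>\<omega>. (\<forall>x y. \<pi> w (x + y) = \<pi> w x + \<pi> w y) \<and> (\<forall>q x. \<pi> w (of_rat q * x) = q * \<pi> w x)"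
    "\<forall>x\<in>(\<lambda>(i, j). d i j) ` ({..<m} \<times> {..<m}). x = (\<Sum>w\<in>\<omega>. w * of_rat (\<pi> w x))" by (elim exE conjE) (rule that)
  define Dw where "Dw w = (\<lambda>i j. \<pi> w (d i j))" for w
  have lin: "\<And>x y. \<pi> w (x + y) = \<pi> w x + \<pi> w y" "\<And>q x. \<pi> w (of_rat q * x) = q * \<pi> w x" if "w \<in> \<omega>" for w
    using w(2) that by blast+
  have mvw: "mv m (Dw w) x = (\<lambda>i. \<pi> w (cmv m d (rc x) i))" if "w \<in> \<omega>" for w and x :: "nat \<Rightarrow> rat"
  proof -
    have z: "\<pi> w 0 = 0" using lin(2)[OF that, of 0 0] by simp
    have s: "\<pi> w (sum f J) = (\<Sum>j\<in>J. \<pi> w (f j))" for f and J :: "nat set"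
      by (induction J rule: infinite_finite_induct) (auto simp: z lin(1)[OF that])
    have "\<pi> w (d i j * of_rat (x j)) = \<pi> w (d i j) * x j" for i j
      using lin(2)[OF that, of "x j" "d i j"] by (simp add: mult.commute)
    then show ?thesis by (auto simp: mv_def cmv_def Dw_def rc_def fun_eq_iff z s)
  qed
  have der: "mv m (Dw w) (lie_br m c x y) = lie_br m c (mv m (Dw w) x) y + lie_br m c x (mv m (Dw w) y)"
    if w': "w \<in> \<omega>" and x: "in_space m x" and y: "in_space m y" for w and x y :: "nat \<Rightarrow> rat"
  proof -
    have rcs: "in_space m (rc x :: nat \<Rightarrow> complex)" "in_space m (rc y :: nat \<Rightarrow> complex)" using x y by (auto simp: in_space_def rc_def)
    have "mv m (Dw w) (lie_br m c x y) = (\<lambda>i. \<pi> w (cmv m d (lie_br m c (rc x) (rc y)) i))"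
      unfolding mvw[OF w'] lie_br_rc ..
    also have "\<dots> = (\<lambda>i. \<pi> w (lie_br m c (cmv m d (rc x)) (rc y) i)) + (\<lambda>i. \<pi> w (lie_br m c (rc x) (cmv m d (rc y)) i))"
      unfolding d(1)[OF rcs] by (auto simp: fun_eq_iff lin(1)[OF w'])
    also have "\<dots> = lie_br m c (mv m (Dw w) x) y + lie_br m c x (mv m (Dw w) y)"
      unfolding functional_lie_br[of "\<pi> w", OF lin[OF w']] mvw[OF w'] ..
    finally show ?thesis .
  qed
  \<comment> \<open>\<open>J\<close> is the set of coefficients already made rational. The start t w
    = w reproduces d.\<close>
  have main: "\<exists>t. (\<forall>w\<in>J. t w \<in> \<rat>) \<and>
    (\<forall>v. in_space m v \<longrightarrow> cmv m (\<lambda>i j. \<Sum>w\<in>\<omega>. t w * of_rat (Dw w i j)) v = 0 \<longrightarrow> v = 0)"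
    if "finite J" "J \<subseteq> \<omega>" for J
    using that
  proof (induction J)
    case empty
    have eq: "cmv m (\<lambda>i j. \<Sum>w\<in>\<omega>. w * of_rat (Dw w i j)) v = cmv m d v" for v
    proof -
      have "d i j = (\<Sum>w\<in>\<omega>. w * of_rat (Dw w i j))" if "i < m" "j < m" for i j
        using bspec[OF w(3), of "d i j"] that unfolding Dw_def by auto
      then show ?thesis unfolding cmv_def by (intro ext if_cong sum.cong refl) simp
    qed
    show ?case
    proof (rule exI[of _ "\<lambda>w. w"], intro conjI ballI allI impI)
      fix v assume "in_space m v" "cmv m (\<lambda>i j. \<Sum>w\<in>\<omega>. w * of_rat (Dw w i j)) v = 0"
      then show "v = 0" unfolding eq by (rule d(2))
    qed simp
  next
    case (insert u J)
    then have "J \<subseteq> \<omega>" by simp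
    from insert.IH[OF this] obtain t where t: "\<forall>w\<in>J. t w \<in> \<rat>"
      "\<forall>v. in_space m v \<longrightarrow> cmv m (\<lambda>i j. \<Sum>w\<in>\<omega>. t w * of_rat (Dw w i j)) v = 0 \<longrightarrow> v = 0"
      by (elim exE conjE) (rule that)
    have u: "u \<in> \<omega>" using insert by simp
    let ?A = "\<lambda>i j. \<Sum>w\<in>\<omega> - {u}. t w * of_rat (Dw w i j)"
    have split: "(\<Sum>w\<in>\<omega>. t' w * of_rat (Dw w i j)) = ?A i j + t' u * of_rat (Dw u i j)"
      if "\<And>w. w \<noteq> u \<Longrightarrow> t' w = t w" for t' i j
      using that by (subst sum.remove[OF w(1) u]) (auto intro!: sum.cong)
    have inj: "cmv m (\<lambda>i j. ?A i j + t u * of_rat (Dw u i j)) v = 0 \<Longrightarrow> v = 0" if "in_space m v" for v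
      using t(2)[THEN spec, THEN mp, OF that] unfolding split[of t, OF refl] by (rule mp)
    from perturb_injective[where A = ?A and z = "t u" and B = "\<lambda>i j. of_rat (Dw u i j)", OF inj]
    obtain r :: rat where r: "\<forall>v. in_space m v \<longrightarrow> cmv m (\<lambda>i j. ?A i j + of_rat r * of_rat (Dw u i j)) v = 0 \<longrightarrow> v = 0" by blast
    let ?t = "t(u := of_rat r)"
    have "(\<Sum>w\<in>\<omega>. ?t w * of_rat (Dw w i j)) = ?A i j + of_rat r * of_rat (Dw u i j)" for i j
      using split[of ?t i j] by simp
    then have "\<forall>v. in_space m v \<longrightarrow> cmv m (\<lambda>i j. \<Sum>w\<in>\<omega>. ?t w * of_rat (Dw w i j)) v = 0 \<longrightarrow> v = 0"
      using r by (simp only:)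
    moreover have "\<forall>w\<in>insert u J. ?t w \<in> \<rat>" using t(1) by auto
    ultimately show ?case by blast
  qed
  from main[OF w(1) subset_refl] obtain t where t: "\<forall>w\<in>\<omega>. t w \<in> \<rat>"
    "\<forall>v. in_space m v \<longrightarrow> cmv m (\<lambda>i j. \<Sum>w\<in>\<omega>. t w * of_rat (Dw w i j)) v = 0 \<longrightarrow> v = 0"
    by (elim exE conjE) (rule that)
  define r where "r w = (SOME r. t w = of_rat r)" for w
  have r: "t w = of_rat (r w)" if "w \<in> \<omega>" for w
  proof -
    have "t w \<in> \<rat>" using t(1) that by blast
    then have "\<exists>r. t w = of_rat r" by (rule Rats_cases) blast
    then show ?thesis unfolding r_def by (rule someI_ex)
  qed
  define D where "D i j = (\<Sum>w\<in>\<omega>. r w * Dw w i j)" for i j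
  have mvD: "mv m D x = (\<Sum>w\<in>\<omega>. vscale (r w) (mv m (Dw w) x))" for x :: "nat \<Rightarrow> rat"
  proof
    fix i
    have "(\<Sum>j<m. (\<Sum>w\<in>\<omega>. r w * Dw w i j) * x j) = (\<Sum>w\<in>\<omega>. r w * (\<Sum>j<m. Dw w i j * x j))"
      by (simp add: sum_distrib_left sum_distrib_right mult_ac) (rule sum.swap)
    then show "mv m D x i = (\<Sum>w\<in>\<omega>. vscale (r w) (mv m (Dw w) x)) i"
      by (auto simp: mv_def D_def sum_fun_apply)
  qed
  have bl: "bilin vscale (lie_br m c :: (nat \<Rightarrow> rat) \<Rightarrow> _)" by (rule bilin_lie_br)
  note bs = bilin_sum[OF bl bilin_zero[OF bl]]
  show thesis
  proof (rule that[of D])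
    fix x y :: "nat \<Rightarrow> rat" assume x: "in_space m x" and y: "in_space m y"
    have sc: "lie_br m c (vscale a u) v = vscale a (lie_br m c u v)" "lie_br m c u (vscale a v) = vscale a (lie_br m c u v)"
      for a and u v :: "nat \<Rightarrow> rat" using bl by (auto simp: bilin_def)
    have "mv m D (lie_br m c x y) = (\<Sum>w\<in>\<omega>. vscale (r w) (lie_br m c (mv m (Dw w) x) y + lie_br m c x (mv m (Dw w) y)))"
      unfolding mvD by (intro sum.cong refl) (simp only: der x y)
    also have "\<dots> = (\<Sum>w\<in>\<omega>. vscale (r w) (lie_br m c (mv m (Dw w) x) y)) + (\<Sum>w\<in>\<omega>. vscale (r w) (lie_br m c x (mv m (Dw w) y)))"
      unfolding sum.distrib[symmetric] by (intro sum.cong refl) (auto simp: fun_eq_iff algebra_simps)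
    also have "\<dots> = lie_br m c (mv m D x) y + lie_br m c x (mv m D y)" unfolding mvD bs sc ..
    finally show "mv m D (lie_br m c x y) = lie_br m c (mv m D x) y + lie_br m c x (mv m D y)" .
  next
    fix x :: "nat \<Rightarrow> rat" assume x: "in_space m x" and D0: "mv m D x = 0"
    have "(\<Sum>w\<in>\<omega>. t w * of_rat (Dw w i j)) = of_rat (D i j)" for i j
      unfolding D_def of_rat_sum of_rat_mult using r by (intro sum.cong) auto
    then have "cmv m (\<lambda>i j. \<Sum>w\<in>\<omega>. t w * of_rat (Dw w i j)) (rc x) = mv m D (rc x)"
      by (simp add: cmv_def mv_def)
    also have "\<dots> = 0" unfolding mv_rc D0 by (auto simp: rc_def fun_eq_iff)
    finally have "cmv m (\<lambda>i j. \<Sum>w\<in>\<omega>. t w * of_rat (Dw w i j)) (rc x) = 0" .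
    moreover have "in_space m (rc x :: nat \<Rightarrow> complex)" using x by (auto simp: in_space_def rc_def)
    ultimately have "rc x = (0 :: nat \<Rightarrow> complex)" using t(2) by blast
    then show "x = 0" by (auto simp: rc_def fun_eq_iff)
  qed
qed

section \<open>An order in the splitting field\<close>

lemma zspan_mult_left:
  fixes F :: "complex set"
  assumes "x \<in> zspan F" shows "a * x \<in> zspan ((\<lambda>y. a * y) ` F)"
  by (rule zspan_map[OF _ _ asub_zspan assms]) (auto simp: algebra_simps intro: zspan_base)

context galois
begin

text \<open>The order is the multiplier ring of a Galois stable lattice, generated by all conjugates
  of a basis. It inherits stability from the lattice, and it is contained in the lattice divided by
  a nonzero element b, which bounds it by a finitely generated group.\<close>

lemma ex_order:
  "\<exists>R. R \<subseteq> K \<and> 1 \<in> R \<and> asub R \<and> (\<forall>x\<in>R. \<forall>y\<in>R. x * y \<in> R) \<and> (\<forall>\<sigma>\<in>Gal. \<forall>x\<in>R. \<sigma> x \<in> R) \<and>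
    (\<forall>x\<in>K. \<exists>N>0. of_int N * x \<in> R) \<and> (\<exists>T. finite T \<and> R \<subseteq> zspan T)"
proof -
  obtain B where B: "finite B" "B \<subseteq> K" "K \<subseteq> QC.span B" using fdQ_basis[OF K(2)] by metis
  define G where "G = (\<Union>\<sigma>\<in>Gal. \<sigma> ` B)"
  have G: "finite G" "G \<subseteq> K" using B finite_Gal emb_K[OF Gal_emb] by (auto simp: G_def)
  have BG: "B \<subseteq> G"
  proof
    fix x assume x: "x \<in> B"
    then have "x = (\<lambda>x. if x \<in> K then x else 0) x" using B(2) by auto
    then show "x \<in> G" using id_Gal x unfolding G_def by blast
  qed
  define M where "M = zspan G"
  have aK: "asub K" using K_ring by (auto simp: asub_def subring_0 subring_diff)
  have MK: "M \<subseteq> K" unfolding M_def by (rule zspan_minimal[OF aK G(2)])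
  have aM: "asub M" unfolding M_def by (rule asub_zspan)
  have sM: "\<sigma> x \<in> M" if s: "\<sigma> \<in> Gal" and x: "x \<in> M" for \<sigma> x
  proof -
    have "x \<in> K \<and> \<sigma> x \<in> M" using x unfolding M_def
    proof (induction rule: zspan_induct)
      case zero
      then show ?case using emb_0[OF K_ring Gal_emb[OF s]] by (simp add: asub_zero asub_zspan subring_0[OF K_ring])
    next
      case (base y)
      then obtain \<tau> z where t: "\<tau> \<in> Gal" "z \<in> B" "y = \<tau> z" by (auto simp: G_def)
      have "\<sigma> y = comp \<sigma> \<tau> z" using t B(2) by (auto simp: comp_def)
      then have "\<sigma> y \<in> G" using comp_Gal[OF s t(1)] t(2) unfolding G_def by blast
      then show ?case using base G(2) by (auto intro: zspan_base)
    next
      case (diff x y)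
      then show ?case using emb_diff[OF K_ring Gal_emb[OF s]] K_ring by (auto simp: subring_diff intro: asub_diff[OF asub_zspan])
    qed
    then show ?thesis by simp
  qed
  define R where "R = {x \<in> K. \<forall>y\<in>M. x * y \<in> M}"
  have "1 \<in> K" by (rule subring_1[OF K_ring])
  then have "B \<noteq> {} \<and> \<not> B \<subseteq> {0}"
  proof -
    have "\<not> B \<subseteq> {0}"
    proof
      assume "B \<subseteq> {0}"
      then have "QC.span B \<subseteq> {0}" by (intro QC.span_minimal) auto
      with \<open>1 \<in> K\<close> B(3) show False by auto
    qed
    then show ?thesis by auto
  qed
  then obtain b where b: "b \<in> B" "b \<noteq> 0" by auto
  have bM: "b \<in> M" using b BG by (auto simp: M_def intro: zspan_base)
  show ?thesis
  proof (rule exI[of _ R], intro conjI ballI)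
    show "R \<subseteq> K" by (auto simp: R_def)
    show "1 \<in> R" using \<open>1 \<in> K\<close> by (simp add: R_def)
    show "asub R" unfolding asub_def R_def
      using K_ring aM by (auto simp: subring_0 subring_diff asub_zero left_diff_distrib asub_diff)
  next
    fix x y assume "x \<in> R" "y \<in> R"
    then show "x * y \<in> R" unfolding R_def using K_ring by (auto simp: subring_mult mult.assoc)
  next
    fix \<sigma> x assume s: "\<sigma> \<in> Gal" and x: "x \<in> R"
    obtain \<tau> where t: "\<tau> \<in> Gal" "\<And>x. x \<in> K \<Longrightarrow> \<sigma> (\<tau> x) = x" "\<And>x. x \<in> K \<Longrightarrow> \<tau> (\<sigma> x) = x"
      by (rule Gal_inverse[OF s]) (rule that; assumption)
    have xK: "x \<in> K" using x by (simp add: R_def)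
    have "\<sigma> x * y \<in> M" if y: "y \<in> M" for y
    proof -
      have ty: "\<tau> y \<in> M" by (rule sM[OF t(1) y])
      have yK: "y \<in> K" and tyK: "\<tau> y \<in> K" using y ty MK by auto
      have "\<sigma> x * y = \<sigma> (x * \<tau> y)"
        using emb_mult[OF K_ring Gal_emb[OF s] xK tyK] t(2)[OF yK] by simp
      moreover have "x * \<tau> y \<in> M" using x ty by (auto simp: R_def)
      ultimately show ?thesis using sM[OF s] by simp
    qed
    then show "\<sigma> x \<in> R" using emb_K[OF Gal_emb[OF s] xK] by (simp add: R_def)
  next
    fix x assume x: "x \<in> K"
    have "\<exists>N>0. \<forall>g\<in>S. of_int N * (x * g) \<in> M" if "finite S" "S \<subseteq> G" for S
      using that
    proof (induction S)
      case empty
      show ?case by (intro exI[of _ 1]) auto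
    next
      case (insert g S)
      then obtain N :: int where N: "N > 0" "\<forall>g\<in>S. of_int N * (x * g) \<in> M" by auto
      have "x * g \<in> K" using x insert.prems G(2) K_ring by (auto simp: subring_mult)
      then have "x * g \<in> QC.span B" using B(3) by blast
      from QC.clear_denominators[OF this] obtain N' D where N': "N' > 0" "D \<subseteq> B" "of_rat (of_int N') * (x * g) \<in> zspan D"
        by (elim exE conjE) (rule that)
      have "zspan D \<subseteq> M" unfolding M_def using N'(2) BG by (intro zspan_mono) auto
      then have 1: "of_int N' * (x * g) \<in> M" using N'(3) by auto
      show ?case
      proof (intro exI[of _ "N * N'"] conjI ballI)
        fix u assume "u \<in> insert g S"
        then show "of_int (N * N') * (x * u) \<in> M"
        proof
          assume "u = g"
          then show ?thesis using QC.asub_scale_int[OF aM 1, of N] by (simp add: mult.assoc)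
        next
          assume "u \<in> S"
          then have "of_int N * (x * u) \<in> M" using N by blast
          from QC.asub_scale_int[OF aM this, of N'] show ?thesis by (simp add: mult_ac)
        qed
      qed (use N N' in auto)
    qed
    from this[OF G(1) subset_refl] obtain N where N: "N > 0" "\<forall>g\<in>G. of_int N * (x * g) \<in> M" by auto
    have "of_int N * x * y \<in> M" if "y \<in> M" for y
      by (rule zspan_map[of "\<lambda>y. of_int N * x * y" G M])
        (use N that aM in \<open>auto simp: algebra_simps M_def\<close>)
    moreover have "of_int N * x \<in> K" using x K_ring by (simp add: subring_mult subring_int)
    ultimately show "\<exists>N>0. of_int N * x \<in> R" using N(1) by (intro exI[of _ N]) (simp add: R_def)
  next
    have "R \<subseteq> zspan ((\<lambda>y. (1 / b) * y) ` G)"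
    proof
      fix x assume "x \<in> R"
      then have "x * b \<in> zspan G" using bM by (auto simp: R_def M_def)
      from zspan_mult_left[OF this, of "1 / b"] show "x \<in> zspan ((\<lambda>y. (1 / b) * y) ` G)" using b by simp
    qed
    then show "\<exists>T. finite T \<and> R \<subseteq> zspan T" using G(1) by (intro exI[of _ "(\<lambda>y. (1 / b) * y) ` G"]) simp
  qed
qed

end

section \<open>Rational polynomials with prescribed values at the eigenvalues\<close>

lemma eproj_dvd_self:
  assumes "finite \<Lambda>" shows "[:-\<alpha>, 1:] ^ n dvd 1 - eproj \<Lambda> n \<alpha>"
proof (cases "n = 0")
  case False
  have "poly (1 - lag \<Lambda> \<alpha> ^ n) \<alpha> = 0" using poly_lag_self[OF assms] by simp
  then have "[:-\<alpha>, 1:] dvd 1 - lag \<Lambda> \<alpha> ^ n" unfolding poly_eq_0_iff_dvd .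
  then show ?thesis by (simp add: eproj_def dvd_power_same)
qed simp

lemma eproj_dvd_other:
  assumes "finite \<Lambda>" "\<alpha> \<in> \<Lambda>" "\<alpha> \<noteq> \<beta>" shows "[:-\<alpha>, 1:] ^ n dvd eproj \<Lambda> n \<beta>"
proof -
  have "[:-\<alpha>, 1:] dvd (\<Prod>\<gamma>\<in>\<Lambda> - {\<beta>}. [:-\<gamma>, 1:])" using assms by (intro dvd_prodI) auto
  then have "[:-\<alpha>, 1:] dvd lag \<Lambda> \<beta>" unfolding lag_def by (rule dvd_smult)
  then have "[:-\<alpha>, 1:] ^ n dvd lag \<Lambda> \<beta> ^ n" by (rule dvd_power_same)
  also have "\<dots> dvd eproj \<Lambda> n \<beta>" unfolding eproj_def by (rule one_minus_power_dvd)
  finally show ?thesis .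
qed

context galois
begin

lemma cpoly_linear: "a \<in> K \<Longrightarrow> cpoly K [:-a, 1:]"
  by (simp add: cpoly_0[OF K_ring] subring_1[OF K_ring] subring_uminus[OF K_ring])

lemma lag_denominator: "\<alpha> \<in> \<Lambda> \<Longrightarrow> 1 / (\<Prod>\<beta>\<in>\<Lambda> - {\<alpha>}. \<alpha> - \<beta>) \<in> K"
  using K(3) by (intro subfield_divide[OF K(1)] subring_1[OF K_ring] subring_prod[OF K_ring] subring_diff[OF K_ring]) auto

lemma cpoly_lag: "\<alpha> \<in> \<Lambda> \<Longrightarrow> cpoly K (lag \<Lambda> \<alpha>)"
  unfolding lag_def using K(3) by (intro cpoly_smult[OF K_ring] cpoly_prod[OF K_ring] lag_denominator cpoly_linear) auto

lemma cpoly_eproj: "\<alpha> \<in> \<Lambda> \<Longrightarrow> cpoly K (eproj \<Lambda> n \<alpha>)"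
  unfolding eproj_def by (intro cpoly_diff[OF K_ring] cpoly_power[OF K_ring] cpoly_1[OF K_ring] cpoly_lag)

lemma Gal_lag:
  assumes s: "\<sigma> \<in> Gal" and a: "\<alpha> \<in> \<Lambda>" shows "map_poly \<sigma> (lag \<Lambda> \<alpha>) = lag \<Lambda> (\<sigma> \<alpha>)"
proof -
  note e = Gal_emb[OF s]
  have LK: "\<And>x. x \<in> \<Lambda> \<Longrightarrow> x \<in> K" using K(3) by auto
  have bij: "bij_betw \<sigma> (\<Lambda> - {\<alpha>}) (\<Lambda> - {\<sigma> \<alpha>})"
    using bij_betw_DiffI[OF Gal_bij_roots[OF s], of "{\<alpha>}" "{\<sigma> \<alpha>}"] a emb_roots[OF e] by (simp add: bij_betw_def)
  have lin: "map_poly \<sigma> [:-\<beta>, 1:] = [:-\<sigma> \<beta>, 1:]" if "\<beta> \<in> \<Lambda>" for \<beta>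
    using LK[OF that] by (simp add: map_poly_pCons[where f = \<sigma>, OF emb_0[OF K_ring e]] emb_uminus[OF K_ring e] emb_1[OF K_ring e])
  have "map_poly \<sigma> (\<Prod>\<beta>\<in>\<Lambda> - {\<alpha>}. [:-\<beta>, 1:]) = (\<Prod>\<beta>\<in>\<Lambda> - {\<alpha>}. [:-\<sigma> \<beta>, 1:])"
    using LK by (subst map_poly_emb_prod[OF K_ring e]) (auto intro!: cpoly_linear prod.cong lin simp del: cpoly_pCons)
  also have "\<dots> = (\<Prod>\<beta>\<in>\<Lambda> - {\<sigma> \<alpha>}. [:-\<beta>, 1:])" by (rule prod.reindex_bij_betw[OF bij])
  finally have 1: "map_poly \<sigma> (\<Prod>\<beta>\<in>\<Lambda> - {\<alpha>}. [:-\<beta>, 1:]) = (\<Prod>\<beta>\<in>\<Lambda> - {\<sigma> \<alpha>}. [:-\<beta>, 1:])" .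
  have "\<sigma> (\<Prod>\<beta>\<in>\<Lambda> - {\<alpha>}. \<alpha> - \<beta>) = (\<Prod>\<beta>\<in>\<Lambda> - {\<alpha>}. \<sigma> \<alpha> - \<sigma> \<beta>)"
    using LK a by (subst emb_prod[OF K_ring e]) (auto intro!: prod.cong emb_diff[OF K_ring e] subring_diff[OF K_ring])
  also have "\<dots> = (\<Prod>\<beta>\<in>\<Lambda> - {\<sigma> \<alpha>}. \<sigma> \<alpha> - \<beta>)" by (rule prod.reindex_bij_betw[OF bij])
  finally have 2: "\<sigma> (\<Prod>\<beta>\<in>\<Lambda> - {\<alpha>}. \<alpha> - \<beta>) = (\<Prod>\<beta>\<in>\<Lambda> - {\<sigma> \<alpha>}. \<sigma> \<alpha> - \<beta>)" .
  have dK: "(\<Prod>\<beta>\<in>\<Lambda> - {\<alpha>}. \<alpha> - \<beta>) \<in> K"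
    using LK a by (intro subring_prod[OF K_ring] subring_diff[OF K_ring]) auto
  have 3: "\<sigma> (1 / (\<Prod>\<beta>\<in>\<Lambda> - {\<alpha>}. \<alpha> - \<beta>)) = 1 / (\<Prod>\<beta>\<in>\<Lambda> - {\<sigma> \<alpha>}. \<sigma> \<alpha> - \<beta>)"
    using emb_inverse[OF K_ring e K(1) dK] 2 by (simp add: divide_inverse)
  have cp: "cpoly K (\<Prod>\<beta>\<in>\<Lambda> - {\<alpha>}. [:-\<beta>, 1:])"
    using LK by (intro cpoly_prod[OF K_ring] cpoly_linear) auto
  show ?thesis unfolding lag_def map_poly_emb_smult[OF K_ring e lag_denominator[OF a] cp] 1 3 ..
qed

lemma Gal_eproj:
  assumes s: "\<sigma> \<in> Gal" and a: "\<alpha> \<in> \<Lambda>" shows "map_poly \<sigma> (eproj \<Lambda> n \<alpha>) = eproj \<Lambda> n (\<sigma> \<alpha>)"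
proof -
  note e = Gal_emb[OF s] and c1 = cpoly_1[OF K_ring] and cl = cpoly_lag[OF a]
  note cp = cpoly_power[OF K_ring]
  have d: "cpoly K (1 - lag \<Lambda> \<alpha> ^ n)" by (rule cpoly_diff[OF K_ring c1 cp[OF cl]])
  show ?thesis unfolding eproj_def
    by (simp only: map_poly_emb_diff[OF K_ring e c1 cp[OF d]] map_poly_emb_power[OF K_ring e d]
        map_poly_emb_diff[OF K_ring e c1 cp[OF cl]] map_poly_emb_power[OF K_ring e cl] map_poly_emb_1[OF K_ring e] Gal_lag[OF s a])
qed

text \<open>The sum of \<phi>(\<alpha>) times the projection polynomial of \<alpha> has the required
  residues. The Galois group permutes its terms by equivariance, so its coefficients are fixed and
  rational.\<close>

lemma rational_interpolation:
  assumes phiK: "\<And>\<alpha>. \<alpha> \<in> \<Lambda> \<Longrightarrow> \<phi> \<alpha> \<in> K"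
    and eqv: "\<And>\<sigma> \<alpha>. \<sigma> \<in> Gal \<Longrightarrow> \<alpha> \<in> \<Lambda> \<Longrightarrow> \<sigma> (\<phi> \<alpha>) = \<phi> (\<sigma> \<alpha>)"
  shows "\<exists>p :: rat poly. \<forall>\<alpha>\<in>\<Lambda>. [:-\<alpha>, 1:] ^ n dvd map_poly of_rat p - [:\<phi> \<alpha>:]"
proof -
  define P where "P = (\<Sum>\<alpha>\<in>\<Lambda>. smult (\<phi> \<alpha>) (eproj \<Lambda> n \<alpha>))"
  have ct: "cpoly K (smult (\<phi> \<alpha>) (eproj \<Lambda> n \<alpha>))" if "\<alpha> \<in> \<Lambda>" for \<alpha>
    by (intro cpoly_smult[OF K_ring] phiK cpoly_eproj that)
  have cP: "cpoly K P" unfolding P_def by (rule cpoly_sum[OF K_ring ct])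
  have "coeff P i \<in> \<rat>" for i
  proof (rule Gal_fixed_rational)
    show "coeff P i \<in> K" using cP by (simp add: cpoly_def)
    fix \<sigma> assume s: "\<sigma> \<in> Gal"
    note e = Gal_emb[OF s]
    have "map_poly \<sigma> P = (\<Sum>\<alpha>\<in>\<Lambda>. map_poly \<sigma> (smult (\<phi> \<alpha>) (eproj \<Lambda> n \<alpha>)))"
      unfolding P_def by (rule map_poly_emb_sum[OF K_ring e ct])
    also have "\<dots> = (\<Sum>\<alpha>\<in>\<Lambda>. smult (\<phi> (\<sigma> \<alpha>)) (eproj \<Lambda> n (\<sigma> \<alpha>)))"
      by (intro sum.cong refl) (simp only: map_poly_emb_smult[OF K_ring e phiK cpoly_eproj] eqv[OF s] Gal_eproj[OF s])
    also have "\<dots> = P" unfolding P_def by (rule sum.reindex_bij_betw[OF Gal_bij_roots[OF s]])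
    finally have "map_poly \<sigma> P = P" .
    then have "coeff (map_poly \<sigma> P) i = coeff P i" by simp
    then show "\<sigma> (coeff P i) = coeff P i" by (simp only: coeff_emb[OF K_ring e])
  qed
  then have "\<forall>i. \<exists>r. coeff P i = of_rat r" by (meson Rats_cases)
  then obtain r where r: "\<And>i. coeff P i = of_rat (r i)" by metis
  define p where "p = (\<Sum>i\<le>degree P. monom (r i) i)"
  have cp: "coeff p i = r i" for i
  proof (cases "i \<le> degree P")
    case False
    then have "of_rat (r i) = (0 :: complex)" using r[of i] by (simp add: coeff_eq_0)
    then show ?thesis using False by (simp add: p_def coeff_sum)
  qed (simp add: p_def coeff_sum)
  have pP: "map_poly of_rat p = P" by (rule poly_eqI) (simp add: coeff_map_poly cp r)
  show ?thesis
  proof (intro exI[of _ p] ballI)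
    fix \<alpha> assume a: "\<alpha> \<in> \<Lambda>"
    have "P - [:\<phi> \<alpha>:] = (\<Sum>\<beta>\<in>\<Lambda> - {\<alpha>}. smult (\<phi> \<beta>) (eproj \<Lambda> n \<beta>)) - smult (\<phi> \<alpha>) (1 - eproj \<Lambda> n \<alpha>)"
      unfolding P_def by (subst sum.remove[OF finite_roots a]) (simp add: smult_diff_right)
    moreover have "[:-\<alpha>, 1:] ^ n dvd (\<Sum>\<beta>\<in>\<Lambda> - {\<alpha>}. smult (\<phi> \<beta>) (eproj \<Lambda> n \<beta>))"
      using eproj_dvd_other[OF finite_roots a] by (intro dvd_sum dvd_smult) auto
    moreover have "[:-\<alpha>, 1:] ^ n dvd smult (\<phi> \<alpha>) (1 - eproj \<Lambda> n \<alpha>)"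
      by (rule dvd_smult[OF eproj_dvd_self[OF finite_roots]])
    ultimately show "[:-\<alpha>, 1:] ^ n dvd map_poly of_rat p - [:\<phi> \<alpha>:]" unfolding pP by (simp only: dvd_diff)
  qed
qed

end

lemma map_poly_of_rat_add: "map_poly of_rat (p + r) = (map_poly of_rat p + map_poly of_rat r :: complex poly)"
  and map_poly_of_rat_diff: "map_poly of_rat (p - r) = (map_poly of_rat p - map_poly of_rat r :: complex poly)"
  and map_poly_of_rat_mult: "map_poly of_rat (p * r) = (map_poly of_rat p * map_poly of_rat r :: complex poly)"
  by (rule poly_eqI; simp add: coeff_map_poly of_rat_add of_rat_diff coeff_mult of_rat_sum of_rat_mult)+

section \<open>The commutative algebra generated by a derivation\<close>

lemma papp_mv_rc:
  "lin_op.papp vscale (mv m D) (map_poly of_rat p) (rc u) = (rc (lin_op.papp vscale (mv m D) p u) :: nat \<Rightarrow> complex)"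
proof -
  interpret S: lin_op "vscale :: complex \<Rightarrow> _" "mv m D" "{x. in_space m x}" by (rule lin_op_mv)
  interpret RQ: lin_op "vscale :: rat \<Rightarrow> _" "mv m D" "{x. in_space m x}" by (rule lin_op_mv)
  show ?thesis
  proof (induction p)
    case 0
    have "rc 0 = (0 :: nat \<Rightarrow> complex)" by (auto simp: rc_def fun_eq_iff)
    then show ?case by (simp only: map_poly_0 S.papp_0 RQ.papp_0)
  next
    case (pCons a p)
    have "map_poly of_rat (pCons a p) = pCons (of_rat a :: complex) (map_poly of_rat p)"
      by (simp add: map_poly_pCons)
    then have "S.papp (map_poly of_rat (pCons a p)) (rc u) = vscale (of_rat a) (rc u) + mv m D (rc (RQ.papp p u))"
      using pCons by (simp only: S.papp_pCons)
    also have "\<dots> = rc (vscale a u + mv m D (RQ.papp p u))"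
      unfolding mv_rc by (auto simp: rc_def fun_eq_iff of_rat_add of_rat_mult)
    finally show ?case by (simp only: RQ.papp_pCons)
  qed
qed

locale deriv_spec = galois q \<Lambda> K Gal for q \<Lambda> K Gal +
  fixes m :: nat and c :: "nat \<Rightarrow> nat \<Rightarrow> nat \<Rightarrow> rat" and D :: "nat \<Rightarrow> nat \<Rightarrow> rat"
  assumes der: "\<And>x y :: nat \<Rightarrow> rat. in_space m x \<Longrightarrow> in_space m y \<Longrightarrow>
      mv m D (lie_br m c x y) = lie_br m c (mv m D x) y + lie_br m c x (mv m D y)"
    and ann: "\<And>v :: nat \<Rightarrow> complex. in_space m v \<Longrightarrow> lin_op.papp vscale (mv m D) q v = 0"
    and root0: "0 \<notin> \<Lambda>"
begin

abbreviation "dq \<equiv> Suc (degree q)"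

sublocale RQ: lin_op "vscale :: rat \<Rightarrow> _" "mv m D" "{x. in_space m x}"
  by (rule lin_op_mv)

sublocale S: spectral "vscale :: complex \<Rightarrow> _" "mv m D" "{x. in_space m x}" \<Lambda> dq
proof -
  interpret L: lin_op "vscale :: complex \<Rightarrow> _" "mv m D" "{x. in_space m x}" by (rule lin_op_mv)
  have q0: "q \<noteq> 0" using q by auto
  have "q dvd (\<Prod>\<beta>\<in>\<Lambda>. [:-\<beta>, 1:]) ^ dq"
    using complex_poly_dvd_roots_power[OF q0] unfolding \<Lambda>_def by (simp add: dvd_mult)
  then show "spectral (vscale :: complex \<Rightarrow> _) (mv m D) {x. in_space m x} \<Lambda> dq"
    using finite_roots ann L.papp_dvd by unfold_locales (auto simp: L.annih_def)
qed

text \<open>The congruence says that p(D) acts as the scalar \<phi>(\<alpha>) on the whole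
  generalized eigenspace of \<alpha>, so the nilpotent part of D leaves no trace in p(D).\<close>

definition vals :: "rat poly \<Rightarrow> (complex \<Rightarrow> complex) \<Rightarrow> bool" where
  "vals p \<phi> \<longleftrightarrow> (\<forall>\<alpha>\<in>\<Lambda>. [:-\<alpha>, 1:] ^ dq dvd map_poly of_rat p - [:\<phi> \<alpha>:])"

lemma vals_add: "vals p \<phi> \<Longrightarrow> vals r \<psi> \<Longrightarrow> vals (p + r) (\<lambda>\<alpha>. \<phi> \<alpha> + \<psi> \<alpha>)"
  unfolding vals_def
proof
  fix \<alpha> assume "\<forall>\<alpha>\<in>\<Lambda>. [:-\<alpha>, 1:] ^ dq dvd map_poly of_rat p - [:\<phi> \<alpha>:]"
    "\<forall>\<alpha>\<in>\<Lambda>. [:-\<alpha>, 1:] ^ dq dvd map_poly of_rat r - [:\<psi> \<alpha>:]" "\<alpha> \<in> \<Lambda>"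
  then have "[:-\<alpha>, 1:] ^ dq dvd (map_poly of_rat p - [:\<phi> \<alpha>:]) + (map_poly of_rat r - [:\<psi> \<alpha>:])"
    by (intro dvd_add) blast+
  then show "[:-\<alpha>, 1:] ^ dq dvd map_poly of_rat (p + r) - [:\<phi> \<alpha> + \<psi> \<alpha>:]"
    by (simp add: map_poly_of_rat_add algebra_simps)
qed

lemma vals_diff: "vals p \<phi> \<Longrightarrow> vals r \<psi> \<Longrightarrow> vals (p - r) (\<lambda>\<alpha>. \<phi> \<alpha> - \<psi> \<alpha>)"
  unfolding vals_def
proof
  fix \<alpha> assume "\<forall>\<alpha>\<in>\<Lambda>. [:-\<alpha>, 1:] ^ dq dvd map_poly of_rat p - [:\<phi> \<alpha>:]"
    "\<forall>\<alpha>\<in>\<Lambda>. [:-\<alpha>, 1:] ^ dq dvd map_poly of_rat r - [:\<psi> \<alpha>:]" "\<alpha> \<in> \<Lambda>"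
  then have "[:-\<alpha>, 1:] ^ dq dvd map_poly of_rat p - [:\<phi> \<alpha>:]" "[:-\<alpha>, 1:] ^ dq dvd map_poly of_rat r - [:\<psi> \<alpha>:]" by blast+
  then have "[:-\<alpha>, 1:] ^ dq dvd (map_poly of_rat p - [:\<phi> \<alpha>:]) - (map_poly of_rat r - [:\<psi> \<alpha>:])"
    by (rule dvd_diff)
  moreover have "(map_poly of_rat p - [:\<phi> \<alpha>:]) - (map_poly of_rat r - [:\<psi> \<alpha>:]) = map_poly of_rat (p - r) - [:\<phi> \<alpha> - \<psi> \<alpha>:]"
    unfolding map_poly_of_rat_diff by (simp add: poly_eq_iff coeff_pCons split: nat.split)
  ultimately show "[:-\<alpha>, 1:] ^ dq dvd map_poly of_rat (p - r) - [:\<phi> \<alpha> - \<psi> \<alpha>:]"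
    by (simp only:)
qed

lemma vals_mult: "vals p \<phi> \<Longrightarrow> vals r \<psi> \<Longrightarrow> vals (p * r) (\<lambda>\<alpha>. \<phi> \<alpha> * \<psi> \<alpha>)"
  unfolding vals_def
proof
  fix \<alpha> assume "\<forall>\<alpha>\<in>\<Lambda>. [:-\<alpha>, 1:] ^ dq dvd map_poly of_rat p - [:\<phi> \<alpha>:]"
    "\<forall>\<alpha>\<in>\<Lambda>. [:-\<alpha>, 1:] ^ dq dvd map_poly of_rat r - [:\<psi> \<alpha>:]" "\<alpha> \<in> \<Lambda>"
  then have "[:-\<alpha>, 1:] ^ dq dvd (map_poly of_rat p - [:\<phi> \<alpha>:]) * map_poly of_rat r + [:\<phi> \<alpha>:] * (map_poly of_rat r - [:\<psi> \<alpha>:])"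
    by (intro dvd_add dvd_mult2 dvd_mult) blast+
  moreover have "(map_poly of_rat p - [:\<phi> \<alpha>:]) * map_poly of_rat r + [:\<phi> \<alpha>:] * (map_poly of_rat r - [:\<psi> \<alpha>:]) =
      map_poly of_rat p * map_poly of_rat r - [:\<phi> \<alpha> * \<psi> \<alpha>:]"
    by (simp only: left_diff_distrib right_diff_distrib diff_add_cancel) (simp add: algebra_simps)
  ultimately show "[:-\<alpha>, 1:] ^ dq dvd map_poly of_rat (p * r) - [:\<phi> \<alpha> * \<psi> \<alpha>:]"
    unfolding map_poly_of_rat_mult by (simp only:)
qed

lemma vals_const: "vals [:r:] (\<lambda>_. of_rat r)"
  by (simp add: vals_def map_poly_pCons)

lemma vals_1: "vals 1 (\<lambda>_. 1)"
  using vals_const[of 1] by (simp add: one_pCons)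

lemma vals_power: "vals p \<phi> \<Longrightarrow> vals (p ^ k) (\<lambda>\<alpha>. \<phi> \<alpha> ^ k)"
  by (induction k) (auto intro: vals_1 vals_mult)

lemmas papp_rc = papp_mv_rc

lemma in_space_rc: "in_space m u \<Longrightarrow> in_space m (rc u)"
  by (auto simp: in_space_def rc_def)

lemma vals_eigen:
  assumes "vals p \<phi>" "\<alpha> \<in> \<Lambda>" "in_space m v"
  shows "S.papp (map_poly of_rat p) (S.E \<alpha> v) = vscale (\<phi> \<alpha>) (S.E \<alpha> v)"
proof -
  have "S.papp ([:-\<alpha>, 1:] ^ dq) (S.E \<alpha> v) = 0" using assms by (intro S.E_gen_eigen) auto
  moreover have "[:-\<alpha>, 1:] ^ dq dvd map_poly of_rat p - [:\<phi> \<alpha>:]" using assms by (simp add: vals_def)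
  ultimately have "S.papp (map_poly of_rat p - [:\<phi> \<alpha>:]) (S.E \<alpha> v) = 0" using S.papp_dvd by blast
  then have "S.papp (map_poly of_rat p) (S.E \<alpha> v) = S.papp [:\<phi> \<alpha>:] (S.E \<alpha> v)"
    unfolding S.papp_diff by (simp only: right_minus_eq)
  also have "\<dots> = vscale (\<phi> \<alpha>) (S.E \<alpha> v)" by (simp only: S.papp_pCons S.papp_0 S.T_zero add_0_right)
  finally show ?thesis .
qed

lemma vals_apply:
  assumes "vals p \<phi>" "in_space m u"
  shows "rc (RQ.papp p u) = (\<Sum>\<alpha>\<in>\<Lambda>. vscale (\<phi> \<alpha>) (S.E \<alpha> (rc u)))"
proof -
  have u: "rc u \<in> {x :: nat \<Rightarrow> complex. in_space m x}" using in_space_rc[OF assms(2)] by simp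
  have "rc (RQ.papp p u) = S.papp (map_poly of_rat p) (\<Sum>\<alpha>\<in>\<Lambda>. S.E \<alpha> (rc u))"
    unfolding S.E_complete[OF u] papp_rc ..
  also have "\<dots> = (\<Sum>\<alpha>\<in>\<Lambda>. S.papp (map_poly of_rat p) (S.E \<alpha> (rc u)))" by (rule S.papp_vsum)
  also have "\<dots> = (\<Sum>\<alpha>\<in>\<Lambda>. vscale (\<phi> \<alpha>) (S.E \<alpha> (rc u)))"
    using u by (intro sum.cong refl vals_eigen[OF assms(1)]) auto
  finally show ?thesis .
qed

lemma rc_inj: "rc u = (rc v :: nat \<Rightarrow> complex) \<Longrightarrow> u = v"
proof
  fix i assume "rc u = (rc v :: nat \<Rightarrow> complex)"
  then have "rc u i = (rc v i :: complex)" by simp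
  then show "u i = v i" by (simp add: rc_def)
qed

lemma vals_unique:
  assumes "vals p \<phi>" "vals r \<psi>" "\<And>\<alpha>. \<alpha> \<in> \<Lambda> \<Longrightarrow> \<phi> \<alpha> = \<psi> \<alpha>" "in_space m u"
  shows "RQ.papp p u = RQ.papp r u"
proof (rule rc_inj)
  have "rc (RQ.papp p u) = (\<Sum>\<alpha>\<in>\<Lambda>. vscale (\<phi> \<alpha>) (S.E \<alpha> (rc u)))" by (rule vals_apply[OF assms(1,4)])
  also have "\<dots> = (\<Sum>\<alpha>\<in>\<Lambda>. vscale (\<psi> \<alpha>) (S.E \<alpha> (rc u)))" by (intro sum.cong refl) (simp only: assms(3))
  also have "\<dots> = rc (RQ.papp r u)" by (rule vals_apply[OF assms(2,4), symmetric])
  finally show "rc (RQ.papp p u) = (rc (RQ.papp r u) :: nat \<Rightarrow> complex)" .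
qed

lemma ex_vals:
  assumes "\<And>\<alpha>. \<alpha> \<in> \<Lambda> \<Longrightarrow> \<phi> \<alpha> \<in> K" "\<And>\<sigma> \<alpha>. \<sigma> \<in> Gal \<Longrightarrow> \<alpha> \<in> \<Lambda> \<Longrightarrow> \<sigma> (\<phi> \<alpha>) = \<phi> (\<sigma> \<alpha>)"
  shows "\<exists>p. vals p \<phi>"
  unfolding vals_def by (rule rational_interpolation[OF assms])

lemma mv_deriv_complex:
  assumes x: "in_space m x" and y: "in_space m (y :: nat \<Rightarrow> complex)"
  shows "mv m D (lie_br m c x y) = lie_br m c (mv m D x) y + lie_br m c x (mv m D y)"
proof (rule bilin_ext[OF _ _ _ x y])
  have b: "bilin vscale (lie_br m c :: (nat \<Rightarrow> complex) \<Rightarrow> _)" by (rule bilin_lie_br)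
  show "bilin vscale (\<lambda>x y. mv m D (lie_br m c x y) :: nat \<Rightarrow> complex)"
    using b by (simp add: bilin_def mv_add mv_scale)
  have sa: "vscale a (u + v) = vscale a u + vscale a v" for a and u v :: "nat \<Rightarrow> complex"
    by (auto simp: fun_eq_iff algebra_simps)
  have b': "\<And>x x' y. lie_br m c (x + x') y = lie_br m c x y + (lie_br m c x' y :: nat \<Rightarrow> complex)"
    "\<And>x y y'. lie_br m c x (y + y') = lie_br m c x y + (lie_br m c x y' :: nat \<Rightarrow> complex)"
    "\<And>a x y. lie_br m c (vscale a x) y = vscale a (lie_br m c x y :: nat \<Rightarrow> complex)"
    "\<And>a x y. lie_br m c x (vscale a y) = vscale a (lie_br m c x y :: nat \<Rightarrow> complex)"
    using b unfolding bilin_def by blast+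
  show "bilin vscale (\<lambda>x y. lie_br m c (mv m D x) y + lie_br m c x (mv m D y) :: nat \<Rightarrow> complex)"
    unfolding bilin_def by (intro conjI allI; simp only: mv_add mv_scale b' sa add_ac)
  fix i j assume "i < m" "j < m"
  then have *: "mv m D (lie_br m c (unit_vec i) (unit_vec j)) =
      (lie_br m c (mv m D (unit_vec i)) (unit_vec j) + lie_br m c (unit_vec i) (mv m D (unit_vec j)) :: nat \<Rightarrow> rat)"
    by (intro der in_space_unit_vec)
  have "mv m D (lie_br m c (rc (unit_vec i)) (rc (unit_vec j))) =
      (lie_br m c (mv m D (rc (unit_vec i))) (rc (unit_vec j)) + lie_br m c (rc (unit_vec i)) (mv m D (rc (unit_vec j))) :: nat \<Rightarrow> complex)"
    unfolding mv_rc lie_br_rc * by (auto simp: rc_def fun_eq_iff of_rat_add)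
  then show "mv m D (lie_br m c (unit_vec i) (unit_vec j)) =
      (lie_br m c (mv m D (unit_vec i)) (unit_vec j) + lie_br m c (unit_vec i) (mv m D (unit_vec j)) :: nat \<Rightarrow> complex)"
    by (simp only: rc_unit_vec)
qed

text \<open>The bracket of the generalized eigenspaces of \<alpha> and \<beta> lies in that of
  \<alpha> + \<beta>, where the operator is the scalar a(\<alpha> + \<beta>). If \<alpha> + \<beta>
  is not an eigenvalue, the bracket is zero.\<close>

lemma vals_automorphism:
  assumes p: "vals p a" and mult: "\<And>\<alpha> \<beta>. \<alpha> \<in> \<Lambda> \<Longrightarrow> \<beta> \<in> \<Lambda> \<Longrightarrow> \<alpha> + \<beta> \<in> \<Lambda> \<Longrightarrow> a (\<alpha> + \<beta>) = a \<alpha> * a \<beta>"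
    and x: "in_space m x" and y: "in_space m y"
  shows "RQ.papp p (lie_br m c x y) = lie_br m c (RQ.papp p x) (RQ.papp p y)"
proof (rule rc_inj)
  let ?W = "{x :: nat \<Rightarrow> complex. in_space m x}" and ?P = "S.papp (map_poly of_rat p)"
  have b: "bilin vscale (lie_br m c :: (nat \<Rightarrow> complex) \<Rightarrow> _)" by (rule bilin_lie_br)
  note z = bilin_zero[OF b]
  have sc: "\<And>a x y. lie_br m c (vscale a x) y = vscale a (lie_br m c x y :: nat \<Rightarrow> complex)"
    "\<And>a x y. lie_br m c x (vscale a y) = vscale a (lie_br m c x y :: nat \<Rightarrow> complex)"
    using b unfolding bilin_def by blast+
  have X: "rc x \<in> ?W" and Y: "rc y \<in> ?W" using in_space_rc x y by auto
  let ?x = "\<lambda>\<alpha>. S.E \<alpha> (rc x)" and ?y = "\<lambda>\<beta>. S.E \<beta> (rc y)"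
  have pair: "?P (lie_br m c (?x \<alpha>) (?y \<beta>)) = vscale (a \<alpha> * a \<beta>) (lie_br m c (?x \<alpha>) (?y \<beta>))"
    if ab: "\<alpha> \<in> \<Lambda>" "\<beta> \<in> \<Lambda>" for \<alpha> \<beta>
  proof -
    let ?z = "lie_br m c (?x \<alpha>) (?y \<beta>)"
    have zW: "?z \<in> ?W" using in_space_lie_br by blast
    have k: "S.papp ([:-(\<alpha> + \<beta>), 1:] ^ (dq + dq)) ?z = 0"
    proof (rule S.gen_eigen_deriv[OF b z])
      show "mv m D (lie_br m c x y) = lie_br m c (mv m D x) y + lie_br m c x (mv m D y)"
        if "x \<in> ?W" "y \<in> ?W" for x y using mv_deriv_complex that by blast
    qed (use S.E_W X Y S.E_gen_eigen ab in blast)+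
    have other: "S.E \<gamma> ?z = 0" if "\<gamma> \<in> \<Lambda>" "\<gamma> \<noteq> \<alpha> + \<beta>" for \<gamma>
      by (rule S.E_other[OF zW k that])
    show ?thesis
    proof (cases "\<alpha> + \<beta> \<in> \<Lambda>")
      case True
      have "?z = (\<Sum>\<gamma>\<in>\<Lambda>. S.E \<gamma> ?z)" by (rule S.E_complete[OF zW, symmetric])
      also have "\<dots> = (\<Sum>\<gamma>\<in>{\<alpha> + \<beta>}. S.E \<gamma> ?z)"
        using True finite_roots other by (intro sum.mono_neutral_right) blast+
      finally have zE: "?z = S.E (\<alpha> + \<beta>) ?z" by simp
      have "?P (S.E (\<alpha> + \<beta>) ?z) = vscale (a (\<alpha> + \<beta>)) (S.E (\<alpha> + \<beta>) ?z)"
        by (rule vals_eigen[OF p True in_space_lie_br])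
      then show ?thesis using mult[OF ab True] zE by metis
    next
      case False
      have "?z = (\<Sum>\<gamma>\<in>\<Lambda>. S.E \<gamma> ?z)" by (rule S.E_complete[OF zW, symmetric])
      also have "\<dots> = 0" using False other by (intro sum.neutral) blast
      finally have z0: "?z = 0" .
      have "vscale (a \<alpha> * a \<beta>) (0 :: nat \<Rightarrow> complex) = 0" by (rule ext) (simp only: vscale_apply zero_fun_apply mult_zero_right)
      then show ?thesis unfolding z0 S.papp_vzero by (rule sym)
    qed
  qed
  have xs: "rc x = (\<Sum>\<alpha>\<in>\<Lambda>. ?x \<alpha>)" and ys: "rc y = (\<Sum>\<beta>\<in>\<Lambda>. ?y \<beta>)"
    using S.E_complete[OF X] S.E_complete[OF Y] by (simp_all only:)
  have exp: "lie_br m c (\<Sum>\<alpha>\<in>\<Lambda>. f \<alpha>) (\<Sum>\<beta>\<in>\<Lambda>. g \<beta>) = (\<Sum>\<alpha>\<in>\<Lambda>. \<Sum>\<beta>\<in>\<Lambda>. lie_br m c (f \<alpha>) (g \<beta>))" for f g :: "complex \<Rightarrow> nat \<Rightarrow> complex"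
    by (subst bilin_sum(1)[OF b z]) (simp only: bilin_sum(2)[OF b z])
  have "rc (RQ.papp p (lie_br m c x y)) = ?P (lie_br m c (rc x) (rc y))" unfolding lie_br_rc papp_rc ..
  also have "lie_br m c (rc x) (rc y) = (\<Sum>\<alpha>\<in>\<Lambda>. \<Sum>\<beta>\<in>\<Lambda>. lie_br m c (?x \<alpha>) (?y \<beta>))"
    unfolding exp[symmetric] xs[symmetric] ys[symmetric] ..
  also have "?P \<dots> = (\<Sum>\<alpha>\<in>\<Lambda>. \<Sum>\<beta>\<in>\<Lambda>. vscale (a \<alpha> * a \<beta>) (lie_br m c (?x \<alpha>) (?y \<beta>)))"
    unfolding S.papp_vsum by (intro sum.cong refl pair)
  also have "\<dots> = (\<Sum>\<alpha>\<in>\<Lambda>. \<Sum>\<beta>\<in>\<Lambda>. lie_br m c (vscale (a \<alpha>) (?x \<alpha>)) (vscale (a \<beta>) (?y \<beta>)))"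
    unfolding sc by (intro sum.cong refl) (auto simp: fun_eq_iff)
  also have "\<dots> = lie_br m c (rc (RQ.papp p x)) (rc (RQ.papp p y))"
    unfolding exp[symmetric] vals_apply[OF p x] vals_apply[OF p y] ..
  also have "\<dots> = rc (lie_br m c (RQ.papp p x) (RQ.papp p y))" by (rule lie_br_rc)
  finally show "rc (RQ.papp p (lie_br m c x y)) = (rc (lie_br m c (RQ.papp p x) (RQ.papp p y)) :: nat \<Rightarrow> complex)" .
qed

end

section \<open>Equivariant functions with values in an order\<close>

locale galois_order = galois q \<Lambda> K Gal for q \<Lambda> K Gal +
  fixes R :: "complex set"
  assumes R_K: "R \<subseteq> K" and R_1: "1 \<in> R" and R_asub: "asub R"
    and R_mult: "\<And>x y. x \<in> R \<Longrightarrow> y \<in> R \<Longrightarrow> x * y \<in> R"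
    and R_Gal: "\<And>\<sigma> x. \<sigma> \<in> Gal \<Longrightarrow> x \<in> R \<Longrightarrow> \<sigma> x \<in> R"
    and R_denom: "\<And>x. x \<in> K \<Longrightarrow> \<exists>N>0. of_int N * x \<in> R"
begin

lemmas R_0 = asub_zero[OF R_asub] and R_diff = asub_diff[OF R_asub] and R_add = asub_add[OF R_asub]
  and R_uminus = asub_uminus[OF R_asub] and R_sum = asub_sum[OF R_asub]

lemma R_int: "x \<in> R \<Longrightarrow> of_int i * x \<in> R"
  using QC.asub_scale_int[OF R_asub, of x i] by simp

lemma R_power: "x \<in> R \<Longrightarrow> x ^ n \<in> R"
  by (induction n) (auto simp: R_1 R_mult)

lemma R_denom_finite:
  assumes "finite S" "S \<subseteq> K" shows "\<exists>N>0. \<forall>x\<in>S. of_int N * x \<in> R"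
  using assms
proof (induction S)
  case empty
  show ?case by (intro exI[of _ 1]) simp
next
  case (insert x S)
  then obtain N :: int where N: "N > 0" "\<forall>x\<in>S. of_int N * x \<in> R" by auto
  obtain M :: int where M: "M > 0" "of_int M * x \<in> R" using R_denom[of x] insert.prems by auto
  have "of_int (N * M) * y \<in> R" if "y \<in> insert x S" for y
  proof (cases "y = x")
    case True
    then show ?thesis using R_int[OF M(2), of N] by (simp add: mult_ac)
  next
    case False
    then have "of_int N * y \<in> R" using N(2) that by blast
    from R_int[OF this, of M] show ?thesis by (simp add: mult_ac)
  qed
  then show ?case using N(1) M(1) by (intro exI[of _ "N * M"]) auto
qed

text \<open>Comaximality: x and y generate the unit ideal of the order, which need not be integrally
  closed.\<close>

definition cop :: "complex \<Rightarrow> complex \<Rightarrow> bool" where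
  "cop x y \<longleftrightarrow> (\<exists>u\<in>R. \<exists>v\<in>R. x * u + y * v = 1)"

lemma cop_sym: "cop x y \<Longrightarrow> cop y x"
  unfolding cop_def by (metis add.commute)

lemma cop_1: "cop x 1"
  unfolding cop_def by (intro bexI[of _ 0] bexI[of _ 1]) (auto simp: R_0 R_1)

lemma cop_mult:
  assumes "y \<in> R" "cop x y" "cop x z" shows "cop x (y * z)"
proof -
  obtain u v u' v' where uv: "u \<in> R" "v \<in> R" "x * u + y * v = 1" "u' \<in> R" "v' \<in> R" "x * u' + z * v' = 1"
    using assms(2,3) by (auto simp: cop_def)
  have "x * (u + y * v * u') + y * z * (v * v') = x * u + y * v * (x * u' + z * v')" by (simp add: algebra_simps)
  also have "\<dots> = 1" using uv by simp
  finally show ?thesis unfolding cop_def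
    using uv assms(1) by (intro bexI[of _ "u + y * v * u'"] bexI[of _ "v * v'"]) (auto intro!: R_add R_mult)
qed

lemma cop_power: "y \<in> R \<Longrightarrow> cop x y \<Longrightarrow> cop x (y ^ n)"
  by (induction n) (auto simp: cop_1 cop_mult)

lemma cop_prod: "(\<And>i. i \<in> J \<Longrightarrow> f i \<in> R) \<Longrightarrow> (\<And>i. i \<in> J \<Longrightarrow> cop x (f i)) \<Longrightarrow> cop x (prod f J)"
  by (induction J rule: infinite_finite_induct) (auto simp: cop_1 cop_mult)

definition cong1 :: "int \<Rightarrow> complex \<Rightarrow> bool" where
  "cong1 H x \<longleftrightarrow> (\<exists>r\<in>R. x = 1 + of_int H * r)"

lemma cong1_1: "cong1 H 1"
  unfolding cong1_def by (intro bexI[of _ 0]) (auto simp: R_0)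

lemma cong1_mult: "cong1 H x \<Longrightarrow> cong1 H y \<Longrightarrow> cong1 H (x * y)"
proof -
  assume "cong1 H x" "cong1 H y"
  then obtain r s where rs: "r \<in> R" "x = 1 + of_int H * r" "s \<in> R" "y = 1 + of_int H * s" by (auto simp: cong1_def)
  have "x * y = 1 + of_int H * (r + s + of_int H * (r * s))" using rs by (simp add: algebra_simps)
  then show ?thesis unfolding cong1_def using rs by (intro bexI[of _ "r + s + of_int H * (r * s)"]) (auto intro!: R_add R_int R_mult)
qed

lemma cong1_power: "cong1 H x \<Longrightarrow> cong1 H (x ^ n)"
  by (induction n) (auto simp: cong1_1 cong1_mult)

lemma cong1_prod: "(\<And>i. i \<in> J \<Longrightarrow> cong1 H (f i)) \<Longrightarrow> cong1 H (prod f J)"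
  by (induction J rule: infinite_finite_induct) (auto simp: cong1_1 cong1_mult)

text \<open>By interpolation these functions are the values of rational polynomials in the
  derivation, and having values in the order bounds the denominators of the corresponding
  operators.\<close>

definition equi :: "(complex \<Rightarrow> complex) \<Rightarrow> bool" where
  "equi \<phi> \<longleftrightarrow> (\<forall>\<alpha>\<in>\<Lambda>. \<phi> \<alpha> \<in> R) \<and> (\<forall>\<sigma>\<in>Gal. \<forall>\<alpha>\<in>\<Lambda>. \<sigma> (\<phi> \<alpha>) = \<phi> (\<sigma> \<alpha>))"

lemma equi_R: "equi \<phi> \<Longrightarrow> \<alpha> \<in> \<Lambda> \<Longrightarrow> \<phi> \<alpha> \<in> R"
  and equi_Gal: "equi \<phi> \<Longrightarrow> \<sigma> \<in> Gal \<Longrightarrow> \<alpha> \<in> \<Lambda> \<Longrightarrow> \<sigma> (\<phi> \<alpha>) = \<phi> (\<sigma> \<alpha>)"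
  by (auto simp: equi_def)

lemma equi_K: "equi \<phi> \<Longrightarrow> \<alpha> \<in> \<Lambda> \<Longrightarrow> \<phi> \<alpha> \<in> K"
  using equi_R R_K by blast

lemma equi_1: "equi (\<lambda>_. 1)"
  using emb_1[OF K_ring Gal_emb] by (simp add: equi_def R_1)

lemma equi_add:
  assumes "equi \<phi>" "equi \<psi>" shows "equi (\<lambda>\<alpha>. \<phi> \<alpha> + \<psi> \<alpha>)"
  unfolding equi_def
proof (intro conjI ballI)
  show "\<phi> \<alpha> + \<psi> \<alpha> \<in> R" if "\<alpha> \<in> \<Lambda>" for \<alpha> by (intro R_add equi_R[OF assms(1)] equi_R[OF assms(2)] that)
  fix \<sigma> \<alpha> assume s: "\<sigma> \<in> Gal" and a: "\<alpha> \<in> \<Lambda>"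
  show "\<sigma> (\<phi> \<alpha> + \<psi> \<alpha>) = \<phi> (\<sigma> \<alpha>) + \<psi> (\<sigma> \<alpha>)"
    unfolding emb_add[OF K_ring Gal_emb[OF s] equi_K[OF assms(1) a] equi_K[OF assms(2) a]]
      equi_Gal[OF assms(1) s a] equi_Gal[OF assms(2) s a] ..
qed

lemma equi_diff:
  assumes "equi \<phi>" "equi \<psi>" shows "equi (\<lambda>\<alpha>. \<phi> \<alpha> - \<psi> \<alpha>)"
  unfolding equi_def
proof (intro conjI ballI)
  show "\<phi> \<alpha> - \<psi> \<alpha> \<in> R" if "\<alpha> \<in> \<Lambda>" for \<alpha> by (intro R_diff equi_R[OF assms(1)] equi_R[OF assms(2)] that)
  fix \<sigma> \<alpha> assume s: "\<sigma> \<in> Gal" and a: "\<alpha> \<in> \<Lambda>"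
  show "\<sigma> (\<phi> \<alpha> - \<psi> \<alpha>) = \<phi> (\<sigma> \<alpha>) - \<psi> (\<sigma> \<alpha>)"
    unfolding emb_diff[OF K_ring Gal_emb[OF s] equi_K[OF assms(1) a] equi_K[OF assms(2) a]]
      equi_Gal[OF assms(1) s a] equi_Gal[OF assms(2) s a] ..
qed

lemma equi_mult:
  assumes "equi \<phi>" "equi \<psi>" shows "equi (\<lambda>\<alpha>. \<phi> \<alpha> * \<psi> \<alpha>)"
  unfolding equi_def
proof (intro conjI ballI)
  show "\<phi> \<alpha> * \<psi> \<alpha> \<in> R" if "\<alpha> \<in> \<Lambda>" for \<alpha> by (intro R_mult equi_R[OF assms(1)] equi_R[OF assms(2)] that)
  fix \<sigma> \<alpha> assume s: "\<sigma> \<in> Gal" and a: "\<alpha> \<in> \<Lambda>"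
  show "\<sigma> (\<phi> \<alpha> * \<psi> \<alpha>) = \<phi> (\<sigma> \<alpha>) * \<psi> (\<sigma> \<alpha>)"
    unfolding emb_mult[OF K_ring Gal_emb[OF s] equi_K[OF assms(1) a] equi_K[OF assms(2) a]]
      equi_Gal[OF assms(1) s a] equi_Gal[OF assms(2) s a] ..
qed

lemma equi_power: "equi \<phi> \<Longrightarrow> equi (\<lambda>\<alpha>. \<phi> \<alpha> ^ n)"
  by (induction n) (auto simp: equi_1 equi_mult)

lemma equi_divide:
  assumes \<phi>: "equi \<phi>" and H: "H \<noteq> 0" and r: "\<And>\<alpha>. \<alpha> \<in> \<Lambda> \<Longrightarrow> \<exists>r\<in>R. \<phi> \<alpha> = of_int H * r"
  shows "equi (\<lambda>\<alpha>. \<phi> \<alpha> / of_int H)"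
proof -
  have d: "\<phi> \<alpha> / of_int H \<in> R" if "\<alpha> \<in> \<Lambda>" for \<alpha> using r[OF that] H by auto
  have "\<sigma> (\<phi> \<alpha> / of_int H) = \<phi> (\<sigma> \<alpha>) / of_int H" if s: "\<sigma> \<in> Gal" and a: "\<alpha> \<in> \<Lambda>" for \<sigma> \<alpha>
  proof -
    have K1: "\<phi> \<alpha> / of_int H \<in> K" using d[OF a] R_K by blast
    have "\<sigma> (of_int H * (\<phi> \<alpha> / of_int H)) = of_int H * \<sigma> (\<phi> \<alpha> / of_int H)"
      using emb_mult[OF K_ring Gal_emb[OF s] subring_int[OF K_ring] K1] by (simp only: emb_of_int[OF K_ring Gal_emb[OF s]])
    then show ?thesis using H equi_Gal[OF \<phi> s a] by (simp add: field_simps)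
  qed
  with d show ?thesis by (simp add: equi_def)
qed

text \<open>A pointwise Bezout identity is made equivariant by averaging over the Galois group; the
  factor \<open>card Gal\<close> lost in this way is recovered from the congruence.\<close>

lemma equi_bezout:
  assumes x: "equi x" and y: "equi y" and cp: "\<And>\<alpha>. \<alpha> \<in> \<Lambda> \<Longrightarrow> cop (x \<alpha>) (y \<alpha>)"
    and g: "\<And>\<alpha>. \<alpha> \<in> \<Lambda> \<Longrightarrow> cong1 (int (card Gal)) (x \<alpha>)"
  shows "\<exists>U V. equi U \<and> equi V \<and> (\<forall>\<alpha>\<in>\<Lambda>. x \<alpha> * U \<alpha> + y \<alpha> * V \<alpha> = 1)"
proof -
  have "\<forall>\<alpha>\<in>\<Lambda>. \<exists>w. fst w \<in> R \<and> snd w \<in> R \<and> x \<alpha> * fst w + y \<alpha> * snd w = 1"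
  proof
    fix \<alpha> assume "\<alpha> \<in> \<Lambda>"
    from cp[OF this] obtain u v where "u \<in> R" "v \<in> R" "x \<alpha> * u + y \<alpha> * v = 1" by (auto simp: cop_def)
    then show "\<exists>w. fst w \<in> R \<and> snd w \<in> R \<and> x \<alpha> * fst w + y \<alpha> * snd w = 1" by (intro exI[of _ "(u, v)"]) simp
  qed
  from bchoice[OF this] obtain w where w: "\<forall>\<alpha>\<in>\<Lambda>. fst (w \<alpha>) \<in> R \<and> snd (w \<alpha>) \<in> R \<and> x \<alpha> * fst (w \<alpha>) + y \<alpha> * snd (w \<alpha>) = 1"
    by (elim exE) (rule that)
  have "\<forall>\<sigma>\<in>Gal. \<exists>\<tau>\<in>Gal. \<forall>x\<in>K. \<tau> (\<sigma> x) = x \<and> \<sigma> (\<tau> x) = x" by (metis Gal_inverse)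
  then obtain i where i: "\<And>\<sigma>. \<sigma> \<in> Gal \<Longrightarrow> i \<sigma> \<in> Gal" "\<And>\<sigma> x. \<sigma> \<in> Gal \<Longrightarrow> x \<in> K \<Longrightarrow> i \<sigma> (\<sigma> x) = x"
    "\<And>\<sigma> x. \<sigma> \<in> Gal \<Longrightarrow> x \<in> K \<Longrightarrow> \<sigma> (i \<sigma> x) = x" by metis
  define avg where "avg f \<alpha> = (\<Sum>\<sigma>\<in>Gal. i \<sigma> (f (\<sigma> \<alpha>)))" for f :: "complex \<Rightarrow> complex" and \<alpha>
  have LK: "\<alpha> \<in> K" if "\<alpha> \<in> \<Lambda>" for \<alpha> using that K(3) by blast
  have L: "\<sigma> \<alpha> \<in> \<Lambda>" if "\<sigma> \<in> Gal" "\<alpha> \<in> \<Lambda>" for \<sigma> \<alpha> using emb_roots[OF Gal_emb] that by blast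
  have avg: "equi (avg f)" if f: "\<And>\<alpha>. \<alpha> \<in> \<Lambda> \<Longrightarrow> f \<alpha> \<in> R" for f
    unfolding equi_def
  proof (intro conjI ballI)
    fix \<alpha> assume a: "\<alpha> \<in> \<Lambda>"
    show "avg f \<alpha> \<in> R" unfolding avg_def
    proof (rule R_sum)
      fix \<sigma> assume s: "\<sigma> \<in> Gal"
      show "i \<sigma> (f (\<sigma> \<alpha>)) \<in> R" by (rule R_Gal[OF i(1)[OF s] f[OF L[OF s a]]])
    qed
  next
    fix \<tau> \<alpha> assume t: "\<tau> \<in> Gal" and a: "\<alpha> \<in> \<Lambda>"
    have fK: "f \<beta> \<in> K" if "\<beta> \<in> \<Lambda>" for \<beta> using f[OF that] R_K by blast
    let ?g = "\<lambda>\<rho>. \<tau> (i \<rho> (f (\<rho> \<alpha>)))"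
    have "i \<sigma> (f (\<sigma> (\<tau> \<alpha>))) = ?g (comp \<sigma> \<tau>)" if s: "\<sigma> \<in> Gal" for \<sigma>
    proof -
      let ?r = "comp \<sigma> \<tau>" and ?z = "f (\<sigma> (\<tau> \<alpha>))"
      have r: "?r \<in> Gal" by (rule comp_Gal[OF s t])
      have ra: "?r \<alpha> = \<sigma> (\<tau> \<alpha>)" using LK[OF a] by (simp add: comp_def)
      have zK: "?z \<in> K" by (rule fK[OF L[OF s L[OF t a]]])
      have wK: "i ?r ?z \<in> K" by (rule emb_K[OF Gal_emb[OF i(1)[OF r]] zK])
      have "\<sigma> (\<tau> (i ?r ?z)) = ?z" using i(3)[OF r zK] wK by (simp add: comp_def)
      then have "i \<sigma> ?z = i \<sigma> (\<sigma> (\<tau> (i ?r ?z)))" by simp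
      also have "\<dots> = \<tau> (i ?r ?z)" by (rule i(2)[OF s emb_K[OF Gal_emb[OF t] wK]])
      finally show ?thesis unfolding ra .
    qed
    then have "avg f (\<tau> \<alpha>) = (\<Sum>\<sigma>\<in>Gal. ?g (comp \<sigma> \<tau>))" unfolding avg_def by (intro sum.cong refl)
    also have "\<dots> = (\<Sum>\<rho>\<in>Gal. ?g \<rho>)" by (rule sum.reindex_bij_betw[OF comp_bij_right[OF t]])
    also have "\<dots> = \<tau> (avg f \<alpha>)" unfolding avg_def
      by (rule emb_sum[OF K_ring Gal_emb[OF t], symmetric]) (rule emb_K[OF Gal_emb[OF i(1)] fK[OF L[OF _ a]]])
    finally show "\<tau> (avg f \<alpha>) = avg f (\<tau> \<alpha>)" ..
  qed
  define x1 y1 where "x1 = avg (\<lambda>\<alpha>. fst (w \<alpha>))" and "y1 = avg (\<lambda>\<alpha>. snd (w \<alpha>))"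
  have e1: "equi x1" "equi y1" unfolding x1_def y1_def by (rule avg, use w in blast)+
  have bz: "x \<alpha> * x1 \<alpha> + y \<alpha> * y1 \<alpha> = of_nat (card Gal)" if a: "\<alpha> \<in> \<Lambda>" for \<alpha>
  proof -
    have "x \<alpha> * i \<sigma> (fst (w (\<sigma> \<alpha>))) + y \<alpha> * i \<sigma> (snd (w (\<sigma> \<alpha>))) = 1" if s: "\<sigma> \<in> Gal" for \<sigma>
    proof -
      note e = Gal_emb[OF i(1)[OF s]]
      have wK: "fst (w (\<sigma> \<alpha>)) \<in> K" "snd (w (\<sigma> \<alpha>)) \<in> K" using w L[OF s a] R_K by blast+
      have xy: "x \<alpha> = i \<sigma> (x (\<sigma> \<alpha>))" "y \<alpha> = i \<sigma> (y (\<sigma> \<alpha>))"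
        using equi_Gal[OF x i(1)[OF s] L[OF s a]] equi_Gal[OF y i(1)[OF s] L[OF s a]] i(2)[OF s LK[OF a]] by auto
      have xyK: "x (\<sigma> \<alpha>) \<in> K" "y (\<sigma> \<alpha>) \<in> K" using equi_K[OF x] equi_K[OF y] L[OF s a] by auto
      have "x \<alpha> * i \<sigma> (fst (w (\<sigma> \<alpha>))) + y \<alpha> * i \<sigma> (snd (w (\<sigma> \<alpha>))) =
          i \<sigma> (x (\<sigma> \<alpha>) * fst (w (\<sigma> \<alpha>)) + y (\<sigma> \<alpha>) * snd (w (\<sigma> \<alpha>)))"
        unfolding xy using xyK wK K_ring by (simp add: emb_add[OF K_ring e] emb_mult[OF K_ring e] subring_mult)
      also have "\<dots> = 1" using w L[OF s a] by (simp add: emb_1[OF K_ring e])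
      finally show ?thesis .
    qed
    then have "(\<Sum>\<sigma>\<in>Gal. x \<alpha> * i \<sigma> (fst (w (\<sigma> \<alpha>))) + y \<alpha> * i \<sigma> (snd (w (\<sigma> \<alpha>)))) = of_nat (card Gal)" by simp
    then show ?thesis by (simp add: x1_def y1_def avg_def sum.distrib sum_distrib_left)
  qed
  have g0: "card Gal \<noteq> 0" using finite_Gal id_Gal by (auto simp: card_eq_0_iff)
  \<comment> \<open>The congruence puts z into the order, and 1 = x + z |Gal|; inserting the
    averaged identity x x1 + y y1 = |Gal| gives the Bezout relation.\<close>
  define z where "z \<alpha> = (1 - x \<alpha>) / of_int (int (card Gal))" for \<alpha>
  have zeq: "x \<alpha> + z \<alpha> * of_nat (card Gal) = 1" for \<alpha> using g0 by (simp add: z_def)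
  have ez: "equi z" unfolding z_def
  proof (rule equi_divide[OF equi_diff[OF equi_1 x]])
    fix \<alpha> assume "\<alpha> \<in> \<Lambda>"
    from g[OF this] obtain r where "r \<in> R" "x \<alpha> = 1 + of_int (int (card Gal)) * r" by (auto simp: cong1_def)
    then show "\<exists>r\<in>R. 1 - x \<alpha> = of_int (int (card Gal)) * r" by (intro bexI[of _ "- r"]) (auto intro: R_uminus)
  qed (use g0 in simp)
  have "x \<alpha> * (1 + z \<alpha> * x1 \<alpha>) + y \<alpha> * (z \<alpha> * y1 \<alpha>) = 1" if "\<alpha> \<in> \<Lambda>" for \<alpha>
  proof -
    have "x \<alpha> * (1 + z \<alpha> * x1 \<alpha>) + y \<alpha> * (z \<alpha> * y1 \<alpha>) = x \<alpha> + z \<alpha> * (x \<alpha> * x1 \<alpha> + y \<alpha> * y1 \<alpha>)"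
      by (simp add: algebra_simps)
    then show ?thesis using bz[OF that] zeq by simp
  qed
  then show ?thesis
    by (intro exI[of _ "\<lambda>\<alpha>. 1 + z \<alpha> * x1 \<alpha>"] exI[of _ "\<lambda>\<alpha>. z \<alpha> * y1 \<alpha>"]) (intro conjI ballI equi_add equi_1 equi_mult ez e1)
qed

text \<open>The function \<open>k\<close> is the Galois invariant form \<open>\<Sum>\<sigma>. h (\<sigma> \<alpha>) * h (\<sigma> \<nu>)\<close>, positive on the
  diagonal, for a rational functional \<open>h\<close> without zeros on the roots.\<close>

lemma ex_exponents:
  assumes root0: "0 \<notin> \<Lambda>"
  obtains k :: "complex \<Rightarrow> complex \<Rightarrow> int" where
    "\<And>\<sigma> \<alpha> \<nu>. \<sigma> \<in> Gal \<Longrightarrow> \<alpha> \<in> \<Lambda> \<Longrightarrow> \<nu> \<in> \<Lambda> \<union> uminus ` \<Lambda> \<Longrightarrow> k (\<sigma> \<alpha>) (\<sigma> \<nu>) = k \<alpha> \<nu>"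
    "\<And>\<alpha> \<beta> \<nu>. \<alpha> \<in> \<Lambda> \<Longrightarrow> \<beta> \<in> \<Lambda> \<Longrightarrow> \<alpha> + \<beta> \<in> \<Lambda> \<Longrightarrow> k (\<alpha> + \<beta>) \<nu> = k \<alpha> \<nu> + k \<beta> \<nu>"
    "\<And>\<alpha>. \<alpha> \<in> \<Lambda> \<Longrightarrow> k \<alpha> (- \<alpha>) < 0"
proof -
  have "QC.subspace {0}" by simp
  from ex_functional[OF QC.vector_space_axioms this finite_roots] root0
  obtain h0 :: "complex \<Rightarrow> rat" where h0: "\<forall>x y. h0 (x + y) = h0 x + h0 y" "\<forall>a x. h0 (of_rat a * x) = a * h0 x"
    "\<forall>s\<in>\<Lambda>. h0 s \<noteq> 0" by auto
  obtain Q :: int where Q: "Q > 0" "\<forall>x\<in>h0 ` \<Lambda>. of_int Q * x \<in> \<int>"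
    using common_denominator[of "h0 ` \<Lambda>"] finite_roots by auto
  define h where "h x = \<lfloor>of_int Q * h0 x\<rfloor>" for x
  have hL: "of_int (h x) = of_int Q * h0 x" if "x \<in> \<Lambda>" for x using Q(2) that by (auto simp: h_def)
  have h_add: "h (x + y) = h x + h y" if "x \<in> \<Lambda>" "y \<in> \<Lambda>" "x + y \<in> \<Lambda>" for x y
  proof -
    have "of_int (h (x + y)) = (of_int (h x + h y) :: rat)" using that h0(1) by (simp add: hL algebra_simps)
    then show ?thesis by (simp only: of_int_eq_iff)
  qed
  have h0m: "h0 (- x) = - h0 x" for x using h0(2)[rule_format, of "- 1" x] by (simp add: of_rat_minus)
  have h_minus: "h (- x) = - h x" if "x \<in> \<Lambda>" for x
  proof -
    have "of_int Q * h0 (- x) = of_int (- h x)" using hL[OF that] by (simp add: h0m)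
    then show ?thesis unfolding h_def[of "- x"] by (simp only: floor_of_int)
  qed
  have h_nz: "h x \<noteq> 0" if "x \<in> \<Lambda>" for x
  proof
    assume "h x = 0"
    with hL[OF that] have "of_int Q * h0 x = 0" by simp
    with Q(1) h0(3) that show False by simp
  qed
  have L: "\<sigma> \<alpha> \<in> \<Lambda>" if "\<sigma> \<in> Gal" "\<alpha> \<in> \<Lambda>" for \<sigma> \<alpha> using emb_roots[OF Gal_emb] that by blast
  have LK: "\<alpha> \<in> K" if "\<alpha> \<in> \<Lambda>" for \<alpha> using that K(3) by blast
  define k where "k \<alpha> \<nu> = (\<Sum>\<sigma>\<in>Gal. h (\<sigma> \<alpha>) * h (\<sigma> \<nu>))" for \<alpha> \<nu>
  show thesis
  proof (rule that[of k])
    fix \<tau> \<alpha> \<nu> assume t: "\<tau> \<in> Gal" and a: "\<alpha> \<in> \<Lambda>" and n: "\<nu> \<in> \<Lambda> \<union> uminus ` \<Lambda>"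
    have nK: "\<nu> \<in> K" using n LK subring_uminus[OF K_ring] by auto
    have "k (\<tau> \<alpha>) (\<tau> \<nu>) = (\<Sum>\<sigma>\<in>Gal. h (comp \<sigma> \<tau> \<alpha>) * h (comp \<sigma> \<tau> \<nu>))"
      unfolding k_def using LK[OF a] nK by (intro sum.cong refl) (simp add: comp_def)
    also have "\<dots> = (\<Sum>\<rho>\<in>Gal. h (\<rho> \<alpha>) * h (\<rho> \<nu>))" by (rule sum.reindex_bij_betw[OF comp_bij_right[OF t]])
    finally show "k (\<tau> \<alpha>) (\<tau> \<nu>) = k \<alpha> \<nu>" by (simp add: k_def)
  next
    fix \<alpha> \<beta> \<nu> assume ab: "\<alpha> \<in> \<Lambda>" "\<beta> \<in> \<Lambda>" "\<alpha> + \<beta> \<in> \<Lambda>"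
    have "h (\<sigma> (\<alpha> + \<beta>)) = h (\<sigma> \<alpha>) + h (\<sigma> \<beta>)" if s: "\<sigma> \<in> Gal" for \<sigma>
    proof -
      have e: "\<sigma> (\<alpha> + \<beta>) = \<sigma> \<alpha> + \<sigma> \<beta>" by (rule emb_add[OF K_ring Gal_emb[OF s] LK[OF ab(1)] LK[OF ab(2)]])
      show ?thesis unfolding e by (rule h_add) (use L[OF s] ab e in metis)+
    qed
    then show "k (\<alpha> + \<beta>) \<nu> = k \<alpha> \<nu> + k \<beta> \<nu>" by (simp add: k_def distrib_right sum.distrib)
  next
    fix \<alpha> assume a: "\<alpha> \<in> \<Lambda>"
    have "h (\<sigma> (- \<alpha>)) = - h (\<sigma> \<alpha>)" if "\<sigma> \<in> Gal" for \<sigma>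
      using emb_uminus[OF K_ring Gal_emb[OF that] LK[OF a]] h_minus[OF L[OF that a]] by simp
    then have "k \<alpha> (- \<alpha>) = - (\<Sum>\<sigma>\<in>Gal. h (\<sigma> \<alpha>) * h (\<sigma> \<alpha>))" by (simp add: k_def sum_negf)
    moreover have "(\<Sum>\<sigma>\<in>Gal. h (\<sigma> \<alpha>) * h (\<sigma> \<alpha>)) > 0"
      using finite_Gal id_Gal by (intro sum_pos) (auto simp: zero_less_mult_iff h_nz L[OF _ a] linorder_neq_iff[symmetric] intro: h_nz)
    ultimately show "k \<alpha> (- \<alpha>) < 0" by simp
  qed
qed

text \<open>With f(\<nu>) = 1 - b \<nu>, the functions c and e are the products of powers of the
  f(\<nu>) with the positive and the negative parts of the exponents; the quotient c / e is
  multiplicative because k is additive.\<close>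

lemma ex_numbers:
  assumes root0: "0 \<notin> \<Lambda>" and h: "h > 0"
  obtains c e Ze Zd where "equi c" "equi e" "equi Ze" "equi Zd"
    "\<And>\<alpha>. \<alpha> \<in> \<Lambda> \<Longrightarrow> 1 < norm (e \<alpha>)"
    "\<And>\<alpha> \<beta>. \<alpha> \<in> \<Lambda> \<Longrightarrow> \<beta> \<in> \<Lambda> \<Longrightarrow> \<alpha> + \<beta> \<in> \<Lambda> \<Longrightarrow> c (\<alpha> + \<beta>) * (e \<alpha> * e \<beta>) = c \<alpha> * c \<beta> * e (\<alpha> + \<beta>)"
    "\<And>\<alpha>. \<alpha> \<in> \<Lambda> \<Longrightarrow> 1 - e \<alpha> = of_int h * Ze \<alpha>" "\<And>\<alpha>. \<alpha> \<in> \<Lambda> \<Longrightarrow> c \<alpha> - 1 = of_int h * Zd \<alpha>"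
    "\<And>n j. \<exists>U V. equi U \<and> equi V \<and> (\<forall>\<alpha>\<in>\<Lambda>. c \<alpha> ^ n * U \<alpha> + e \<alpha> ^ j * V \<alpha> = 1)"
proof -
  define Y where "Y = \<Lambda> \<union> uminus ` \<Lambda>"
  have fY: "finite Y" using finite_roots by (simp add: Y_def)
  have LK: "\<alpha> \<in> K" if "\<alpha> \<in> \<Lambda>" for \<alpha> using that K(3) by blast
  have YK: "\<nu> \<in> K" if "\<nu> \<in> Y" for \<nu> using that LK subring_uminus[OF K_ring] by (auto simp: Y_def)
  have Y0: "\<nu> \<noteq> 0" if "\<nu> \<in> Y" for \<nu> using that root0 by (auto simp: Y_def)
  show thesis
  proof (rule ex_exponents[OF root0, folded Y_def])
  fix k :: "complex \<Rightarrow> complex \<Rightarrow> int"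
  assume k: "\<And>\<sigma> \<alpha> \<nu>. \<sigma> \<in> Gal \<Longrightarrow> \<alpha> \<in> \<Lambda> \<Longrightarrow> \<nu> \<in> Y \<Longrightarrow> k (\<sigma> \<alpha>) (\<sigma> \<nu>) = k \<alpha> \<nu>"
    "\<And>\<alpha> \<beta> \<nu>. \<alpha> \<in> \<Lambda> \<Longrightarrow> \<beta> \<in> \<Lambda> \<Longrightarrow> \<alpha> + \<beta> \<in> \<Lambda> \<Longrightarrow> k (\<alpha> + \<beta>) \<nu> = k \<alpha> \<nu> + k \<beta> \<nu>"
    "\<And>\<alpha>. \<alpha> \<in> \<Lambda> \<Longrightarrow> k \<alpha> (- \<alpha>) < 0"
  \<comment> \<open>\<open>N\<close> is to clear the denominators of the \<nu> and of the inverse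
    differences used for comaximality; a pair with x = y contributes the harmless value 1/0 =
    0.\<close>
  let ?S = "Y \<union> (\<lambda>(x, y). 1 / (y - x)) ` (Y \<times> Y)"
  have "?S \<subseteq> K" using YK by (auto intro!: subfield_divide[OF K(1)] subring_1[OF K_ring] subring_diff[OF K_ring])
  then obtain N :: int where N: "N > 0" "\<forall>x\<in>?S. of_int N * x \<in> R" using R_denom_finite[of ?S] fY by auto
  have N1: "of_int N * \<nu> \<in> R" if "\<nu> \<in> Y" for \<nu> using N(2) that by blast
  have N2: "of_int N * (1 / (y - x)) \<in> R" if "x \<in> Y" "y \<in> Y" for x y
  proof -
    have "1 / (y - x) \<in> ?S" using that by force
    then show ?thesis using N(2) by blast
  qed
  have "\<exists>L::nat. \<forall>\<nu>\<in>S. 2 / norm \<nu> < real L" if "finite S" for S :: "complex set"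
    using that
  proof (induction S)
    case (insert x S)
    then obtain L :: nat where L: "\<forall>\<nu>\<in>S. 2 / norm \<nu> < real L" by blast
    obtain L' :: nat where "2 / norm x < real L'" using reals_Archimedean2 by blast
    with L show ?case by (intro exI[of _ "max L L'"]) (auto simp: less_max_iff_disj)
  qed simp
  from this[OF fY] obtain L :: nat where L: "\<And>\<nu>. \<nu> \<in> Y \<Longrightarrow> 2 / norm \<nu> < real L" by blast
  define g where "g = int (card Gal)"
  have g: "g > 0" using finite_Gal id_Gal by (auto simp: g_def card_gt_0_iff)
  \<comment> \<open>h is the congruence asked for, g = |Gal| serves the averaged Bezout identity,
    and L + 1 makes |b \<nu>| exceed 2. The square of \<open>N\<close> in \<open>b\<close> clears
    products of two elements, such as x and 1 / (y - x).\<close>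
  define H where "H = h * g * int (Suc L)"
  have H: "H > 0" using h g by (simp add: H_def)
  define b where "b = N * N * H"
  define f where "f \<nu> = 1 - of_int b * \<nu>" for \<nu> :: complex
  have bR: "of_int b * \<nu> = of_int H * (of_int N * (of_int N * \<nu>))" for \<nu> :: complex by (simp add: b_def mult_ac)
  have f_cong: "cong1 H (f \<nu>)" if "\<nu> \<in> Y" for \<nu>
    unfolding cong1_def f_def bR using N1[OF that] by (intro bexI[of _ "- (of_int N * (of_int N * \<nu>))"]) (auto intro!: R_uminus R_int)
  have cong_R: "x \<in> R" if "cong1 M x" for M x using that by (auto simp: cong1_def intro!: R_add R_1 R_int)
  have f_R: "f \<nu> \<in> R" if "\<nu> \<in> Y" for \<nu> by (rule cong_R[OF f_cong[OF that]])
  \<comment> \<open>With t = b / (y - x) one has f(x) y t - f(y) x t = b, so b is in the ideal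
    generated by both; and 1 = f(x)(1 + b x) + b w for w = b x^2.\<close>
  have f_cop: "cop (f x) (f y)" if xy: "x \<in> Y" "y \<in> Y" "x \<noteq> y" for x y
  proof -
    define t where "t = of_int b * (1 / (y - x))"
    define w where "w = of_int b * x * x"
    have xt: "u * t \<in> R" if "u \<in> Y" for u
    proof -
      have "u * t = of_int H * ((of_int N * u) * (of_int N * (1 / (y - x))))" by (simp add: t_def b_def)
      also have "\<dots> \<in> R" by (rule R_int[OF R_mult[OF N1[OF that] N2[OF xy(1,2)]]])
      finally show ?thesis .
    qed
    have "w = of_int H * ((of_int N * x) * (of_int N * x))" by (simp add: w_def b_def)
    also have "\<dots> \<in> R" by (rule R_int[OF R_mult[OF N1[OF xy(1)] N1[OF xy(1)]]])
    finally have wR: "w \<in> R" .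
    have bx: "of_int b * x \<in> R" unfolding bR by (rule R_int[OF R_int[OF N1[OF xy(1)]]])
    have tb: "t * (y - x) = of_int b" using xy(3) by (simp add: t_def)
    have "f x * (y * t) - f y * (x * t) = t * (y - x)" by (simp add: f_def algebra_simps)
    then have b1: "f x * (y * t) - f y * (x * t) = of_int b" using tb by simp
    have "f x * (1 + of_int b * x + y * t * w) + f y * (- (x * t * w)) =
        f x * (1 + of_int b * x) + (f x * (y * t) - f y * (x * t)) * w" by (simp add: algebra_simps)
    also have "\<dots> = 1" unfolding b1 by (simp add: f_def w_def algebra_simps)
    finally have eq: "f x * (1 + of_int b * x + y * t * w) + f y * (- (x * t * w)) = 1" .
    have U: "1 + of_int b * x + y * t * w \<in> R" by (intro R_add R_1 R_mult[OF xt wR] xy bx)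
    have V: "- (x * t * w) \<in> R" by (rule R_uminus[OF R_mult[OF xt[OF xy(1)] wR]])
    show ?thesis unfolding cop_def using eq U V by blast
  qed
  have f_big: "1 < norm (f \<nu>)" if n: "\<nu> \<in> Y" for \<nu>
  proof -
    have "2 < real L * norm \<nu>" using L[OF n] Y0[OF n] by (simp add: field_simps)
    also have "\<dots> \<le> of_int b * norm \<nu>"
    proof (rule mult_right_mono)
      have "int L \<le> 1 * int (Suc L)" by simp
      also have "\<dots> \<le> (N * N * h * g) * int (Suc L)"
      proof (rule mult_right_mono)
        have "0 < N * N * h * g" using N(1) h g by simp
        then show "1 \<le> N * N * h * g" by linarith
      qed simp
      finally have "int L \<le> b" by (simp add: b_def H_def mult_ac)
      then have "real_of_int (int L) \<le> of_int b" by (simp only: of_int_le_iff)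
      then show "real L \<le> of_int b" by simp
    qed simp
    finally have "2 < norm (of_int b * \<nu>)" using N(1) H by (simp add: norm_mult b_def)
    moreover have "norm (of_int b * \<nu>) - norm (1 :: complex) \<le> norm (f \<nu>)"
      unfolding f_def by (metis norm_minus_commute norm_triangle_ineq2)
    ultimately show ?thesis by simp
  qed
  \<comment> \<open>For s = 1 and s = -1 the truncation by \<open>nat\<close> keeps the positive and
    the negative exponents respectively, the latter with changed sign.\<close>
  define P where "P s \<alpha> = (\<Prod>\<nu>\<in>Y. f \<nu> ^ nat (s * k \<alpha> \<nu>))" for s \<alpha>
  have P_cong: "cong1 H (P s \<alpha>)" for s \<alpha> unfolding P_def by (intro cong1_prod cong1_power f_cong)
  have P_R: "P s \<alpha> \<in> R" for s \<alpha> by (rule cong_R[OF P_cong])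
  have YG: "bij_betw \<sigma> Y Y" if s: "\<sigma> \<in> Gal" for \<sigma>
  proof -
    have "\<sigma> ` Y \<subseteq> Y"
    proof
      fix y assume "y \<in> \<sigma> ` Y"
      then obtain x where x: "x \<in> Y" "y = \<sigma> x" by blast
      show "y \<in> Y"
      proof (cases "x \<in> \<Lambda>")
        case True
        then show ?thesis using x emb_roots[OF Gal_emb[OF s]] by (simp add: Y_def)
      next
        case False
        then obtain z where z: "z \<in> \<Lambda>" "x = - z" using x(1) by (auto simp: Y_def)
        then have "y = - \<sigma> z" using x(2) emb_uminus[OF K_ring Gal_emb[OF s] LK] by simp
        then show ?thesis using z(1) emb_roots[OF Gal_emb[OF s]] by (simp add: Y_def)
      qed
    qed
    moreover have inj: "inj_on \<sigma> Y" using emb_inj[OF K_ring Gal_emb[OF s] K(1)] YK by (intro inj_onI) blast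
    ultimately show ?thesis using endo_inj_surj[OF fY _ inj] by (simp add: bij_betw_def)
  qed
  have P_equi: "equi (P s)" for s
    unfolding equi_def
  proof (intro conjI ballI P_R)
    fix \<sigma> \<alpha> assume s: "\<sigma> \<in> Gal" and a: "\<alpha> \<in> \<Lambda>"
    note e = Gal_emb[OF s]
    have fK: "f \<nu> \<in> K" if "\<nu> \<in> Y" for \<nu> using f_R[OF that] R_K by blast
    have sf: "\<sigma> (f \<nu>) = f (\<sigma> \<nu>)" if "\<nu> \<in> Y" for \<nu>
      unfolding f_def using YK[OF that] K_ring
      by (simp add: emb_diff[OF K_ring e] emb_mult[OF K_ring e] emb_1[OF K_ring e] emb_of_int[OF K_ring e] subring_1 subring_mult subring_int)
    have "\<sigma> (P s' \<alpha>) = (\<Prod>\<nu>\<in>Y. f (\<sigma> \<nu>) ^ nat (s' * k (\<sigma> \<alpha>) (\<sigma> \<nu>)))" for s'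
      unfolding P_def using fK K_ring
      by (subst emb_prod[OF K_ring e]) (auto simp: emb_power[OF K_ring e] sf k(1)[OF s a] subring_power intro!: prod.cong)
    also have "(\<Prod>\<nu>\<in>Y. f (\<sigma> \<nu>) ^ nat (s' * k (\<sigma> \<alpha>) (\<sigma> \<nu>))) = P s' (\<sigma> \<alpha>)" for s'
      unfolding P_def by (rule prod.reindex_bij_betw[OF YG[OF s], of "\<lambda>\<nu>. f \<nu> ^ nat (s' * k (\<sigma> \<alpha>) \<nu>)"])
    finally show "\<sigma> (P s' \<alpha>) = P s' (\<sigma> \<alpha>)" for s' .
  qed
  have PH: "equi (\<lambda>\<alpha>. (P s \<alpha> - 1) / of_int h)" "equi (\<lambda>\<alpha>. (1 - P s \<alpha>) / of_int h)" for s
  proof -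
    have "\<exists>r\<in>R. P s \<alpha> - 1 = of_int h * r" "\<exists>r\<in>R. 1 - P s \<alpha> = of_int h * r" for \<alpha>
    proof -
      obtain r where r: "r \<in> R" "P s \<alpha> = 1 + of_int H * r" using P_cong[of s \<alpha>] by (auto simp: cong1_def)
      then have "P s \<alpha> - 1 = of_int h * (of_int (g * int (Suc L)) * r)" "1 - P s \<alpha> = of_int h * - (of_int (g * int (Suc L)) * r)"
        by (simp_all add: H_def mult_ac)
      then show "\<exists>r\<in>R. P s \<alpha> - 1 = of_int h * r" "\<exists>r\<in>R. 1 - P s \<alpha> = of_int h * r"
        using R_int[OF r(1), of "g * int (Suc L)"] R_uminus by blast+
    qed
    then show "equi (\<lambda>\<alpha>. (P s \<alpha> - 1) / of_int h)" "equi (\<lambda>\<alpha>. (1 - P s \<alpha>) / of_int h)"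
      using h by (auto intro!: equi_divide equi_diff P_equi equi_1)
  qed
  \<comment> \<open>The additivity of k, rewritten for positive and negative parts, without
    subtraction.\<close>
  have nats: "nat (1 * (a + b)) + (nat (- 1 * a) + nat (- 1 * b)) = nat (1 * a) + nat (1 * b) + nat (- 1 * (a + b))" for a b :: int
    unfolding mult_1 mult_minus1 by arith
  show thesis
  proof (rule that[of "P 1" "P (- 1)" "\<lambda>\<alpha>. (1 - P (- 1) \<alpha>) / of_int h" "\<lambda>\<alpha>. (P 1 \<alpha> - 1) / of_int h"])
    show "1 < norm (P (- 1) \<alpha>)" if a: "\<alpha> \<in> \<Lambda>" for \<alpha>
    proof -
      \<comment> \<open>The factor for \<nu> = - \<alpha> has the positive exponent - k \<alpha> (-
        \<alpha>) and modulus above 1; every other factor has modulus at least 1.\<close>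
      have ma: "- \<alpha> \<in> Y" using a by (simp add: Y_def)
      let ?F = "\<lambda>\<nu>. norm (f \<nu>) ^ nat (- 1 * k \<alpha> \<nu>)"
      have "norm (P (- 1) \<alpha>) = ?F (- \<alpha>) * (\<Prod>\<nu>\<in>Y - {- \<alpha>}. ?F \<nu>)"
        unfolding P_def prod_norm[symmetric] norm_power by (rule prod.remove[OF fY ma])
      moreover have "1 < ?F (- \<alpha>)" using f_big[OF ma] k(3)[OF a] by (intro one_less_power) auto
      moreover have "1 \<le> (\<Prod>\<nu>\<in>Y - {- \<alpha>}. ?F \<nu>)"
        using f_big by (intro prod_ge_1 one_le_power) (auto intro: less_imp_le)
      ultimately show ?thesis using mult_strict_mono'[of 1 "?F (- \<alpha>)" 1] mult_left_mono[of 1 "\<Prod>\<nu>\<in>Y - {- \<alpha>}. ?F \<nu>" "?F (- \<alpha>)"] by linarith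
    qed
    show "P 1 (\<alpha> + \<beta>) * (P (- 1) \<alpha> * P (- 1) \<beta>) = P 1 \<alpha> * P 1 \<beta> * P (- 1) (\<alpha> + \<beta>)"
      if ab: "\<alpha> \<in> \<Lambda>" "\<beta> \<in> \<Lambda>" "\<alpha> + \<beta> \<in> \<Lambda>" for \<alpha> \<beta>
      unfolding P_def prod.distrib[symmetric] power_add[symmetric] k(2)[OF ab] nats ..
    show "\<exists>U V. equi U \<and> equi V \<and> (\<forall>\<alpha>\<in>\<Lambda>. P 1 \<alpha> ^ n * U \<alpha> + P (- 1) \<alpha> ^ j * V \<alpha> = 1)" for n j
    proof (rule equi_bezout[OF equi_power[OF P_equi] equi_power[OF P_equi]])
      fix \<alpha> assume a: "\<alpha> \<in> \<Lambda>"
      \<comment> \<open>Factors at different points are comaximal; at the same point one of the two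
        exponents is 0.\<close>
      have "cop (f x ^ nat (1 * k \<alpha> x)) (f y ^ nat (- 1 * k \<alpha> y))" if xy: "x \<in> Y" "y \<in> Y" for x y
      proof (cases "x = y")
        case True
        then have "nat (1 * k \<alpha> x) = 0 \<or> nat (- 1 * k \<alpha> y) = 0" by auto
        then show ?thesis using cop_1 cop_sym by (elim disjE) (simp_all only: power_0)
      next
        case False
        then show ?thesis by (intro cop_power f_R xy cop_sym[OF cop_power[OF f_R cop_sym]] f_cop)
      qed
      then have "cop (f x ^ nat (1 * k \<alpha> x)) (P (- 1) \<alpha>)" if "x \<in> Y" for x
        unfolding P_def using that by (intro cop_prod R_power f_R) auto
      then have "cop (P (- 1) \<alpha>) (P 1 \<alpha>)" unfolding P_def[of 1]
        by (intro cop_prod R_power f_R) (auto intro: cop_sym)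
      then show "cop (P 1 \<alpha> ^ n) (P (- 1) \<alpha> ^ j)"
        by (intro cop_power P_R cop_sym[OF cop_power[OF P_R]]) 
      have "cong1 H (P 1 \<alpha> ^ n)" by (rule cong1_power[OF P_cong])
      then obtain r where "r \<in> R" "P 1 \<alpha> ^ n = 1 + of_int H * r" by (auto simp: cong1_def)
      then show "cong1 (int (card Gal)) (P 1 \<alpha> ^ n)"
        unfolding cong1_def using R_int[of r "h * int (Suc L)"]
        by (intro bexI[of _ "of_int (h * int (Suc L)) * r"]) (auto simp: H_def g_def mult_ac)
    qed
  qed (use h in \<open>auto simp: P_equi PH\<close>)
qed
qed

end

section \<open>Integral operators commuting with the derivation\<close>

definition intvec :: "nat \<Rightarrow> (nat \<Rightarrow> rat) set" where
  "intvec m = {u. in_space m u \<and> (\<forall>i. u i \<in> \<int>)}"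

text \<open>What remains of the number theory: \<open>J\<close> inverts \<open>E\<close>, and
  \<open>C * J\<close> is the automorphism. \<A> is a ring of operators whose denominators are all
  bounded by the same \<open>N\<close>, and Z, Z' witness that 1 - E and C - 1 are divisible by
  \<open>h\<close> in it.\<close>

locale contracting = lin_op "vscale :: rat \<Rightarrow> (nat \<Rightarrow> rat) \<Rightarrow> nat \<Rightarrow> rat" "mv m D" "{x. in_space m x}"
  for m :: nat and D :: "nat \<Rightarrow> nat \<Rightarrow> rat" +
  fixes c :: "nat \<Rightarrow> nat \<Rightarrow> nat \<Rightarrow> rat" and \<A> :: "rat poly set" and N h :: int
    and C E Z Z' J :: "rat poly"
  assumes der: "in_space m x \<Longrightarrow> in_space m y \<Longrightarrow>
      mv m D (lie_br m c x y) = lie_br m c (mv m D x) y + lie_br m c x (mv m D y)"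
    and A_1: "1 \<in> \<A>"
    and A_add: "p \<in> \<A> \<Longrightarrow> r \<in> \<A> \<Longrightarrow> p + r \<in> \<A>"
    and A_mult: "p \<in> \<A> \<Longrightarrow> r \<in> \<A> \<Longrightarrow> p * r \<in> \<A>"
    and A_int: "p \<in> \<A> \<Longrightarrow> u \<in> intvec m \<Longrightarrow> vscale (of_int N) (papp p u) \<in> intvec m"
    and A_CE: "C \<in> \<A>" "E \<in> \<A>" "Z \<in> \<A>" "Z' \<in> \<A>"
    and E_Z: "in_space m u \<Longrightarrow> u - papp E u = vscale (of_int h) (papp Z u)"
    and C_Z: "in_space m u \<Longrightarrow> papp C u - u = vscale (of_int h) (papp Z' u)"
    and JE: "in_space m u \<Longrightarrow> papp (J * E) u = u"
    and CJ_br: "in_space m x \<Longrightarrow> in_space m y \<Longrightarrow>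
      papp (C * J) (lie_br m c x y) = lie_br m c (papp (C * J) x) (papp (C * J) y)"
    and bezout: "\<exists>U\<in>\<A>. \<exists>V\<in>\<A>. \<forall>u. in_space m u \<longrightarrow> papp (C ^ n * U + E ^ j * V) u = u"
    and J_contracts: "in_space m u \<Longrightarrow> (\<lambda>n. complex_of_rat (papp (J ^ n) u i)) \<longlonglongrightarrow> 0"

context deriv_spec
begin

text \<open>The coordinates of p(D)u, for integral u, lie in the group generated by a finite set
  \<open>B\<close> that depends neither on p nor on u. A functional linear over Q and equal to the
  identity on Q maps this group to rationals with a common denominator and fixes the coordinates,
  which are rational.\<close>

lemma integral_bound:
  assumes fT: "finite T" and RT: "R \<subseteq> zspan T"
  shows "\<exists>N>0. \<forall>p \<phi>. vals p \<phi> \<longrightarrow> (\<forall>\<alpha>\<in>\<Lambda>. \<phi> \<alpha> \<in> R) \<longrightarrow> (\<forall>u\<in>intvec m. vscale (of_int N) (RQ.papp p u) \<in> intvec m)"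
proof -
  define B where "B = (\<lambda>(t, \<alpha>, j, i). t * S.E \<alpha> (unit_vec j) i) ` (T \<times> \<Lambda> \<times> {..<m} \<times> {..<m})"
  have fB: "finite B" using fT finite_roots by (simp add: B_def)
  have "QC.subspace {0}" by simp
  from ex_functional_single[OF QC.vector_space_axioms this, of 1] obtain h :: "complex \<Rightarrow> rat" where
    h: "\<forall>x y. h (x + y) = h x + h y" "\<forall>a x. h (of_rat a * x) = a * h x" "h 1 \<noteq> 0" by auto
  have h_diff: "h (x - y) = h x - h y" for x y using h(1)[rule_format, of "x - y" y] by simp
  define \<pi> where "\<pi> x = h x / h 1" for x
  have p1: "\<pi> (of_rat r) = r" for r using h(2)[rule_format, of r 1] h(3) by (simp add: \<pi>_def)
  obtain N :: int where N: "N > 0" "\<forall>x\<in>\<pi> ` B. of_int N * x \<in> \<int>" using common_denominator[of "\<pi> ` B"] fB by auto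
  have "h 0 = 0" using h_diff[of 0 0] by simp
  then have "asub {z. of_int N * \<pi> z \<in> \<int>}"
    by (auto simp: asub_def \<pi>_def h_diff diff_divide_distrib right_diff_distrib)
  then have zB: "zspan B \<subseteq> {z. of_int N * \<pi> z \<in> \<int>}" using N(2) by (intro zspan_minimal) auto
  show ?thesis
  proof (intro exI[of _ N] conjI allI impI ballI N(1))
    fix p \<phi> u assume p: "vals p \<phi>" "\<forall>\<alpha>\<in>\<Lambda>. \<phi> \<alpha> \<in> R" and u: "u \<in> intvec m"
    have um: "in_space m u" using u by (simp add: intvec_def)
    have pm: "in_space m (RQ.papp p u)" using RQ.papp_W[of u p] um by simp
    have summand: "\<phi> \<alpha> * S.E \<alpha> (rc u) i \<in> zspan B" if a: "\<alpha> \<in> \<Lambda>" and i: "i < m" for \<alpha> i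
    proof -
      have "rc u = (\<Sum>j<m. vscale (rc u j) (unit_vec j) :: nat \<Rightarrow> complex)" by (rule in_space_expand[OF in_space_rc[OF um]])
      then have "S.E \<alpha> (rc u) = (\<Sum>j<m. vscale (rc u j) (S.E \<alpha> (unit_vec j)))"
        unfolding S.E_def by (metis (no_types, lifting) S.papp_vsum S.papp_vscale sum.cong)
      then have "\<phi> \<alpha> * S.E \<alpha> (rc u) i = (\<Sum>j<m. rc u j * (\<phi> \<alpha> * S.E \<alpha> (unit_vec j) i))"
        by (simp only: sum_fun_apply vscale_apply sum_distrib_left mult_ac)
      also have "\<dots> \<in> zspan B"
      proof (rule asub_sum[OF asub_zspan])
        fix j assume j: "j \<in> {..<m}"
        have "u j \<in> \<int>" using u by (simp add: intvec_def)
        then obtain n where n: "u j = of_int n" by (auto elim: Ints_cases)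
        have "\<phi> \<alpha> \<in> zspan T" using p(2) a RT by blast
        from zspan_mult_left[OF this, of "S.E \<alpha> (unit_vec j) i"]
        have "\<phi> \<alpha> * S.E \<alpha> (unit_vec j) i \<in> zspan ((\<lambda>y. S.E \<alpha> (unit_vec j) i * y) ` T)" by (simp only: mult.commute)
        moreover have "(\<lambda>y. S.E \<alpha> (unit_vec j) i * y) ` T \<subseteq> B"
          unfolding B_def using a i j by (force simp: mult.commute)
        ultimately have "\<phi> \<alpha> * S.E \<alpha> (unit_vec j) i \<in> zspan B" using zspan_mono by blast
        from QC.asub_scale_int[OF asub_zspan this, of n]
        show "rc u j * (\<phi> \<alpha> * S.E \<alpha> (unit_vec j) i) \<in> zspan B" by (simp add: rc_def n)
      qed
      finally show ?thesis .
    qed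
    have "of_int N * RQ.papp p u i \<in> \<int>" for i
    proof (cases "i < m")
      case True
      have "of_rat (RQ.papp p u i) = (\<Sum>\<alpha>\<in>\<Lambda>. \<phi> \<alpha> * S.E \<alpha> (rc u) i)"
        using fun_cong[OF vals_apply[OF p(1) um], of i] by (simp only: rc_def sum_fun_apply vscale_apply)
      also have "\<dots> \<in> zspan B" using summand True by (intro asub_sum[OF asub_zspan]) blast
      finally show ?thesis using zB p1 by auto
    next
      case False
      then show ?thesis using pm by (simp add: in_space_def)
    qed
    then show "vscale (of_int N) (RQ.papp p u) \<in> intvec m" using pm by (simp add: intvec_def in_space_def)
  qed
qed

text \<open>The order of the quantifiers matters: \<open>N\<close> is determined by the order and
  the derivation, so that \<open>h\<close> can later be taken divisible by it.\<close>

lemma ex_contracting_spec: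
  "\<exists>\<A> N. N > 0 \<and> (\<forall>h>0. \<exists>C E Z Z' J. contracting m D c \<A> N h C E Z Z' J)"
proof -
  obtain R T where R: "R \<subseteq> K" "1 \<in> R" "asub R" "\<forall>x\<in>R. \<forall>y\<in>R. x * y \<in> R" "\<forall>\<sigma>\<in>Gal. \<forall>x\<in>R. \<sigma> x \<in> R"
    "\<forall>x\<in>K. \<exists>N>0. of_int N * x \<in> R" "finite T" "R \<subseteq> zspan T"
    using ex_order by (elim exE conjE) (rule that)
  interpret O: galois_order q \<Lambda> K Gal R
    by (intro galois_order.intro galois_order_axioms.intro) (use galois_axioms R in \<open>simp_all add: \<Lambda>_def K_def Gal_def\<close>)
  obtain N where N: "N > 0" "\<forall>p \<phi>. vals p \<phi> \<longrightarrow> (\<forall>\<alpha>\<in>\<Lambda>. \<phi> \<alpha> \<in> R) \<longrightarrow> (\<forall>u\<in>intvec m. vscale (of_int N) (RQ.papp p u) \<in> intvec m)"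
    using integral_bound[OF R(7,8)] by (elim exE conjE) (rule that)
  define \<A> where "\<A> = {p. \<exists>\<phi>. vals p \<phi> \<and> O.equi \<phi>}"
  have AI: "p \<in> \<A>" if "vals p \<phi>" "O.equi \<phi>" for p \<phi> using that by (auto simp: \<A>_def)
  have ex: "\<exists>p. vals p \<phi>" if "O.equi \<phi>" for \<phi> by (rule ex_vals) (use that O.equi_K O.equi_Gal in auto)
  have "\<exists>C E Z Z' J. contracting m D c \<A> N h C E Z Z' J" if h: "h > 0" for h
  proof (rule O.ex_numbers[OF root0 h])
    fix cn en zn zn'
    assume e: "O.equi cn" "O.equi en" "O.equi zn" "O.equi zn'"
      and big: "\<And>\<alpha>. \<alpha> \<in> \<Lambda> \<Longrightarrow> 1 < norm (en \<alpha>)"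
      and mult: "\<And>\<alpha> \<beta>. \<alpha> \<in> \<Lambda> \<Longrightarrow> \<beta> \<in> \<Lambda> \<Longrightarrow> \<alpha> + \<beta> \<in> \<Lambda> \<Longrightarrow> cn (\<alpha> + \<beta>) * (en \<alpha> * en \<beta>) = cn \<alpha> * cn \<beta> * en (\<alpha> + \<beta>)"
      and z: "\<And>\<alpha>. \<alpha> \<in> \<Lambda> \<Longrightarrow> 1 - en \<alpha> = of_int h * zn \<alpha>" "\<And>\<alpha>. \<alpha> \<in> \<Lambda> \<Longrightarrow> cn \<alpha> - 1 = of_int h * zn' \<alpha>"
      and bz: "\<And>n j. \<exists>U V. O.equi U \<and> O.equi V \<and> (\<forall>\<alpha>\<in>\<Lambda>. cn \<alpha> ^ n * U \<alpha> + en \<alpha> ^ j * V \<alpha> = 1)"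
    have e0: "en \<alpha> \<noteq> 0" if "\<alpha> \<in> \<Lambda>" for \<alpha> using big[OF that] by auto
    obtain C E Z Z' where p: "vals C cn" "vals E en" "vals Z zn" "vals Z' zn'" using ex e by metis
    have "\<exists>J. vals J (\<lambda>\<alpha>. inverse (en \<alpha>))"
    proof (rule ex_vals)
      show "inverse (en \<alpha>) \<in> K" if "\<alpha> \<in> \<Lambda>" for \<alpha> using K(1) O.equi_K[OF e(2) that] by (simp add: subfield_C_def)
      show "\<sigma> (inverse (en \<alpha>)) = inverse (en (\<sigma> \<alpha>))" if "\<sigma> \<in> Gal" "\<alpha> \<in> \<Lambda>" for \<sigma> \<alpha>
        using emb_inverse[OF K_ring Gal_emb[OF that(1)] K(1) O.equi_K[OF e(2) that(2)]] O.equi_Gal[OF e(2) that] by simp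
    qed
    then obtain J where J: "vals J (\<lambda>\<alpha>. inverse (en \<alpha>))" by blast
    have const: "vals [:of_int h:] (\<lambda>_. of_int h)" using vals_const[of "of_int h"] by simp
    have hp: "RQ.papp ([:of_int h:] * r) u = vscale (of_int h) (RQ.papp r u)" for r u
      using RQ.papp_smult[of "of_int h" r u] by simp
    note CJ = vals_mult[OF p(1) J]
    have "contracting m D c \<A> N h C E Z Z' J"
    proof (intro contracting.intro contracting_axioms.intro)
      show "lin_op (vscale :: rat \<Rightarrow> _) (mv m D) {x. in_space m x}" by (rule RQ.lin_op_axioms)
    next
      fix x y :: "nat \<Rightarrow> rat" assume "in_space m x" "in_space m y"
      then show "mv m D (lie_br m c x y) = lie_br m c (mv m D x) y + lie_br m c x (mv m D y)" by (rule der)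
    next
      show "1 \<in> \<A>" by (rule AI[OF vals_1 O.equi_1])
    next
      fix p r assume "p \<in> \<A>" "r \<in> \<A>"
      then obtain \<phi> \<psi> where pr: "vals p \<phi>" "O.equi \<phi>" "vals r \<psi>" "O.equi \<psi>" by (auto simp: \<A>_def)
      show "p + r \<in> \<A>" by (rule AI[OF vals_add O.equi_add]) (rule pr)+
      show "p * r \<in> \<A>" by (rule AI[OF vals_mult O.equi_mult]) (rule pr)+
    next
      fix p u assume "p \<in> \<A>" "u \<in> intvec m"
      then obtain \<phi> where "vals p \<phi>" "O.equi \<phi>" by (auto simp: \<A>_def)
      then show "vscale (of_int N) (RQ.papp p u) \<in> intvec m" using N(2) O.equi_R \<open>u \<in> intvec m\<close> by blast
    next
      show "C \<in> \<A>" "E \<in> \<A>" "Z \<in> \<A>" "Z' \<in> \<A>" using AI p e by blast+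
    next
      fix u :: "nat \<Rightarrow> rat" assume u: "in_space m u"
      have "RQ.papp (1 - E) u = RQ.papp ([:of_int h:] * Z) u"
        by (rule vals_unique[OF vals_diff[OF vals_1 p(2)] vals_mult[OF const p(3)] z(1) u])
      then show "u - RQ.papp E u = vscale (of_int h) (RQ.papp Z u)" by (simp only: hp RQ.papp_diff RQ.papp_1)
      have "RQ.papp (C - 1) u = RQ.papp ([:of_int h:] * Z') u"
        by (rule vals_unique[OF vals_diff[OF p(1) vals_1] vals_mult[OF const p(4)] z(2) u])
      then show "RQ.papp C u - u = vscale (of_int h) (RQ.papp Z' u)" by (simp only: hp RQ.papp_diff RQ.papp_1)
      have "RQ.papp (J * E) u = RQ.papp 1 u"
        by (rule vals_unique[OF vals_mult[OF J p(2)] vals_1 _ u]) (simp add: e0)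
      then show "RQ.papp (J * E) u = u" by (simp only: RQ.papp_1)
    next
      fix x y :: "nat \<Rightarrow> rat" assume xy: "in_space m x" "in_space m y"
      show "RQ.papp (C * J) (lie_br m c x y) = lie_br m c (RQ.papp (C * J) x) (RQ.papp (C * J) y)"
      proof (rule vals_automorphism[OF CJ _ xy])
        fix \<alpha> \<beta> assume ab: "\<alpha> \<in> \<Lambda>" "\<beta> \<in> \<Lambda>" "\<alpha> + \<beta> \<in> \<Lambda>"
        show "cn (\<alpha> + \<beta>) * inverse (en (\<alpha> + \<beta>)) = cn \<alpha> * inverse (en \<alpha>) * (cn \<beta> * inverse (en \<beta>))"
          using mult[OF ab] e0[OF ab(1)] e0[OF ab(2)] e0[OF ab(3)] by (simp add: field_simps)
      qed
    next
      fix n j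
      obtain U V where UV: "O.equi U" "O.equi V" "\<forall>\<alpha>\<in>\<Lambda>. cn \<alpha> ^ n * U \<alpha> + en \<alpha> ^ j * V \<alpha> = 1"
        using bz[of n j] by (elim exE conjE) (rule that)
      obtain PU PV where P: "vals PU U" "vals PV V" using ex UV by metis
      have "RQ.papp (C ^ n * PU + E ^ j * PV) u = u" if "in_space m u" for u
      proof -
        have "RQ.papp (C ^ n * PU + E ^ j * PV) u = RQ.papp 1 u"
          by (rule vals_unique[OF vals_add[OF vals_mult[OF vals_power[OF p(1)] P(1)] vals_mult[OF vals_power[OF p(2)] P(2)]] vals_1 _ that])
            (use UV(3) in blast)
        then show ?thesis by (simp only: RQ.papp_1)
      qed
      then show "\<exists>U\<in>\<A>. \<exists>V\<in>\<A>. \<forall>u. in_space m u \<longrightarrow> RQ.papp (C ^ n * U + E ^ j * V) u = u"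
        using AI P UV by blast
    next
      fix u :: "nat \<Rightarrow> rat" and i assume u: "in_space m u"
      have "complex_of_rat (RQ.papp (J ^ n) u i) = (\<Sum>\<alpha>\<in>\<Lambda>. inverse (en \<alpha>) ^ n * S.E \<alpha> (rc u) i)" for n
        using fun_cong[OF vals_apply[OF vals_power[OF J, of n] u], of i] by (simp only: rc_def sum_fun_apply vscale_apply)
      moreover have "(\<lambda>n. \<Sum>\<alpha>\<in>\<Lambda>. inverse (en \<alpha>) ^ n * S.E \<alpha> (rc u) i) \<longlonglongrightarrow> (\<Sum>\<alpha>\<in>\<Lambda>. 0 * S.E \<alpha> (rc u) i)"
      proof (intro tendsto_sum tendsto_mult tendsto_const LIMSEQ_power_zero)
        fix \<alpha> assume "\<alpha> \<in> \<Lambda>"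
        from big[OF this] show "norm (inverse (en \<alpha>)) < 1" by (simp add: norm_inverse inverse_less_1_iff)
      qed
      ultimately show "(\<lambda>n. complex_of_rat (RQ.papp (J ^ n) u i)) \<longlonglongrightarrow> 0" by simp
    qed
    then show "\<exists>C E Z Z' J. contracting m D c \<A> N h C E Z Z' J" by (intro exI)
  qed
  then show ?thesis using N(1) by blast
qed

end

text \<open>The minimal polynomial of D over Q serves as q. Its constant coefficient is nonzero,
  since D is injective and a factor X could be divided out; so 0 is no eigenvalue.\<close>

theorem ex_contracting:
  assumes "has_very_special_grading_C m c"
  obtains D \<A> N where "N > 0" "\<And>h. h > 0 \<Longrightarrow> \<exists>C E Z Z' J. contracting m D c \<A> N h C E Z Z' J"
proof -
  obtain D :: "nat \<Rightarrow> nat \<Rightarrow> rat" where der: "\<And>x y :: nat \<Rightarrow> rat. in_space m x \<Longrightarrow> in_space m y \<Longrightarrow>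
      mv m D (lie_br m c x y) = lie_br m c (mv m D x) y + lie_br m c x (mv m D y)"
    and inj: "\<And>x :: nat \<Rightarrow> rat. in_space m x \<Longrightarrow> mv m D x = 0 \<Longrightarrow> x = 0"
    using rational_derivation[OF assms] by metis
  interpret RQ: lin_op "vscale :: rat \<Rightarrow> _" "mv m D" "{x. in_space m x}" by (rule lin_op_mv)
  interpret S: lin_op "vscale :: complex \<Rightarrow> _" "mv m D" "{x. in_space m x}" by (rule lin_op_mv)
  from RQ.ex_minimal_annihilator[OF in_space_basis in_space_span_unit]
  obtain p where p: "lead_coeff p = 1" "RQ.annih p" "\<And>q. RQ.annih q \<Longrightarrow> q \<noteq> 0 \<Longrightarrow> degree p \<le> degree q" by blast
  let ?q = "map_poly of_rat p :: complex poly"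
  have dq: "degree ?q = degree p" using p(1) by (intro degree_map_poly) auto
  have a: "coeff p 0 \<noteq> 0"
  proof
    assume c0: "coeff p 0 = 0"
    obtain b r where pr: "p = pCons b r" by (cases p)
    with c0 have b0: "b = 0" by simp
    have "RQ.annih r" unfolding RQ.annih_def
    proof
      fix w :: "nat \<Rightarrow> rat" assume w: "w \<in> {x. in_space m x}"
      have "RQ.papp p w = 0" using p(2) w by (simp add: RQ.annih_def)
      then have "mv m D (RQ.papp r w) = 0" unfolding pr b0 RQ.papp_pCons RQ.scale_zero_left by simp
      moreover have "in_space m (RQ.papp r w)" using RQ.papp_W[OF w] by simp
      ultimately show "RQ.papp r w = 0" using inj by blast
    qed
    moreover have "r \<noteq> 0" using p(1) b0 pr by auto
    ultimately show False using p(3)[of r] pr by simp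
  qed
  have ann: "S.papp ?q v = 0" if v: "in_space m v" for v
  proof -
    have 1: "S.papp ?q (unit_vec i) = 0" if "i < m" for i
    proof -
      have "S.papp ?q (rc (unit_vec i)) = rc (RQ.papp p (unit_vec i))" by (rule papp_mv_rc)
      also have "RQ.papp p (unit_vec i) = 0" 
        using p(2) in_space_unit_vec[OF that] unfolding RQ.annih_def by blast
      also have "rc 0 = (0 :: nat \<Rightarrow> complex)" by (auto simp: rc_def fun_eq_iff)
      finally show ?thesis by (simp only: rc_unit_vec)
    qed
    have "S.papp ?q v = S.papp ?q (\<Sum>i<m. vscale (v i) (unit_vec i))" using in_space_expand[OF v] by metis
    also have "\<dots> = (\<Sum>i<m. vscale (v i) (S.papp ?q (unit_vec i)))" by (simp only: S.papp_vsum S.papp_vscale)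
    also have "\<dots> = (\<Sum>i<m. 0)" by (intro sum.cong refl) (simp only: 1 lessThan_iff S.scale_zero_right)
    finally show ?thesis by simp
  qed
  have "galois ?q"
  proof
    show "cpoly \<rat> ?q" by (simp add: cpoly_def coeff_map_poly)
    show "lead_coeff ?q = 1" unfolding dq using p(1) by (simp add: coeff_map_poly)
  qed
  moreover have "0 \<notin> {z. poly ?q z = 0}" using a by (simp add: poly_0_coeff_0 coeff_map_poly)
  ultimately have ds: "deriv_spec ?q m c D"
    using der ann by (intro deriv_spec.intro deriv_spec_axioms.intro) auto
  from deriv_spec.ex_contracting_spec[OF ds] show thesis using that by blast
qed

section \<open>Integer vectors and the image of the group\<close>

lemma (in nilpotent_lie) chp_hom:
  assumes H: "subalg H" and add: "\<And>x y. F (x + y) = F x + F y" and scl: "\<And>a x. F (a \<star> x) = a \<star> F x"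
    and br: "\<And>x y. x \<in> H \<Longrightarrow> y \<in> H \<Longrightarrow> F (br x y) = br (F x) (F y)" and xy: "x \<in> H" "y \<in> H"
  shows "F (chp x y) = chp (F x) (F y)"
proof -
  have F0: "F 0 = 0" using scl[of 0 0] by simp
  have Fsum: "F (sum f S) = (\<Sum>i\<in>S. F (f i))" for f and S :: "(nat \<times> nat) list set"
    by (induction S rule: infinite_finite_induct) (auto simp: F0 add)
  have 0: "0 \<in> H" using H by (auto simp: subalg_def subspace_0)
  have nest: "set zs \<subseteq> H \<Longrightarrow> nest br zs \<in> H \<and> F (nest br zs) = nest br (map F zs)" for zs
  proof (induction zs rule: induct_list012)
    case (3 z z' zs)
    then show ?case using H br by (auto simp: subalg_def)
  qed (auto simp: F0 0)
  have word: "F (nest br (dyn_word x y ps)) = nest br (dyn_word (F x) (F y) ps)" for ps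
  proof -
    have "set (dyn_word x y ps) \<subseteq> H" using xy by (subst dyn_word_map) auto
    moreover have "map F (dyn_word x y ps) = dyn_word (F x) (F y) ps"
      unfolding dyn_word_map[of x y] dyn_word_map[of "F x" "F y"] by auto
    ultimately show ?thesis using nest by metis
  qed
  show ?thesis unfolding chp_def Fsum scl word ..
qed

lemma asub_intvec: "asub (intvec m)"
  by (auto simp: asub_def intvec_def in_space_def)

lemma intvec_scale: "u \<in> intvec m \<Longrightarrow> vscale (of_int n) u \<in> intvec m"
  by (auto simp: intvec_def in_space_def)

lemma intvec_space: "u \<in> intvec m \<Longrightarrow> in_space m u"
  by (simp add: intvec_def)

lemma intvec_zspan: "intvec m = zspan (unit_vec ` {..<m})"
proof
  interpret rational_space "vscale :: rat \<Rightarrow> _" by (rule rational_space.intro[OF vector_space_vscale])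
  show "zspan (unit_vec ` {..<m}) \<subseteq> intvec m"
  proof (rule zspan_minimal[OF asub_intvec], rule subsetI)
    fix u :: "nat \<Rightarrow> rat" assume "u \<in> unit_vec ` {..<m}"
    then obtain i where i: "i < m" "u = unit_vec i" by auto
    have "unit_vec i j \<in> (\<int> :: rat set)" for j by (simp add: unit_vec_def)
    with in_space_unit_vec[OF i(1)] show "u \<in> intvec m" unfolding i(2) intvec_def by blast
  qed
  show "intvec m \<subseteq> zspan (unit_vec ` {..<m})"
  proof
    fix u assume u: "u \<in> intvec m"
    have "(\<Sum>i<m. vscale (u i) (unit_vec i)) \<in> zspan (unit_vec ` {..<m})"
    proof (rule asub_sum[OF asub_zspan])
      fix i assume "i \<in> {..<m}"
      then have b: "unit_vec i \<in> zspan (unit_vec ` {..<m})" by (intro zspan_base) auto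
      have "u i \<in> \<int>" using u by (simp add: intvec_def)
      then obtain n where "u i = of_int n" by (auto elim: Ints_cases)
      then show "vscale (u i) (unit_vec i) \<in> zspan (unit_vec ` {..<m})" using asub_scale_int[OF asub_zspan b] by metis
    qed
    then show "u \<in> zspan (unit_vec ` {..<m})" using in_space_expand[OF intvec_space[OF u]] by simp
  qed
qed

lemma zspan_denominator:
  fixes F :: "(nat \<Rightarrow> rat) set"
  assumes "finite F"
  shows "\<exists>N::int>0. \<forall>x\<in>zspan F. in_space m x \<longrightarrow> vscale (of_int N) x \<in> intvec m"
proof -
  have "finite ((\<lambda>(x, i). x i) ` (F \<times> {..<m}))" using assms by simp
  from common_denominator[OF this] obtain N :: int where N: "N > 0" "\<forall>x\<in>F. \<forall>i<m. of_int N * x i \<in> \<int>" by auto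
  have "asub {x :: nat \<Rightarrow> rat. \<forall>i<m. of_int N * x i \<in> \<int>}" by (auto simp: asub_def right_diff_distrib)
  then have *: "zspan F \<subseteq> {x. \<forall>i<m. of_int N * x i \<in> \<int>}" using N(2) by (intro zspan_minimal) auto
  have "vscale (of_int N) x \<in> intvec m" if "x \<in> zspan F" "in_space m x" for x
  proof -
    have "of_int N * x i \<in> \<int>" for i using * that by (cases "i < m") (auto simp: in_space_def)
    then show ?thesis using that(2) by (simp add: intvec_def in_space_def)
  qed
  then show ?thesis using N(1) by blast
qed

locale malcev_group = malcev_hom "vscale :: rat \<Rightarrow> (nat \<Rightarrow> rat) \<Rightarrow> nat \<Rightarrow> rat" "lie_br m c" "m + 1" G \<iota>
  for m c and G :: "('g, 'b) monoid_scheme" (structure) and \<iota> +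
  assumes iota_inj: "inj_on \<iota> (carrier G)"
    and iota_space: "g \<in> carrier G \<Longrightarrow> in_space m (\<iota> g)"
    and hull: "lie_hull (\<iota> ` carrier G) = {x. in_space m x}"
    and fg: "fin_gen_group G"
begin

abbreviation "Vm \<equiv> {x :: nat \<Rightarrow> rat. in_space m x}"

lemma subalg_Vm: "subalg Vm"
  using subalg_lie_hull[of \<Delta>] unfolding hull .

lemma image_denominator: "\<exists>R::int>0. \<forall>g\<in>carrier G. vscale (of_int R) (\<iota> g) \<in> intvec m"
proof -
  obtain F where F: "finite F" "\<Delta> \<subseteq> zspan F" using image_in_lattice[OF fg] by blast
  obtain R :: int where "R > 0" "\<forall>x\<in>zspan F. in_space m x \<longrightarrow> vscale (of_int R) x \<in> intvec m"
    using zspan_denominator[OF F(1)] by blast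
  then show ?thesis using F(2) iota_space by (intro exI[of _ R]) blast
qed

lemma intvec_in_image: "\<exists>R::int>0. \<forall>u\<in>intvec m. vscale (of_int R) u \<in> \<Delta>"
  unfolding intvec_zspan
  by (rule lattice_in_image[where k = 0]) (use hull in_space_unit_vec in auto)

text \<open>The solution of \<iota> g * s = y is divisible by d up to bounded denominators when y -
  \<iota> g is, so a suitable multiple d of \<open>M\<close> works. Choosing \<open>M\<close> with M
  Z^m in \<Delta> shows that \<Delta> is stable under translations by d Z^m.\<close>

lemma close_to_image:
  fixes M :: int
  assumes M: "M > 0"
  shows "\<exists>d::int>0. \<forall>g\<in>carrier G. \<forall>y. y - \<iota> g \<in> vscale (of_int d) ` intvec m \<longrightarrow>
    (\<exists>s\<in>intvec m. y = chp (\<iota> g) (vscale (of_int M) s))"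
proof -
  obtain F where F: "finite F" "\<Delta> \<subseteq> zspan F" using image_in_lattice[OF fg] by blast
  let ?F = "F \<union> unit_vec ` {..<m}"
  obtain K where K: "\<And>H. lcs H K \<subseteq> {0}" using ex_lcs_trivial by blast
  have "finite ?F" using F by simp
  from sol_lattice[OF this, of K] obtain F' where F': "finite F'"
    "\<forall>(M::int) w y. w \<in> zspan ?F \<longrightarrow> y - w \<in> dil (of_int M) (zspan ?F) \<longrightarrow> sol w y K \<in> dil (of_int M) (zspan F')"
    by (elim exE conjE) (rule that)
  obtain N :: int where N: "N > 0" "\<forall>x\<in>zspan F'. in_space m x \<longrightarrow> vscale (of_int N) x \<in> intvec m"
    using zspan_denominator[OF F'(1)] by blast
  let ?d = "M * N"
  show ?thesis
  proof (intro exI[of _ ?d] conjI ballI allI impI)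
    show "0 < ?d" using M N(1) by simp
    fix g y assume g: "g \<in> carrier G" and y: "y - \<iota> g \<in> vscale (of_int ?d) ` intvec m"
    have gF: "\<iota> g \<in> zspan ?F" using F(2) g zspan_mono[of F ?F] by blast
    have "intvec m \<subseteq> zspan ?F" unfolding intvec_zspan by (rule zspan_mono) auto
    then have "y - \<iota> g \<in> dil (of_int ?d) (zspan ?F)" using y unfolding dil_def by blast
    with F'(2) gF have "sol (\<iota> g) y K \<in> dil (of_int ?d) (zspan F')" by blast
    then obtain e where e: "e \<in> zspan F'" "sol (\<iota> g) y K = vscale (of_int ?d) e" by (auto simp: dil_def)
    obtain x where x: "x \<in> intvec m" "y - \<iota> g = vscale (of_int ?d) x" using y by blast
    have "in_space m (vscale (of_int ?d) x)" using intvec_space[OF intvec_scale[OF x(1)]] .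
    then have "y - \<iota> g \<in> lcs Vm 0" unfolding x(2) lcs.simps by blast
    from sol_lcs[OF subalg_Vm _ this, of K] have "in_space m (vscale (of_int ?d) e)" using iota_space[OF g] e(2) by simp
    then have "in_space m e" using M N(1) by (simp add: in_space_def)
    then have "vscale (of_int N) e \<in> intvec m" using N(2) e(1) by blast
    moreover have "y = chp (\<iota> g) (vscale (of_int M) (vscale (of_int N) e))"
    proof -
      have "vscale (of_int M) (vscale (of_int N) e) = vscale (of_int ?d) e" by (rule ext) (simp add: mult.assoc)
      then show ?thesis using chp_sol[OF K, of "\<iota> g" y] e(2) by simp
    qed
    ultimately show "\<exists>s\<in>intvec m. y = chp (\<iota> g) (vscale (of_int M) s)" by blast
  qed
qed

end

section \<open>The contracting virtual endomorphism\<close>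

text \<open>R1 \<Delta> is integral, the operators of \<A> have denominators dividing
  \<open>N\<close>, R2 Z^m lies in \<Delta>, and \<Delta> is stable under translations by d Z^m. The
  divisibilities of \<open>h\<close> are chosen so that h times an operator of \<A> maps \<Delta>
  into \<Delta> and into d Z^m.\<close>

locale contracting_group = malcev_group m c G \<iota> + contracting m D c \<A> N h C E Z Z' J
  for m c and G :: "('g, 'b) monoid_scheme" (structure) and \<iota> D \<A> N h C E Z Z' J +
  fixes R1 R2 d :: int
  assumes R1: "R1 > 0" "\<And>g. g \<in> carrier G \<Longrightarrow> vscale (of_int R1) (\<iota> g) \<in> intvec m"
    and N: "N > 0"
    and R2: "u \<in> intvec m \<Longrightarrow> vscale (of_int R2) u \<in> \<iota> ` carrier G"
    and close: "g \<in> carrier G \<Longrightarrow> y - \<iota> g \<in> vscale (of_int d) ` intvec m \<Longrightarrow> y \<in> \<iota> ` carrier G"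
    and h1: "R1 * N * R2 dvd h" and h2: "R1 * N * d dvd h"
begin

abbreviation "F \<equiv> papp (C * J)"
abbreviation "L k \<equiv> lcs Vm k"

lemma papp_space: "in_space m u \<Longrightarrow> in_space m (papp p u)"
  using papp_W[of u p] by simp

lemma papp_uminus: "papp p (- u) = - papp p u"
  using papp_vdiff[of p 0 u] by simp

lemmas asub_L = asub_lcs[OF subalg_Vm]

lemma L_space: "u \<in> L k \<Longrightarrow> in_space m u"
  using lcs_subset[OF subalg_Vm, of k] by blast

lemma mv_L: "u \<in> L k \<Longrightarrow> mv m D u \<in> L k"
proof (induction k arbitrary: u)
  case 0
  show ?case unfolding lcs.simps using in_space_mv by blast
next
  case (Suc k)
  note sL = subspace_lcs[OF subalg_Vm, of "Suc k"]
  from Suc.prems have "u \<in> span {lie_br m c x y | x y. x \<in> Vm \<and> y \<in> L k}" by (simp only: lcs.simps)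
  then show ?case
  proof (induction rule: span_induct_alt)
    case base
    show ?case by (simp only: T_zero subspace_0[OF sL])
  next
    case (step a b z)
    then obtain x y where xy: "b = lie_br m c x y" "in_space m x" "y \<in> L k" by blast
    have "mv m D b = lie_br m c (mv m D x) y + lie_br m c x (mv m D y)"
      unfolding xy(1) by (rule der[OF xy(2) L_space[OF xy(3)]])
    moreover have "lie_br m c (mv m D x) y \<in> L (Suc k)"
      by (rule br_lcs[OF _ xy(3)]) (use in_space_mv in blast)
    moreover have "lie_br m c x (mv m D y) \<in> L (Suc k)"
      by (rule br_lcs[OF _ Suc.IH[OF xy(3)]]) (use xy(2) in blast)
    ultimately have "mv m D b \<in> L (Suc k)" using subspace_add[OF sL] by simp
    then show ?case using step unfolding T_add T_scale by (intro subspace_add[OF sL] subspace_scale[OF sL])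
  qed
qed

lemma papp_L: "u \<in> L k \<Longrightarrow> papp p u \<in> L k"
proof -
  interpret LL: lin_op "vscale :: rat \<Rightarrow> _" "mv m D" "L k"
    by unfold_locales (use T_add T_scale mv_L subspace_lcs[OF subalg_Vm] in blast)+
  show "u \<in> L k \<Longrightarrow> papp p u \<in> L k" by (rule LL.papp_W)
qed

lemma F_chp: "in_space m x \<Longrightarrow> in_space m y \<Longrightarrow> F (chp x y) = chp (F x) (F y)"
  using chp_hom[OF subalg_Vm, of F x y] papp_vadd papp_vscale CJ_br by simp

lemma chp_space: "in_space m x \<Longrightarrow> in_space m y \<Longrightarrow> in_space m (chp x y)"
  using chp_in_subalg[OF subalg_Vm] by blast

lemma Fpow_Suc: "papp ((C * J) ^ Suc i) u = F (papp ((C * J) ^ i) u)"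
  by (simp only: power_Suc papp_mult)

lemma Fpow_chp: "in_space m x \<Longrightarrow> in_space m y \<Longrightarrow>
    papp ((C * J) ^ i) (chp x y) = chp (papp ((C * J) ^ i) x) (papp ((C * J) ^ i) y)"
proof (induction i)
  case (Suc i)
  then show ?case by (simp only: Fpow_Suc F_chp papp_space)
qed (simp only: power_0 papp_1)

lemma JE_pow: "in_space m u \<Longrightarrow> papp ((J * E) ^ i) u = u"
proof (induction i)
  case (Suc i)
  then show ?case by (simp only: power_Suc papp_mult[of "J * E"] JE)
qed (simp only: power_0 papp_1)

lemma A_power: "p \<in> \<A> \<Longrightarrow> p ^ n \<in> \<A>"
  by (induction n) (auto intro: A_1 A_mult)

lemma small:
  assumes p: "p \<in> \<A>" and g: "g \<in> carrier G"
  shows "vscale (of_int h) (papp p (\<iota> g)) \<in> \<Delta>" "vscale (of_int h) (papp p (\<iota> g)) \<in> vscale (of_int d) ` intvec m"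
proof -
  define a where "a = vscale (of_int N) (papp p (vscale (of_int R1) (\<iota> g)))"
  have a: "a \<in> intvec m" unfolding a_def by (intro A_int p R1 g)
  have eq: "vscale (of_int (R1 * N * q * k)) (papp p (\<iota> g)) = vscale (of_int q) (vscale (of_int k) a)" for q k
    unfolding a_def papp_vscale by (rule ext) (simp add: mult_ac)
  obtain k where "h = R1 * N * R2 * k" using h1 by (elim dvdE)
  then show "vscale (of_int h) (papp p (\<iota> g)) \<in> \<Delta>" using R2[OF intvec_scale[OF a]] eq by metis
  obtain k where "h = R1 * N * d * k" using h2 by (elim dvdE)
  then show "vscale (of_int h) (papp p (\<iota> g)) \<in> vscale (of_int d) ` intvec m" using intvec_scale[OF a] eq by blast
qed

lemma intvec_neg: "x \<in> vscale (of_int d) ` intvec m \<Longrightarrow> - x \<in> vscale (of_int d) ` intvec m"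
proof -
  assume "x \<in> vscale (of_int d) ` intvec m"
  then obtain u where u: "u \<in> intvec m" "x = vscale (of_int d) u" by blast
  have "- x = vscale (of_int d) (- u)" unfolding u(2) by (rule ext) simp
  then show ?thesis using asub_uminus[OF asub_intvec u(1)] by blast
qed

definition S :: "'g set" where
  "S = {g \<in> carrier G. F (\<iota> g) \<in> \<Delta>}"

text \<open>The values of the n-th iterate of the virtual endomorphism: r and its first n images
  under \<open>F\<close> all belong to \<Delta>.\<close>

definition deep :: "nat \<Rightarrow> 'g set" where
  "deep n = {p \<in> carrier G. \<exists>r. in_space m r \<and> (\<forall>i\<le>n. papp ((C * J) ^ i) r \<in> \<Delta>) \<and> papp ((C * J) ^ n) r = \<iota> p}"

lemma S_mult: "x \<in> S \<Longrightarrow> y \<in> S \<Longrightarrow> x \<otimes> y \<in> S"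
proof -
  assume "x \<in> S" "y \<in> S"
  then have c: "x \<in> carrier G" "y \<in> carrier G" and F: "F (\<iota> x) \<in> \<Delta>" "F (\<iota> y) \<in> \<Delta>" by (auto simp: S_def)
  have "F (\<iota> (x \<otimes> y)) = chp (F (\<iota> x)) (F (\<iota> y))" by (simp only: hom c F_chp iota_space)
  then show ?thesis unfolding S_def using chp_in_image[OF F] c by simp
qed

lemma S_one: "\<one> \<in> S"
  by (simp add: S_def iota_one zero_in_image)

lemma S_inv: "x \<in> S \<Longrightarrow> inv x \<in> S"
  using int_scale_in_image[of _ "- 1"] by (auto simp: S_def iota_inv papp_uminus)

lemma subgroup_S: "subgroup S G"
  by (rule subgroup.intro) (auto simp: S_mult S_one S_inv, auto simp: S_def)

lemma deep_mult: "x \<in> deep n \<Longrightarrow> y \<in> deep n \<Longrightarrow> x \<otimes> y \<in> deep n"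
proof -
  assume "x \<in> deep n" "y \<in> deep n"
  then obtain r s where rs: "x \<in> carrier G" "y \<in> carrier G" "in_space m r" "in_space m s"
    "\<forall>i\<le>n. papp ((C * J) ^ i) r \<in> \<Delta>" "\<forall>i\<le>n. papp ((C * J) ^ i) s \<in> \<Delta>"
    "papp ((C * J) ^ n) r = \<iota> x" "papp ((C * J) ^ n) s = \<iota> y" unfolding deep_def by blast
  have "\<forall>i\<le>n. papp ((C * J) ^ i) (chp r s) \<in> \<Delta>" unfolding Fpow_chp[OF rs(3,4)] using rs(5,6) chp_in_image by blast
  moreover have "papp ((C * J) ^ n) (chp r s) = \<iota> (x \<otimes> y)" unfolding Fpow_chp[OF rs(3,4)] rs(7,8) hom[OF rs(1,2)] ..
  ultimately show ?thesis unfolding deep_def using rs(1-4) chp_space by blast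
qed

text \<open>With C^n U + E V = 1, the vector u = \<iota> g is the sum of p1 = C^n U (1 - E) u and q1
  = E (1 + V (1 - E)) u. The first has n preimages under C / E and the second can be divided by E.
  The factor 1 - E makes p1 divisible by \<open>h\<close>, so both summands come from group
  elements, and the additive splitting is multiplicative up to the next term of the series.\<close>

lemma split_step:
  assumes g: "g \<in> carrier G" and gL: "\<iota> g \<in> L k"
  obtains p q where "p \<in> deep n" "q \<in> S" "\<iota> (inv p \<otimes> (g \<otimes> inv q)) \<in> L (Suc k)"
proof -
  let ?u = "\<iota> g"
  have u: "in_space m ?u" by (rule iota_space[OF g])
  obtain U V where UV: "U \<in> \<A>" "V \<in> \<A>" "\<And>u. in_space m u \<Longrightarrow> papp (C ^ n * U + E ^ 1 * V) u = u"
    using bezout[of n 1] by blast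
  define p1 where "p1 = vscale (of_int h) (papp (C ^ n * U * Z) ?u)"
  define r1 where "r1 = vscale (of_int h) (papp (E ^ n * U * Z) ?u)"
  have r1: "in_space m r1" unfolding r1_def using papp_space[OF u, of "E ^ n * U * Z"] by (simp add: in_space_def)
  \<comment> \<open>The factor E^n of r1 absorbs the inverses of E, so each iterate is
    \<open>h\<close> times an operator of \<A> applied to u and remains in \<Delta>.\<close>
  have Fr: "papp ((C * J) ^ i) r1 = vscale (of_int h) (papp (C ^ i * E ^ (n - i) * U * Z) ?u)" if "i \<le> n" for i
  proof -
    have "E ^ n = E ^ i * E ^ (n - i)" using that by (simp flip: power_add)
    then have "(C * J) ^ i * (E ^ n * U * Z) = (J * E) ^ i * (C ^ i * E ^ (n - i) * U * Z)" by (simp only: power_mult_distrib mult_ac)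
    then have "papp ((C * J) ^ i) (papp (E ^ n * U * Z) ?u) = papp (C ^ i * E ^ (n - i) * U * Z) ?u"
      using JE_pow[OF papp_space[OF u]] by (metis papp_mult)
    then show ?thesis unfolding r1_def papp_vscale by simp
  qed
  have p1D: "p1 \<in> \<Delta>" unfolding p1_def by (intro small A_mult A_power A_CE UV g)
  then obtain p where p: "p \<in> carrier G" "\<iota> p = p1" by auto
  have pdeep: "p \<in> deep n" unfolding deep_def
  proof (intro CollectI conjI exI[of _ r1] allI impI p(1) r1)
    fix i assume "i \<le> n"
    show "papp ((C * J) ^ i) r1 \<in> \<Delta>" unfolding Fr[OF \<open>i \<le> n\<close>] by (intro small A_mult A_power A_CE UV g)
  next
    show "papp ((C * J) ^ n) r1 = \<iota> p" unfolding Fr[OF order_refl] p(2) p1_def by simp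
  qed
  define q1 where "q1 = ?u - p1"
  have "q1 - ?u = - vscale (of_int h) (papp (C ^ n * U * Z) ?u)" by (simp add: q1_def p1_def)
  moreover have "\<dots> \<in> vscale (of_int d) ` intvec m" by (intro intvec_neg small A_mult A_power A_CE UV g)
  ultimately have "q1 \<in> \<Delta>" using close[OF g] by metis
  then obtain q where q: "q \<in> carrier G" "\<iota> q = q1" by auto
  have EZ: "papp (r * (1 - E)) ?u = vscale (of_int h) (papp (r * Z) ?u)" for r
    using E_Z[OF u] by (simp only: papp_mult papp_diff papp_1 papp_vscale)
  have "p1 = papp (C ^ n * U * (1 - E)) ?u" unfolding EZ p1_def ..
  also have "C ^ n * U * (1 - E) = (C ^ n * U + E ^ 1 * V) * (1 - E) - E * V * (1 - E)" by (simp add: algebra_simps)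
  also have "papp \<dots> ?u = papp (1 - E) ?u - papp (E * V * (1 - E)) ?u"
    unfolding papp_diff[of "(C ^ n * U + E ^ 1 * V) * (1 - E)"] papp_mult[of "C ^ n * U + E ^ 1 * V"] UV(3)[OF papp_space[OF u]] ..
  finally have "q1 = papp E ?u + papp (E * V * (1 - E)) ?u" by (simp add: q1_def papp_diff)
  also have "\<dots> = papp (E * (1 + V * (1 - E))) ?u" unfolding papp_add[symmetric] by (simp add: algebra_simps)
  finally have "F q1 = papp (C * J * (E * (1 + V * (1 - E)))) ?u" by (simp only: papp_mult[of "C * J"])
  also have "C * J * (E * (1 + V * (1 - E))) = (J * E) * (C + C * V * (1 - E))" by (simp add: algebra_simps)
  also have "papp \<dots> ?u = papp C ?u + papp (C * V * (1 - E)) ?u"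
    by (rule trans[OF papp_mult trans[OF JE[OF papp_space[OF u]] papp_add]])
  finally have Fq1: "F q1 = papp C ?u + papp (C * V * (1 - E)) ?u" .
  \<comment> \<open>Dividing by E leaves C (1 + V (1 - E)) u, which differs from u by
    \<open>h\<close> times an operator of \<A>; hence F q1 is in \<Delta> by translation
    stability.\<close>
  have "F q1 - ?u = (papp C ?u - ?u) + papp (C * V * (1 - E)) ?u" unfolding Fq1 diff_add_eq ..
  also have "\<dots> = vscale (of_int h) (papp (Z' + C * V * Z) ?u)" unfolding C_Z[OF u] EZ by (simp only: scale_right_distrib papp_add)
  finally have "F q1 - ?u \<in> vscale (of_int d) ` intvec m" using small(2)[OF _ g] A_add A_mult A_CE UV by metis
  then have qS: "q \<in> S" using close[OF g] q by (simp add: S_def)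
  have p1L: "p1 \<in> L k" unfolding p1_def by (intro subspace_scale[OF subspace_lcs[OF subalg_Vm]] papp_L gL)
  then have q1L: "q1 \<in> L k" unfolding q1_def by (intro asub_diff[OF asub_L] gL)
  have mono: "x \<in> L k" if "x \<in> L (Suc k)" for x using lcs_Suc_subset[OF subalg_Vm, of k] that by blast
  \<comment> \<open>All vectors lie in \<open>L k\<close>, so products are sums modulo
    \<open>L (Suc k)\<close>, and u - q1 - p1 = 0.\<close>
  let ?y = "chp ?u (- q1)"
  have y1: "?y - ?u - - q1 \<in> L (Suc k)" using chp_lcs(1)[OF subalg_Vm, of ?u "- q1" k] u asub_uminus[OF asub_L q1L] by blast
  have eq: "(?y - ?u - - q1) + p1 = ?y" by (simp add: q1_def)
  have yL: "?y \<in> L k" using asub_add[OF asub_L mono[OF y1] p1L] unfolding eq .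
  have "- p1 \<in> Vm" using p1L L_space by (simp add: in_space_def)
  from chp_lcs(1)[OF subalg_Vm this yL] have cL: "chp (- p1) ?y - - p1 - ?y \<in> L (Suc k)" .
  have eq2: "(chp (- p1) ?y - - p1 - ?y) + (?y - ?u - - q1) = chp (- p1) ?y" by (simp add: q1_def)
  have "\<iota> (inv p \<otimes> (g \<otimes> inv q)) = chp (- p1) ?y"
    unfolding p(2)[symmetric] q(2)[symmetric] using p(1) q(1) g by (simp only: hom iota_inv inv_closed m_closed)
  with asub_add[OF asub_L cL y1] have "\<iota> (inv p \<otimes> (g \<otimes> inv q)) \<in> L (Suc k)" unfolding eq2 by (simp only:)
  then show thesis by (rule that[OF pdeep qS])
qed

text \<open>Repeated splitting of the remaining middle factor moves it one term down the series each
  time, until it is trivial. The outer factors are collected because both \<open>deep n\<close> and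
  \<open>S\<close> are closed under products.\<close>

lemma split:
  assumes "g \<in> carrier G" shows "\<exists>p\<in>deep n. \<exists>q\<in>S. g = p \<otimes> q"
proof -
  obtain K where K: "\<And>H. lcs H K \<subseteq> {0}" using ex_lcs_trivial by blast
  have "\<exists>p\<in>deep n. \<exists>q\<in>S. g = p \<otimes> q" if "g \<in> carrier G" "\<iota> g \<in> L (K - j)" for j g
    using that
  proof (induction j arbitrary: g)
    case 0
    have "\<iota> g \<in> L K" using 0(2) by (simp only: diff_zero)
    then have "\<iota> g = \<iota> \<one>" using K[of Vm] unfolding iota_one by blast
    then have "g = \<one>" using iota_inj 0 by (auto dest: inj_onD)
    moreover have "\<one> \<in> deep n" unfolding deep_def
      by (intro CollectI conjI exI[of _ 0]) (auto simp: in_space_def iota_one zero_in_image)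
    ultimately show ?case using S_one by force
  next
    case (Suc j)
    show ?case
    proof (cases "j < K")
      case False
      then have "K - Suc j = K - j" by simp
      then show ?thesis using Suc by (simp only:)
    next
      case True
      then have k: "Suc (K - Suc j) = K - j" by simp
      obtain p q where pq: "p \<in> deep n" "q \<in> S" "\<iota> (inv p \<otimes> (g \<otimes> inv q)) \<in> L (K - j)"
        using split_step[OF Suc.prems, of n] unfolding k by metis
      have c: "p \<in> carrier G" "q \<in> carrier G" using pq by (auto simp: deep_def S_def)
      then obtain p' q' where pq': "p' \<in> deep n" "q' \<in> S" "inv p \<otimes> (g \<otimes> inv q) = p' \<otimes> q'"
        using Suc.IH[OF _ pq(3)] Suc.prems(1) by auto
      have c': "p' \<in> carrier G" "q' \<in> carrier G" using pq' by (auto simp: deep_def S_def)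
      have "g = p \<otimes> (inv p \<otimes> (g \<otimes> inv q)) \<otimes> q" using c Suc.prems(1) by (simp add: m_assoc inv_solve_left r_inv_ex flip: m_assoc) (simp add: m_assoc)
      also have "\<dots> = (p \<otimes> p') \<otimes> (q' \<otimes> q)" unfolding pq'(3) using c c' by (simp add: m_assoc)
      finally show ?thesis using deep_mult[OF pq(1) pq'(1)] S_mult[OF pq'(2) pq(2)] by blast
    qed
  qed
  from this[of g K] show ?thesis using assms iota_space by simp
qed

text \<open>Conjugation is trivial on the quotients of the lower central series: to leading order v
  * t is v + t, and multiplying by -t removes t.\<close>

lemma conj_L:
  assumes v: "v \<in> L k" and t: "in_space m t"
  shows "chp (- t) (chp v t) - v \<in> L (Suc k)"
proof -
  have tV: "t \<in> Vm" "- t \<in> Vm" using t by (auto simp: in_space_def)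
  have 1: "chp v t - v - t \<in> L (Suc k)" using chp_lcs(2)[OF subalg_Vm tV(1) v] by simp
  have "chp v t - v - t \<in> L k" using 1 lcs_Suc_subset[OF subalg_Vm, of k] by blast
  from asub_add[OF asub_L this v] have 2: "chp v t - t \<in> L k" by simp
  have cV: "chp v t \<in> Vm" using chp_space[OF L_space[OF v] t] by simp
  have "chp (- t) t = 0" using chp_collinear[of "- 1" t 1] by simp
  then have "chp (- t) (chp v t) - (chp v t - t) \<in> L (Suc k)"
    using chp_diff_lcs[OF subalg_Vm tV(2) tV(1) cV 2] by simp
  from asub_add[OF asub_L this 1] show ?thesis by (simp add: algebra_simps)
qed

text \<open>If all \<open>v i\<close> lie in \<open>L k\<close>, then modulo \<open>L (Suc k)\<close> the vectors \<open>papp (J ^ i) (v 0)\<close> have bounded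
  denominators; as they tend to \<open>0\<close>, one of them lies in \<open>L (Suc k)\<close>.\<close>

lemma orbit_step:
  assumes vD: "\<And>i. v i \<in> \<Delta>" and vL: "\<And>i. v i \<in> L k" and step: "\<And>i. v (Suc i) - F (v i) \<in> L (Suc k)"
  shows "v 0 \<in> L (Suc k)"
proof -
  let ?L = "L (Suc k)"
  have sL: "subspace ?L" by (rule subspace_lcs[OF subalg_Vm])
  have v0: "in_space m (v 0)" by (rule L_space[OF vL])
  have vF: "v i - papp ((C * J) ^ i) (v 0) \<in> ?L" for i
  proof (induction i)
    case 0
    have "v 0 - papp ((C * J) ^ 0) (v 0) = 0" by (simp only: power_0 papp_1 diff_self)
    then show ?case using asub_zero[OF asub_L[of "Suc k"]] by (simp only:)
  next
    case (Suc i)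
    have "v (Suc i) - papp ((C * J) ^ Suc i) (v 0) = (v (Suc i) - F (v i)) + F (v i - papp ((C * J) ^ i) (v 0))"
      unfolding Fpow_Suc papp_vdiff by simp
    then show ?case using asub_add[OF asub_L step papp_L[OF Suc]] by (simp only:)
  qed
  let ?w = "\<lambda>i. papp (J ^ i) (v 0)" and ?M = "R1 * N"
  \<comment> \<open>Multiplying C^i U + E^i V = 1 by J^i gives J^i = U F^i + V. Since F^i (v 0)
    agrees with v i modulo the next term, J^i (v 0) agrees with U (v i) + V (v 0), whose
    denominators are bounded.\<close>
  have w: "\<exists>a. vscale (of_int ?M) a \<in> intvec m \<and> ?w i - a \<in> ?L" for i
  proof -
    obtain U V where UV: "U \<in> \<A>" "V \<in> \<A>" "\<And>u. in_space m u \<Longrightarrow> papp (C ^ i * U + E ^ i * V) u = u"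
      using bezout[of i i] by blast
    have "?w i = papp ((C ^ i * U + E ^ i * V) * J ^ i) (v 0)"
      unfolding papp_mult UV(3)[OF papp_space[OF v0]] ..
    also have "(C ^ i * U + E ^ i * V) * J ^ i = U * (C * J) ^ i + (J * E) ^ i * V"
      by (simp add: power_mult_distrib algebra_simps)
    also have "papp \<dots> (v 0) = papp U (papp ((C * J) ^ i) (v 0)) + papp V (v 0)"
      by (simp only: papp_add papp_mult[of U] papp_mult[of "(J * E) ^ i"] JE_pow[OF papp_space[OF v0]])
    finally have wi: "?w i = papp U (papp ((C * J) ^ i) (v 0)) + papp V (v 0)" .
    have "?w i - (papp U (v i) + papp V (v 0)) = - papp U (v i - papp ((C * J) ^ i) (v 0))"
      unfolding wi papp_vdiff by simp
    then have 1: "?w i - (papp U (v i) + papp V (v 0)) \<in> ?L" using asub_uminus[OF asub_L papp_L[OF vF]] by (simp only:)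
    have "vscale (of_int ?M) (papp p (v j)) \<in> intvec m" if "p \<in> \<A>" for p j
    proof -
      obtain g where g: "g \<in> carrier G" "v j = \<iota> g" using vD[of j] by blast
      have "vscale (of_int ?M) (papp p (v j)) = vscale (of_int N) (papp p (vscale (of_int R1) (v j)))"
        unfolding papp_vscale by (rule ext) (simp add: mult_ac)
      also have "\<dots> \<in> intvec m" unfolding g(2) by (rule A_int[OF that R1(2)[OF g(1)]])
      finally show ?thesis .
    qed
    from asub_add[OF asub_intvec this[OF UV(1)] this[OF UV(2)]]
    have "vscale (of_int ?M) (papp U (v i) + papp V (v 0)) \<in> intvec m" unfolding scale_right_distrib .
    with 1 show ?thesis by blast
  qed
  obtain P where P: "range P \<subseteq> ?L" "\<forall>x y. P (x - y) = P x - P y" "\<forall>a x. P (vscale a x) = vscale a (P x)" "\<forall>w\<in>?L. P w = w"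
    using ex_projection[OF sL] by (elim exE conjE) (rule that)
  \<comment> \<open>\<open>l\<close> is reduction modulo \<open>L (Suc k)\<close>, realized inside
    the same space; it has bounded denominators on integral vectors.\<close>
  define l where "l x = x - P x" for x
  have l_diff: "l (x - y) = l x - l y" for x y unfolding l_def using P(2) by simp
  have l_scale: "l (vscale a x) = vscale a (l x)" for a x unfolding l_def using P(3) scale_right_diff_distrib by simp
  have l_zero: "l 0 = 0" using l_diff[of 0 0] by simp
  have l_add: "l (x + y) = l x + l y" for x y using l_diff[of "x + y" y] by (simp add: algebra_simps)
  have l_sum: "l (sum f I) = (\<Sum>i\<in>I. l (f i))" for f and I :: "nat set"
    by (induction I rule: infinite_finite_induct) (simp_all only: sum.infinite sum.empty sum.insert l_zero l_add not_False_eq_True)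
  have l_L: "l x = 0" if "x \<in> ?L" for x using P(4) that unfolding l_def by simp
  have l_V: "in_space m (l x)" if "in_space m x" for x
  proof -
    have "in_space m (P x)" using P(1) L_space by blast
    then show ?thesis using that by (simp add: l_def in_space_def)
  qed
  have "finite (l ` unit_vec ` {..<m})" by simp
  from zspan_denominator[OF this, of m] obtain N2 :: int where N2: "N2 > 0"
    "\<forall>x\<in>zspan (l ` unit_vec ` {..<m}). in_space m x \<longrightarrow> vscale (of_int N2) x \<in> intvec m" by blast
  have l_int: "vscale (of_int N2) (l u) \<in> intvec m" if u: "u \<in> intvec m" for u
  proof -
    have "l u \<in> zspan (l ` unit_vec ` {..<m})"
      by (rule zspan_map[of l, OF l_diff _ asub_zspan]) (use u in \<open>auto simp: intvec_zspan intro: zspan_base\<close>)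
    then show ?thesis using N2(2) l_V[OF intvec_space[OF u]] by blast
  qed
  define b where "b i = vscale (of_int N2) (l (vscale (of_int ?M) (?w i)))" for i
  have b_int: "b i \<in> intvec m" for i
  proof -
    obtain a where a: "vscale (of_int ?M) a \<in> intvec m" "?w i - a \<in> ?L" using w by blast
    have "l (?w i) = l a" using l_L[OF a(2)] l_diff by simp
    then have "b i = vscale (of_int N2) (l (vscale (of_int ?M) a))" unfolding b_def l_scale by simp
    then show ?thesis using l_int[OF a(1)] by simp
  qed
  have lim: "(\<lambda>i. complex_of_rat (b i j)) \<longlonglongrightarrow> 0" for j
  proof -
    have "b i j = (\<Sum>s<m. ?w i s * (of_int N2 * (of_int ?M * l (unit_vec s) j)))" for i
    proof -
      have "l (?w i) = (\<Sum>s<m. vscale (?w i s) (l (unit_vec s)))"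
        by (subst in_space_expand[OF papp_space[OF v0, of "J ^ i"]]) (simp only: l_sum l_scale)
      then show ?thesis unfolding b_def l_scale
        by (simp only: vscale_apply sum_fun_apply sum_distrib_left) (intro sum.cong refl, simp)
    qed
    then have "(\<lambda>i. complex_of_rat (b i j)) =
        (\<lambda>i. \<Sum>s<m. complex_of_rat (?w i s) * of_rat (of_int N2 * (of_int ?M * l (unit_vec s) j)))"
      by (simp only: of_rat_sum of_rat_mult)
    moreover have "(\<lambda>i. \<Sum>s<m. complex_of_rat (?w i s) * of_rat (of_int N2 * (of_int ?M * l (unit_vec s) j)))
        \<longlonglongrightarrow> (\<Sum>s<m. 0 * of_rat (of_int N2 * (of_int ?M * l (unit_vec s) j)))"
      by (intro tendsto_sum tendsto_mult tendsto_const J_contracts v0)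
    ultimately show ?thesis by simp
  qed
  have "\<forall>\<^sub>F i in sequentially. \<forall>j\<in>{..<m}. norm (complex_of_rat (b i j)) < 1"
  proof (rule eventually_ball_finite)
    show "\<forall>j\<in>{..<m}. \<forall>\<^sub>F i in sequentially. norm (complex_of_rat (b i j)) < 1"
      using lim by (auto simp: tendsto_iff)
  qed simp
  then obtain i where i: "\<forall>j\<in>{..<m}. norm (complex_of_rat (b i j)) < 1" by (auto simp: eventually_sequentially)
  have "b i j = 0" for j
  proof (cases "j < m")
    case True
    have "b i j \<in> \<int>" using b_int by (simp add: intvec_def)
    then obtain n where n: "b i j = of_int n" by (auto elim: Ints_cases)
    have "norm (complex_of_rat (b i j)) < 1" using i True by blast
    then have "norm (of_int n :: complex) < 1" unfolding n of_rat_of_int_eq .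
    then have "real_of_int \<bar>n\<bar> < 1" by (simp only: norm_of_int of_int_abs)
    then have "\<bar>n\<bar> < 1" by (simp only: of_int_less_1_iff)
    then have "n = 0" by (simp only: zabs_less_one_iff)
    then show ?thesis using n by simp
  next
    case False
    then show ?thesis using intvec_space[OF b_int] by (simp add: in_space_def)
  qed
  then have "b i = 0" by (intro ext) simp
  then have "l (?w i) = 0" unfolding b_def l_scale using N2(1) R1(1) N by (simp add: scale_eq_0_iff)
  then have "P (?w i) = ?w i" by (simp add: l_def)
  then have "?w i \<in> ?L" using P(1) by (metis rangeI subsetD)
  \<comment> \<open>E^i preserves the term of the series and undoes J^i, which leads back to v
    0.\<close>
  then have "papp (E ^ i) (?w i) \<in> ?L" by (rule papp_L)
  moreover have "papp (E ^ i) (?w i) = papp ((J * E) ^ i) (v 0)" by (simp only: papp_mult[symmetric] power_mult_distrib mult.commute)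
  ultimately show ?thesis using JE_pow[OF v0] by (simp only:)
qed

text \<open>Conjugation by t i is invisible modulo the next term, so the orbit follows
  \<open>F\<close> there. The previous lemma is applied to every tail of the sequence, because the
  next stage needs all g i, and not g 0 alone, in the deeper term.\<close>

lemma orbit_trivial:
  assumes g: "\<And>i. g i \<in> carrier G" and t: "\<And>i. t i \<in> carrier G"
    and step: "\<And>i. \<iota> (g (Suc i)) = F (\<iota> (inv (t i) \<otimes> (g i \<otimes> t i)))"
  shows "g 0 = \<one>"
proof -
  obtain K where K: "\<And>H. lcs H K \<subseteq> {0}" using ex_lcs_trivial by blast
  have "\<forall>i. \<iota> (g i) \<in> L k" for k
  proof (induction k)
    case 0
    show ?case unfolding lcs.simps using g iota_space by blast
  next
    case (Suc k)
    have st: "\<iota> (g (Suc i)) - F (\<iota> (g i)) \<in> L (Suc k)" for i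
    proof -
      have "\<iota> (g (Suc i)) - F (\<iota> (g i)) = F (chp (- \<iota> (t i)) (chp (\<iota> (g i)) (\<iota> (t i))) - \<iota> (g i))"
        unfolding step papp_vdiff using g t by (simp add: hom iota_inv)
      also have "\<dots> \<in> L (Suc k)" by (rule papp_L[OF conj_L[OF spec[OF Suc] iota_space[OF t]]])
      finally show ?thesis .
    qed
    show ?case
    proof
      fix j
      have "\<iota> (g (0 + j)) \<in> L (Suc k)"
      proof (rule orbit_step[where v = "\<lambda>i. \<iota> (g (i + j))"])
        show "\<iota> (g (i + j)) \<in> \<Delta>" for i using g by blast
        show "\<iota> (g (i + j)) \<in> L k" for i by (rule spec[OF Suc])
        show "\<iota> (g (Suc i + j)) - F (\<iota> (g (i + j))) \<in> L (Suc k)" for i unfolding add_Suc by (rule st)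
      qed
      then show "\<iota> (g j) \<in> L (Suc k)" by (simp only: add_0_left)
    qed
  qed
  then have "\<iota> (g 0) = \<iota> \<one>" using K[of Vm] unfolding iota_one by blast
  then show ?thesis using iota_inj g by (auto dest: inj_onD)
qed

text \<open>If \<iota> g - \<iota> t lies in d' Z^m, then the image of inv t * g is Q M s with s
  integral. Since M F s is integral, \<open>F\<close> maps it into Q Z^m, a subset of
  \<Delta>.\<close>

lemma finite_index: "\<exists>A. finite A \<and> A \<subseteq> carrier G \<and> (\<forall>g\<in>carrier G. \<exists>t\<in>A. inv t \<otimes> g \<in> S)"
proof -
  have "finite (F ` unit_vec ` {..<m})" by simp
  from zspan_denominator[OF this, of m] obtain M :: int where M: "M > 0"
    "\<forall>x\<in>zspan (F ` unit_vec ` {..<m}). in_space m x \<longrightarrow> vscale (of_int M) x \<in> intvec m" by blast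
  have FM: "vscale (of_int M) (F u) \<in> intvec m" if u: "u \<in> intvec m" for u
  proof -
    have "F u \<in> zspan (F ` unit_vec ` {..<m})"
      by (rule zspan_map[of F, OF papp_vdiff _ asub_zspan]) (use u in \<open>auto simp: intvec_zspan intro: zspan_base\<close>)
    then show ?thesis using M(2) papp_space[OF intvec_space[OF u]] by blast
  qed
  obtain Q :: int where Q: "Q > 0" "\<forall>u\<in>intvec m. vscale (of_int Q) u \<in> \<Delta>" using intvec_in_image by blast
  have "Q * M > 0" using Q M by simp
  from close_to_image[OF this] obtain d' :: int where d': "d' > 0"
    "\<forall>g\<in>carrier G. \<forall>y. y - \<iota> g \<in> vscale (of_int d') ` intvec m \<longrightarrow>
      (\<exists>s\<in>intvec m. y = chp (\<iota> g) (vscale (of_int (Q * M)) s))" by blast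
  have near: "inv t \<otimes> g \<in> S" if g: "g \<in> carrier G" and t: "t \<in> carrier G" and gt: "\<iota> g - \<iota> t \<in> vscale (of_int d') ` intvec m" for g t
  proof -
    obtain s where s: "s \<in> intvec m" "\<iota> g = chp (\<iota> t) (vscale (of_int (Q * M)) s)" using d'(2) g t gt by blast
    have "t \<otimes> (inv t \<otimes> g) = g" using g t by (simp flip: m_assoc)
    then have "\<iota> g = chp (\<iota> t) (\<iota> (inv t \<otimes> g))" using hom[of t "inv t \<otimes> g"] g t by (simp only: m_closed inv_closed)
    with s(2) have e: "\<iota> (inv t \<otimes> g) = vscale (of_int (Q * M)) s" by (metis chp_left_cancel)
    have "F (\<iota> (inv t \<otimes> g)) = vscale (of_int Q) (vscale (of_int M) (F s))"
      unfolding e papp_vscale by (rule ext) (simp add: mult.assoc)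
    also have "\<dots> \<in> \<Delta>" using Q(2) FM[OF s(1)] by blast
    finally show ?thesis using g t by (simp add: S_def)
  qed
  \<comment> \<open>Residues of the integral vector R1 \<iota> g modulo R1 d'. Equal residues mean
    that the images differ by an element of d' Z^m, and there are finitely many residue
    vectors.\<close>
  define \<rho> where "\<rho> g = (\<lambda>i. if i < m then \<lfloor>of_int R1 * \<iota> g i\<rfloor> mod (R1 * d') else 0)" for g
  have Rd: "R1 * d' > 0" using R1 d'(1) by simp
  have "\<rho> ` carrier G \<subseteq> {f. \<forall>i. (i \<in> {..<m} \<longrightarrow> f i \<in> {0..<R1 * d'}) \<and> (i \<notin> {..<m} \<longrightarrow> f i = 0)}"
    using Rd by (auto simp: \<rho>_def)
  then have fin: "finite (\<rho> ` carrier G)"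
    by (rule finite_subset) (rule finite_set_of_finite_funs, auto)
  let ?A = "inv_into (carrier G) \<rho> ` (\<rho> ` carrier G)"
  have A: "?A \<subseteq> carrier G" by (auto intro: inv_into_into)
  show ?thesis
  proof (intro exI[of _ ?A] conjI ballI A)
    show "finite ?A" using fin by simp
    fix g assume g: "g \<in> carrier G"
    let ?t = "inv_into (carrier G) \<rho> (\<rho> g)"
    have t: "?t \<in> carrier G" "\<rho> ?t = \<rho> g" using g by (auto intro: inv_into_into f_inv_into_f)
    have int: "of_int R1 * \<iota> x i = of_int \<lfloor>of_int R1 * \<iota> x i\<rfloor>" if "x \<in> carrier G" for x i
      using R1(2)[OF that] by (auto simp: intvec_def)
    have "\<exists>k::int. \<iota> g i - \<iota> ?t i = of_int d' * of_int k" if "i < m" for i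
    proof -
      have "\<lfloor>of_int R1 * \<iota> g i\<rfloor> mod (R1 * d') = \<lfloor>of_int R1 * \<iota> ?t i\<rfloor> mod (R1 * d')"
        using fun_cong[OF t(2), of i] that by (simp add: \<rho>_def)
      then have "R1 * d' dvd \<lfloor>of_int R1 * \<iota> g i\<rfloor> - \<lfloor>of_int R1 * \<iota> ?t i\<rfloor>" by (simp add: mod_eq_dvd_iff)
      then obtain k where k: "\<lfloor>of_int R1 * \<iota> g i\<rfloor> - \<lfloor>of_int R1 * \<iota> ?t i\<rfloor> = R1 * d' * k" by (elim dvdE)
      have "of_int R1 * (\<iota> g i - \<iota> ?t i) = of_int \<lfloor>of_int R1 * \<iota> g i\<rfloor> - of_int \<lfloor>of_int R1 * \<iota> ?t i\<rfloor>"
        unfolding right_diff_distrib using int[OF g, of i] int[OF t(1), of i] by simp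
      also have "\<dots> = of_int (R1 * d' * k)" by (simp only: k of_int_diff[symmetric])
      finally have "of_int R1 * (\<iota> g i - \<iota> ?t i) = of_int R1 * (of_int d' * of_int k)" by (simp add: mult.assoc)
      then show ?thesis using R1(1) by (intro exI[of _ k]) simp
    qed
    then obtain k where k: "\<And>i. i < m \<Longrightarrow> \<iota> g i - \<iota> ?t i = of_int d' * of_int (k i)" by metis
    let ?u = "\<lambda>i. if i < m then of_int (k i) else 0 :: rat"
    have "\<iota> g - \<iota> ?t = vscale (of_int d') ?u"
      using k iota_space[OF g] iota_space[OF t(1)] by (auto simp: fun_eq_iff in_space_def)
    moreover have "?u \<in> intvec m" by (auto simp: intvec_def in_space_def)
    ultimately have "inv ?t \<otimes> g \<in> S" using near[OF g t(1)] by blast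
    then show "\<exists>t\<in>?A. inv t \<otimes> g \<in> S" using g by blast
  qed
qed

end

theorem ex_virtual_endomorphism:
  fixes G (structure)
  assumes G: "group G" and mal: "malcev_lie_algebra G m c" and gr: "has_very_special_grading_C m c"
  obtains S f A where "subgroup S G" "\<And>x. x \<in> S \<Longrightarrow> f x \<in> carrier G"
    "\<And>x y. x \<in> S \<Longrightarrow> y \<in> S \<Longrightarrow> f (x \<otimes> y) = f x \<otimes> f y"
    "finite A" "A \<subseteq> carrier G" "\<And>g. g \<in> carrier G \<Longrightarrow> \<exists>t\<in>A. inv t \<otimes> g \<in> S"
    "\<And>g n. g \<in> carrier G \<Longrightarrow> \<exists>r\<in>carrier G. \<exists>q\<in>S. (\<forall>i<n. (f ^^ i) r \<in> S) \<and> g = (f ^^ n) r \<otimes> q"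
    "\<And>g t. (\<And>i. g i \<in> carrier G) \<Longrightarrow> (\<And>i. t i \<in> carrier G) \<Longrightarrow>
      (\<And>i. inv (t i) \<otimes> (g i \<otimes> t i) \<in> S) \<Longrightarrow> (\<And>i. g (Suc i) = f (inv (t i) \<otimes> (g i \<otimes> t i))) \<Longrightarrow> g 0 = \<one>"
proof -
  obtain \<iota> where mh: "malcev_hom vscale (lie_br m c) (m + 1) G \<iota>" and i: "inj_on \<iota> (carrier G)"
    "\<And>g. g \<in> carrier G \<Longrightarrow> in_space m (\<iota> g)"
    "nilpotent_lie.lie_hull vscale (lie_br m c) (\<iota> ` carrier G) = {x. in_space m x}" "fin_gen_group G"
    using malcev_embedding[OF G mal] by metis
  interpret malcev_group m c G \<iota>
    by (intro malcev_group.intro malcev_group_axioms.intro mh i)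
  obtain D \<A> N where N: "N > 0" and ops: "\<And>h. h > 0 \<Longrightarrow> \<exists>C E Z Z' J. contracting m D c \<A> N h C E Z Z' J"
    using ex_contracting[OF gr] by metis
  obtain R1 :: int where R1: "R1 > 0" "\<forall>g\<in>carrier G. vscale (of_int R1) (\<iota> g) \<in> intvec m" using image_denominator by blast
  obtain R2 :: int where R2: "R2 > 0" "\<forall>u\<in>intvec m. vscale (of_int R2) u \<in> \<iota> ` carrier G" using intvec_in_image by blast
  obtain d :: int where d: "d > 0" "\<forall>g\<in>carrier G. \<forall>y. y - \<iota> g \<in> vscale (of_int d) ` intvec m \<longrightarrow>
    (\<exists>s\<in>intvec m. y = chp (\<iota> g) (vscale (of_int R2) s))" using close_to_image[OF R2(1)] by blast
  \<comment> \<open>All four constants are known before the operators C and E are built, so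
    \<open>h\<close> can be a common multiple of the numbers required.\<close>
  define h where "h = R1 * N * R2 * d"
  have "h > 0" using R1(1) N R2(1) d(1) by (simp add: h_def)
  then obtain C E Z Z' J where con: "contracting m D c \<A> N h C E Z Z' J" using ops by blast
  interpret contracting_group m c G \<iota> D \<A> N h C E Z Z' J R1 R2 d
  proof (intro contracting_group.intro contracting_group_axioms.intro con)
    show "malcev_group m c G \<iota>" by (rule malcev_group_axioms)
    fix g y assume "g \<in> carrier G" "y - \<iota> g \<in> vscale (of_int d) ` intvec m"
    then obtain s where "s \<in> intvec m" "y = chp (\<iota> g) (vscale (of_int R2) s)" using d(2) by blast
    then show "y \<in> \<iota> ` carrier G" using R2(2) \<open>g \<in> carrier G\<close> chp_in_image by blast
  next
    show "R1 * N * R2 dvd h" "R1 * N * d dvd h" by (simp_all add: h_def)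
  qed (use R1 N R2 in blast)+
  define f where "f g = inv_into (carrier G) \<iota> (F (\<iota> g))" for g
  have f: "f x \<in> carrier G" "\<iota> (f x) = F (\<iota> x)" if "x \<in> S" for x
    using that unfolding f_def S_def by (auto intro: inv_into_into f_inv_into_f)
  have SG: "S \<subseteq> carrier G" by (auto simp: S_def)
  note inj = inj_onD[OF i(1)]
  obtain A where A: "finite A" "A \<subseteq> carrier G" "\<forall>g\<in>carrier G. \<exists>t\<in>A. inv t \<otimes> g \<in> S" using finite_index by blast
  show thesis
  proof (rule that[OF subgroup_S, of f A])
    show "f x \<in> carrier G" if "x \<in> S" for x by (rule f(1)[OF that])
    show "f (x \<otimes> y) = f x \<otimes> f y" if "x \<in> S" "y \<in> S" for x y
    proof (rule inj)
      show "\<iota> (f (x \<otimes> y)) = \<iota> (f x \<otimes> f y)"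
        unfolding f(2)[OF S_mult[OF that]] hom[OF f(1)[OF that(1)] f(1)[OF that(2)]] f(2)[OF that(1)] f(2)[OF that(2)]
          hom[OF subsetD[OF SG that(1)] subsetD[OF SG that(2)]]
        by (intro F_chp iota_space subsetD[OF SG] that)
    qed (use f that S_mult in auto)
    show "\<exists>t\<in>A. inv t \<otimes> g \<in> S" if "g \<in> carrier G" for g using A(3) that by blast
    show "\<exists>r\<in>carrier G. \<exists>q\<in>S. (\<forall>i<n. (f ^^ i) r \<in> S) \<and> g = (f ^^ n) r \<otimes> q" if g: "g \<in> carrier G" for g n
    proof -
      obtain p q where pq: "p \<in> deep n" "q \<in> S" "g = p \<otimes> q" using split[OF g] by blast
      then obtain v where v: "p \<in> carrier G" "\<forall>i\<le>n. papp ((C * J) ^ i) v \<in> \<iota> ` carrier G" "papp ((C * J) ^ n) v = \<iota> p"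
        unfolding deep_def by blast
      have "papp ((C * J) ^ 0) v \<in> \<iota> ` carrier G" using v(2) by blast
      then obtain r where r: "r \<in> carrier G" "\<iota> r = v" by auto
      \<comment> \<open>Membership of the vector with index i + 1 in the image puts the i-th iterate
        of r into \<open>S\<close>; hence the bound i < n there.\<close>
      have it: "(f ^^ i) r \<in> carrier G \<and> \<iota> ((f ^^ i) r) = papp ((C * J) ^ i) v \<and> (i < n \<longrightarrow> (f ^^ i) r \<in> S)" if "i \<le> n" for i
        using that
      proof (induction i)
        case 0
        have "\<iota> r = papp ((C * J) ^ 0) v" unfolding r(2) power_0 papp_1 ..
        moreover have "r \<in> S" if "0 < n"
        proof -
          have "papp ((C * J) ^ 1) v \<in> \<iota> ` carrier G" using v(2) that by (simp only: Suc_leI One_nat_def)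
          then show ?thesis using r unfolding S_def by (simp only: power_one_right mem_Collect_eq simp_thms)
        qed
        ultimately show ?case using r(1) unfolding funpow_0 by blast
      next
        case (Suc i)
        then have IH: "\<iota> ((f ^^ i) r) = papp ((C * J) ^ i) v" "(f ^^ i) r \<in> S" by (metis Suc_leD, metis Suc_le_lessD Suc_leD)
        have 1: "(f ^^ Suc i) r \<in> carrier G" "\<iota> ((f ^^ Suc i) r) = papp ((C * J) ^ Suc i) v"
          using f[OF IH(2)] IH(1) by (simp_all only: funpow.simps comp_apply Fpow_Suc)
        moreover have "(f ^^ Suc i) r \<in> S" if "Suc i < n"
          using 1 v(2)[rule_format, of "Suc (Suc i)"] that unfolding S_def Fpow_Suc[of "Suc i"] by (simp only: mem_Collect_eq)
        ultimately show ?case by blast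
      qed
      have "(f ^^ n) r = p" using it[of n] v(1,3) by (intro inj) auto
      then show ?thesis using r(1) pq(2,3) it by (intro bexI[of _ r] bexI[of _ q]) auto
    qed
    fix g t :: "nat \<Rightarrow> 'a"
    assume gt: "\<And>i. g i \<in> carrier G" "\<And>i. t i \<in> carrier G" "\<And>i. inv (t i) \<otimes> (g i \<otimes> t i) \<in> S"
      "\<And>i. g (Suc i) = f (inv (t i) \<otimes> (g i \<otimes> t i))"
    show "g 0 = \<one>" by (rule orbit_trivial[OF gt(1,2)]) (simp only: gt(4) f(2)[OF gt(3)])
  qed (use A in auto)
qed

section \<open>The tree action of a virtual endomorphism\<close>

text \<open>The letters are the left cosets of \<open>S\<close>, numbered by \<kappa>, with
  representatives \<open>t\<close>. The coset of the neutral element has representative \<one>, so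
  that elements of \<open>S\<close> act along its letter by \<open>f\<close> itself.\<close>

locale virtual_endo = group G for G :: "('g, 'b) monoid_scheme" (structure) +
  fixes S :: "'g set" and f :: "'g \<Rightarrow> 'g" and \<kappa> :: "'g \<Rightarrow> nat" and t :: "nat \<Rightarrow> 'g" and d :: nat
  assumes S: "subgroup S G"
    and f_closed: "x \<in> S \<Longrightarrow> f x \<in> carrier G"
    and f_mult: "x \<in> S \<Longrightarrow> y \<in> S \<Longrightarrow> f (x \<otimes> y) = f x \<otimes> f y"
    and \<kappa>_less: "g \<in> carrier G \<Longrightarrow> \<kappa> g < d"
    and \<kappa>_eq: "g \<in> carrier G \<Longrightarrow> g' \<in> carrier G \<Longrightarrow> \<kappa> g = \<kappa> g' \<longleftrightarrow> inv g \<otimes> g' \<in> S"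
    and t_closed: "a < d \<Longrightarrow> t a \<in> carrier G"
    and \<kappa>_t: "a < d \<Longrightarrow> \<kappa> (t a) = a"
    and t_one: "t (\<kappa> \<one>) = \<one>"
begin

interpretation S: subgroup S G by (rule S)

lemma f_one: "f \<one> = \<one>"
  using f_mult[of \<one> \<one>] f_closed[of \<one>] by (simp add: r_cancel_one')

text \<open>Write g t(a) = t(b) s with s in \<open>S\<close>: then g replaces the letter a by b =
  \<open>step g a\<close> and acts on the rest of the word by f(s) = \<open>nxt g a\<close>.\<close>

definition step :: "'g \<Rightarrow> nat \<Rightarrow> nat" where
  "step g a = \<kappa> (g \<otimes> t a)"

definition nxt :: "'g \<Rightarrow> nat \<Rightarrow> 'g" where
  "nxt g a = f (inv (t (step g a)) \<otimes> (g \<otimes> t a))"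

primrec state :: "'g \<Rightarrow> (nat \<Rightarrow> nat) \<Rightarrow> nat \<Rightarrow> 'g" where
  "state g w 0 = g"
| "state g w (Suc i) = nxt (state g w i) (w i)"

definition act :: "'g \<Rightarrow> (nat \<Rightarrow> nat) \<Rightarrow> nat \<Rightarrow> nat" where
  "act g w i = step (state g w i) (w i)"

text \<open>Restricted to words because the elements of \<open>BijGroup\<close> are extensional
  functions.\<close>

definition \<phi> :: "'g \<Rightarrow> (nat \<Rightarrow> nat) \<Rightarrow> nat \<Rightarrow> nat" where
  "\<phi> g = restrict (act g) (inf_words d)"

lemma step_less: "g \<in> carrier G \<Longrightarrow> a < d \<Longrightarrow> step g a < d"
  by (simp add: step_def \<kappa>_less t_closed)

lemma step_S: "g \<in> carrier G \<Longrightarrow> a < d \<Longrightarrow> inv (t (step g a)) \<otimes> (g \<otimes> t a) \<in> S"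
  using \<kappa>_eq[of "t (step g a)" "g \<otimes> t a"] \<kappa>_t[OF step_less] by (simp add: step_less t_closed step_def[symmetric])

lemma nxt_closed: "g \<in> carrier G \<Longrightarrow> a < d \<Longrightarrow> nxt g a \<in> carrier G"
  by (simp add: nxt_def f_closed step_S)

lemma \<kappa>_mult_S: "g \<in> carrier G \<Longrightarrow> s \<in> S \<Longrightarrow> \<kappa> (g \<otimes> s) = \<kappa> g"
  using \<kappa>_eq[of g "g \<otimes> s"] by (simp flip: m_assoc)

text \<open>Cocycle identities. If h t(a) = t(b) s, then g h t(a) = g t(b) s, and the factor s in
  \<open>S\<close> does not change the coset; multiplicativity of \<open>f\<close> gives the second
  equation.\<close>

lemma step_nxt_mult:
  assumes g: "g \<in> carrier G" and h: "h \<in> carrier G" and a: "a < d"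
  shows "step (g \<otimes> h) a = step g (step h a)" "nxt (g \<otimes> h) a = nxt g (step h a) \<otimes> nxt h a"
proof -
  let ?b = "step h a" and ?s = "inv (t (step h a)) \<otimes> (h \<otimes> t a)"
  have b: "?b < d" and s: "?s \<in> S" using h a by (auto simp: step_less step_S)
  note c = g h t_closed[OF a] t_closed[OF b] S.mem_carrier[OF s]
  have eq: "g \<otimes> h \<otimes> t a = g \<otimes> t ?b \<otimes> ?s" using c by (simp add: m_assoc) (simp add: r_inv flip: m_assoc)
  show 1: "step (g \<otimes> h) a = step g ?b"
    unfolding step_def[of "g \<otimes> h"] eq using c s by (simp add: \<kappa>_mult_S step_def)
  have "inv (t (step g ?b)) \<otimes> (g \<otimes> h \<otimes> t a) = (inv (t (step g ?b)) \<otimes> (g \<otimes> t ?b)) \<otimes> ?s"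
    unfolding eq using c t_closed[OF step_less[OF g b]] by (simp add: m_assoc)
  then show "nxt (g \<otimes> h) a = nxt g ?b \<otimes> nxt h a"
    unfolding nxt_def 1 using f_mult[OF step_S[OF g b] s] by simp
qed

lemma step_nxt_one: "a < d \<Longrightarrow> step \<one> a = a" "a < d \<Longrightarrow> nxt \<one> a = \<one>"
  by (simp_all add: step_def nxt_def t_closed \<kappa>_t f_one)

lemma word_less: "w \<in> inf_words d \<Longrightarrow> w i < d"
  by (simp add: inf_words_def)

lemma state_closed: "g \<in> carrier G \<Longrightarrow> w \<in> inf_words d \<Longrightarrow> state g w i \<in> carrier G"
  by (induction i) (auto intro: nxt_closed word_less)

lemma act_words:
  assumes "g \<in> carrier G" "w \<in> inf_words d" shows "act g w \<in> inf_words d"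
proof -
  have "act g w i < d" for i unfolding act_def by (rule step_less[OF state_closed[OF assms] word_less[OF assms(2)]])
  then show ?thesis by (simp add: inf_words_def)
qed

lemma state_mult:
  assumes "g \<in> carrier G" "h \<in> carrier G" "w \<in> inf_words d"
  shows "state (g \<otimes> h) w i = state g (act h w) i \<otimes> state h w i"
proof (induction i)
  case (Suc i)
  note c = state_closed[OF assms(1) act_words[OF assms(2,3)], of i] state_closed[OF assms(2,3), of i] word_less[OF assms(3), of i]
  show ?case unfolding state.simps Suc step_nxt_mult(2)[OF c] act_def[of h w i] ..
qed simp

lemma act_mult:
  assumes "g \<in> carrier G" "h \<in> carrier G" "w \<in> inf_words d"
  shows "act (g \<otimes> h) w = act g (act h w)"
proof
  fix i
  show "act (g \<otimes> h) w i = act g (act h w) i"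
    unfolding act_def[of "g \<otimes> h"] state_mult[OF assms] act_def[of g] act_def[of h w i]
    by (rule step_nxt_mult(1)[OF state_closed[OF assms(1) act_words[OF assms(2,3)]] state_closed[OF assms(2,3)] word_less[OF assms(3)]])
qed

lemma act_one: "w \<in> inf_words d \<Longrightarrow> act \<one> w = w"
proof -
  assume w: "w \<in> inf_words d"
  have "state \<one> w i = \<one>" for i by (induction i) (simp_all add: step_nxt_one(2) word_less[OF w])
  then show ?thesis by (auto simp: act_def fun_eq_iff step_nxt_one(1) word_less[OF w])
qed

lemma group_action_\<phi>: "group_action G (inf_words d) \<phi>"
proof -
  have bij: "\<phi> g \<in> Bij (inf_words d)" if g: "g \<in> carrier G" for g
  proof -
    have "bij_betw (act g) (inf_words d) (inf_words d)"
    proof (rule bij_betw_byWitness[where f' = "act (inv g)"])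
      show "\<forall>w\<in>inf_words d. act (inv g) (act g w) = w" "\<forall>w\<in>inf_words d. act g (act (inv g) w) = w"
        using g by (simp_all add: act_one flip: act_mult)
    qed (use g act_words in auto)
    then show ?thesis by (simp add: Bij_def \<phi>_def)
  qed
  have "\<phi> (g \<otimes> h) = compose (inf_words d) (\<phi> g) (\<phi> h)" if "g \<in> carrier G" "h \<in> carrier G" for g h
    using that by (auto simp: \<phi>_def compose_def act_mult act_words fun_eq_iff)
  then have "\<phi> \<in> hom G (BijGroup (inf_words d))"
    using bij by (auto simp: hom_def BijGroup_def)
  then show ?thesis
    by (intro group_action.intro group_hom.intro group_hom_axioms.intro group_BijGroup is_group)
qed

lemma act_wcons:
  assumes "g \<in> carrier G" "a < d"
  shows "act g (wcons a w) = wcons (step g a) (act (nxt g a) w)"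
proof -
  have "state g (wcons a w) (Suc i) = state (nxt g a) w i" for i
    by (induction i) simp_all
  then show ?thesis by (auto simp: fun_eq_iff act_def wcons_def gr0_conv_Suc)
qed

lemma self_similar: "self_similar_action G d \<phi>"
  unfolding self_similar_action_def
proof (intro conjI ballI allI impI group_action_\<phi>)
  fix g a assume g: "g \<in> carrier G" and a: "a < d"
  show "\<exists>h\<in>carrier G. \<exists>b<d. \<forall>w\<in>inf_words d. \<phi> g (wcons a w) = wcons b (\<phi> h w)"
    by (intro bexI[of _ "nxt g a"] exI[of _ "step g a"] conjI ballI)
      (use g a in \<open>simp_all add: \<phi>_def wcons_in_words act_wcons step_less nxt_closed\<close>)
qed

text \<open>Along a fixed word each state keeps its letter, so the next state is \<open>f\<close> of
  the state conjugated by the representative of that letter: the states form a sequence to which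
  \<open>orbit\<close> applies.\<close>

lemma free:
  assumes orbit: "\<And>g t. (\<And>i. g i \<in> carrier G) \<Longrightarrow> (\<And>i. t i \<in> carrier G) \<Longrightarrow>
      (\<And>i. inv (t i) \<otimes> (g i \<otimes> t i) \<in> S) \<Longrightarrow> (\<And>i. g (Suc i) = f (inv (t i) \<otimes> (g i \<otimes> t i))) \<Longrightarrow> g 0 = \<one>"
  shows "free_action G d \<phi>"
  unfolding free_action_def
proof (intro ballI impI)
  fix g w assume g: "g \<in> carrier G" and w: "w \<in> inf_words d" and "\<phi> g w = w"
  then have "act g w = w" by (simp add: \<phi>_def)
  then have st: "step (state g w i) (w i) = w i" for i by (metis act_def)
  have "state g w 0 = \<one>"
  proof (rule orbit[of "state g w" "\<lambda>i. t (w i)"])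
    fix i
    note c = state_closed[OF g w, of i] and l = word_less[OF w, of i]
    show "state g w i \<in> carrier G" "t (w i) \<in> carrier G" using c t_closed[OF l] by auto
    show "inv (t (w i)) \<otimes> (state g w i \<otimes> t (w i)) \<in> S" using step_S[OF c l] unfolding st .
    show "state g w (Suc i) = f (inv (t (w i)) \<otimes> (state g w i \<otimes> t (w i)))" by (simp add: nxt_def st)
  qed
  then show "g = \<one>" by simp
qed

lemma state_prefix: "(\<And>i. i < n \<Longrightarrow> w i = v i) \<Longrightarrow> state g w n = state g v n"
  by (induction n) auto

lemma act_prefix: "(\<And>i. i < n \<Longrightarrow> w i = v i) \<Longrightarrow> i < n \<Longrightarrow> act g w i = act g v i"
  using state_prefix[of i w v g] by (simp add: act_def)

abbreviation "base \<equiv> (\<lambda>_. \<kappa> \<one>) :: nat \<Rightarrow> nat"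

lemma base: "base \<in> inf_words d"
  by (simp add: inf_words_def \<kappa>_less)

lemma step_nxt_base: "s \<in> S \<Longrightarrow> step s (\<kappa> \<one>) = \<kappa> \<one>" "s \<in> S \<Longrightarrow> nxt s (\<kappa> \<one>) = f s"
  using \<kappa>_mult_S[of \<one> s] by (simp_all add: nxt_def step_def t_one)

text \<open>Induction on the length of the prefix. Let s be the state of g after n letters and y the
  representative of the desired letter. Splitting inv s * y as f^n(r) q yields an r that fixes the
  first n letters of \<open>base\<close> and has state f^n(r) there. So g r keeps the prefix, and
  its state s f^n(r) = y inv q lies in the coset of y.\<close>

lemma reach_from_base:
  assumes split: "\<And>g n. g \<in> carrier G \<Longrightarrow> \<exists>r\<in>carrier G. \<exists>q\<in>S. (\<forall>i<n. (f ^^ i) r \<in> S) \<and> g = (f ^^ n) r \<otimes> q"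
  shows "(\<And>i. i < n \<Longrightarrow> u i < d) \<Longrightarrow> \<exists>g\<in>carrier G. \<forall>i<n. act g base i = u i"
proof (induction n)
  case 0
  show ?case by (rule bexI[of _ \<one>]) auto
next
  case (Suc n)
  then obtain g where g: "g \<in> carrier G" "\<forall>i<n. act g base i = u i" by auto
  let ?s = "state g base n" and ?y = "t (u n)"
  have s: "?s \<in> carrier G" and y: "?y \<in> carrier G" using state_closed[OF g(1) base] t_closed Suc.prems by auto
  obtain r q where rq: "r \<in> carrier G" "q \<in> S" "\<forall>i<n. (f ^^ i) r \<in> S" "inv ?s \<otimes> ?y = (f ^^ n) r \<otimes> q"
    using split[of "inv ?s \<otimes> ?y" n] s y by auto
  have st: "state r base i = (f ^^ i) r" if "i \<le> n" for i
    using that by (induction i) (use rq(3) step_nxt_base(2) in auto)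
  have fix_base: "act r base i = base i" if "i < n" for i
    unfolding act_def st[OF less_imp_le[OF that]] using rq(3) that step_nxt_base(1) by blast
  have rn: "(f ^^ n) r \<in> carrier G" using st[OF order_refl] state_closed[OF rq(1) base, of n] by simp
  have qc: "q \<in> carrier G" using rq(2) by (rule S.mem_carrier)
  have "?s \<otimes> (f ^^ n) r = ?y \<otimes> inv q"
  proof -
    have "(f ^^ n) r = inv ?s \<otimes> ?y \<otimes> inv q" unfolding rq(4) using rn qc by (simp add: m_assoc)
    then show ?thesis using s y qc by (simp flip: m_assoc)
  qed
  moreover have "state (g \<otimes> r) base n = ?s \<otimes> (f ^^ n) r"
    unfolding state_mult[OF g(1) rq(1) base] st[OF order_refl]
    using state_prefix[of n "act r base" base g] fix_base by simp
  ultimately have "act (g \<otimes> r) base n = \<kappa> (?y \<otimes> inv q)"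
    using y qc by (simp add: act_def step_def t_one)
  also have "\<dots> = u n" using \<kappa>_mult_S[OF y S.m_inv_closed[OF rq(2)]] \<kappa>_t Suc.prems by simp
  finally have last: "act (g \<otimes> r) base n = u n" .
  have "act (g \<otimes> r) base i = u i" if "i < n" for i
    unfolding act_mult[OF g(1) rq(1) base] using act_prefix[of n "act r base" base i g] fix_base g(2) that by simp
  with last have "\<forall>i<Suc n. act (g \<otimes> r) base i = u i" by (auto simp: less_Suc_eq)
  then show ?case using g(1) rq(1) by blast
qed

text \<open>Any two prefixes are reached from \<open>base\<close>; going back to \<open>base\<close>
  from the first and on to the second joins them.\<close>

lemma dense:
  assumes split: "\<And>g n. g \<in> carrier G \<Longrightarrow> \<exists>r\<in>carrier G. \<exists>q\<in>S. (\<forall>i<n. (f ^^ i) r \<in> S) \<and> g = (f ^^ n) r \<otimes> q"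
  shows "dense_orbits G d \<phi>"
  unfolding dense_orbits_def
proof (intro ballI allI impI)
  fix w u assume w: "w \<in> inf_words d" and u: "set u \<subseteq> {..<d}"
  obtain g where g: "g \<in> carrier G" "\<forall>i<length u. act g base i = w i"
    using reach_from_base[OF split, of "length u" w] word_less[OF w] by auto
  have "u ! i < d" if "i < length u" for i using u that nth_mem by blast
  then obtain h where h: "h \<in> carrier G" "\<forall>i<length u. act h base i = u ! i"
    using reach_from_base[OF split, of "length u" "(!) u"] by auto
  have base_eq: "act (inv g) (act g base) = base" using g(1) base by (simp add: act_one flip: act_mult)
  have "act (inv g) w i = base i" if "i < length u" for i
    using act_prefix[of "length u" w "act g base" i "inv g"] g(2) that base_eq by simp
  then have "act (h \<otimes> inv g) w i = u ! i" if "i < length u" for i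
    unfolding act_mult[OF h(1) inv_closed[OF g(1)] w]
    using act_prefix[of "length u" "act (inv g) w" base i h] h(2) that by simp
  then show "\<exists>g\<in>carrier G. \<forall>i<length u. \<phi> g w i = u ! i"
    using g(1) h(1) w by (intro bexI[of _ "h \<otimes> inv g"]) (auto simp: \<phi>_def)
qed

end

text \<open>The set \<open>A\<close> meets every left coset, so there are finitely many and they can
  be numbered; the representative of the trivial coset is set to \<one>.\<close>

lemma (in group) ex_coset_index:
  assumes S: "subgroup S G" and A: "finite A" "A \<subseteq> carrier G" "\<And>g. g \<in> carrier G \<Longrightarrow> \<exists>t\<in>A. inv t \<otimes> g \<in> S"
    and f: "\<And>x. x \<in> S \<Longrightarrow> f x \<in> carrier G" "\<And>x y. x \<in> S \<Longrightarrow> y \<in> S \<Longrightarrow> f (x \<otimes> y) = f x \<otimes> f y"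
  shows "\<exists>\<kappa> t d. virtual_endo G S f \<kappa> t d"
proof -
  interpret S: subgroup S G by (rule S)
  define cos where "cos g = {x \<in> carrier G. inv g \<otimes> x \<in> S}" for g
  have sub: "cos h \<subseteq> cos g" if "g \<in> carrier G" "h \<in> carrier G" "inv g \<otimes> h \<in> S" for g h
  proof
    fix x assume x: "x \<in> cos h"
    then have "inv g \<otimes> h \<otimes> (inv h \<otimes> x) \<in> S" using that(3) by (auto simp: cos_def)
    moreover have "inv g \<otimes> h \<otimes> (inv h \<otimes> x) = inv g \<otimes> x" using that x
      by (simp add: cos_def m_assoc inv_closed) (simp add: r_inv flip: m_assoc)
    ultimately show "x \<in> cos g" using x by (simp add: cos_def)
  qed
  have cos_eq: "cos g = cos h \<longleftrightarrow> inv g \<otimes> h \<in> S" if gh: "g \<in> carrier G" "h \<in> carrier G" for g h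
  proof
    assume "cos g = cos h"
    moreover have "h \<in> cos h" using gh by (simp add: cos_def)
    ultimately have "h \<in> cos g" by blast
    then show "inv g \<otimes> h \<in> S" by (simp add: cos_def)
  next
    assume s: "inv g \<otimes> h \<in> S"
    then have "inv (inv g \<otimes> h) \<in> S" by (rule S.m_inv_closed)
    then have "inv h \<otimes> g \<in> S" using gh by (simp add: inv_mult_group)
    then show "cos g = cos h" using sub gh s by blast
  qed
  have "cos ` carrier G \<subseteq> cos ` A"
  proof
    fix x assume "x \<in> cos ` carrier G"
    then obtain g where g: "g \<in> carrier G" "x = cos g" by blast
    from A(3)[OF g(1)] obtain t where "t \<in> A" "inv t \<otimes> g \<in> S" by blast
    then show "x \<in> cos ` A" using cos_eq[of t g] g A(2) by blast
  qed
  then have "finite (cos ` carrier G)" using A(1) by (rule finite_surj[rotated])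
  from ex_bij_betw_finite_nat[OF this] obtain h where h: "bij_betw h (cos ` carrier G) {0..<card (cos ` carrier G)}" by blast
  define d where "d = card (cos ` carrier G)"
  define \<kappa> where "\<kappa> g = h (cos g)" for g
  define t where "t a = (if a = \<kappa> \<one> then \<one> else inv_into (carrier G) \<kappa> a)" for a
  have im: "\<kappa> ` carrier G = {0..<d}" using h by (simp add: bij_betw_def \<kappa>_def d_def image_image)
  have "virtual_endo G S f \<kappa> t d"
  proof (intro virtual_endo.intro virtual_endo_axioms.intro is_group S f)
    show "\<kappa> g < d" if "g \<in> carrier G" for g using im that by auto
    show "\<kappa> g = \<kappa> g' \<longleftrightarrow> inv g \<otimes> g' \<in> S" if "g \<in> carrier G" "g' \<in> carrier G" for g g'
      unfolding cos_eq[OF that, symmetric] \<kappa>_def using h that by (auto simp: bij_betw_def dest: inj_onD)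
    fix a assume "a < d"
    then have "a \<in> \<kappa> ` carrier G" using im by simp
    then show "t a \<in> carrier G" "\<kappa> (t a) = a" by (auto simp: t_def inv_into_into f_inv_into_f)
  qed (simp_all add: t_def)
  then show ?thesis by blast
qed

section \<open>From a grading to a free self-similar action with dense orbits\<close>

theorem grading_imp_densely_self_similar:
  assumes G: "group G" and "malcev_lie_algebra G m c" "has_very_special_grading_C m c"
  shows "freely_densely_self_similar G"
proof (rule ex_virtual_endomorphism[OF assms])
  fix S f A
  assume S: "subgroup S G" and f: "\<And>x. x \<in> S \<Longrightarrow> f x \<in> carrier G"
    "\<And>x y. x \<in> S \<Longrightarrow> y \<in> S \<Longrightarrow> f (x \<otimes>\<^bsub>G\<^esub> y) = f x \<otimes>\<^bsub>G\<^esub> f y"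
    and A: "finite A" "A \<subseteq> carrier G" "\<And>g. g \<in> carrier G \<Longrightarrow> \<exists>t\<in>A. inv\<^bsub>G\<^esub> t \<otimes>\<^bsub>G\<^esub> g \<in> S"
    and split: "\<And>g n. g \<in> carrier G \<Longrightarrow>
      \<exists>r\<in>carrier G. \<exists>q\<in>S. (\<forall>i<n. (f ^^ i) r \<in> S) \<and> g = (f ^^ n) r \<otimes>\<^bsub>G\<^esub> q"
    and orbit: "\<And>g t. (\<And>i. g i \<in> carrier G) \<Longrightarrow> (\<And>i. t i \<in> carrier G) \<Longrightarrow>
      (\<And>i. inv\<^bsub>G\<^esub> (t i) \<otimes>\<^bsub>G\<^esub> (g i \<otimes>\<^bsub>G\<^esub> t i) \<in> S) \<Longrightarrow>
      (\<And>i. g (Suc i) = f (inv\<^bsub>G\<^esub> (t i) \<otimes>\<^bsub>G\<^esub> (g i \<otimes>\<^bsub>G\<^esub> t i))) \<Longrightarrow> g 0 = \<one>\<^bsub>G\<^esub>"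
  interpret group G by (rule G)
  obtain \<kappa> t d where "virtual_endo G S f \<kappa> t d" using ex_coset_index[OF S A f] by blast
  then interpret V: virtual_endo G S f \<kappa> t d .
  have "d \<ge> 1" using V.\<kappa>_less[OF one_closed] by simp
  moreover have "free_action G d V.\<phi>"
  proof (rule V.free)
    fix g t assume "\<And>i. g i \<in> carrier G" "\<And>i. t i \<in> carrier G"
      "\<And>i. inv\<^bsub>G\<^esub> (t i) \<otimes>\<^bsub>G\<^esub> (g i \<otimes>\<^bsub>G\<^esub> t i) \<in> S"
      "\<And>i. g (Suc i) = f (inv\<^bsub>G\<^esub> (t i) \<otimes>\<^bsub>G\<^esub> (g i \<otimes>\<^bsub>G\<^esub> t i))"
    then show "g 0 = \<one>\<^bsub>G\<^esub>" by (rule orbit[of g t])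
  qed
  ultimately show ?thesis unfolding freely_densely_self_similar_def
    using V.self_similar V.dense[OF split] by blast
qed

theorem theorem3:
  fixes G :: "('g, 'b) monoid_scheme"
    and m :: nat and c :: "nat \<Rightarrow> nat \<Rightarrow> nat \<Rightarrow> rat"
  assumes "group G"
    and "fin_gen_group G"
    and "torsion_free_group G"
    and "nilpotent_group G"
    and "malcev_lie_algebra G m c"
  shows "(freely_self_similar G \<longleftrightarrow> freely_densely_self_similar G) \<and>
         (freely_densely_self_similar G \<longleftrightarrow> has_very_special_grading_C m c)"
proof -
  have "freely_densely_self_similar G \<Longrightarrow> freely_self_similar G"
    unfolding freely_densely_self_similar_def freely_self_similar_def by blast
  then show ?thesis
    using self_similar_imp_grading[OF assms(1,5)] grading_imp_densely_self_similar[OF assms(1,5)] by blast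
qed

end
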